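(* Let $p$ be a prime and let $F_n$ be the free group on $n$ generators. Consider the system $X=\{ K(F_n/H,1) \}$ as $H$ ranges over all normal subgroups of $F_n$ such that $F_n/H$ is a finite $p$-group; the structure maps are induced by the canonical quotient maps. This pro-space, with the canonical map $cK(F_n,1)\to X$ induced by the quotient maps $F_n\to F_n/H$, is the fibrant replacement, up to strict fibrancy, for $K(F_n,1)$ in either the $\mathbb{Z}/p$-cohomological or the $\mathbb{Z}/p$-homological model structure on pro-spaces.
   Context: "Space" means simplicial set. A pro-space is a (small) cofiltered diagram of simplicial sets, with morphisms $\mathrm{Hom}(X,Y)=\lim_s \operatorname{colim}_t \mathrm{Hom}(X_t,Y_s)$; $cZ$ is the constant pro-space on a space $Z$. $H^m(X;M)=\operatorname{colim}_sH^m(X_s;M)$. Eilenberg-Mac Lane spaces $K(G,1)$ are given by a functorial fibrant model. In the $\mathbb Z/p$-cohomological (resp. $\mathbb Z/p$-homological) model structure on pro-spaces, the weak equivalences are the maps inducing isomorphisms on $H^*(-;\mathbb Z/p)$ (resp. on $H^*(-;M)$ for all $\mathbb Z/p$-modules $M$), and the cofibrations are the maps isomorphic to levelwise monomorphisms of diagrams. For a collection $K$ of fibrant spaces, the class of $K$-nilpotent spaces is the smallest class of fibrant spaces such that: $*$ is $K$-nilpotent; the class is closed under weak equivalences between fibrant spaces; and if $X$ is $K$-nilpotent, $A\in K$, and $X\to A^{\partial\Delta^k}$ is any map, then $X\times_{A^{\partial\Delta^k}}A^{\Delta^k}$ is $K$-nilpotent. A pro-space is essentially levelwise $K$-nilpotent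 if it is isomorphic to a pro-space each of whose terms is $K$-nilpotent. The fibrant objects of the $\mathbb Z/p$-cohomological model structure are the pro-spaces that are strictly fibrant and essentially levelwise $K$-nilpotent for $K=\{K(\mathbb Z/p,m):m\ge0\}$. The fibrant objects of the $\mathbb Z/p$-homological model structure are the pro-spaces that are strictly fibrant and, for some infinite cardinal $\lambda$, essentially levelwise $K_\lambda$-nilpotent, where $K_\lambda$ is the set of (fibrant) spaces $K(M,m)$ with $m\ge0$ and $M$ a $\mathbb Z/p$-module having a generating set of cardinality at most $\lambda$. ("Strictly fibrant" means fibrant in the strict model structure, whose weak equivalences and cofibrations are the maps isomorphic to levelwise weak equivalences and levelwise cofibrations respectively.) "Fibrant replacement up to strict fibrancy" of a pro-space $Z$ means: a weak equivalence $Z\to X$ in the given model structure such that $X$ is essentially levelwise $K$-nilpotent for $K=\{K(\mathbb Z/p,m):m\ge0\}$ in the case of the $\mathbb Z/p$-cohomological model structure, respectively essentially levelwise $K_\lambda$-nilpotent for some infinite cardinal $\lambda$ in the case of the $\mathbb Z/p$-homological model structure; the requirement of strict fibrancy is dropped (i.e. only the essentially levelwise nilpotence condition is required). *)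

theory Defs
  imports "HOL-Number_Theory.Residues" "HOL-Algebra.Coset" "HOL-Algebra.Module"
begin

unbundle cardinal_syntax

section \<open>Simplicial sets\<close>

text \<open>
  A morphism \<open>[m] \<rightarrow> [n]\<close> of the simplex category is encoded as the list of its \<open>m + 1\<close> values;
  the composite of \<open>\<theta> : [m] \<rightarrow> [n]\<close> with \<open>\<phi> : [l] \<rightarrow> [m]\<close> is \<open>map ((!) \<theta>) \<phi>\<close>.
\<close>

definition delta :: "nat \<Rightarrow> nat \<Rightarrow> nat list set" where
  "delta m n = {\<theta>. length \<theta> = m + 1 \<and> sorted \<theta> \<and> set \<theta> \<subseteq> {..n}}"

text \<open>
  \<open>act S n \<theta>\<close> is the operator \<open>S\<^sub>n \<rightarrow> S\<^sub>m\<close> induced by \<open>\<theta> : [m] \<rightarrow> [n]\<close>.  The argument \<open>n\<close> is needed since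
  the sets \<open>S\<^sub>n\<close> are not required to be disjoint; \<open>m\<close> is determined by the length of \<open>\<theta>\<close>.
\<close>

record 'a sset =
  simp :: "nat \<Rightarrow> 'a set"
  act :: "nat \<Rightarrow> nat list \<Rightarrow> 'a \<Rightarrow> 'a"

definition simplicial_set :: "'a sset \<Rightarrow> bool" where
  "simplicial_set S \<longleftrightarrow>
     (\<forall>m n. \<forall>\<theta>\<in>delta m n. \<forall>x\<in>simp S n. act S n \<theta> x \<in> simp S m) \<and>
     (\<forall>n. \<forall>x\<in>simp S n. act S n [0..<n + 1] x = x) \<and>
     (\<forall>l m n. \<forall>\<theta>\<in>delta m n. \<forall>\<phi>\<in>delta l m. \<forall>x\<in>simp S n.
        act S m \<phi> (act S n \<theta> x) = act S n (map ((!) \<theta>) \<phi>) x)"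

text \<open>Simplicial maps are taken extensional, so that equality of maps is equality in HOL.\<close>

definition smaps :: "'a sset \<Rightarrow> 'b sset \<Rightarrow> (nat \<Rightarrow> 'a \<Rightarrow> 'b) set" where
  "smaps S T = {f. (\<forall>n. f n \<in> simp S n \<rightarrow>\<^sub>E simp T n) \<and>
     (\<forall>m n. \<forall>\<theta>\<in>delta m n. \<forall>x\<in>simp S n. f m (act S n \<theta> x) = act T n \<theta> (f n x))}"

definition sid :: "'a sset \<Rightarrow> nat \<Rightarrow> 'a \<Rightarrow> 'a" where
  "sid S = (\<lambda>n. \<lambda>x\<in>simp S n. x)"

definition scomp :: "'a sset \<Rightarrow> (nat \<Rightarrow> 'b \<Rightarrow> 'c) \<Rightarrow> (nat \<Rightarrow> 'a \<Rightarrow> 'b) \<Rightarrow> nat \<Rightarrow> 'a \<Rightarrow> 'c" where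
  "scomp S g f = (\<lambda>n. compose (simp S n) (g n) (f n))"

definition siso :: "'a sset \<Rightarrow> 'b sset \<Rightarrow> bool" where
  "siso S T \<longleftrightarrow> (\<exists>f\<in>smaps S T. \<forall>n. bij_betw (f n) (simp S n) (simp T n))"

definition std_simplex :: "nat \<Rightarrow> nat list sset" where
  "std_simplex k = \<lparr>simp = (\<lambda>n. delta n k), act = (\<lambda>n \<theta> \<phi>. map ((!) \<phi>) \<theta>)\<rparr>"

definition bdry :: "nat \<Rightarrow> nat list sset" where
  "bdry k = \<lparr>simp = (\<lambda>n. {\<phi>\<in>delta n k. set \<phi> \<noteq> {..k}}), act = act (std_simplex k)\<rparr>"

definition horn :: "nat \<Rightarrow> nat \<Rightarrow> nat list sset" where
  "horn k j = \<lparr>simp = (\<lambda>n. {\<phi>\<in>delta n k. \<not> {..k} - {j} \<subseteq> set \<phi>}), act = act (std_simplex k)\<rparr>"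

definition sprod :: "'a sset \<Rightarrow> 'b sset \<Rightarrow> ('a \<times> 'b) sset" where
  "sprod S T = \<lparr>simp = (\<lambda>n. simp S n \<times> simp T n),
                act = (\<lambda>n \<theta> (x, y). (act S n \<theta> x, act T n \<theta> y))\<rparr>"

definition kan :: "'a sset \<Rightarrow> bool" where
  "kan S \<longleftrightarrow> simplicial_set S \<and>
     (\<forall>k\<ge>1. \<forall>j\<le>k. \<forall>f\<in>smaps (horn k j) S. \<exists>g\<in>smaps (std_simplex k) S.
        \<forall>m. \<forall>\<phi>\<in>simp (horn k j) m. g m \<phi> = f m \<phi>)"

text \<open>The mapping space \<open>A\<^sup>B\<close>: its \<open>n\<close>-simplices are the maps \<open>\<Delta>\<^sup>n \<times> B \<rightarrow> A\<close>.\<close>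

definition mapsp :: "'b sset \<Rightarrow> 'a sset \<Rightarrow> (nat \<Rightarrow> nat list \<times> 'b \<Rightarrow> 'a) sset" where
  "mapsp B A = \<lparr>simp = (\<lambda>n. smaps (sprod (std_simplex n) B) A),
     act = (\<lambda>n \<theta> f l. \<lambda>(\<phi>, b)\<in>simp (sprod (std_simplex (length \<theta> - 1)) B) l.
              f l (map ((!) \<theta>) \<phi>, b))\<rparr>"

text \<open>The restriction \<open>A\<^sup>B \<rightarrow> A\<^sup>C\<close> along the inclusion of a subobject \<open>C\<close> of \<open>B\<close>.\<close>

definition mapsp_restr ::
  "'b sset \<Rightarrow> 'b sset \<Rightarrow> 'a sset \<Rightarrow>
     nat \<Rightarrow> (nat \<Rightarrow> nat list \<times> 'b \<Rightarrow> 'a) \<Rightarrow> nat \<Rightarrow> nat list \<times> 'b \<Rightarrow> 'a" where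
  "mapsp_restr C B A = (\<lambda>n. \<lambda>f\<in>simp (mapsp B A) n. \<lambda>l.
     restrict (f l) (simp (sprod (std_simplex n) C) l))"

definition pullback ::
  "'a sset \<Rightarrow> (nat \<Rightarrow> 'a \<Rightarrow> 'c) \<Rightarrow> (nat \<Rightarrow> 'b \<Rightarrow> 'c) \<Rightarrow> 'b sset \<Rightarrow> ('a \<times> 'b) sset" where
  "pullback S f g T = \<lparr>simp = (\<lambda>n. {(x, y). x \<in> simp S n \<and> y \<in> simp T n \<and> f n x = g n y}),
                       act = act (sprod S T)\<rparr>"

section \<open>Weak equivalences between fibrant simplicial sets\<close>

text \<open>
  Homotopy of \<open>n\<close>-simplices relative to the boundary, by homotopies \<open>\<Delta>\<^sup>n \<times> \<Delta>\<^sup>1 \<rightarrow> S\<close> that are constant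
  on \<open>\<partial>\<Delta>\<^sup>n\<close>.
\<close>

definition hrel :: "'a sset \<Rightarrow> nat \<Rightarrow> ('a \<times> 'a) set" where
  "hrel S n = {(a, b). a \<in> simp S n \<and> b \<in> simp S n \<and>
     (\<exists>h\<in>smaps (sprod (std_simplex n) (std_simplex 1)) S.
        (\<forall>m. \<forall>\<phi>\<in>delta m n.
           h m (\<phi>, replicate (m + 1) 0) = act S n \<phi> a \<and>
           h m (\<phi>, replicate (m + 1) 1) = act S n \<phi> b) \<and>
        (\<forall>m. \<forall>\<phi>\<in>simp (bdry n) m. \<forall>\<tau>\<in>delta m 1. h m (\<phi>, \<tau>) = act S n \<phi> a))}"

text \<open>The \<open>n\<close>-simplices whose boundary is constant at the vertex \<open>v\<close>.\<close>

definition spheres :: "'a sset \<Rightarrow> nat \<Rightarrow> 'a \<Rightarrow> 'a set" where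
  "spheres S n v = {a\<in>simp S n. \<forall>m. \<forall>\<phi>\<in>simp (bdry n) m.
     act S n \<phi> a = act S 0 (replicate (m + 1) 0) v}"

definition pi0 :: "'a sset \<Rightarrow> 'a set set" where
  "pi0 S = simp S 0 // hrel S 0"

definition pi_n :: "'a sset \<Rightarrow> nat \<Rightarrow> 'a \<Rightarrow> 'a set set" where
  "pi_n S n v = spheres S n v // hrel S n"

definition pi_map :: "'b sset \<Rightarrow> (nat \<Rightarrow> 'a \<Rightarrow> 'b) \<Rightarrow> nat \<Rightarrow> 'a set \<Rightarrow> 'b set" where
  "pi_map T f n c = hrel T n `` (f n ` c)"

text \<open>
  A map of Kan complexes is a weak equivalence if it is bijective on path components and on all
  homotopy groups.  The map on \<open>\<pi>\<^sub>n\<close> is automatically a homomorphism, so the group structure is not needed.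
\<close>

definition weak_equiv :: "'a sset \<Rightarrow> 'b sset \<Rightarrow> (nat \<Rightarrow> 'a \<Rightarrow> 'b) \<Rightarrow> bool" where
  "weak_equiv S T f \<longleftrightarrow> f \<in> smaps S T \<and>
     bij_betw (pi_map T f 0) (pi0 S) (pi0 T) \<and>
     (\<forall>n\<ge>1. \<forall>v\<in>simp S 0. bij_betw (pi_map T f n) (pi_n S n v) (pi_n T n (f 0 v)))"

section \<open>Nilpotent spaces\<close>

text \<open>
  The spaces live in a universe \<open>'u\<close>.  Since simplicial pullbacks of mapping spaces have another type
  of simplices, the class is closed under passing to an isomorphic copy in \<open>'u\<close> of the pullback.
\<close>

inductive nilpotent :: "'k sset set \<Rightarrow> 'u sset \<Rightarrow> bool" for K :: "'k sset set" where
  point: "simplicial_set X \<Longrightarrow> (\<And>n. \<exists>x. simp X n = {x}) \<Longrightarrow> nilpotent K X"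
| weq_forward: "nilpotent K X \<Longrightarrow> kan X \<Longrightarrow> kan Y \<Longrightarrow> weak_equiv X Y f \<Longrightarrow> nilpotent K Y"
| weq_backward: "nilpotent K X \<Longrightarrow> kan X \<Longrightarrow> kan Y \<Longrightarrow> weak_equiv Y X f \<Longrightarrow> nilpotent K Y"
| pullback: "nilpotent K X \<Longrightarrow> A \<in> K \<Longrightarrow> f \<in> smaps X (mapsp (bdry k) A) \<Longrightarrow>
    simplicial_set Y \<Longrightarrow>
    siso Y (pullback X f (mapsp_restr (bdry k) (std_simplex k) A) (mapsp (std_simplex k) A)) \<Longrightarrow>
    nilpotent K Y"

section \<open>Cohomology of simplicial sets\<close>

definition cochains :: "('m, 'x) ring_scheme \<Rightarrow> 'a sset \<Rightarrow> nat \<Rightarrow> ('a \<Rightarrow> 'm) monoid" where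
  "cochains M S m = \<lparr>carrier = simp S m \<rightarrow>\<^sub>E carrier M,
     monoid.mult = (\<lambda>c d. \<lambda>x\<in>simp S m. c x \<oplus>\<^bsub>M\<^esub> d x),
     monoid.one = (\<lambda>x\<in>simp S m. \<zero>\<^bsub>M\<^esub>)\<rparr>"

definition coface :: "nat \<Rightarrow> nat \<Rightarrow> nat list" where
  "coface m i = filter (\<lambda>j. j \<noteq> i) [0..<m + 2]"

definition cobdry ::
  "('m, 'x) ring_scheme \<Rightarrow> 'a sset \<Rightarrow> nat \<Rightarrow> ('a \<Rightarrow> 'm) \<Rightarrow> 'a \<Rightarrow> 'm" where
  "cobdry M S m c = (\<lambda>x\<in>simp S (m + 1). \<Oplus>\<^bsub>M\<^esub>i\<in>{..m + 1}.
     (if even i then c (act S (m + 1) (coface m i) x)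
      else \<ominus>\<^bsub>M\<^esub> c (act S (m + 1) (coface m i) x)))"

definition cocycles :: "('m, 'x) ring_scheme \<Rightarrow> 'a sset \<Rightarrow> nat \<Rightarrow> ('a \<Rightarrow> 'm) set" where
  "cocycles M S m = {c\<in>carrier (cochains M S m). cobdry M S m c = \<one>\<^bsub>cochains M S (m + 1)\<^esub>}"

definition coboundaries :: "('m, 'x) ring_scheme \<Rightarrow> 'a sset \<Rightarrow> nat \<Rightarrow> ('a \<Rightarrow> 'm) set" where
  "coboundaries M S m = (case m of 0 \<Rightarrow> {\<one>\<^bsub>cochains M S 0\<^esub>}
     | Suc k \<Rightarrow> cobdry M S k ` carrier (cochains M S k))"

definition cohom :: "('m, 'x) ring_scheme \<Rightarrow> 'a sset \<Rightarrow> nat \<Rightarrow> ('a \<Rightarrow> 'm) set monoid" where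
  "cohom M S m = (cochains M S m)\<lparr>carrier := cocycles M S m\<rparr> Mod coboundaries M S m"

text \<open>The map \<open>H\<^sup>m(T; M) \<rightarrow> H\<^sup>m(S; M)\<close> induced by \<open>f : S \<rightarrow> T\<close>.\<close>

definition cohom_map ::
  "('m, 'x) ring_scheme \<Rightarrow> 'a sset \<Rightarrow> nat \<Rightarrow> (nat \<Rightarrow> 'a \<Rightarrow> 'b) \<Rightarrow> ('b \<Rightarrow> 'm) set \<Rightarrow> ('a \<Rightarrow> 'm) set" where
  "cohom_map M S m f C =
     (\<Union>c\<in>C. coboundaries M S m #>\<^bsub>cochains M S m\<^esub> compose (simp S m) c (f m))"

section \<open>Eilenberg--MacLane spaces\<close>

text \<open>
  \<open>K(M, m)\<close>: the \<open>n\<close>-simplices are the normalized \<open>m\<close>-cocycles of \<open>\<Delta>\<^sup>n\<close> with values in \<open>M\<close>.  An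
  \<open>m\<close>-simplex of \<open>\<Delta>\<^sup>n\<close> is degenerate iff its list of vertices has a repetition.
\<close>

definition EM :: "('m, 'x) ring_scheme \<Rightarrow> nat \<Rightarrow> (nat list \<Rightarrow> 'm) sset" where
  "EM M m = \<lparr>simp = (\<lambda>n. {c\<in>cocycles M (std_simplex n) m.
                            \<forall>\<phi>\<in>delta m n. \<not> distinct \<phi> \<longrightarrow> c \<phi> = \<zero>\<^bsub>M\<^esub>}),
     act = (\<lambda>n \<theta> c. \<lambda>\<psi>\<in>delta m (length \<theta> - 1). c (map ((!) \<theta>) \<psi>))\<rparr>"

text \<open>
  \<open>K(G, 1)\<close>: the nerve of \<open>G\<close> viewed as a category with one object.  An \<open>n\<close>-simplex is a functor
  from the poset \<open>[n]\<close> to this category.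
\<close>

definition ipairs :: "nat \<Rightarrow> (nat \<times> nat) set" where
  "ipairs n = {(i, j). i \<le> j \<and> j \<le> n}"

definition nerve :: "('g, 'x) monoid_scheme \<Rightarrow> (nat \<times> nat \<Rightarrow> 'g) sset" where
  "nerve G = \<lparr>simp = (\<lambda>n. {g\<in>ipairs n \<rightarrow>\<^sub>E carrier G.
        (\<forall>i\<le>n. g (i, i) = \<one>\<^bsub>G\<^esub>) \<and>
        (\<forall>i j k. i \<le> j \<and> j \<le> k \<and> k \<le> n \<longrightarrow> g (i, j) \<otimes>\<^bsub>G\<^esub> g (j, k) = g (i, k))}),
     act = (\<lambda>n \<theta> g. \<lambda>(i, j)\<in>ipairs (length \<theta> - 1). g (\<theta> ! i, \<theta> ! j))\<rparr>"

definition nerve_map ::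
  "('g, 'x) monoid_scheme \<Rightarrow> ('g \<Rightarrow> 'h) \<Rightarrow> nat \<Rightarrow> (nat \<times> nat \<Rightarrow> 'g) \<Rightarrow> nat \<times> nat \<Rightarrow> 'h" where
  "nerve_map G h = (\<lambda>n. \<lambda>g\<in>simp (nerve G) n. compose (ipairs n) h g)"

section \<open>Pro-spaces\<close>

record ('i, 'e) cat =
  Ob :: "'i set"
  Ar :: "'e set"
  src :: "'e \<Rightarrow> 'i"
  tgt :: "'e \<Rightarrow> 'i"
  ident :: "'i \<Rightarrow> 'e"
  cmp :: "'e \<Rightarrow> 'e \<Rightarrow> 'e"

definition hom_arr :: "('i, 'e) cat \<Rightarrow> 'i \<Rightarrow> 'i \<Rightarrow> 'e set" where
  "hom_arr C s t = {e\<in>Ar C. src C e = s \<and> tgt C e = t}"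

definition category :: "('i, 'e) cat \<Rightarrow> bool" where
  "category C \<longleftrightarrow>
     (\<forall>e\<in>Ar C. src C e \<in> Ob C \<and> tgt C e \<in> Ob C) \<and>
     (\<forall>s\<in>Ob C. ident C s \<in> hom_arr C s s) \<and>
     (\<forall>r s t. \<forall>e\<in>hom_arr C r s. \<forall>e'\<in>hom_arr C s t. cmp C e' e \<in> hom_arr C r t) \<and>
     (\<forall>s t. \<forall>e\<in>hom_arr C s t. cmp C e (ident C s) = e \<and> cmp C (ident C t) e = e) \<and>
     (\<forall>q r s t. \<forall>e\<in>hom_arr C q r. \<forall>e'\<in>hom_arr C r s. \<forall>e''\<in>hom_arr C s t.
        cmp C e'' (cmp C e' e) = cmp C (cmp C e'' e') e)"

definition cofiltered :: "('i, 'e) cat \<Rightarrow> bool" where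
  "cofiltered C \<longleftrightarrow> Ob C \<noteq> {} \<and>
     (\<forall>s\<in>Ob C. \<forall>t\<in>Ob C. \<exists>r\<in>Ob C. hom_arr C r s \<noteq> {} \<and> hom_arr C r t \<noteq> {}) \<and>
     (\<forall>s\<in>Ob C. \<forall>t\<in>Ob C. \<forall>e\<in>hom_arr C s t. \<forall>e'\<in>hom_arr C s t.
        \<exists>r\<in>Ob C. \<exists>d\<in>hom_arr C r s. cmp C e d = cmp C e' d)"

record ('i, 'e, 'a) diagram =
  idx :: "('i, 'e) cat"
  sp :: "'i \<Rightarrow> 'a sset"
  tr :: "'e \<Rightarrow> nat \<Rightarrow> 'a \<Rightarrow> 'a"

abbreviation obs :: "('i, 'e, 'a) diagram \<Rightarrow> 'i set" where
  "obs X \<equiv> Ob (idx X)"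

abbreviation arrs :: "('i, 'e, 'a) diagram \<Rightarrow> 'i \<Rightarrow> 'i \<Rightarrow> 'e set" where
  "arrs X \<equiv> hom_arr (idx X)"

definition pro_space :: "('i, 'e, 'a) diagram \<Rightarrow> bool" where
  "pro_space X \<longleftrightarrow> category (idx X) \<and> cofiltered (idx X) \<and>
     (\<forall>s\<in>obs X. simplicial_set (sp X s)) \<and>
     (\<forall>s t. \<forall>e\<in>arrs X s t. tr X e \<in> smaps (sp X s) (sp X t)) \<and>
     (\<forall>s\<in>obs X. tr X (ident (idx X) s) = sid (sp X s)) \<and>
     (\<forall>r s t. \<forall>e\<in>arrs X r s. \<forall>e'\<in>arrs X s t.
        tr X (cmp (idx X) e' e) = scomp (sp X r) (tr X e') (tr X e))"

text \<open>
  The equivalence relation whose quotient is \<open>colim\<^sub>t Hom(X\<^sub>t, A)\<close>, and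
  \<open>Hom(X, Y) = lim\<^sub>s colim\<^sub>t Hom(X\<^sub>t, Y\<^sub>s)\<close>.
\<close>

definition germ ::
  "('i, 'e, 'a) diagram \<Rightarrow> 'b sset \<Rightarrow>
     (('i \<times> (nat \<Rightarrow> 'a \<Rightarrow> 'b)) \<times> ('i \<times> (nat \<Rightarrow> 'a \<Rightarrow> 'b))) set" where
  "germ X A = {((t, f), (t', f')).
     t \<in> obs X \<and> f \<in> smaps (sp X t) A \<and> t' \<in> obs X \<and> f' \<in> smaps (sp X t') A \<and>
     (\<exists>r\<in>obs X. \<exists>e\<in>arrs X r t. \<exists>e'\<in>arrs X r t'.
        scomp (sp X r) f (tr X e) = scomp (sp X r) f' (tr X e'))}"

definition colim_hom ::
  "('i, 'e, 'a) diagram \<Rightarrow> 'b sset \<Rightarrow> ('i \<times> (nat \<Rightarrow> 'a \<Rightarrow> 'b)) set set" where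
  "colim_hom X A = (SIGMA t:obs X. smaps (sp X t) A) // germ X A"

definition pro_hom ::
  "('i, 'e, 'a) diagram \<Rightarrow> ('j, 'd, 'b) diagram \<Rightarrow> ('j \<Rightarrow> ('i \<times> (nat \<Rightarrow> 'a \<Rightarrow> 'b)) set) set" where
  "pro_hom X Y = {F\<in>(\<Pi>\<^sub>E s\<in>obs Y. colim_hom X (sp Y s)).
     \<forall>s s'. \<forall>e\<in>arrs Y s s'. \<forall>(t, f)\<in>F s. (t, scomp (sp X t) (tr Y e) f) \<in> F s'}"

definition pro_id ::
  "('i, 'e, 'a) diagram \<Rightarrow> 'i \<Rightarrow> ('i \<times> (nat \<Rightarrow> 'a \<Rightarrow> 'a)) set" where
  "pro_id X = (\<lambda>s\<in>obs X. germ X (sp X s) `` {(s, sid (sp X s))})"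

definition pro_comp ::
  "('i, 'e, 'a) diagram \<Rightarrow> ('k, 'd, 'c) diagram \<Rightarrow> ('k \<Rightarrow> ('j \<times> (nat \<Rightarrow> 'b \<Rightarrow> 'c)) set) \<Rightarrow>
     ('j \<Rightarrow> ('i \<times> (nat \<Rightarrow> 'a \<Rightarrow> 'b)) set) \<Rightarrow> 'k \<Rightarrow> ('i \<times> (nat \<Rightarrow> 'a \<Rightarrow> 'c)) set" where
  "pro_comp X Z G F = (\<lambda>r\<in>obs Z. \<Union>(s, g)\<in>G r. \<Union>(t, f)\<in>F s.
     germ X (sp Z r) `` {(t, scomp (sp X t) g f)})"

definition pro_isomorphic :: "('i, 'e, 'a) diagram \<Rightarrow> ('j, 'd, 'b) diagram \<Rightarrow> bool" where
  "pro_isomorphic X Y \<longleftrightarrow> (\<exists>F\<in>pro_hom X Y. \<exists>G\<in>pro_hom Y X.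
     pro_comp X X G F = pro_id X \<and> pro_comp Y Y F G = pro_id Y)"

definition const_pro :: "'a sset \<Rightarrow> (unit, unit, 'a) diagram" where
  "const_pro S = \<lparr>idx = \<lparr>Ob = UNIV, Ar = UNIV, src = (\<lambda>_. ()), tgt = (\<lambda>_. ()),
                         ident = (\<lambda>_. ()), cmp = (\<lambda>_ _. ())\<rparr>,
                  sp = (\<lambda>_. S), tr = (\<lambda>_. sid S)\<rparr>"

text \<open>\<open>H\<^sup>m(X; M) = colim\<^sub>s H\<^sup>m(X\<^sub>s; M)\<close> as a group, and the map \<open>H\<^sup>m(Y; M) \<rightarrow> H\<^sup>m(X; M)\<close> induced by
  \<open>F : X \<rightarrow> Y\<close>.\<close>

definition cohom_germ ::
  "('m, 'x) ring_scheme \<Rightarrow> ('i, 'e, 'a) diagram \<Rightarrow> nat \<Rightarrow>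
     (('i \<times> ('a \<Rightarrow> 'm) set) \<times> ('i \<times> ('a \<Rightarrow> 'm) set)) set" where
  "cohom_germ M X m = {((s, a), (s', a')).
     s \<in> obs X \<and> a \<in> carrier (cohom M (sp X s) m) \<and>
     s' \<in> obs X \<and> a' \<in> carrier (cohom M (sp X s') m) \<and>
     (\<exists>r\<in>obs X. \<exists>e\<in>arrs X r s. \<exists>e'\<in>arrs X r s'.
        cohom_map M (sp X r) m (tr X e) a = cohom_map M (sp X r) m (tr X e') a')}"

definition pro_cohom ::
  "('m, 'x) ring_scheme \<Rightarrow> ('i, 'e, 'a) diagram \<Rightarrow> nat \<Rightarrow> ('i \<times> ('a \<Rightarrow> 'm) set) set monoid" where
  "pro_cohom M X m =
     \<lparr>carrier = (SIGMA s:obs X. carrier (cohom M (sp X s) m)) // cohom_germ M X m,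
      monoid.mult = (\<lambda>A B. \<Union>(s, a)\<in>A. \<Union>(s', a')\<in>B. \<Union>r\<in>obs X. \<Union>e\<in>arrs X r s. \<Union>e'\<in>arrs X r s'.
        cohom_germ M X m `` {(r, cohom_map M (sp X r) m (tr X e) a
                                   \<otimes>\<^bsub>cohom M (sp X r) m\<^esub> cohom_map M (sp X r) m (tr X e') a')}),
      monoid.one = (\<Union>s\<in>obs X. cohom_germ M X m `` {(s, \<one>\<^bsub>cohom M (sp X s) m\<^esub>)})\<rparr>"

definition pro_cohom_map ::
  "('m, 'x) ring_scheme \<Rightarrow> ('i, 'e, 'a) diagram \<Rightarrow> nat \<Rightarrow>
     ('j \<Rightarrow> ('i \<times> (nat \<Rightarrow> 'a \<Rightarrow> 'b)) set) \<Rightarrow> ('j \<times> ('b \<Rightarrow> 'm) set) set \<Rightarrow> ('i \<times> ('a \<Rightarrow> 'm) set) set" where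
  "pro_cohom_map M X m F A = (\<Union>(s, a)\<in>A. \<Union>(t, f)\<in>F s.
     cohom_germ M X m `` {(t, cohom_map M (sp X t) m f a)})"

definition cohom_iso ::
  "('m, 'x) ring_scheme \<Rightarrow> ('i, 'e, 'a) diagram \<Rightarrow> ('j, 'd, 'b) diagram \<Rightarrow>
     ('j \<Rightarrow> ('i \<times> (nat \<Rightarrow> 'a \<Rightarrow> 'b)) set) \<Rightarrow> bool" where
  "cohom_iso M X Y F \<longleftrightarrow>
     (\<forall>m. pro_cohom_map M X m F \<in> iso (pro_cohom M Y m) (pro_cohom M X m))"

section \<open>The two model structures\<close>

definition ess_levelwise_nilpotent ::
  "'u itself \<Rightarrow> 'k sset set \<Rightarrow> ('i, 'e, 'a) diagram \<Rightarrow> bool" where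
  "ess_levelwise_nilpotent U K X \<longleftrightarrow> (\<exists>Y :: ('u, 'u, 'u) diagram.
     pro_space Y \<and> pro_isomorphic X Y \<and> (\<forall>s\<in>obs Y. nilpotent K (sp Y s)))"

definition generated_by_at_most ::
  "nat \<Rightarrow> (int, 'u) module \<Rightarrow> 'u rel \<Rightarrow> bool" where
  "generated_by_at_most p M l \<longleftrightarrow> (\<exists>S\<subseteq>carrier M. |S| \<le>o l \<and>
     (\<forall>N. submodule N (residue_ring (int p)) M \<and> S \<subseteq> N \<longrightarrow> N = carrier M))"

definition K_cohomological :: "nat \<Rightarrow> (nat list \<Rightarrow> int) sset set" where
  "K_cohomological p = {EM (residue_ring (int p)) m | m. True}"

definition K_homological :: "nat \<Rightarrow> 'u rel \<Rightarrow> (nat list \<Rightarrow> 'u) sset set" where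
  "K_homological p l = {EM M m | M m. module (residue_ring (int p)) M \<and> generated_by_at_most p M l}"

definition cohomological_weq ::
  "nat \<Rightarrow> ('i, 'e, 'a) diagram \<Rightarrow> ('j, 'd, 'b) diagram \<Rightarrow>
     ('j \<Rightarrow> ('i \<times> (nat \<Rightarrow> 'a \<Rightarrow> 'b)) set) \<Rightarrow> bool" where
  "cohomological_weq p X Y F \<longleftrightarrow> F \<in> pro_hom X Y \<and> cohom_iso (residue_ring (int p)) X Y F"

definition homological_weq ::
  "'u itself \<Rightarrow> nat \<Rightarrow> ('i, 'e, 'a) diagram \<Rightarrow> ('j, 'd, 'b) diagram \<Rightarrow>
     ('j \<Rightarrow> ('i \<times> (nat \<Rightarrow> 'a \<Rightarrow> 'b)) set) \<Rightarrow> bool" where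
  "homological_weq U p X Y F \<longleftrightarrow> F \<in> pro_hom X Y \<and>
     (\<forall>M :: (int, 'u) module. module (residue_ring (int p)) M \<longrightarrow> cohom_iso M X Y F)"

text \<open>
  The type \<open>'u\<close> is the universe in which the test modules, the nilpotent spaces, their index categories
  and the cardinals are taken; HOL cannot quantify over types inside a definition.  Levelwise
  finite pullbacks and mapping spaces out of finite simplicial sets do not leave an infinite universe.
\<close>

definition cohomological_fibrant_replacement ::
  "'u itself \<Rightarrow> nat \<Rightarrow> ('i, 'e, 'a) diagram \<Rightarrow> ('j, 'd, 'b) diagram \<Rightarrow>
     ('j \<Rightarrow> ('i \<times> (nat \<Rightarrow> 'a \<Rightarrow> 'b)) set) \<Rightarrow> bool" where
  "cohomological_fibrant_replacement U p Z X F \<longleftrightarrow> pro_space Z \<and> pro_space X \<and>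
     cohomological_weq p Z X F \<and> ess_levelwise_nilpotent U (K_cohomological p) X"

definition homological_fibrant_replacement ::
  "'u itself \<Rightarrow> nat \<Rightarrow> ('i, 'e, 'a) diagram \<Rightarrow> ('j, 'd, 'b) diagram \<Rightarrow>
     ('j \<Rightarrow> ('i \<times> (nat \<Rightarrow> 'a \<Rightarrow> 'b)) set) \<Rightarrow> bool" where
  "homological_fibrant_replacement U p Z X F \<longleftrightarrow> pro_space Z \<and> pro_space X \<and>
     homological_weq U p Z X F \<and>
     (\<exists>l :: 'u rel. Cinfinite l \<and> ess_levelwise_nilpotent U (K_homological p l) X)"

section \<open>The free group and its finite \<open>p\<close>-group quotients\<close>

text \<open>
  The free group on \<open>{..<n}\<close> as the group of reduced words; the letter \<open>(True, i)\<close> stands for the \<open>i\<close>-th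
  generator and \<open>(False, i)\<close> for its inverse.
\<close>

definition reduced :: "(bool \<times> nat) list \<Rightarrow> bool" where
  "reduced w \<longleftrightarrow> (\<forall>i. i + 1 < length w \<longrightarrow>
     \<not> (snd (w ! i) = snd (w ! (i + 1)) \<and> fst (w ! i) \<noteq> fst (w ! (i + 1))))"

fun cons_reduce :: "bool \<times> nat \<Rightarrow> (bool \<times> nat) list \<Rightarrow> (bool \<times> nat) list" where
  "cons_reduce x [] = [x]"
| "cons_reduce x (y # w) = (if snd x = snd y \<and> fst x \<noteq> fst y then w else x # y # w)"

definition free_group :: "nat \<Rightarrow> (bool \<times> nat) list monoid" where
  "free_group n = \<lparr>carrier = {w. reduced w \<and> (\<forall>x\<in>set w. snd x < n)},
                   monoid.mult = (\<lambda>v w. foldr cons_reduce v w), monoid.one = []\<rparr>"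

definition finite_p_quotients :: "nat \<Rightarrow> ('g, 'x) monoid_scheme \<Rightarrow> 'g set set" where
  "finite_p_quotients p G = {H. H \<lhd> G \<and> (\<exists>k. order (G Mod H) = p ^ k)}"

text \<open>
  The system \<open>{K(G/H, 1)}\<close>: there is exactly one arrow \<open>(H, H')\<close> whenever \<open>H \<subseteq> H'\<close>, and it
  acts by the canonical quotient map \<open>G/H \<rightarrow> G/H'\<close>, \<open>C \<mapsto> H'C\<close>.
\<close>

definition p_completion ::
  "nat \<Rightarrow> ('g, 'x) monoid_scheme \<Rightarrow> ('g set, 'g set \<times> 'g set, nat \<times> nat \<Rightarrow> 'g set) diagram" where
  "p_completion p G =
     \<lparr>idx = \<lparr>Ob = finite_p_quotients p G,
             Ar = {(H, H'). H \<in> finite_p_quotients p G \<and> H' \<in> finite_p_quotients p G \<and> H \<subseteq> H'},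
             src = fst, tgt = snd, ident = (\<lambda>H. (H, H)), cmp = (\<lambda>e' e. (fst e, snd e'))\<rparr>,
      sp = (\<lambda>H. nerve (G Mod H)),
      tr = (\<lambda>(H, H'). nerve_map (G Mod H) (\<lambda>C. H' <#>\<^bsub>G\<^esub> C))\<rparr>"

definition p_completion_map ::
  "nat \<Rightarrow> ('g, 'x) monoid_scheme \<Rightarrow>
     'g set \<Rightarrow> (unit \<times> (nat \<Rightarrow> (nat \<times> nat \<Rightarrow> 'g) \<Rightarrow> nat \<times> nat \<Rightarrow> 'g set)) set" where
  "p_completion_map p G = (\<lambda>H\<in>finite_p_quotients p G.
     germ (const_pro (nerve G)) (nerve (G Mod H)) `` {((), nerve_map G (\<lambda>x. H #>\<^bsub>G\<^esub> x))})"

end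

(*
  Cohomology: for M killed by p, the map K(F,1) -> {K(F/H,1)} is an isomorphism on cohomology iff every
  cocycle of F becomes, up to a coboundary, a cocycle of some F/H, and every cocycle of F/H that bounds on F
  bounds on some F/K.  Both follow once cocycles of degree >= 2 that factor through some F/H are coboundaries of
  cochains factoring through some F/K.  Dimension shifting, with twisted coefficients, reduces this to degree 2.
  There the extension classified by the cocycle splits because F is free, and since the splitting is
  determined by its values on the generators, it has finite image modulo the normal subgroup K of those
  elements of H on which it is trivial.

  Nilpotency: a nontrivial finite p-group Q has a central subgroup of order p with quotient Q'.  The pullback
  of NQ' -> K(Z/p,2)^(boundary of Delta^1), with components 0 and the class of the extension, along the
  restriction from K(Z/p,2)^(Delta^1) is isomorphic to NQ x C, where C is the contractible simplicial set
  of normalized 1-cochains.  Hence NQ is nilpotent if NQ' is.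
*)
theory Submission
  imports Defs "HOL-Algebra.Sylow" "HOL-Algebra.Group_Action" "HOL-Library.Countable_Set"
begin

section \<open>Free groups\<close>

text \<open>Twisted coefficients are forced: even for a trivial action on \<open>M\<close>, the
  cokernel of \<open>M \<rightarrow> Map(F/H, M)\<close> carries a nontrivial one in general, so the
  induction ranges over all modules killed by \<open>p\<close> on which some member of the family
  acts trivially. These modules may be infinite; the finiteness of \<open>F/K\<close> comes from the
  cocycle, which takes finitely many values, and from torsion, which makes their span finite. The
  same induction for the family consisting of the trivial subgroup gives
  \<open>H^m(F; M) = 0\<close> for \<open>m \<ge> 2\<close>. Degrees 0 and 1 are direct: a cocycle
  of degree 1 is a homomorphism whose image is finitely generated and killed by \<open>p\<close>.
  Homotopy relative to the boundary is equality in a nerve, so comparing \<open>NQ\<close> with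
  \<open>NQ \<times> C\<close> comes down to explicit homotopies in \<open>C\<close>. The fixed
  types are an obstacle: coefficients are recoded after each shift, and spaces and indices are
  copied into an arbitrary infinite type. This is possible because the nerves are levelwise finite
  and a free group of finite rank has countably many finite quotients.\<close>

definition letters :: "nat \<Rightarrow> (bool \<times> nat) set" where
  "letters n = UNIV \<times> {..<n}"

definition opp :: "bool \<times> nat \<Rightarrow> bool \<times> nat" where
  "opp x = (\<not> fst x, snd x)"

lemma opp_opp [simp]: "opp (opp x) = x"
  by (simp add: opp_def)

lemma opp_in_letters: "x \<in> letters n \<Longrightarrow> opp x \<in> letters n"
  by (auto simp: opp_def letters_def)

lemma finite_letters: "finite (letters n)"
  by (simp add: letters_def)

lemma cancels_iff: "snd x = snd y \<and> fst x \<noteq> fst y \<longleftrightarrow> y = opp x"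
  by (cases x; cases y) (auto simp: opp_def)

text \<open>Cancellation as the single equation \<open>y = opp x\<close>. The defining equation is
  removed from the simplifier wherever this form is used, so that goals are phrased with
  \<open>opp\<close> throughout.\<close>

lemma cons_reduce_Cons: "cons_reduce x (y # w) = (if y = opp x then w else x # y # w)"
  using cancels_iff[of x y] by auto

lemma reduced_Nil [simp]: "reduced []"
  and reduced_single [simp]: "reduced [x]"
  by (auto simp: reduced_def)

lemma reduced_Cons_Cons: "reduced (x # y # w) \<longleftrightarrow> y \<noteq> opp x \<and> reduced (y # w)"
proof -
  have all_nat: "(\<forall>i. P i) \<longleftrightarrow> P 0 \<and> (\<forall>i. P (Suc i))" for P :: "nat \<Rightarrow> bool"
    by (metis not0_implies_Suc)
  have "reduced (x # y # w) \<longleftrightarrow>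
     (\<forall>i. i + 1 < length (x # y # w) \<longrightarrow> (x # y # w) ! (i + 1) \<noteq> opp ((x # y # w) ! i))"
    unfolding reduced_def by (simp only: cancels_iff)
  also have "\<dots> \<longleftrightarrow> y \<noteq> opp x \<and>
     (\<forall>i. i + 1 < length (y # w) \<longrightarrow> (y # w) ! (i + 1) \<noteq> opp ((y # w) ! i))"
    by (subst all_nat) simp
  also have "\<dots> \<longleftrightarrow> y \<noteq> opp x \<and> reduced (y # w)"
    unfolding reduced_def by (simp only: cancels_iff)
  finally show ?thesis .
qed

lemma reduced_ConsD: "reduced (x # w) \<Longrightarrow> reduced w"
  by (cases w) (auto simp: reduced_Cons_Cons)

lemma cons_reduce_reduced_Cons: "reduced (x # w) \<Longrightarrow> cons_reduce x w = x # w"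
  by (cases w) (auto simp: reduced_Cons_Cons cons_reduce_Cons simp del: cons_reduce.simps(2))

lemma reduced_cons_reduce: "reduced w \<Longrightarrow> reduced (cons_reduce x w)"
  by (cases w) (auto simp: reduced_Cons_Cons cons_reduce_Cons reduced_ConsD
      simp del: cons_reduce.simps(2))

text \<open>If \<open>w = x # v\<close>, the inner step leaves \<open>v\<close>, and reducedness of
  \<open>w\<close> keeps \<open>x\<close> from cancelling against \<open>v\<close>; otherwise the
  inner step puts \<open>opp x\<close> in front and \<open>x\<close> removes it. Hence letters act
  on reduced words by permutations.\<close>

lemma cons_reduce_opp: "reduced w \<Longrightarrow> cons_reduce x (cons_reduce (opp x) w) = w"
  by (cases w) (auto simp: cons_reduce_Cons cons_reduce_reduced_Cons opp_def
      simp del: cons_reduce.simps(2))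

lemma set_cons_reduce: "set (cons_reduce x w) \<subseteq> insert x (set w)"
  by (cases w) (auto simp: cons_reduce_Cons simp del: cons_reduce.simps(2))

lemma reduced_foldr: "reduced w \<Longrightarrow> reduced (foldr cons_reduce v w)"
  by (induction v) (auto intro: reduced_cons_reduce)

lemma set_foldr: "set (foldr cons_reduce v w) \<subseteq> set v \<union> set w"
  by (induction v) (use set_cons_reduce in fastforce)+

text \<open>Associativity for one letter: a cancellation inside \<open>x # v\<close> is invisible
  after acting on \<open>w\<close>, because \<open>x\<close> and \<open>opp x\<close> act by
  mutually inverse permutations.\<close>

lemma foldr_cons_reduce:
  assumes "reduced w"
  shows "foldr cons_reduce (cons_reduce x v) w = cons_reduce x (foldr cons_reduce v w)"
  by (cases v) (auto simp: cons_reduce_Cons cons_reduce_opp reduced_foldr assms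
      simp del: cons_reduce.simps(2))

lemma foldr_assoc:
  assumes "reduced w"
  shows "foldr cons_reduce (foldr cons_reduce u v) w = foldr cons_reduce u (foldr cons_reduce v w)"
  by (induction u) (auto simp: foldr_cons_reduce assms)

lemma foldr_opp_rev: "reduced v \<Longrightarrow> foldr cons_reduce (map opp (rev v)) v = []"
proof (induction v)
  case (Cons x v)
  have "cons_reduce (opp x) (x # v) = v"
    by (simp add: cons_reduce_Cons del: cons_reduce.simps(2))
  then show ?case
    using Cons by (simp add: reduced_ConsD)
qed simp

lemma carrier_free_group: "carrier (free_group n) = {w. reduced w \<and> set w \<subseteq> letters n}"
  by (auto simp: free_group_def letters_def)

lemma one_free_group: "\<one>\<^bsub>free_group n\<^esub> = []"
  by (simp add: free_group_def)

lemma mult_free_group: "v \<otimes>\<^bsub>free_group n\<^esub> w = foldr cons_reduce v w"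
  by (simp add: free_group_def)

lemma group_free_group: "group (free_group n)"
proof (rule groupI)
  fix v assume v: "v \<in> carrier (free_group n)"
  let ?i = "foldr cons_reduce (map opp (rev v)) []"
  have "?i \<in> carrier (free_group n)"
    using v set_foldr[of "map opp (rev v)" "[]"] opp_in_letters
    by (fastforce simp: carrier_free_group reduced_foldr)
  moreover have "?i \<otimes>\<^bsub>free_group n\<^esub> v = \<one>\<^bsub>free_group n\<^esub>"
    using v by (simp add: mult_free_group one_free_group foldr_assoc foldr_opp_rev carrier_free_group)
  ultimately show "\<exists>w\<in>carrier (free_group n). w \<otimes>\<^bsub>free_group n\<^esub> v = \<one>\<^bsub>free_group n\<^esub>"
    by blast
next
  fix v w assume "v \<in> carrier (free_group n)" "w \<in> carrier (free_group n)"
  then show "v \<otimes>\<^bsub>free_group n\<^esub> w \<in> carrier (free_group n)"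
    using set_foldr[of v w] by (fastforce simp: carrier_free_group mult_free_group reduced_foldr)
qed (auto simp: carrier_free_group mult_free_group one_free_group foldr_assoc)

text \<open>Makes induction over group elements an induction over lists: a reduced word is the
  product of its first letter and its tail without cancellation.\<close>

lemma Cons_in_free_group:
  assumes "x # w \<in> carrier (free_group n)"
  shows "[x] \<in> carrier (free_group n)" "w \<in> carrier (free_group n)"
    "[x] \<otimes>\<^bsub>free_group n\<^esub> w = x # w"
  using assms by (auto simp: carrier_free_group mult_free_group cons_reduce_reduced_Cons
      dest: reduced_ConsD)

section \<open>Normal subgroups of \<open>p\<close>-power index\<close>

lemma (in group) coset_eq_iff:
  assumes "subgroup H G" "x \<in> carrier G" "y \<in> carrier G"
  shows "H #> x = H #> y \<longleftrightarrow> x \<otimes> inv y \<in> H"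
proof
  assume "H #> x = H #> y"
  then have "x \<in> H #> y"
    using rcos_self assms by metis
  then obtain h where h: "h \<in> H" "x = h \<otimes> y"
    unfolding r_coset_def by auto
  then have "h \<in> carrier G"
    using assms subgroup.mem_carrier by metis
  then show "x \<otimes> inv y \<in> H"
    using h assms by (simp add: m_assoc)
next
  assume "x \<otimes> inv y \<in> H"
  then have "x \<in> H #> y"
    unfolding r_coset_def using assms inv_solve_right' by (force simp: m_assoc)
  then show "H #> x = H #> y"
    using repr_independence assms by metis
qed

text \<open>For the converse, a second prime divisor \<open>q\<close> of the order would give a
  nontrivial Sylow \<open>q\<close>-subgroup, and the order of any element of it divides both a
  power of \<open>q\<close> and a power of \<open>p\<close>.\<close>

lemma (in group) order_prime_power_iff:
  assumes "prime p"
  shows "(\<exists>k. order G = p ^ k) \<longleftrightarrow>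
     finite (carrier G) \<and> (\<forall>x\<in>carrier G. \<exists>k::nat. x [^] (p ^ k) = \<one>)"
proof
  assume "\<exists>k. order G = p ^ k"
  then obtain k where k: "order G = p ^ k" by blast
  then have "card (carrier G) > 0"
    using assms prime_gt_0_nat by (simp add: order_def)
  then show "finite (carrier G) \<and> (\<forall>x\<in>carrier G. \<exists>k::nat. x [^] (p ^ k) = \<one>)"
    using k pow_order_eq_1 by (metis card_gt_0_iff)
next
  assume *: "finite (carrier G) \<and> (\<forall>x\<in>carrier G. \<exists>k::nat. x [^] (p ^ k) = \<one>)"
  then have pos: "order G > 0"
    by (simp add: order_gt_0_iff_finite)
  then obtain m where m: "order G = p ^ multiplicity p (order G) * m" "\<not> p dvd m"
    using assms multiplicity_decompose'[of "order G" p] by (metis not_prime_unit not_gr_zero)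
  have "m = 1"
  proof (rule ccontr)
    assume "m \<noteq> 1"
    then obtain q where q: "prime q" "q dvd m"
      using prime_factor_nat by blast
    then have "q \<noteq> p" "q dvd order G"
      using m(2) dvd_trans[OF q(2), of "order G"] by (blast, metis m(1) dvd_triv_right)
    define a where "a = multiplicity q (order G)"
    obtain r where r: "order G = q ^ a * r"
      using multiplicity_dvd[of q "order G"] unfolding a_def dvd_def by blast
    have "a > 0"
      using q pos \<open>q dvd order G\<close> by (simp add: a_def prime_multiplicity_gt_zero_iff)
    obtain H where H: "subgroup H G" "card H = q ^ a"
      using sylow_thm[OF q(1) group_axioms r] * by blast
    have "\<exists>x\<in>H. x \<noteq> \<one>"
    proof (rule ccontr)
      assume "\<not> ?thesis"
      then have "H \<subseteq> {\<one>}" by auto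
      then have "card H \<le> 1"
        using card_mono[of "{\<one>}" H] by simp
      moreover have "q ^ a > 1"
        using \<open>a > 0\<close> q prime_gt_1_nat one_less_power by blast
      ultimately show False using H by simp
    qed
    then obtain x where x: "x \<in> H" "x \<noteq> \<one>" by blast
    then have xG: "x \<in> carrier G"
      using H subgroup.mem_carrier by metis
    interpret S: group "G\<lparr>carrier := H\<rparr>"
      using H(1) subgroup_imp_group by blast
    have "x [^]\<^bsub>G\<lparr>carrier := H\<rparr>\<^esub> (q ^ a) = \<one>"
      using S.pow_order_eq_1[of x] x H by (simp add: order_def)
    then have "x [^] (q ^ a) = \<one>"
      by (simp add: nat_pow_def)
    then have "ord x dvd q ^ a"
      using xG pow_eq_id by simp
    moreover obtain k where "x [^] (p ^ k) = \<one>"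
      using * xG by blast
    then have "ord x dvd p ^ k"
      using xG pow_eq_id by simp
    moreover have "coprime (q ^ a) (p ^ k)"
      using \<open>q \<noteq> p\<close> q assms by (simp add: primes_coprime)
    ultimately have "ord x = 1"
      using coprime_common_divisor_nat by blast
    then show False
      using x xG ord_eq_1 by simp
  qed
  then show "\<exists>k. order G = p ^ k"
    using m(1) by (metis mult.right_neutral)
qed

lemma (in normal) coset_pow:
  assumes "x \<in> carrier G"
  shows "(H #> x) [^]\<^bsub>G Mod H\<^esub> (k::nat) = H #> (x [^] k)"
proof -
  interpret Q: group "G Mod H"
    by (rule factorgroup_is_group)
  interpret group_hom G "G Mod H" "\<lambda>a. H #> a"
    by (rule group_hom.intro) (auto simp: group_hom_axioms_def r_coset_hom_Mod Q.is_group)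
  show ?thesis
    using hom_nat_pow[OF assms] by simp
qed

lemma carrier_Mod: "carrier (G Mod H) = (\<lambda>x. H #>\<^bsub>G\<^esub> x) ` carrier G"
  by (auto simp: FactGroup_def RCOSETS_def)

text \<open>Elementwise form of membership: unlike the order of the quotient, it passes to
  intersections and to the kernels constructed later without counting.\<close>

lemma finite_p_quotients_iff:
  assumes "prime p"
  shows "H \<in> finite_p_quotients p G \<longleftrightarrow> H \<lhd> G \<and> finite (carrier (G Mod H)) \<and>
    (\<forall>x\<in>carrier G. \<exists>k::nat. x [^]\<^bsub>G\<^esub> (p ^ k) \<in> H)"
proof (cases "H \<lhd> G")
  case True
  interpret normal H G by (rule True)
  interpret Q: group "G Mod H" by (rule factorgroup_is_group)
  have "(H #>\<^bsub>G\<^esub> x) [^]\<^bsub>G Mod H\<^esub> k = \<one>\<^bsub>G Mod H\<^esub> \<longleftrightarrow> x [^]\<^bsub>G\<^esub> k \<in> H"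
    if "x \<in> carrier G" for x and k :: nat
    using that coset_pow[OF that] coset_join1[of H "x [^]\<^bsub>G\<^esub> k"] coset_join2[of "x [^]\<^bsub>G\<^esub> k" H]
      subgroup_axioms by auto
  then show ?thesis
    using True by (simp add: finite_p_quotients_def Q.order_prime_power_iff[OF assms] carrier_Mod)
qed (simp add: finite_p_quotients_def)

text \<open>Finiteness of \<open>G/H\<close> is certified by a map with finite image that separates
  cosets: choosing a preimage for each value of \<open>f\<close> maps that image onto the
  quotient.\<close>

lemma finite_p_quotientsI:
  assumes "prime p" "H \<lhd> G" "finite (f ` carrier G)"
    and "\<And>x y. x \<in> carrier G \<Longrightarrow> y \<in> carrier G \<Longrightarrow> f x = f y \<Longrightarrow> H #>\<^bsub>G\<^esub> x = H #>\<^bsub>G\<^esub> y"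
    and "\<And>x. x \<in> carrier G \<Longrightarrow> \<exists>k::nat. x [^]\<^bsub>G\<^esub> (p ^ k) \<in> H"
  shows "H \<in> finite_p_quotients p G"
proof -
  have "carrier (G Mod H) \<subseteq> (\<lambda>y. H #>\<^bsub>G\<^esub> (SOME x. x \<in> carrier G \<and> f x = y)) ` f ` carrier G"
  proof (clarsimp simp: carrier_Mod)
    fix x assume x: "x \<in> carrier G"
    let ?y = "SOME y. y \<in> carrier G \<and> f y = f x"
    have "?y \<in> carrier G \<and> f ?y = f x"
      by (rule someI) (use x in auto)
    then show "H #>\<^bsub>G\<^esub> x \<in> (\<lambda>y. H #>\<^bsub>G\<^esub> (SOME x. x \<in> carrier G \<and> f x = y)) ` f ` carrier G"
      using assms(4)[of x ?y] x by auto
  qed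
  then have "finite (carrier (G Mod H))"
    using assms(3) finite_surj by blast
  then show ?thesis
    using assms(2,5) by (simp add: finite_p_quotients_iff[OF assms(1)])
qed

lemma (in group) normal_Int:
  assumes "H \<lhd> G" "K \<lhd> G"
  shows "H \<inter> K \<lhd> G"
  using assms subgroups_Inter_pair by (auto simp: normal_inv_iff)

lemma finite_p_quotients_Int:
  assumes "prime p" "H \<in> finite_p_quotients p G" "K \<in> finite_p_quotients p G"
  shows "H \<inter> K \<in> finite_p_quotients p G"
proof -
  have HK: "H \<lhd> G" "K \<lhd> G"
    using assms by (auto simp: finite_p_quotients_def)
  interpret H: normal H G by (rule HK)
  interpret K: normal K G by (rule HK)
  show ?thesis
  proof (rule finite_p_quotientsI[where f = "\<lambda>x. (H #>\<^bsub>G\<^esub> x, K #>\<^bsub>G\<^esub> x)"])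
    have "(\<lambda>x. (H #>\<^bsub>G\<^esub> x, K #>\<^bsub>G\<^esub> x)) ` carrier G \<subseteq> carrier (G Mod H) \<times> carrier (G Mod K)"
      by (auto simp: carrier_Mod)
    then show "finite ((\<lambda>x. (H #>\<^bsub>G\<^esub> x, K #>\<^bsub>G\<^esub> x)) ` carrier G)"
      using assms by (meson finite_SigmaI finite_p_quotients_iff finite_subset)
  next
    fix x y assume "x \<in> carrier G" "y \<in> carrier G" "(H #>\<^bsub>G\<^esub> x, K #>\<^bsub>G\<^esub> x) = (H #>\<^bsub>G\<^esub> y, K #>\<^bsub>G\<^esub> y)"
    then show "(H \<inter> K) #>\<^bsub>G\<^esub> x = (H \<inter> K) #>\<^bsub>G\<^esub> y"
      using H.coset_eq_iff H.subgroup_axioms K.subgroup_axioms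
        H.subgroups_Inter_pair[OF H.subgroup_axioms K.subgroup_axioms] by simp
  next
    fix x assume x: "x \<in> carrier G"
    obtain k l where kl: "x [^]\<^bsub>G\<^esub> (p ^ k) \<in> H" "x [^]\<^bsub>G\<^esub> (p ^ l) \<in> K"
      using assms x by (meson finite_p_quotients_iff)
    have "x [^]\<^bsub>G\<^esub> (p ^ (k + l)) \<in> H"
      using H.subgroup_axioms kl x
      by (metis H.nat_pow_pow H.subgroup_int_pow_closed int_pow_int power_add)
    moreover have "x [^]\<^bsub>G\<^esub> (p ^ (k + l)) \<in> K"
      using K.subgroup_axioms kl x
      by (metis H.nat_pow_pow H.subgroup_int_pow_closed int_pow_int power_add mult.commute)
    ultimately show "\<exists>k::nat. x [^]\<^bsub>G\<^esub> (p ^ k) \<in> H \<inter> K"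
      by blast
  qed (use assms HK H.normal_Int in auto)
qed

lemma (in group) carrier_in_finite_p_quotients:
  assumes "prime p"
  shows "carrier G \<in> finite_p_quotients p G"
proof (rule finite_p_quotientsI[OF assms, where f = "\<lambda>_. ()"])
  show "carrier G \<lhd> G"
    by (auto simp: normal_inv_iff subgroup_self)
qed (auto simp: coset_join2 subgroup_self)

section \<open>Countability of the family of finite quotients\<close>

text \<open>A subgroup of finite index is the stabiliser of a point of a finite automaton.\<close>

fun leads :: "('x \<times> nat \<times> nat) set \<Rightarrow> 'x list \<Rightarrow> nat \<Rightarrow> nat \<Rightarrow> bool" where
  "leads R [] i j \<longleftrightarrow> i = j"
| "leads R (x # w) i j \<longleftrightarrow> (\<exists>k. (x, i, k) \<in> R \<and> leads R w k j)"

text \<open>This is what later allows the index category to be placed in any infinite type. The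
  letters act on the finitely many cosets of \<open>H\<close> by right multiplication, and
  \<open>H\<close> consists of the words that lead from the coset \<open>H\<close> back to itself.
  So \<open>H\<close> is determined by a finite transition table and one state, and there are
  countably many such data.\<close>

lemma countable_finite_p_quotients:
  assumes "prime p"
  shows "countable (finite_p_quotients p (free_group n))"
proof -
  let ?F = "free_group n"
  have "finite_p_quotients p ?F \<subseteq>
    range (\<lambda>(L, s). {w \<in> carrier ?F. leads (set L) w s s})"
  proof
    fix H assume H: "H \<in> finite_p_quotients p ?F"
    then have "H \<lhd> ?F"
      by (simp add: finite_p_quotients_def)
    then interpret normal H ?F .
    let ?C = "carrier (?F Mod H)"
    have fin: "finite ?C"
      using H assms finite_p_quotients_iff by blast
    define b where "b = to_nat_on ?C"
    have b: "inj_on b ?C"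
      unfolding b_def by (rule inj_on_to_nat_on) (rule countable_finite[OF fin])
    \<comment> \<open>The transition table of the action of the letters on the cosets, with the
      cosets numbered by \<open>b\<close>.\<close>
    define R where "R = (\<lambda>(x, C). (x, b C, b (C #>\<^bsub>?F\<^esub> [x]))) ` (letters n \<times> ?C)"
    have "finite R"
      using fin by (simp add: R_def finite_letters)
    then obtain L where L: "set L = R"
      using finite_list by blast
    have R: "(x, b C, k) \<in> R \<longleftrightarrow> k = b (C #>\<^bsub>?F\<^esub> [x])" if "x \<in> letters n" "C \<in> ?C" for x C k
      using that b by (auto simp: R_def inj_on_def image_iff)
    have leads: "leads R w (b C) j \<longleftrightarrow> j = b (C #>\<^bsub>?F\<^esub> w)" if "w \<in> carrier ?F" "C \<in> ?C" for w C j
      using that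
    proof (induction w arbitrary: C)
      case Nil
      then have "C \<subseteq> carrier ?F"
        unfolding carrier_Mod using r_coset_subset_G[OF subset] by blast
      then show ?case
        using coset_mult_one[of C] by (auto simp: one_free_group)
    next
      case (Cons x w)
      note w = Cons_in_free_group[OF Cons.prems(1)]
      obtain g where g: "g \<in> carrier ?F" "C = H #>\<^bsub>?F\<^esub> g"
        using Cons.prems by (auto simp: carrier_Mod)
      have C: "C #>\<^bsub>?F\<^esub> [x] \<in> ?C"
        using g w by (auto simp: carrier_Mod coset_mult_assoc subset)
      have "x \<in> letters n"
        using Cons.prems by (auto simp: carrier_free_group)
      then have "leads R (x # w) (b C) j \<longleftrightarrow> leads R w (b (C #>\<^bsub>?F\<^esub> [x])) j"
        using R[of x C] Cons.prems by auto
      also have "\<dots> \<longleftrightarrow> j = b (C #>\<^bsub>?F\<^esub> [x] #>\<^bsub>?F\<^esub> w)"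
        using Cons.IH[OF w(2) C] .
      also have "C #>\<^bsub>?F\<^esub> [x] #>\<^bsub>?F\<^esub> w = C #>\<^bsub>?F\<^esub> (x # w)"
        using coset_mult_assoc[of C "[x]" w] w g r_coset_subset_G[OF subset g(1)] by simp
      finally show ?case .
    qed
    have H': "H \<in> ?C"
      using coset_join2[OF one_closed subgroup_axioms] one_closed by (force simp: carrier_Mod)
    have "H = {w \<in> carrier ?F. leads (set L) w (b H) (b H)}"
    proof -
      have "w \<in> H \<longleftrightarrow> leads R w (b H) (b H)" if w: "w \<in> carrier ?F" for w
      proof -
        have "leads R w (b H) (b H) \<longleftrightarrow> H = H #>\<^bsub>?F\<^esub> w"
          using leads[OF w H'] inj_onD[OF b _ H', of "H #>\<^bsub>?F\<^esub> w"] w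
          by (auto simp: carrier_Mod)
        then show ?thesis
          using coset_join1[OF _ w subgroup_axioms] coset_join2[OF w subgroup_axioms] by auto
      qed
      then show ?thesis
        using L subset by auto
    qed
    then show "H \<in> range (\<lambda>(L, s). {w \<in> carrier ?F. leads (set L) w s s})"
      by (intro range_eqI[of _ _ "(L, b H)"]) simp
  qed
  then show ?thesis
    by (rule countable_subset) simp
qed

text \<open>The class equation: conjugacy classes have \<open>p\<close>-power size, and those of
  size one are the central elements. If only \<open>\<one>\<close> were central, the order would be
  1 modulo \<open>p\<close>. A suitable power of a nontrivial central element then has order
  \<open>p\<close>.\<close>

lemma (in group) exists_central_of_order_p:
  assumes "prime p" "order G = p ^ k" "k > 0"
  shows "\<exists>z\<in>carrier G. z \<noteq> \<one> \<and> z [^] p = \<one> \<and> (\<forall>g\<in>carrier G. g \<otimes> z = z \<otimes> g)"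
proof -
  let ?\<phi> = "\<lambda>g. \<lambda>h\<in>carrier G. g \<otimes> h \<otimes> inv g"
  interpret C: group_action G "carrier G" ?\<phi>
    by (rule action_by_conjugation)
  let ?O = "orbits G (carrier G) ?\<phi>"
  have fin: "finite (carrier G)"
    using assms by (metis order_gt_0_iff_finite prime_gt_0_nat zero_less_power)
  have conj: "g \<otimes> x \<otimes> inv g = x \<longleftrightarrow> g \<otimes> x = x \<otimes> g" if "g \<in> carrier G" "x \<in> carrier G" for g x
    using that inv_solve_right' by (metis m_closed)
  have "\<exists>z\<in>carrier G. z \<noteq> \<one> \<and> (\<forall>g\<in>carrier G. g \<otimes> z = z \<otimes> g)"
  proof (rule ccontr)
    assume no: "\<not> ?thesis"
    have one: "orbit G ?\<phi> \<one> = {\<one>}"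
      by (auto simp: orbit_def intro: exI[of _ \<one>])
    have "p dvd card o'" if "o' \<in> ?O - {{\<one>}}" for o'
    proof -
      have "\<exists>x. o' = orbit G ?\<phi> x \<and> x \<in> carrier G"
        using DiffD1[OF that] by (simp only: orbits_def mem_Collect_eq)
      then obtain x where x: "x \<in> carrier G" "o' = orbit G ?\<phi> x"
        by (elim exE conjE)
      then have "x \<noteq> \<one>"
        using that one by auto
      then obtain g where g: "g \<in> carrier G" "g \<otimes> x \<noteq> x \<otimes> g"
        using no x by blast
      have "x \<in> o'"
        using C.orbit_refl[OF x(1)] x(2) by simp
      moreover have "g \<otimes> x \<otimes> inv g \<in> o'"
        unfolding x(2) orbit_def using g(1) x(1) by force
      moreover have "g \<otimes> x \<otimes> inv g \<noteq> x"
        using g conj[OF g(1) x(1)] by simp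
      ultimately have "card o' \<noteq> 1"
        by (metis card_1_singletonE singletonD)
      moreover have "card o' dvd p ^ k"
        unfolding x(2) assms(2)[symmetric] C.orbit_stabilizer_theorem[OF x(1), symmetric]
        by (rule dvd_triv_left)
      then obtain i where "card o' = p ^ i"
        using divides_primepow_nat[OF assms(1)] by blast
      ultimately show ?thesis
        by (cases i) simp_all
    qed
    then have "p dvd (\<Sum>o'\<in>?O - {{\<one>}}. card o')"
      by (rule dvd_sum)
    moreover have finO: "finite ?O"
      using fin by (auto simp: orbits_def)
    moreover have "{\<one>} \<in> ?O"
      using one by (force simp: orbits_def)
    ultimately have "(\<Sum>o'\<in>?O. card o') = card {\<one>} + (\<Sum>o'\<in>?O - {{\<one>}}. card o')"
      by (simp add: sum.remove)
    moreover have "(\<Sum>o'\<in>?O. card o') = card (carrier G)"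
      using C.disjoint_sum[OF fin, of "\<lambda>_. 1::nat"] by simp
    ultimately have "p ^ k = 1 + (\<Sum>o'\<in>?O - {{\<one>}}. card o')"
      using assms by (simp add: order_def)
    moreover have "p dvd p ^ k"
      using assms by (simp add: dvd_power)
    ultimately have "p dvd 1 + (\<Sum>o'\<in>?O - {{\<one>}}. card o')"
      by (simp only:)
    then have "p dvd 1"
      using dvd_add_left_iff[OF \<open>p dvd (\<Sum>o'\<in>?O - {{\<one>}}. card o')\<close>] by (rule iffD1[rotated])
    then show False
      using assms by (simp add: prime_nat_iff)
  qed
  then obtain z where z: "z \<in> carrier G" "z \<noteq> \<one>" "\<And>g. g \<in> carrier G \<Longrightarrow> g \<otimes> z = z \<otimes> g"
    by blast
  have "ord z dvd p ^ k"
    using z assms ord_dvd_group_order by metis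
  then obtain i where i: "ord z = p ^ i"
    using assms divides_primepow_nat by blast
  have "i \<noteq> 0"
    using i z ord_eq_1 by (metis power_0)
  then obtain j where j: "i = Suc j"
    using not0_implies_Suc by blast
  \<comment> \<open>\<open>z\<close> has order \<open>p ^ Suc j\<close>, so this power has order
    \<open>p\<close>.\<close>
  define y where "y = z [^] (p ^ j)"
  have "y \<in> carrier G" using z by (simp add: y_def)
  moreover have "y \<noteq> \<one>"
  proof
    assume "y = \<one>"
    then have "p ^ i dvd p ^ j"
      using z pow_eq_id i by (simp add: y_def)
    then show False
      using j assms prime_gt_1_nat by (metis Suc_n_not_le_n power_dvd_imp_le)
  qed
  moreover have "y [^] p = \<one>"
    using z i j pow_ord_eq_1[of z] by (simp add: y_def nat_pow_pow mult.commute)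
  moreover have "g \<otimes> y = y \<otimes> g" if "g \<in> carrier G" for g
  proof -
    have "g \<otimes> z [^] m = z [^] m \<otimes> g" for m :: nat
    proof (induction m)
      case (Suc m)
      then show ?case
        using z that by (metis (no_types, lifting) m_assoc nat_pow_Suc nat_pow_closed)
    qed (use that in simp)
    then show ?thesis by (simp add: y_def)
  qed
  ultimately show ?thesis by blast
qed

section \<open>Group cohomology with inhomogeneous cochains\<close>

lemma (in abelian_group) a_inv_zero [simp]: "\<ominus> \<zero> = \<zero>"
  by (rule minus_equality) simp_all

text \<open>The method \<open>algebra\<close> is set up for rings only; this makes it decide identities in abelian groups.\<close>

lemmas (in abelian_group) abelian_group_simprules
  [algebra abelian_group "zero G" "add G" "a_inv G" "a_minus G"] =
  a_closed zero_closed a_inv_closed minus_closed a_assoc l_zero l_neg a_comm minus_eq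
  r_zero r_neg r_neg2 r_neg1 minus_add minus_minus a_inv_zero a_lcomm

text \<open>Inhomogeneous cochains are functions on all lists, with values prescribed only on lists
  of length \<open>m\<close> over \<open>G\<close>. Without an extensionality condition,
  \<open>\<lambda>k. c (g # k)\<close> is again a cochain, which the recursion \<open>tau\<close>
  relies on.\<close>

definition lcochains :: "('g, 'b) monoid_scheme \<Rightarrow> ('a, 'c) ring_scheme \<Rightarrow> nat \<Rightarrow> ('g list \<Rightarrow> 'a) set" where
  "lcochains G N m = {c. \<forall>l. length l = m \<and> set l \<subseteq> carrier G \<longrightarrow> c l \<in> carrier N}"

text \<open>
  The part of the inhomogeneous coboundary that does not involve the action, i.e. the alternating
  sum of all faces but the first one; peeling off the first letter turns the sum into a recursion.
\<close>

fun tau :: "('g, 'b) monoid_scheme \<Rightarrow> ('a, 'c) ring_scheme \<Rightarrow> ('g list \<Rightarrow> 'a) \<Rightarrow> 'g list \<Rightarrow> 'a" where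
  "tau G N c [] = \<zero>\<^bsub>N\<^esub>"
| "tau G N c [g] = c []"
| "tau G N c (g # h # l) = c ((g \<otimes>\<^bsub>G\<^esub> h) # l) \<ominus>\<^bsub>N\<^esub> tau G N (\<lambda>k. c (g # k)) (h # l)"

definition lcobdry :: "('g, 'b) monoid_scheme \<Rightarrow> ('a, 'c) ring_scheme \<Rightarrow> ('g \<Rightarrow> 'a \<Rightarrow> 'a) \<Rightarrow>
    ('g list \<Rightarrow> 'a) \<Rightarrow> 'g list \<Rightarrow> 'a" where
  "lcobdry G N rho c l = rho (hd l) (c (tl l)) \<ominus>\<^bsub>N\<^esub> tau G N c l"

definition lcocycle :: "('g, 'b) monoid_scheme \<Rightarrow> ('a, 'c) ring_scheme \<Rightarrow> ('g \<Rightarrow> 'a \<Rightarrow> 'a) \<Rightarrow> nat \<Rightarrow>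
    ('g list \<Rightarrow> 'a) \<Rightarrow> bool" where
  "lcocycle G N rho m c \<longleftrightarrow> c \<in> lcochains G N m \<and>
     (\<forall>l. length l = Suc m \<and> set l \<subseteq> carrier G \<longrightarrow> lcobdry G N rho c l = \<zero>\<^bsub>N\<^esub>)"

text \<open>The cochains inflated from \<open>G/H\<close>, expressed on \<open>G\<close> itself so
  that one group carries all cochains of the argument.\<close>

definition invariant_mod :: "('g, 'b) monoid_scheme \<Rightarrow> 'g set \<Rightarrow> nat \<Rightarrow> ('g list \<Rightarrow> 'a) \<Rightarrow> bool" where
  "invariant_mod G H m c \<longleftrightarrow> (\<forall>l l'. length l = m \<and> set l \<subseteq> carrier G \<and> set l' \<subseteq> carrier G \<and>
     map (\<lambda>x. H #>\<^bsub>G\<^esub> x) l = map (\<lambda>x. H #>\<^bsub>G\<^esub> x) l' \<longrightarrow> c l = c l')"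

lemma lcochainsD: "c \<in> lcochains G N m \<Longrightarrow> length l = m \<Longrightarrow> set l \<subseteq> carrier G \<Longrightarrow> c l \<in> carrier N"
  by (simp add: lcochains_def)

lemma lcochains_Cons: "c \<in> lcochains G N (Suc m) \<Longrightarrow> g \<in> carrier G \<Longrightarrow> (\<lambda>k. c (g # k)) \<in> lcochains G N m"
  by (simp add: lcochains_def)

lemma invariant_modD:
  "invariant_mod G H m c \<Longrightarrow> length l = m \<Longrightarrow> set l \<subseteq> carrier G \<Longrightarrow> set l' \<subseteq> carrier G \<Longrightarrow>
   map (\<lambda>x. H #>\<^bsub>G\<^esub> x) l = map (\<lambda>x. H #>\<^bsub>G\<^esub> x) l' \<Longrightarrow> c l = c l'"
  by (simp add: invariant_mod_def)

lemma (in group) invariant_mod_mono: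
  assumes "invariant_mod G H m c" "subgroup K G" "subgroup H G" "K \<subseteq> H"
  shows "invariant_mod G K m c"
proof -
  have "map (\<lambda>x. H #> x) l = map (\<lambda>x. H #> x) l'"
    if "map (\<lambda>x. K #> x) l = map (\<lambda>x. K #> x) l'" "set l \<subseteq> carrier G" "set l' \<subseteq> carrier G" for l l'
    using that assms(2-4) by (auto simp: coset_eq_iff list_eq_iff_nth_eq subset_iff)
  then show ?thesis
    using assms(1) unfolding invariant_mod_def by blast
qed

lemma (in abelian_group) diff_diff_diff:
  assumes "a \<in> carrier G" "b \<in> carrier G" "c \<in> carrier G" "d \<in> carrier G"
  shows "(a \<ominus> b) \<ominus> (c \<ominus> d) = (a \<ominus> c) \<ominus> (b \<ominus> d)"
  using assms by algebra

lemma (in abelian_group) eq_of_diff_zero: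
  assumes "a \<in> carrier G" "b \<in> carrier G" "a \<ominus> b = \<zero>"
  shows "a = b"
proof -
  have "a = (a \<ominus> b) \<oplus> b"
    using assms(1,2) by algebra
  then show ?thesis using assms by simp
qed

lemma (in abelian_group) diff_diff_cancel:
  assumes "a \<in> carrier G" "b \<in> carrier G"
  shows "a \<ominus> (a \<ominus> b) = b"
  using assms by algebra

locale gmodule = abelian_group N + G: group G
  for N :: "('a, 'c) ring_scheme" (structure) and G :: "('g, 'b) monoid_scheme" +
  fixes rho :: "'g \<Rightarrow> 'a \<Rightarrow> 'a"
  assumes act_closed [simp, intro]: "g \<in> carrier G \<Longrightarrow> x \<in> carrier N \<Longrightarrow> rho g x \<in> carrier N"
    and act_add: "g \<in> carrier G \<Longrightarrow> x \<in> carrier N \<Longrightarrow> y \<in> carrier N \<Longrightarrow>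
      rho g (x \<oplus> y) = rho g x \<oplus> rho g y"
    and act_one [simp]: "x \<in> carrier N \<Longrightarrow> rho \<one>\<^bsub>G\<^esub> x = x"
    and act_mult: "g \<in> carrier G \<Longrightarrow> h \<in> carrier G \<Longrightarrow> x \<in> carrier N \<Longrightarrow>
      rho (g \<otimes>\<^bsub>G\<^esub> h) x = rho g (rho h x)"
begin

lemma act_zero [simp]: "g \<in> carrier G \<Longrightarrow> rho g \<zero> = \<zero>"
  using act_add[of g \<zero> \<zero>] act_closed[of g \<zero>] add.l_cancel_one by fastforce

lemma act_minus: "g \<in> carrier G \<Longrightarrow> x \<in> carrier N \<Longrightarrow> rho g (\<ominus> x) = \<ominus> rho g x"
  using act_add[of g x "\<ominus> x"] using minus_equality[of "rho g (\<ominus> x)" "rho g x"] by (simp add: r_neg a_comm)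

lemma act_diff: "g \<in> carrier G \<Longrightarrow> x \<in> carrier N \<Longrightarrow> y \<in> carrier N \<Longrightarrow>
    rho g (x \<ominus> y) = rho g x \<ominus> rho g y"
  by (simp add: minus_eq act_add act_minus)

section \<open>Additivity and equivariance of the action-free part of the coboundary\<close>

lemma tau_closed:
  "c \<in> lcochains G N m \<Longrightarrow> length l = Suc m \<Longrightarrow> set l \<subseteq> carrier G \<Longrightarrow> tau G N c l \<in> carrier N"
proof (induction m arbitrary: c l)
  case 0
  then obtain g where "l = [g]"
    by (auto simp: length_Suc_conv)
  then show ?case using 0 by (simp add: lcochains_def)
next
  case (Suc m)
  then obtain g h k where l: "l = g # h # k"
    by (auto simp: length_Suc_conv)
  show ?case
    using Suc.IH[of "\<lambda>k. c (g # k)" "h # k"] Suc.prems l lcochains_Cons[OF Suc.prems(1), of g]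
      lcochainsD[OF Suc.prems(1), of "(g \<otimes>\<^bsub>G\<^esub> h) # k"] by auto
qed

lemma tau_cong:
  "(\<And>k. length k = m \<Longrightarrow> set k \<subseteq> carrier G \<Longrightarrow> c k = d k) \<Longrightarrow> length l = Suc m \<Longrightarrow>
   set l \<subseteq> carrier G \<Longrightarrow> tau G N c l = tau G N d l"
proof (induction m arbitrary: c d l)
  case 0
  then obtain g where "l = [g]"
    by (auto simp: length_Suc_conv)
  then show ?case using 0 by simp
next
  case (Suc m)
  then obtain g h k where l: "l = g # h # k"
    by (auto simp: length_Suc_conv)
  have "tau G N (\<lambda>k. c (g # k)) (h # k) = tau G N (\<lambda>k. d (g # k)) (h # k)"
    by (rule Suc.IH) (use Suc.prems l in auto)
  moreover have "c ((g \<otimes>\<^bsub>G\<^esub> h) # k) = d ((g \<otimes>\<^bsub>G\<^esub> h) # k)"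
    by (rule Suc.prems) (use Suc.prems l in auto)
  ultimately show ?case
    using l by simp
qed

lemma tau_diff:
  "c \<in> lcochains G N m \<Longrightarrow> d \<in> lcochains G N m \<Longrightarrow> length l = Suc m \<Longrightarrow> set l \<subseteq> carrier G \<Longrightarrow>
   tau G N (\<lambda>k. c k \<ominus> d k) l = tau G N c l \<ominus> tau G N d l"
proof (induction m arbitrary: c d l)
  case 0
  then obtain g where "l = [g]"
    by (auto simp: length_Suc_conv)
  then show ?case by simp
next
  case (Suc m)
  then obtain g h k where l: "l = g # h # k"
    by (auto simp: length_Suc_conv)
  have g: "g \<in> carrier G" "h \<in> carrier G" "set k \<subseteq> carrier G" "length k = m"
    using Suc.prems l by auto
  note cd = lcochains_Cons[OF Suc.prems(1) g(1)] lcochains_Cons[OF Suc.prems(2) g(1)]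
  have "tau G N (\<lambda>k. c (g # k) \<ominus> d (g # k)) (h # k) =
      tau G N (\<lambda>k. c (g # k)) (h # k) \<ominus> tau G N (\<lambda>k. d (g # k)) (h # k)"
    by (rule Suc.IH[OF cd]) (use g in auto)
  moreover have "c ((g \<otimes>\<^bsub>G\<^esub> h) # k) \<in> carrier N" "d ((g \<otimes>\<^bsub>G\<^esub> h) # k) \<in> carrier N"
    using Suc.prems g by (auto intro!: lcochainsD)
  moreover have "tau G N (\<lambda>k. c (g # k)) (h # k) \<in> carrier N" "tau G N (\<lambda>k. d (g # k)) (h # k) \<in> carrier N"
    using tau_closed[OF cd(1)] tau_closed[OF cd(2)] g by auto
  ultimately show ?case
    unfolding l tau.simps by (simp only: diff_diff_diff)
qed

lemma tau_act:
  "c \<in> lcochains G N m \<Longrightarrow> x \<in> carrier G \<Longrightarrow> length l = Suc m \<Longrightarrow> set l \<subseteq> carrier G \<Longrightarrow>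
   tau G N (\<lambda>k. rho x (c k)) l = rho x (tau G N c l)"
proof (induction m arbitrary: c l)
  case 0
  then obtain g where "l = [g]"
    by (auto simp: length_Suc_conv)
  then show ?case by simp
next
  case (Suc m)
  then obtain g h k where l: "l = g # h # k"
    by (auto simp: length_Suc_conv)
  have g: "g \<in> carrier G" "h \<in> carrier G" "set k \<subseteq> carrier G" "length k = m"
    using Suc.prems l by auto
  note c = lcochains_Cons[OF Suc.prems(1) g(1)]
  have "tau G N (\<lambda>k. rho x (c (g # k))) (h # k) = rho x (tau G N (\<lambda>k. c (g # k)) (h # k))"
    by (rule Suc.IH[OF c]) (use g Suc.prems in auto)
  then show ?case
    unfolding l tau.simps
    using act_diff[OF Suc.prems(2) lcochainsD[OF Suc.prems(1), of "(g \<otimes>\<^bsub>G\<^esub> h) # k"] tau_closed[OF c, of "h # k"]] g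
    by simp
qed

end

subsection \<open>Dimension shifting\<close>

text \<open>
  \<open>shift_mod\<close> is the cokernel of \<open>N \<rightarrow> Map(G/H, N)\<close>, \<open>n \<mapsto> (x \<mapsto> x n)\<close>, identified with the functions vanishing
  at \<open>1\<close>.  The coding \<open>enc\<close> keeps the module in the same type, so that shifting can be iterated.
\<close>

locale shift = gmodule N G rho + H: normal H G
  for N :: "('a, 'c) ring_scheme" (structure) and G :: "('g, 'b) monoid_scheme" and rho H +
  fixes enc :: "('g \<Rightarrow> 'a) \<Rightarrow> 'a" and dec :: "'a \<Rightarrow> 'g \<Rightarrow> 'a"
  assumes dec_enc [simp]: "dec (enc f) = f"
    and act_H: "h \<in> H \<Longrightarrow> x \<in> carrier N \<Longrightarrow> rho h x = x"
begin

definition shift_funs :: "('g \<Rightarrow> 'a) set" where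
  "shift_funs = {f \<in> carrier G \<rightarrow>\<^sub>E carrier N. f \<one>\<^bsub>G\<^esub> = \<zero> \<and>
     (\<forall>x\<in>carrier G. \<forall>y\<in>carrier G. H #>\<^bsub>G\<^esub> x = H #>\<^bsub>G\<^esub> y \<longrightarrow> f x = f y)}"

definition shift_mod :: "'a ring" where
  "shift_mod = \<lparr>carrier = enc ` shift_funs, monoid.mult = (\<lambda>_ _. undefined), one = undefined,
     zero = enc (\<lambda>x\<in>carrier G. \<zero>), add = (\<lambda>\<phi> \<psi>. enc (\<lambda>x\<in>carrier G. dec \<phi> x \<oplus> dec \<psi> x))\<rparr>"

text \<open>Translation \<open>x \<mapsto> dec \<phi> (x g)\<close> on \<open>Map(G/H, N)\<close>
  takes the value \<open>dec \<phi> g\<close> at 1. Subtracting the image of that value under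
  \<open>n \<mapsto> (x \<mapsto> x n)\<close> returns to the representative vanishing at 1.\<close>

definition shift_act :: "'g \<Rightarrow> 'a \<Rightarrow> 'a" where
  "shift_act g \<phi> = enc (\<lambda>x\<in>carrier G. dec \<phi> (x \<otimes>\<^bsub>G\<^esub> g) \<ominus> rho x (dec \<phi> g))"

lemma act_coset:
  assumes "x \<in> carrier G" "y \<in> carrier G" "H #>\<^bsub>G\<^esub> x = H #>\<^bsub>G\<^esub> y" "n \<in> carrier N"
  shows "rho x n = rho y n"
proof -
  have "x \<otimes>\<^bsub>G\<^esub> inv\<^bsub>G\<^esub> y \<in> H"
    using assms G.coset_eq_iff H.subgroup_axioms by metis
  then have "rho (x \<otimes>\<^bsub>G\<^esub> inv\<^bsub>G\<^esub> y) (rho y n) = rho y n"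
    using assms act_H by simp
  moreover have "rho (x \<otimes>\<^bsub>G\<^esub> inv\<^bsub>G\<^esub> y) (rho y n) = rho ((x \<otimes>\<^bsub>G\<^esub> inv\<^bsub>G\<^esub> y) \<otimes>\<^bsub>G\<^esub> y) n"
    using assms by (simp add: act_mult)
  moreover have "(x \<otimes>\<^bsub>G\<^esub> inv\<^bsub>G\<^esub> y) \<otimes>\<^bsub>G\<^esub> y = x"
    using assms by (simp add: G.m_assoc)
  ultimately show ?thesis by simp
qed

lemma coset_mult_right:
  assumes "x \<in> carrier G" "y \<in> carrier G" "g \<in> carrier G" "H #>\<^bsub>G\<^esub> x = H #>\<^bsub>G\<^esub> y"
  shows "H #>\<^bsub>G\<^esub> (x \<otimes>\<^bsub>G\<^esub> g) = H #>\<^bsub>G\<^esub> (y \<otimes>\<^bsub>G\<^esub> g)"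
  using assms by (metis G.coset_mult_assoc H.subset)

lemma shift_carrierD:
  assumes "\<phi> \<in> carrier shift_mod"
  shows "\<And>x. x \<in> carrier G \<Longrightarrow> dec \<phi> x \<in> carrier N" "dec \<phi> \<one>\<^bsub>G\<^esub> = \<zero>"
    "\<And>x y. x \<in> carrier G \<Longrightarrow> y \<in> carrier G \<Longrightarrow> H #>\<^bsub>G\<^esub> x = H #>\<^bsub>G\<^esub> y \<Longrightarrow> dec \<phi> x = dec \<phi> y"
proof -
  have "carrier shift_mod = enc ` shift_funs"
    by (simp add: shift_mod_def)
  then obtain f where f: "\<phi> = enc f" "f \<in> shift_funs"
    using assms by blast
  have f': "f \<in> carrier G \<rightarrow>\<^sub>E carrier N" "f \<one>\<^bsub>G\<^esub> = \<zero>"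
    "\<forall>x\<in>carrier G. \<forall>y\<in>carrier G. H #>\<^bsub>G\<^esub> x = H #>\<^bsub>G\<^esub> y \<longrightarrow> f x = f y"
    using f(2) unfolding shift_funs_def by blast+
  show "\<And>x. x \<in> carrier G \<Longrightarrow> dec \<phi> x \<in> carrier N" "dec \<phi> \<one>\<^bsub>G\<^esub> = \<zero>"
    unfolding f dec_enc using f'(1,2) by blast+
  show "dec \<phi> x = dec \<phi> y" if "x \<in> carrier G" "y \<in> carrier G" "H #>\<^bsub>G\<^esub> x = H #>\<^bsub>G\<^esub> y" for x y
    unfolding f dec_enc using f'(3) that by blast
qed

lemma shift_carrierI:
  assumes "\<And>x. x \<in> carrier G \<Longrightarrow> f x \<in> carrier N" "f \<one>\<^bsub>G\<^esub> = \<zero>"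
    "\<And>x y. x \<in> carrier G \<Longrightarrow> y \<in> carrier G \<Longrightarrow> H #>\<^bsub>G\<^esub> x = H #>\<^bsub>G\<^esub> y \<Longrightarrow> f x = f y"
  shows "enc (\<lambda>x\<in>carrier G. f x) \<in> carrier shift_mod"
proof -
  have "restrict f (carrier G) \<in> shift_funs"
    unfolding shift_funs_def
  proof (intro CollectI conjI ballI impI)
    fix x y assume "x \<in> carrier G" "y \<in> carrier G" "H #>\<^bsub>G\<^esub> x = H #>\<^bsub>G\<^esub> y"
    then show "restrict f (carrier G) x = restrict f (carrier G) y"
      using assms(3)[of x y] by simp
  qed (use assms(1,2) in auto)
  then show ?thesis
    by (simp add: shift_mod_def)
qed

lemma shift_eqI:
  assumes "\<phi> \<in> carrier shift_mod" "\<psi> \<in> carrier shift_mod"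
    and eq: "\<And>x. x \<in> carrier G \<Longrightarrow> dec \<phi> x = dec \<psi> x"
  shows "\<phi> = \<psi>"
proof -
  have "carrier shift_mod = enc ` shift_funs"
    by (simp add: shift_mod_def)
  then obtain f f' where f: "\<phi> = enc f" "f \<in> shift_funs" "\<psi> = enc f'" "f' \<in> shift_funs"
    using assms by blast
  then have "f \<in> carrier G \<rightarrow>\<^sub>E carrier N" "f' \<in> carrier G \<rightarrow>\<^sub>E carrier N"
    unfolding shift_funs_def by blast+
  then have "f = f'"
    by (rule PiE_ext) (use eq f in simp)
  then show ?thesis using f by simp
qed

lemma dec_add: "x \<in> carrier G \<Longrightarrow> dec (\<phi> \<oplus>\<^bsub>shift_mod\<^esub> \<psi>) x = dec \<phi> x \<oplus> dec \<psi> x"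
  and dec_zero: "x \<in> carrier G \<Longrightarrow> dec \<zero>\<^bsub>shift_mod\<^esub> x = \<zero>"
  and dec_act: "x \<in> carrier G \<Longrightarrow> dec (shift_act g \<phi>) x = dec \<phi> (x \<otimes>\<^bsub>G\<^esub> g) \<ominus> rho x (dec \<phi> g)"
  by (simp_all add: shift_mod_def shift_act_def)

lemma shift_add_closed:
  assumes "\<phi> \<in> carrier shift_mod" "\<psi> \<in> carrier shift_mod"
  shows "\<phi> \<oplus>\<^bsub>shift_mod\<^esub> \<psi> \<in> carrier shift_mod"
proof -
  note D = shift_carrierD[OF assms(1)] shift_carrierD[OF assms(2)]
  have "\<phi> \<oplus>\<^bsub>shift_mod\<^esub> \<psi> = enc (\<lambda>x\<in>carrier G. dec \<phi> x \<oplus> dec \<psi> x)"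
    by (simp add: shift_mod_def)
  moreover have "enc (\<lambda>x\<in>carrier G. dec \<phi> x \<oplus> dec \<psi> x) \<in> carrier shift_mod"
  proof (rule shift_carrierI)
    fix x y assume "x \<in> carrier G" "y \<in> carrier G" "H #>\<^bsub>G\<^esub> x = H #>\<^bsub>G\<^esub> y"
    then show "dec \<phi> x \<oplus> dec \<psi> x = dec \<phi> y \<oplus> dec \<psi> y"
      using D(3)[of x y] D(6)[of x y] by simp
  qed (use D(1,2,4,5) in auto)
  ultimately show ?thesis by simp
qed

lemma shift_zero_closed: "\<zero>\<^bsub>shift_mod\<^esub> \<in> carrier shift_mod"
  using shift_carrierI[of "\<lambda>_. \<zero>"] by (simp add: shift_mod_def)

lemma shift_act_closed:
  assumes "\<phi> \<in> carrier shift_mod" "g \<in> carrier G"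
  shows "shift_act g \<phi> \<in> carrier shift_mod"
  unfolding shift_act_def
proof (rule shift_carrierI)
  note \<phi> = shift_carrierD[OF assms(1)]
  show "dec \<phi> (x \<otimes>\<^bsub>G\<^esub> g) \<ominus> rho x (dec \<phi> g) \<in> carrier N" if "x \<in> carrier G" for x
    using that \<phi>(1) assms by simp
  show "dec \<phi> (\<one>\<^bsub>G\<^esub> \<otimes>\<^bsub>G\<^esub> g) \<ominus> rho \<one>\<^bsub>G\<^esub> (dec \<phi> g) = \<zero>"
    using \<phi>(1) assms by (simp add: r_neg minus_eq)
  show "dec \<phi> (x \<otimes>\<^bsub>G\<^esub> g) \<ominus> rho x (dec \<phi> g) = dec \<phi> (y \<otimes>\<^bsub>G\<^esub> g) \<ominus> rho y (dec \<phi> g)"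
    if "x \<in> carrier G" "y \<in> carrier G" "H #>\<^bsub>G\<^esub> x = H #>\<^bsub>G\<^esub> y" for x y
    using that \<phi>(1)[OF assms(2)] \<phi>(3)[of "x \<otimes>\<^bsub>G\<^esub> g" "y \<otimes>\<^bsub>G\<^esub> g"] assms(2)
      act_coset[OF that] coset_mult_right[OF that(1,2) assms(2) that(3)] by simp
qed

sublocale S: abelian_group shift_mod
proof (rule abelian_groupI)
  fix \<phi> assume \<phi>: "\<phi> \<in> carrier shift_mod"
  let ?\<psi> = "enc (\<lambda>x\<in>carrier G. \<ominus> dec \<phi> x)"
  have \<psi>: "?\<psi> \<in> carrier shift_mod"
  proof (rule shift_carrierI)
    fix x y assume "x \<in> carrier G" "y \<in> carrier G" "H #>\<^bsub>G\<^esub> x = H #>\<^bsub>G\<^esub> y"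
    then show "\<ominus> dec \<phi> x = \<ominus> dec \<phi> y"
      using shift_carrierD(3)[OF \<phi>, of x y] by simp
  qed (use shift_carrierD(1,2)[OF \<phi>] in auto)
  have "?\<psi> \<oplus>\<^bsub>shift_mod\<^esub> \<phi> = \<zero>\<^bsub>shift_mod\<^esub>"
    by (rule shift_eqI)
      (use \<phi> \<psi> shift_carrierD(1)[OF \<phi>] in \<open>auto simp: shift_add_closed shift_zero_closed dec_add dec_zero l_neg\<close>)
  then show "\<exists>\<psi>\<in>carrier shift_mod. \<psi> \<oplus>\<^bsub>shift_mod\<^esub> \<phi> = \<zero>\<^bsub>shift_mod\<^esub>"
    using \<psi> by blast
next
  fix \<phi> \<psi> \<chi> assume *: "\<phi> \<in> carrier shift_mod" "\<psi> \<in> carrier shift_mod" "\<chi> \<in> carrier shift_mod"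
  note D = shift_carrierD(1)[OF *(1)] shift_carrierD(1)[OF *(2)] shift_carrierD(1)[OF *(3)]
  show "\<phi> \<oplus>\<^bsub>shift_mod\<^esub> \<psi> \<oplus>\<^bsub>shift_mod\<^esub> \<chi> = \<phi> \<oplus>\<^bsub>shift_mod\<^esub> (\<psi> \<oplus>\<^bsub>shift_mod\<^esub> \<chi>)"
    by (rule shift_eqI) (use * D in \<open>auto simp: shift_add_closed dec_add a_assoc\<close>)
next
  fix \<phi> \<psi> assume *: "\<phi> \<in> carrier shift_mod" "\<psi> \<in> carrier shift_mod"
  note D = shift_carrierD(1)[OF *(1)] shift_carrierD(1)[OF *(2)]
  show "\<phi> \<oplus>\<^bsub>shift_mod\<^esub> \<psi> = \<psi> \<oplus>\<^bsub>shift_mod\<^esub> \<phi>"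
    by (rule shift_eqI) (use * D in \<open>auto simp: shift_add_closed dec_add a_comm\<close>)
next
  fix \<phi> assume *: "\<phi> \<in> carrier shift_mod"
  note D = shift_carrierD(1)[OF *(1)]
  show "\<zero>\<^bsub>shift_mod\<^esub> \<oplus>\<^bsub>shift_mod\<^esub> \<phi> = \<phi>"
    by (rule shift_eqI) (use * D in \<open>auto simp: shift_add_closed shift_zero_closed dec_add dec_zero\<close>)
qed (simp_all add: shift_add_closed shift_zero_closed)

lemma dec_minus:
  assumes "\<phi> \<in> carrier shift_mod" "x \<in> carrier G"
  shows "dec (\<ominus>\<^bsub>shift_mod\<^esub> \<phi>) x = \<ominus> dec \<phi> x"
proof -
  have "dec (\<ominus>\<^bsub>shift_mod\<^esub> \<phi> \<oplus>\<^bsub>shift_mod\<^esub> \<phi>) x = \<zero>"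
    using assms by (simp add: S.l_neg dec_zero)
  then have "dec (\<ominus>\<^bsub>shift_mod\<^esub> \<phi>) x \<oplus> dec \<phi> x = \<zero>"
    using assms by (simp add: dec_add)
  then show ?thesis
    using assms shift_carrierD(1)[OF assms(1)] shift_carrierD(1)[OF S.a_inv_closed[OF assms(1)]]
    by (simp add: minus_equality)
qed

lemma dec_diff:
  assumes "\<phi> \<in> carrier shift_mod" "\<psi> \<in> carrier shift_mod" "x \<in> carrier G"
  shows "dec (\<phi> \<ominus>\<^bsub>shift_mod\<^esub> \<psi>) x = dec \<phi> x \<ominus> dec \<psi> x"
  using assms by (simp add: a_minus_def dec_add dec_minus)

sublocale S: gmodule shift_mod G shift_act
proof (unfold_locales)
  fix g \<phi> assume *: "g \<in> carrier G" "\<phi> \<in> carrier shift_mod"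
  show "shift_act g \<phi> \<in> carrier shift_mod"
    using * by (simp add: shift_act_closed)
next
  fix g \<phi> \<psi> assume *: "g \<in> carrier G" "\<phi> \<in> carrier shift_mod" "\<psi> \<in> carrier shift_mod"
  show "shift_act g (\<phi> \<oplus>\<^bsub>shift_mod\<^esub> \<psi>) = shift_act g \<phi> \<oplus>\<^bsub>shift_mod\<^esub> shift_act g \<psi>"
  proof (rule shift_eqI)
    fix x assume x: "x \<in> carrier G"
    note [simp] = shift_carrierD(1)[OF *(2)] shift_carrierD(1)[OF *(3)]
    have "dec \<phi> (x \<otimes>\<^bsub>G\<^esub> g) \<in> carrier N" "dec \<psi> (x \<otimes>\<^bsub>G\<^esub> g) \<in> carrier N"
      "rho x (dec \<phi> g) \<in> carrier N" "rho x (dec \<psi> g) \<in> carrier N"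
      using x * by auto
    then have "dec \<phi> (x \<otimes>\<^bsub>G\<^esub> g) \<oplus> dec \<psi> (x \<otimes>\<^bsub>G\<^esub> g) \<ominus> (rho x (dec \<phi> g) \<oplus> rho x (dec \<psi> g)) =
      dec \<phi> (x \<otimes>\<^bsub>G\<^esub> g) \<ominus> rho x (dec \<phi> g) \<oplus> (dec \<psi> (x \<otimes>\<^bsub>G\<^esub> g) \<ominus> rho x (dec \<psi> g))"
      by algebra
    then show "dec (shift_act g (\<phi> \<oplus>\<^bsub>shift_mod\<^esub> \<psi>)) x = dec (shift_act g \<phi> \<oplus>\<^bsub>shift_mod\<^esub> shift_act g \<psi>) x"
      using * x by (simp add: dec_act dec_add act_add)
  qed (use * in \<open>auto simp: shift_act_closed\<close>)
next
  fix \<phi> assume *: "\<phi> \<in> carrier shift_mod"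
  show "shift_act \<one>\<^bsub>G\<^esub> \<phi> = \<phi>"
    by (rule shift_eqI)
      (use * shift_carrierD(1,2)[OF *] in \<open>auto simp: shift_act_closed dec_act minus_eq\<close>)
next
  fix g h \<phi> assume *: "g \<in> carrier G" "h \<in> carrier G" "\<phi> \<in> carrier shift_mod"
  show "shift_act (g \<otimes>\<^bsub>G\<^esub> h) \<phi> = shift_act g (shift_act h \<phi>)"
  proof (rule shift_eqI)
    fix x assume x: "x \<in> carrier G"
    note [simp] = shift_carrierD(1)[OF *(3)]
    have "dec \<phi> (x \<otimes>\<^bsub>G\<^esub> g \<otimes>\<^bsub>G\<^esub> h) \<in> carrier N" "rho x (dec \<phi> (g \<otimes>\<^bsub>G\<^esub> h)) \<in> carrier N"
      "rho x (rho g (dec \<phi> h)) \<in> carrier N"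
      using x * by auto
    then have "dec \<phi> (x \<otimes>\<^bsub>G\<^esub> g \<otimes>\<^bsub>G\<^esub> h) \<ominus> rho x (dec \<phi> (g \<otimes>\<^bsub>G\<^esub> h)) =
      dec \<phi> (x \<otimes>\<^bsub>G\<^esub> g \<otimes>\<^bsub>G\<^esub> h) \<ominus> rho x (rho g (dec \<phi> h)) \<ominus>
        (rho x (dec \<phi> (g \<otimes>\<^bsub>G\<^esub> h)) \<ominus> rho x (rho g (dec \<phi> h)))"
      by algebra
    then show "dec (shift_act (g \<otimes>\<^bsub>G\<^esub> h) \<phi>) x = dec (shift_act g (shift_act h \<phi>)) x"
      using * x by (simp add: dec_act act_mult act_diff G.m_assoc)
  qed (use * in \<open>auto simp: shift_act_closed\<close>)
qed

text \<open>The shifted module satisfies the same hypothesis as \<open>N\<close>, so that shifting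
  can be repeated. Normality puts \<open>x h\<close> and \<open>x\<close> into one coset, and the
  correction term vanishes because \<open>dec \<phi> h\<close> equals the value at 1.\<close>

lemma shift_act_H:
  assumes "h \<in> H" "\<phi> \<in> carrier shift_mod"
  shows "shift_act h \<phi> = \<phi>"
proof (rule shift_eqI)
  note \<phi> = shift_carrierD[OF assms(2)]
  have h: "h \<in> carrier G"
    using assms H.subset by blast
  fix x assume x: "x \<in> carrier G"
  have "H #>\<^bsub>G\<^esub> (x \<otimes>\<^bsub>G\<^esub> h) = H #>\<^bsub>G\<^esub> x"
    using G.coset_eq_iff[OF H.subgroup_axioms, of "x \<otimes>\<^bsub>G\<^esub> h" x] H.inv_op_closed2[OF x assms(1)] x h
    by simp
  then have "dec \<phi> (x \<otimes>\<^bsub>G\<^esub> h) = dec \<phi> x"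
    using \<phi>(3)[of "x \<otimes>\<^bsub>G\<^esub> h" x] x h by simp
  moreover have "H #>\<^bsub>G\<^esub> h = H #>\<^bsub>G\<^esub> \<one>\<^bsub>G\<^esub>"
    using assms h G.coset_eq_iff[OF H.subgroup_axioms h G.one_closed] by simp
  then have "dec \<phi> h = \<zero>"
    using \<phi>(2,3) h by (metis G.one_closed)
  ultimately show "dec (shift_act h \<phi>) x = dec \<phi> x"
    using x \<phi>(1)[OF x] dec_act[OF x, of h \<phi>] by (simp add: minus_eq)
next
  show "shift_act h \<phi> \<in> carrier shift_mod"
    using assms H.subset by (auto intro: shift_act_closed)
qed fact

lemma shift_torsion:
  assumes "\<And>n. n \<in> carrier N \<Longrightarrow> [p] \<cdot> n = \<zero>" "\<phi> \<in> carrier shift_mod"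
  shows "[(p::nat)] \<cdot>\<^bsub>shift_mod\<^esub> \<phi> = \<zero>\<^bsub>shift_mod\<^esub>"
proof (rule shift_eqI)
  fix x assume x: "x \<in> carrier G"
  have "dec ([k] \<cdot>\<^bsub>shift_mod\<^esub> \<phi>) x = [k] \<cdot> dec \<phi> x" for k :: nat
    by (induction k) (use x in \<open>auto simp: dec_zero dec_add\<close>)
  then show "dec ([p] \<cdot>\<^bsub>shift_mod\<^esub> \<phi>) x = dec \<zero>\<^bsub>shift_mod\<^esub> x"
    using assms x shift_carrierD(1) by (simp add: dec_zero)
qed (use assms in simp_all)

lemma dec_tau:
  "c \<in> lcochains G shift_mod m \<Longrightarrow> x \<in> carrier G \<Longrightarrow> length l = Suc m \<Longrightarrow> set l \<subseteq> carrier G \<Longrightarrow>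
   dec (tau G shift_mod c l) x = tau G N (\<lambda>k. dec (c k) x) l"
proof (induction m arbitrary: c l)
  case 0
  then obtain g where "l = [g]"
    by (auto simp: length_Suc_conv)
  then show ?case by simp
next
  case (Suc m)
  then obtain g h k where l: "l = g # h # k"
    by (auto simp: length_Suc_conv)
  have g: "g \<in> carrier G" "h \<in> carrier G" "set k \<subseteq> carrier G" "length k = m"
    using Suc.prems l by auto
  note c = lcochains_Cons[OF Suc.prems(1) g(1)]
  have "dec (tau G shift_mod (\<lambda>k. c (g # k)) (h # k)) x = tau G N (\<lambda>k. dec (c (g # k)) x) (h # k)"
    by (rule Suc.IH[OF c]) (use g Suc.prems in auto)
  then show ?case
    unfolding l tau.simps
    using dec_diff[OF lcochainsD[OF Suc.prems(1), of "(g \<otimes>\<^bsub>G\<^esub> h) # k"] S.tau_closed[OF c, of "h # k"]] g Suc.prems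
    by simp
qed

text \<open>By the cocycle identity, the cochain \<open>l \<mapsto> (x \<mapsto> c (x # l))\<close>
  with values in \<open>Map(G/H, N)\<close> has the image of \<open>c\<close> as its coboundary. Its
  class in the cokernel is therefore a cocycle, of degree one less than \<open>c\<close>. The
  subtracted term selects the representative that vanishes at 1.\<close>

definition shift_cochain :: "('g list \<Rightarrow> 'a) \<Rightarrow> 'g list \<Rightarrow> 'a" where
  "shift_cochain c l = enc (\<lambda>x\<in>carrier G. c (x # l) \<ominus> rho x (c (\<one>\<^bsub>G\<^esub> # l)))"

lemma dec_shift_cochain:
  "x \<in> carrier G \<Longrightarrow> dec (shift_cochain c l) x = c (x # l) \<ominus> rho x (c (\<one>\<^bsub>G\<^esub> # l))"
  by (simp add: shift_cochain_def)

lemma shift_cochain_in: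
  assumes "c \<in> lcochains G N (Suc m)" "invariant_mod G H (Suc m) c"
  shows "shift_cochain c \<in> lcochains G shift_mod m"
  unfolding lcochains_def
proof (clarify)
  fix l :: "'g list" assume l: "set l \<subseteq> carrier G" "m = length l"
  have c: "c (x # l) \<in> carrier N" if "x \<in> carrier G" for x
    using lcochainsD[OF assms(1), of "x # l"] l that by simp
  show "shift_cochain c l \<in> carrier shift_mod"
    unfolding shift_cochain_def
  proof (rule shift_carrierI)
    show "c (x # l) \<ominus> rho x (c (\<one>\<^bsub>G\<^esub> # l)) = c (y # l) \<ominus> rho y (c (\<one>\<^bsub>G\<^esub> # l))"
      if "x \<in> carrier G" "y \<in> carrier G" "H #>\<^bsub>G\<^esub> x = H #>\<^bsub>G\<^esub> y" for x y
      using invariant_modD[OF assms(2), of "x # l" "y # l"] act_coset[OF that c] l that by simp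
  qed (use c in \<open>auto simp: minus_eq r_neg\<close>)
qed

lemma shift_cochain_cocycle:
  assumes c: "lcocycle G N rho (Suc m) c" "invariant_mod G H (Suc m) c" and "m > 0"
  shows "lcocycle G shift_mod shift_act m (shift_cochain c)"
  unfolding lcocycle_def
proof (intro conjI allI impI; (elim conjE)?)
  have cc: "c \<in> lcochains G N (Suc m)"
    using c by (simp add: lcocycle_def)
  show sc: "shift_cochain c \<in> lcochains G shift_mod m"
    using shift_cochain_in cc c by blast
  fix l assume l: "length l = Suc m" "set l \<subseteq> carrier G"
  then obtain g h k where lg: "l = g # h # k"
    using \<open>m > 0\<close> by (cases l; cases "tl l") auto
  have g: "g \<in> carrier G" "h \<in> carrier G" "set k \<subseteq> carrier G" "length (h # k) = m"
    using l lg by auto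
  have D: "rho (hd k) (c (tl k)) \<ominus> tau G N c k = \<zero>" if "length k = Suc (Suc m)" "set k \<subseteq> carrier G" for k
    using c that by (simp add: lcocycle_def lcobdry_def)
  show "lcobdry G shift_mod shift_act (shift_cochain c) l = \<zero>\<^bsub>shift_mod\<^esub>"
  proof (rule shift_eqI)
    have t: "tau G shift_mod (shift_cochain c) l \<in> carrier shift_mod"
      using S.tau_closed[OF sc l] .
    have a: "shift_act g (shift_cochain c (h # k)) \<in> carrier shift_mod"
      using g by (auto intro!: shift_act_closed lcochainsD[OF sc])
    show "lcobdry G shift_mod shift_act (shift_cochain c) l \<in> carrier shift_mod"
      unfolding lcobdry_def using t a lg by simp
    fix x assume x: "x \<in> carrier G"
    note cx = lcochains_Cons[OF cc x] and c1 = lcochains_Cons[OF cc G.one_closed]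
    have ac1: "(\<lambda>k. rho x (c (\<one>\<^bsub>G\<^esub> # k))) \<in> lcochains G N m"
      using c1 x by (auto simp: lcochains_def)
    have tx: "tau G N (\<lambda>k. c (x # k)) l \<in> carrier N" "tau G N (\<lambda>k. c (\<one>\<^bsub>G\<^esub> # k)) l \<in> carrier N"
      using tau_closed[OF cx l] tau_closed[OF c1 l] .
    have cl: "c (g # h # k) \<in> carrier N" "c ((x \<otimes>\<^bsub>G\<^esub> g) # h # k) \<in> carrier N" "c (\<one>\<^bsub>G\<^esub> # h # k) \<in> carrier N"
      using g x by (auto intro!: lcochainsD[OF cc])
    have "dec (tau G shift_mod (shift_cochain c) l) x = tau G N (\<lambda>k. dec (shift_cochain c k) x) l"
      using dec_tau[OF sc x l] .
    also have "\<dots> = tau G N (\<lambda>k. c (x # k)) l \<ominus> tau G N (\<lambda>k. rho x (c (\<one>\<^bsub>G\<^esub> # k))) l"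
      using tau_diff[OF cx ac1 l] x by (simp add: dec_shift_cochain)
    also have "tau G N (\<lambda>k. rho x (c (\<one>\<^bsub>G\<^esub> # k))) l = rho x (tau G N (\<lambda>k. c (\<one>\<^bsub>G\<^esub> # k)) l)"
      using tau_act[OF c1 x l] .
    finally have 1: "dec (tau G shift_mod (shift_cochain c) l) x =
      tau G N (\<lambda>k. c (x # k)) l \<ominus> rho x (tau G N (\<lambda>k. c (\<one>\<^bsub>G\<^esub> # k)) l)" .
    \<comment> \<open>The cocycle identity at \<open>1 # l\<close>: the first two faces cancel, so
      the normalizing term contributes nothing to \<open>tau\<close>.\<close>
    have "rho \<one>\<^bsub>G\<^esub> (c l) \<ominus> (c ((\<one>\<^bsub>G\<^esub> \<otimes>\<^bsub>G\<^esub> g) # h # k) \<ominus> tau G N (\<lambda>k. c (\<one>\<^bsub>G\<^esub> # k)) l) = \<zero>"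
      using D[of "\<one>\<^bsub>G\<^esub> # l"] l lg by simp
    then have "c l \<ominus> (c l \<ominus> tau G N (\<lambda>k. c (\<one>\<^bsub>G\<^esub> # k)) l) = \<zero>"
      using cl lg g by simp
    moreover have "c l \<ominus> (c l \<ominus> tau G N (\<lambda>k. c (\<one>\<^bsub>G\<^esub> # k)) l) = tau G N (\<lambda>k. c (\<one>\<^bsub>G\<^esub> # k)) l"
      using diff_diff_cancel cl(1) tx(2) unfolding lg[symmetric] by blast
    ultimately have 2: "tau G N (\<lambda>k. c (\<one>\<^bsub>G\<^esub> # k)) l = \<zero>" by simp
    have 3: "rho x (c l) \<ominus> (c ((x \<otimes>\<^bsub>G\<^esub> g) # h # k) \<ominus> tau G N (\<lambda>k. c (x # k)) l) = \<zero>"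
      using D[of "x # l"] l lg x by simp
    \<comment> \<open>Two corrections meet here, one from \<open>shift_act\<close> and one from the
      normalization of \<open>shift_cochain\<close>; the terms
      \<open>rho x (rho g (c (1 # h # k)))\<close> they contain cancel.\<close>
    have 4: "dec (shift_act g (shift_cochain c (h # k))) x =
       c ((x \<otimes>\<^bsub>G\<^esub> g) # h # k) \<ominus> rho x (rho g (c (\<one>\<^bsub>G\<^esub> # h # k))) \<ominus> (rho x (c (g # h # k)) \<ominus> rho x (rho g (c (\<one>\<^bsub>G\<^esub> # h # k))))"
      using x g cl by (simp add: dec_act dec_shift_cochain act_mult act_diff)
    have "rho x (rho g (c (\<one>\<^bsub>G\<^esub> # h # k))) \<in> carrier N" "rho x (c (g # h # k)) \<in> carrier N"
      using x g cl by auto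
    moreover have "a \<ominus> b \<ominus> (d \<ominus> b) \<ominus> t = \<ominus> (d \<ominus> (a \<ominus> t))"
      if "a \<in> carrier N" "b \<in> carrier N" "d \<in> carrier N" "t \<in> carrier N" for a b d t
      using that by algebra
    ultimately have "c ((x \<otimes>\<^bsub>G\<^esub> g) # h # k) \<ominus> rho x (rho g (c (\<one>\<^bsub>G\<^esub> # h # k))) \<ominus> (rho x (c (g # h # k)) \<ominus> rho x (rho g (c (\<one>\<^bsub>G\<^esub> # h # k))))
       \<ominus> tau G N (\<lambda>k. c (x # k)) l = \<ominus> (rho x (c (g # h # k)) \<ominus> (c ((x \<otimes>\<^bsub>G\<^esub> g) # h # k) \<ominus> tau G N (\<lambda>k. c (x # k)) l))"
      using cl(2) tx(1) by blast
    then have fin: "dec (shift_act g (shift_cochain c (h # k))) x \<ominus> tau G N (\<lambda>k. c (x # k)) l = \<zero>"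
      unfolding 4 using 3 lg by simp
    show "dec (lcobdry G shift_mod shift_act (shift_cochain c) l) x = dec \<zero>\<^bsub>shift_mod\<^esub> x"
    proof -
      have "tau G N (\<lambda>k. c (x # k)) l \<ominus> rho x \<zero> = tau G N (\<lambda>k. c (x # k)) l"
        using x tx by (simp add: minus_eq)
      then have "dec (tau G shift_mod (shift_cochain c) l) x = tau G N (\<lambda>k. c (x # k)) l"
        using 1 2 by metis
      moreover have "lcobdry G shift_mod shift_act (shift_cochain c) l =
          shift_act g (shift_cochain c (h # k)) \<ominus>\<^bsub>shift_mod\<^esub> tau G shift_mod (shift_cochain c) l"
        by (simp only: lcobdry_def) (simp add: lg)
      ultimately show ?thesis
        using dec_diff[OF a t x] dec_zero[OF x] fin by metis
    qed
  qed (rule shift_zero_closed)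
qed

text \<open>Let \<open>b l = (x \<mapsto> c (x # l))\<close>, and let \<open>a\<close> have
  coboundary \<open>shift_cochain c\<close>. In \<open>Map(G/H, N)\<close> the difference of
  \<open>b\<close> and the coboundary of \<open>a\<close> is zero in the cokernel, hence comes from
  \<open>N\<close>, and it still has coboundary \<open>c\<close>. The formula is its value at
  1.\<close>

definition unshift :: "('g list \<Rightarrow> 'a) \<Rightarrow> ('g list \<Rightarrow> 'a) \<Rightarrow> 'g list \<Rightarrow> 'a" where
  "unshift c a l = c (\<one>\<^bsub>G\<^esub> # l) \<ominus> dec (a (tl l)) (hd l)"

lemma unshift_in:
  assumes "c \<in> lcochains G N (Suc (Suc m))" "a \<in> lcochains G shift_mod m"
  shows "unshift c a \<in> lcochains G N (Suc m)"
  unfolding lcochains_def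
proof (clarify)
  fix l :: "'g list" assume l: "length l = Suc m" "set l \<subseteq> carrier G"
  then obtain g k where "l = g # k" by (cases l) auto
  then show "unshift c a l \<in> carrier N"
    using l lcochainsD[OF assms(1), of "\<one>\<^bsub>G\<^esub> # l"] shift_carrierD(1)[OF lcochainsD[OF assms(2), of k]]
    by (simp add: unshift_def)
qed

lemma unshift_cobdry:
  assumes c: "lcocycle G N rho (Suc (Suc m)) c" and a: "a \<in> lcochains G shift_mod m"
    and eq: "\<And>l. length l = Suc m \<Longrightarrow> set l \<subseteq> carrier G \<Longrightarrow>
      lcobdry G shift_mod shift_act a l = shift_cochain c l"
    and l: "length l = Suc (Suc m)" "set l \<subseteq> carrier G"
  shows "lcobdry G N rho (unshift c a) l = c l"
proof -
  have cc: "c \<in> lcochains G N (Suc (Suc m))"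
    using c by (simp add: lcocycle_def)
  obtain x g k where lx: "l = x # g # k"
    using l by (cases l; cases "tl l") auto
  have g: "x \<in> carrier G" "g \<in> carrier G" "set k \<subseteq> carrier G" "length k = m"
    using l lx by auto
  note c1 = lcochains_Cons[OF cc G.one_closed]
  have ak: "a k \<in> carrier shift_mod"
    using lcochainsD[OF a] g by simp
  \<comment> \<open>The contribution of \<open>a\<close> to \<open>unshift\<close>, split off so
    that \<open>tau\<close> can be evaluated on the two summands separately.\<close>
  define b where "b = (\<lambda>l. dec (a (tl l)) (hd l))"
  have b: "b \<in> lcochains G N (Suc m)"
    unfolding lcochains_def b_def
  proof (clarify)
    fix l :: "'g list" assume "length l = Suc m" "set l \<subseteq> carrier G"
    then show "dec (a (tl l)) (hd l) \<in> carrier N"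
      using shift_carrierD(1)[OF lcochainsD[OF a, of "tl l"]] by (cases l) auto
  qed
  have ax: "(\<lambda>k. dec (a k) x) \<in> lcochains G N m"
    using a g shift_carrierD(1) by (auto simp: lcochains_def)
  have cl: "c (\<one>\<^bsub>G\<^esub> # g # k) \<in> carrier N" "c (x # g # k) \<in> carrier N" "c ((x \<otimes>\<^bsub>G\<^esub> g) # k) \<in> carrier N \<or> True"
    using g by (auto intro!: lcochainsD[OF cc])
  have da: "dec (a k) g \<in> carrier N" "dec (a k) (x \<otimes>\<^bsub>G\<^esub> g) \<in> carrier N"
    using shift_carrierD(1)[OF ak] g by auto
  have tc: "tau G N (\<lambda>k. c (\<one>\<^bsub>G\<^esub> # k)) l \<in> carrier N"
    using tau_closed[OF c1 l] .
  have ta: "tau G N (\<lambda>k. dec (a k) x) (g # k) \<in> carrier N"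
    using tau_closed[OF ax, of "g # k"] g by simp
  have "rho \<one>\<^bsub>G\<^esub> (c l) \<ominus> (c ((\<one>\<^bsub>G\<^esub> \<otimes>\<^bsub>G\<^esub> x) # g # k) \<ominus> tau G N (\<lambda>k. c (\<one>\<^bsub>G\<^esub> # k)) l) = \<zero>"
    using c l lx by (auto simp: lcocycle_def lcobdry_def dest!: spec[of _ "\<one>\<^bsub>G\<^esub> # l"])
  then have "c l \<ominus> (c l \<ominus> tau G N (\<lambda>k. c (\<one>\<^bsub>G\<^esub> # k)) l) = \<zero>"
    using cl lx g by simp
  moreover have "c l \<ominus> (c l \<ominus> tau G N (\<lambda>k. c (\<one>\<^bsub>G\<^esub> # k)) l) = tau G N (\<lambda>k. c (\<one>\<^bsub>G\<^esub> # k)) l"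
    using diff_diff_cancel cl(2) tc unfolding lx[symmetric] by blast
  ultimately have 1: "tau G N (\<lambda>k. c (\<one>\<^bsub>G\<^esub> # k)) l = \<zero>" by simp
  have 2: "tau G N b l = dec (a k) (x \<otimes>\<^bsub>G\<^esub> g) \<ominus> tau G N (\<lambda>k. dec (a k) x) (g # k)"
    unfolding lx tau.simps by (simp add: b_def)
  have "unshift c a = (\<lambda>k. c (\<one>\<^bsub>G\<^esub> # k) \<ominus> b k)"
    by (simp add: unshift_def b_def fun_eq_iff)
  then have 3: "tau G N (unshift c a) l = \<zero> \<ominus> (dec (a k) (x \<otimes>\<^bsub>G\<^esub> g) \<ominus> tau G N (\<lambda>k. dec (a k) x) (g # k))"
    using tau_diff[OF c1 b l] 1 2 by simp
  have aa: "shift_act g (a k) \<in> carrier shift_mod"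
    using ak g by (simp add: shift_act_closed)
  have ta': "tau G shift_mod a (g # k) \<in> carrier shift_mod"
    using S.tau_closed[OF a, of "g # k"] g by simp
  have "dec (shift_act g (a k) \<ominus>\<^bsub>shift_mod\<^esub> tau G shift_mod a (g # k)) x = c (x # g # k) \<ominus> rho x (c (\<one>\<^bsub>G\<^esub> # g # k))"
    using eq[of "g # k"] g by (simp add: lcobdry_def dec_shift_cochain)
  then have 4: "dec (a k) (x \<otimes>\<^bsub>G\<^esub> g) \<ominus> rho x (dec (a k) g) \<ominus> tau G N (\<lambda>k. dec (a k) x) (g # k) =
      c (x # g # k) \<ominus> rho x (c (\<one>\<^bsub>G\<^esub> # g # k))"
    using dec_diff[OF aa ta'] dec_tau[OF a, of x "g # k"] g by (simp add: dec_act)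
  have "lcobdry G N rho (unshift c a) l = rho x (c (\<one>\<^bsub>G\<^esub> # g # k)) \<ominus> rho x (dec (a k) g) \<ominus>
      (\<zero> \<ominus> (dec (a k) (x \<otimes>\<^bsub>G\<^esub> g) \<ominus> tau G N (\<lambda>k. dec (a k) x) (g # k)))"
    unfolding lcobdry_def 3 using g cl da by (simp add: lx unshift_def act_diff)
  also have "\<dots> = rho x (c (\<one>\<^bsub>G\<^esub> # g # k)) \<oplus> (dec (a k) (x \<otimes>\<^bsub>G\<^esub> g) \<ominus> rho x (dec (a k) g) \<ominus> tau G N (\<lambda>k. dec (a k) x) (g # k))"
  proof -
    have "u \<ominus> v \<ominus> (\<zero> \<ominus> (w \<ominus> t)) = u \<oplus> (w \<ominus> v \<ominus> t)"
      if "u \<in> carrier N" "v \<in> carrier N" "w \<in> carrier N" "t \<in> carrier N" for u v w t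
      using that by algebra
    then show ?thesis
      using act_closed[OF g(1) cl(1)] act_closed[OF g(1) da(1)] da(2) ta by blast
  qed
  also have "\<dots> = c (x # g # k)"
    unfolding 4 using act_closed[OF g(1) cl(1)] cl(2) by algebra
  finally show ?thesis using lx by simp
qed

end

section \<open>Vanishing of cohomology along a family of normal subgroups\<close>

abbreviation cobounds where
  "cobounds G N \<rho> \<H> m c \<equiv> \<exists>K\<in>\<H>. \<exists>a\<in>lcochains G N (m - 1). invariant_mod G K (m - 1) a \<and>
     (\<forall>l. length l = m \<and> set l \<subseteq> carrier G \<longrightarrow> lcobdry G N \<rho> a l = c l)"

text \<open>For a family closed under intersections this expresses that classes of degree
  \<open>m\<close> inflated from the quotients die in the colimit over the family. All modules on
  the type \<open>'a\<close> are quantified over, since shifting replaces both the module and the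
  action.\<close>

definition vanishes :: "'a itself \<Rightarrow> nat \<Rightarrow> ('g, 'b) monoid_scheme \<Rightarrow> 'g set set \<Rightarrow> nat \<Rightarrow> bool" where
  "vanishes U p G \<H> m \<longleftrightarrow> (\<forall>(N :: 'a ring) \<rho> H c. H \<in> \<H> \<longrightarrow> gmodule N G \<rho> \<longrightarrow>
     (\<forall>h\<in>H. \<forall>x\<in>carrier N. \<rho> h x = x) \<longrightarrow> (\<forall>x\<in>carrier N. [p] \<cdot>\<^bsub>N\<^esub> x = \<zero>\<^bsub>N\<^esub>) \<longrightarrow>
     lcocycle G N \<rho> m c \<longrightarrow> invariant_mod G H m c \<longrightarrow>
     cobounds G N \<rho> \<H> m c)"

lemma vanishesD:
  fixes N :: "'a ring"
  assumes "vanishes TYPE('a) p G \<H> m" "H \<in> \<H>" "gmodule N G \<rho>"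
    and "\<And>h x. h \<in> H \<Longrightarrow> x \<in> carrier N \<Longrightarrow> \<rho> h x = x"
    and "\<And>x. x \<in> carrier N \<Longrightarrow> [p] \<cdot>\<^bsub>N\<^esub> x = \<zero>\<^bsub>N\<^esub>"
    and "lcocycle G N \<rho> m c" "invariant_mod G H m c"
  shows "cobounds G N \<rho> \<H> m c"
  using assms unfolding vanishes_def by blast

text \<open>A primitive of the shifted cocycle is turned into one of \<open>c\<close> by
  \<open>unshift\<close>. That involves \<open>c\<close> and the values of \<open>a\<close>, which
  depend on cosets of \<open>H\<close>, and \<open>a\<close> itself, which depends on cosets of
  \<open>K\<close>; so the primitive lives over \<open>H \<inter> K\<close>.\<close>

lemma vanishes_Suc:
  fixes enc :: "('g \<Rightarrow> 'a) \<Rightarrow> 'a" and G :: "('g, 'b) monoid_scheme"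
  assumes dec_enc: "\<And>f. dec (enc f) = f"
    and \<H>: "\<And>H. H \<in> \<H> \<Longrightarrow> H \<lhd> G" "\<And>H K. H \<in> \<H> \<Longrightarrow> K \<in> \<H> \<Longrightarrow> H \<inter> K \<in> \<H>"
    and vanishes: "vanishes TYPE('a) p G \<H> (Suc m)"
  shows "vanishes TYPE('a) p G \<H> (Suc (Suc m))"
  unfolding vanishes_def
proof (intro allI impI)
  fix N :: "'a ring" and \<rho> H c
  assume H: "H \<in> \<H>" and N: "gmodule N G \<rho>" and triv: "\<forall>h\<in>H. \<forall>x\<in>carrier N. \<rho> h x = x"
    and tors: "\<forall>x\<in>carrier N. [p] \<cdot>\<^bsub>N\<^esub> x = \<zero>\<^bsub>N\<^esub>"
    and c: "lcocycle G N \<rho> (Suc (Suc m)) c" and inv: "invariant_mod G H (Suc (Suc m)) c"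
  interpret gmodule N G \<rho> by (rule N)
  interpret H: normal H G by (rule \<H>(1)[OF H])
  interpret shift N G \<rho> H enc dec
    by unfold_locales (use dec_enc triv in auto)
  have cc: "c \<in> lcochains G N (Suc (Suc m))"
    using c by (simp add: lcocycle_def)
  have "invariant_mod G H (Suc m) (shift_cochain c)"
    unfolding invariant_mod_def
  proof (intro allI impI; elim conjE)
    fix l l' :: "'g list"
    assume l: "length l = Suc m" "set l \<subseteq> carrier G" "set l' \<subseteq> carrier G"
      "map (\<lambda>x. H #>\<^bsub>G\<^esub> x) l = map (\<lambda>x. H #>\<^bsub>G\<^esub> x) l'"
    have "c (x # l) = c (x # l')" if "x \<in> carrier G" for x
      by (rule invariant_modD[OF inv]) (use l that in auto)
    then show "shift_cochain c l = shift_cochain c l'"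
      unfolding shift_cochain_def by (intro arg_cong[of _ _ enc] restrict_ext) simp
  qed
  moreover have "lcocycle G shift_mod shift_act (Suc m) (shift_cochain c)"
    by (rule shift_cochain_cocycle) (use c inv in auto)
  moreover have "\<forall>x\<in>carrier shift_mod. [p] \<cdot>\<^bsub>shift_mod\<^esub> x = \<zero>\<^bsub>shift_mod\<^esub>"
    using shift_torsion tors by blast
  moreover have "\<forall>h\<in>H. \<forall>x\<in>carrier shift_mod. shift_act h x = x"
    using shift_act_H by blast
  moreover have "gmodule shift_mod G shift_act"
    by (rule S.gmodule_axioms)
  ultimately obtain K a where K: "K \<in> \<H>" and a: "a \<in> lcochains G shift_mod m" "invariant_mod G K m a"
      and Da: "\<And>l. length l = Suc m \<Longrightarrow> set l \<subseteq> carrier G \<Longrightarrow>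
        lcobdry G shift_mod shift_act a l = shift_cochain c l"
    using vanishes H unfolding vanishes_def diff_Suc_1 by metis
  interpret K: normal K G by (rule \<H>(1)[OF K])
  have HK: "subgroup (H \<inter> K) G"
    using \<H> H K normal_imp_subgroup by blast
  have "invariant_mod G (H \<inter> K) (Suc m) (unshift c a)"
    unfolding invariant_mod_def
  proof (intro allI impI; elim conjE)
    fix l l' :: "'g list"
    assume l: "length l = Suc m" "set l \<subseteq> carrier G" "set l' \<subseteq> carrier G"
      "map (\<lambda>x. (H \<inter> K) #>\<^bsub>G\<^esub> x) l = map (\<lambda>x. (H \<inter> K) #>\<^bsub>G\<^esub> x) l'"
    then obtain g k g' k' where k: "l = g # k" "l' = g' # k'"
      by (cases l; cases l') auto
    have "c (\<one>\<^bsub>G\<^esub> # l) = c (\<one>\<^bsub>G\<^esub> # l')"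
      by (rule invariant_modD[OF G.invariant_mod_mono[OF inv HK H.subgroup_axioms]]) (use l in auto)
    moreover have ak: "a k = a k'"
      by (rule invariant_modD[OF G.invariant_mod_mono[OF a(2) HK K.subgroup_axioms]]) (use l k in auto)
    moreover have gg: "g \<in> carrier G" "g' \<in> carrier G" "(H \<inter> K) #>\<^bsub>G\<^esub> g = (H \<inter> K) #>\<^bsub>G\<^esub> g'"
      using l k by auto
    then have "H #>\<^bsub>G\<^esub> g = H #>\<^bsub>G\<^esub> g'"
      using G.coset_eq_iff[OF HK gg(1,2)] G.coset_eq_iff[OF H.subgroup_axioms gg(1,2)] by blast
    then have "dec (a k) g = dec (a k) g'"
      using shift_carrierD(3)[OF lcochainsD[OF a(1)], of k g g'] gg l k by simp
    ultimately show "unshift c a l = unshift c a l'"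
      by (simp add: unshift_def k)
  qed
  moreover have "unshift c a \<in> lcochains G N (Suc m)"
    by (rule unshift_in[OF cc a(1)])
  moreover have "\<forall>l. length l = Suc (Suc m) \<and> set l \<subseteq> carrier G \<longrightarrow> lcobdry G N \<rho> (unshift c a) l = c l"
    using unshift_cobdry[OF c a(1) Da] by blast
  ultimately show "cobounds G N \<rho> \<H> (Suc (Suc m)) c"
    using \<H>(2)[OF H K] by auto
qed

subsection \<open>Two-cocycles on a free group\<close>

locale free_gmodule = gmodule N "free_group n" \<rho>
  for N :: "('a, 'c) ring_scheme" (structure) and n :: nat and \<rho> +
  fixes c :: "(bool \<times> nat) list list \<Rightarrow> 'a"
  assumes c: "lcocycle (free_group n) N \<rho> 2 c"
begin

abbreviation F where "F \<equiv> free_group n"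

lemma c_closed [simp]: "x \<in> carrier F \<Longrightarrow> y \<in> carrier F \<Longrightarrow> c [x, y] \<in> carrier N"
  using c by (simp add: lcocycle_def lcochains_def)

lemma cocycle:
  assumes "x \<in> carrier F" "y \<in> carrier F" "z \<in> carrier F"
  shows "\<rho> x (c [y, z]) \<ominus> (c [x \<otimes>\<^bsub>F\<^esub> y, z] \<ominus> (c [x, y \<otimes>\<^bsub>F\<^esub> z] \<ominus> c [x, y])) = \<zero>"
proof -
  have "lcobdry F N \<rho> c [x, y, z] = \<zero>"
    using c assms by (simp add: lcocycle_def)
  then show ?thesis by (simp add: lcobdry_def)
qed

lemma one_in [simp]: "[] \<in> carrier F"
  by (simp add: carrier_free_group)

lemma one_mult [simp]: "x \<in> carrier F \<Longrightarrow> [] \<otimes>\<^bsub>F\<^esub> x = x" "x \<in> carrier F \<Longrightarrow> x \<otimes>\<^bsub>F\<^esub> [] = x"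
  "v \<in> carrier N \<Longrightarrow> \<rho> [] v = v"
  using G.l_one G.r_one act_one unfolding one_free_group by auto

text \<open>The cocycle is not normalized, and the constant \<open>c [[], []]\<close> measures the
  failure; it reappears as the value of the splitting at the empty word.\<close>

lemma c_one_left: 
  assumes "x \<in> carrier F" shows "c [[], x] = c [[], []]"
proof -
  have "c [[], x] \<ominus> (c [[], x] \<ominus> (c [[], x] \<ominus> c [[], []])) = \<zero>"
    using cocycle[of "[]" "[]" x] assms by simp
  moreover have "a \<ominus> (a \<ominus> (a \<ominus> b)) = a \<ominus> b" if "a \<in> carrier N" "b \<in> carrier N" for a b
    using that by algebra
  ultimately have "c [[], x] \<ominus> c [[], []] = \<zero>"
    using assms by simp
  then show ?thesis
    by (rule eq_of_diff_zero[rotated 2]) (use assms in simp_all)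
qed

lemma c_one_right:
  assumes "x \<in> carrier F" shows "c [x, []] = \<rho> x (c [[], []])"
proof -
  have "\<rho> x (c [[], []]) \<ominus> (c [x, []] \<ominus> (c [x, []] \<ominus> c [x, []])) = \<zero>"
    using cocycle[of x "[]" "[]"] assms by simp
  moreover have "b \<ominus> (a \<ominus> (a \<ominus> a)) = b \<ominus> a" if "a \<in> carrier N" "b \<in> carrier N" for a b
    using that by algebra
  ultimately have "\<rho> x (c [[], []]) \<ominus> c [x, []] = \<zero>"
    using assms by simp
  then show ?thesis
    by (rule eq_of_diff_zero[rotated 2, symmetric]) (use assms in simp_all)
qed

text \<open>
  A splitting of the extension of \<open>F\<close> by \<open>N\<close> classified by \<open>c\<close>: the generators are lifted with
  \<open>N\<close>-component \<open>0\<close>, which forces the value on their inverses and then on all words.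
\<close>

definition letter_val :: "bool \<times> nat \<Rightarrow> 'a" where
  "letter_val x = (if fst x then \<zero> else \<rho> [x] (c [[], []] \<oplus> c [[opp x], [x]]))"

text \<open>The extension is \<open>N \<times> F\<close> with
  \<open>(a, v) (b, w) = (a + v b - c [v, w], v w)\<close>, and
  \<open>w \<mapsto> (word_val w, w)\<close> is its splitting. The unit of this group has first
  component \<open>c [[], []]\<close>, which explains the value at the empty word.\<close>

primrec word_val :: "(bool \<times> nat) list \<Rightarrow> 'a" where
  "word_val [] = c [[], []]"
| "word_val (x # w) = letter_val x \<oplus> \<rho> [x] (word_val w) \<ominus> c [[x], w]"

lemma opp_in: "[x] \<in> carrier F \<Longrightarrow> [opp x] \<in> carrier F"
  using opp_in_letters by (auto simp: carrier_free_group)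

lemma opp_mult: "[x] \<otimes>\<^bsub>F\<^esub> [opp x] = []" "[opp x] \<otimes>\<^bsub>F\<^esub> [x] = []"
  by (auto simp: mult_free_group cons_reduce_Cons simp del: cons_reduce.simps(2))

lemma act_opp:
  assumes "[x] \<in> carrier F" "v \<in> carrier N"
  shows "\<rho> [x] (\<rho> [opp x] v) = v"
  using act_mult[of "[x]" "[opp x]" v] assms opp_in opp_mult by simp

lemma letter_val_closed [simp]: "[x] \<in> carrier F \<Longrightarrow> letter_val x \<in> carrier N"
  by (auto simp: letter_val_def opp_in)

text \<open>In the extension, the lifts of \<open>x\<close> and \<open>opp x\<close> multiply to the
  unit. For a generator this is the choice of \<open>letter_val (opp x)\<close>; for an inverse
  letter it needs the cocycle identity at \<open>x\<close>, \<open>opp x\<close>,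
  \<open>x\<close>.\<close>

lemma letter_val_opp:
  assumes x: "[x] \<in> carrier F"
  shows "letter_val x \<oplus> \<rho> [x] (letter_val (opp x)) \<ominus> c [[x], [opp x]] = c [[], []]"
proof (cases "fst x")
  case True
  have "\<zero> \<oplus> (a \<oplus> b) \<ominus> b = a" if "a \<in> carrier N" "b \<in> carrier N" for a b
    using that by algebra
  moreover have "letter_val x = \<zero>" "letter_val (opp x) = \<rho> [opp x] (c [[], []] \<oplus> c [[x], [opp x]])"
    using True by (auto simp: letter_val_def) (simp add: opp_def)
  ultimately show ?thesis
    using x by (simp add: act_opp opp_in)
next
  case False
  have "letter_val (opp x) = \<zero>" "letter_val x = \<rho> [x] (c [[], []] \<oplus> c [[opp x], [x]])"
    using False by (auto simp: letter_val_def) (simp add: opp_def)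
  moreover have "\<rho> [x] (c [[opp x], [x]]) \<ominus> (c [[], [x]] \<ominus> (c [[x], []] \<ominus> c [[x], [opp x]])) = \<zero>"
    using cocycle[of "[x]" "[opp x]" "[x]"] x opp_in opp_mult by simp
  then have "\<rho> [x] (c [[opp x], [x]]) \<ominus> (c [[], []] \<ominus> (\<rho> [x] (c [[], []]) \<ominus> c [[x], [opp x]])) = \<zero>"
    using c_one_left[OF x] c_one_right[OF x] by simp
  moreover have "a \<oplus> b \<ominus> d = (b \<ominus> (e \<ominus> (a \<ominus> d))) \<oplus> e"
    if "a \<in> carrier N" "b \<in> carrier N" "d \<in> carrier N" "e \<in> carrier N" for a b d e
    using that by algebra
  then have "\<rho> [x] (c [[], []]) \<oplus> \<rho> [x] (c [[opp x], [x]]) \<ominus> c [[x], [opp x]] = 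
      (\<rho> [x] (c [[opp x], [x]]) \<ominus> (c [[], []] \<ominus> (\<rho> [x] (c [[], []]) \<ominus> c [[x], [opp x]]))) \<oplus> c [[], []]"
    using x opp_in[OF x] by simp
  ultimately show ?thesis
    using x opp_in[OF x] by (simp add: act_add)
qed

lemma word_val_closed [simp]: "w \<in> carrier F \<Longrightarrow> word_val w \<in> carrier N"
proof (induction w)
  case (Cons x w)
  note Cons_in_free_group[OF Cons.prems]
  then show ?case using Cons.IH by simp
qed simp

text \<open>Without cancellation this is the recursion. With cancellation, the value of the longer
  word \<open>w = opp x # v\<close> is unwound by the cocycle identity at \<open>x\<close>,
  \<open>opp x\<close>, \<open>v\<close>, and the two letter values combine by
  \<open>letter_val_opp\<close>.\<close>

lemma word_val_cons_reduce:
  assumes x: "[x] \<in> carrier F" and w: "w \<in> carrier F"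
  shows "word_val (cons_reduce x w) = letter_val x \<oplus> \<rho> [x] (word_val w) \<ominus> c [[x], w]"
proof (cases "\<exists>v. w = opp x # v")
  case False
  then have "cons_reduce x w = x # w"
    by (cases w) (auto simp: cons_reduce_Cons simp del: cons_reduce.simps(2))
  then show ?thesis by simp
next
  case True
  then obtain v where v: "w = opp x # v" by blast
  have vF: "[opp x] \<in> carrier F" "v \<in> carrier F" "[opp x] \<otimes>\<^bsub>F\<^esub> v = w"
    using Cons_in_free_group w v by auto
  have 1: "\<rho> [x] (c [[opp x], v]) \<ominus> (c [[], []] \<ominus> (c [[x], w] \<ominus> c [[x], [opp x]])) = \<zero>"
    using cocycle[of "[x]" "[opp x]" v] x vF opp_mult c_one_left[OF vF(2)] by simp
  have "lx \<oplus> (lo \<oplus> wv \<ominus> d) \<ominus> cw =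
      (lx \<oplus> lo \<ominus> cx) \<oplus> wv \<ominus> e \<ominus> (d \<ominus> (e \<ominus> (cw \<ominus> cx)))"
    if "lx \<in> carrier N" "lo \<in> carrier N" "cx \<in> carrier N" "wv \<in> carrier N" "d \<in> carrier N"
      "e \<in> carrier N" "cw \<in> carrier N" for lx lo cx wv d e cw
    using that by algebra
  then have "letter_val x \<oplus> (\<rho> [x] (letter_val (opp x)) \<oplus> word_val v \<ominus> \<rho> [x] (c [[opp x], v])) \<ominus> c [[x], w] =
    (letter_val x \<oplus> \<rho> [x] (letter_val (opp x)) \<ominus> c [[x], [opp x]]) \<oplus> word_val v \<ominus> c [[], []] \<ominus>
     (\<rho> [x] (c [[opp x], v]) \<ominus> (c [[], []] \<ominus> (c [[x], w] \<ominus> c [[x], [opp x]])))"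
    using x vF w by simp
  also have "\<dots> = c [[], []] \<oplus> word_val v \<ominus> c [[], []] \<ominus> \<zero>"
    unfolding 1 letter_val_opp[OF x] ..
  also have "\<dots> = word_val v"
  proof -
    have "e \<oplus> v \<ominus> e \<ominus> \<zero> = v" if "e \<in> carrier N" "v \<in> carrier N" for e v
      using that by algebra
    then show ?thesis using vF by simp
  qed
  finally have "letter_val x \<oplus> \<rho> [x] (word_val w) \<ominus> c [[x], w] = word_val v"
    using x vF by (simp add: v act_add act_diff act_opp)
  moreover have "cons_reduce x w = v"
    unfolding v by (simp add: cons_reduce_Cons del: cons_reduce.simps(2))
  ultimately show ?thesis by simp
qed

text \<open>Multiplicativity of the splitting, equivalently that \<open>c\<close> is the coboundary
  of \<open>word_val\<close>. Freeness enters through the letterwise recursion for the product: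
  multiplying by a word is multiplying by its letters in turn.\<close>

lemma word_val_mult:
  assumes "v \<in> carrier F" "w \<in> carrier F"
  shows "word_val (v \<otimes>\<^bsub>F\<^esub> w) = word_val v \<oplus> \<rho> v (word_val w) \<ominus> c [v, w]"
  using assms(1)
proof (induction v)
  case Nil
  have "a = e \<oplus> a \<ominus> e" if "e \<in> carrier N" "a \<in> carrier N" for e a
    using that by algebra
  then show ?case
    using assms c_one_left[OF assms(2)] by simp
next
  case (Cons x v)
  note v = Cons_in_free_group[OF Cons.prems]
  have vw: "v \<otimes>\<^bsub>F\<^esub> w \<in> carrier F"
    using v assms by simp
  have "(x # v) \<otimes>\<^bsub>F\<^esub> w = cons_reduce x (v \<otimes>\<^bsub>F\<^esub> w)"
    by (simp add: mult_free_group)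
  then have "word_val ((x # v) \<otimes>\<^bsub>F\<^esub> w) =
     letter_val x \<oplus> \<rho> [x] (word_val v \<oplus> \<rho> v (word_val w) \<ominus> c [v, w]) \<ominus> c [[x], v \<otimes>\<^bsub>F\<^esub> w]"
    using word_val_cons_reduce[OF v(1) vw] Cons.IH[OF v(2)] by simp
  also have "\<dots> = letter_val x \<oplus> (\<rho> [x] (word_val v) \<oplus> \<rho> (x # v) (word_val w) \<ominus> \<rho> [x] (c [v, w])) \<ominus> c [[x], v \<otimes>\<^bsub>F\<^esub> w]"
    using v assms act_mult[OF v(1,2), of "word_val w"] by (simp add: act_add act_diff)
  also have "\<dots> = (letter_val x \<oplus> \<rho> [x] (word_val v) \<ominus> c [[x], v]) \<oplus> \<rho> (x # v) (word_val w) \<ominus> c [x # v, w] \<ominus>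
     (\<rho> [x] (c [v, w]) \<ominus> (c [x # v, w] \<ominus> (c [[x], v \<otimes>\<^bsub>F\<^esub> w] \<ominus> c [[x], v])))"
  proof -
    have "lx \<oplus> (a \<oplus> b \<ominus> d) \<ominus> e = (lx \<oplus> a \<ominus> f) \<oplus> b \<ominus> k \<ominus> (d \<ominus> (k \<ominus> (e \<ominus> f)))"
      if "lx \<in> carrier N" "a \<in> carrier N" "b \<in> carrier N" "d \<in> carrier N" "e \<in> carrier N"
        "f \<in> carrier N" "k \<in> carrier N" for lx a b d e f k
      using that by algebra
    then show ?thesis
      using v assms vw Cons.prems by simp
  qed
  also have "\<rho> [x] (c [v, w]) \<ominus> (c [x # v, w] \<ominus> (c [[x], v \<otimes>\<^bsub>F\<^esub> w] \<ominus> c [[x], v])) = \<zero>"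
    using cocycle[OF v(1,2) assms(2)] v(3) by simp
  finally show ?case
    using v assms Cons.prems by (simp add: minus_eq)
qed

text \<open>Applied with \<open>V\<close> the finite span of the translates of the values of
  \<open>c\<close>, this bounds the image of the splitting.\<close>

lemma word_val_in:
  assumes "w \<in> carrier F" "\<zero> \<in> V" "\<And>x y. x \<in> V \<Longrightarrow> y \<in> V \<Longrightarrow> x \<oplus> y \<in> V" "\<And>x. x \<in> V \<Longrightarrow> \<ominus> x \<in> V"
    "\<And>g x. g \<in> carrier F \<Longrightarrow> x \<in> V \<Longrightarrow> \<rho> g x \<in> V"
    "\<And>x y. x \<in> carrier F \<Longrightarrow> y \<in> carrier F \<Longrightarrow> c [x, y] \<in> V"
  shows "word_val w \<in> V"
  using assms(1)
proof (induction w)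
  case (Cons x w)
  note v = Cons_in_free_group[OF Cons.prems]
  have "letter_val x \<in> V"
    using assms(2-) v opp_in[OF v(1)] by (simp add: letter_val_def)
  then show ?case
    using assms(2-) v Cons.IH by (simp add: minus_eq)
qed (use assms in simp)

lemma word_val_cochain: "(\<lambda>l. word_val (hd l)) \<in> lcochains F N 1"
  by (auto simp: lcochains_def length_Suc_conv)

lemma word_val_cobdry:
  assumes "length l = 2" "set l \<subseteq> carrier F"
  shows "lcobdry F N \<rho> (\<lambda>l. word_val (hd l)) l = c l"
proof -
  obtain g h where l: "l = [g, h]"
    using assms by (auto simp: length_Suc_conv numeral_2_eq_2)
  have "b \<ominus> ((a \<oplus> b \<ominus> d) \<ominus> a) = d" if "a \<in> carrier N" "b \<in> carrier N" "d \<in> carrier N" for a b d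
    using that by algebra
  then show ?thesis
    using assms l by (simp add: lcobdry_def word_val_mult)
qed

end

subsection \<open>Finite span\<close>

text \<open>Only sums of generators are formed; in a group killed by \<open>p\<close> the negatives
  come for free, since \<open>-x\<close> is \<open>p - 1\<close> times \<open>x\<close>.\<close>

inductive_set (in abelian_group) int_span :: "'a set \<Rightarrow> 'a set" for S where
  zero: "\<zero> \<in> int_span S"
| plus: "s \<in> S \<Longrightarrow> x \<in> int_span S \<Longrightarrow> s \<oplus> x \<in> int_span S"

context abelian_group
begin

lemma int_span_subset: "S \<subseteq> carrier G \<Longrightarrow> int_span S \<subseteq> carrier G"
proof
  fix x assume "x \<in> int_span S" "S \<subseteq> carrier G"
  then show "x \<in> carrier G" by induction auto
qed

lemma int_span_incl: "S \<subseteq> carrier G \<Longrightarrow> s \<in> S \<Longrightarrow> s \<in> int_span S"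
  using int_span.plus[OF _ int_span.zero, of s S] by auto

lemma int_span_add:
  assumes "x \<in> int_span S" "y \<in> int_span S" "S \<subseteq> carrier G"
  shows "x \<oplus> y \<in> int_span S"
  using assms(1)
proof induction
  case zero
  then show ?case using assms int_span_subset by (metis l_zero subsetD)
next
  case (plus s x)
  have "s \<in> carrier G" "x \<in> carrier G" "y \<in> carrier G"
    using plus assms int_span_subset by blast+
  then show ?case
    using int_span.plus[OF plus(1) plus(3)] by (simp add: a_assoc)
qed

lemma int_span_minus:
  assumes "x \<in> int_span S" "S \<subseteq> carrier G" "\<And>x. x \<in> carrier G \<Longrightarrow> [p] \<cdot> x = \<zero>" "p > (0::nat)"
  shows "\<ominus> x \<in> int_span S"
proof -
  have x: "x \<in> carrier G"
    using assms int_span_subset by blast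
  have "[k] \<cdot> x \<in> int_span S" for k :: nat
    by (induction k) (use assms x int_span_add int_span.zero in auto)
  moreover have "[(p - 1)] \<cdot> x \<oplus> x = \<zero>"
    using assms(3)[OF x] \<open>p > 0\<close> by (metis add_pow_def Suc_diff_1 add.nat_pow_Suc)
  then have "\<ominus> x = [(p - 1)] \<cdot> x"
    using x by (intro minus_equality) auto
  ultimately show ?thesis by simp
qed

text \<open>Each further generator multiplies the size by at most \<open>p\<close>, because its
  multiples depend on the coefficient modulo \<open>p\<close> only.\<close>

lemma finite_int_span:
  assumes "finite S" "S \<subseteq> carrier G" "\<And>x. x \<in> carrier G \<Longrightarrow> [p] \<cdot> x = \<zero>" "p > (0::nat)"
  shows "finite (int_span S)"
  using assms(1,2)
proof (induction S)
  case empty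
  have "int_span {} \<subseteq> {\<zero>}"
    by (auto elim: int_span.cases)
  then show ?case by (rule finite_subset) simp
next
  case (insert s S)
  then have s: "s \<in> carrier G" "S \<subseteq> carrier G" "finite (int_span S)" by auto
  have mult: "[k] \<cdot> s = [(k mod p)] \<cdot> s" for k :: nat
  proof -
    have "[(p * j)] \<cdot> s = \<zero>" for j
      using s assms(3) add.nat_pow_pow[OF s(1), of p j] add.nat_pow_pow[OF s(1), of j p]
        add.nat_pow_one[of j] by (simp add: add_pow_def mult.commute)
    moreover have "[k] \<cdot> s = [(p * (k div p))] \<cdot> s \<oplus> [(k mod p)] \<cdot> s"
      using s add.nat_pow_mult[OF s(1), of "p * (k div p)" "k mod p"] by (simp add: add_pow_def)
    ultimately show ?thesis
      using s by simp
  qed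
  have "int_span (insert s S) \<subseteq> (\<lambda>(k, x). [k] \<cdot> s \<oplus> x) ` ({..<p} \<times> int_span S)"
  proof
    fix y assume "y \<in> int_span (insert s S)"
    then have "\<exists>k::nat. \<exists>x\<in>int_span S. y = [k] \<cdot> s \<oplus> x"
    proof induction
      case zero
      then show ?case using int_span.zero by (intro exI[of _ 0] bexI[of _ \<zero>]) auto
    next
      case (plus t y)
      then obtain k :: nat and x where kx: "x \<in> int_span S" "y = [k] \<cdot> s \<oplus> x" by blast
      then have xc: "x \<in> carrier G"
        using int_span_subset s by blast
      show ?case
      proof (cases "t = s")
        case True
        have "s \<oplus> ([k] \<cdot> s \<oplus> x) = [Suc k] \<cdot> s \<oplus> x"
          using s xc by (simp add: a_ac add.nat_pow_Suc)
        then show ?thesis using kx True by blast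
      next
        case False
        then have t: "t \<in> S" "t \<in> carrier G" using plus s by auto
        have "t \<oplus> ([k] \<cdot> s \<oplus> x) = [k] \<cdot> s \<oplus> (t \<oplus> x)"
          using s xc t by (simp add: a_ac)
        then show ?thesis using kx int_span.plus[OF t(1) kx(1)] by metis
      qed
    qed
    then obtain k :: nat and x where "x \<in> int_span S" "y = [(k mod p)] \<cdot> s \<oplus> x"
      using mult by metis
    then show "y \<in> (\<lambda>(k, x). [k] \<cdot> s \<oplus> x) ` ({..<p} \<times> int_span S)"
      using \<open>p > 0\<close> by (intro image_eqI[of _ _ "(k mod p, x)"]) auto
  qed
  then show ?case
    by (rule finite_subset) (use s in auto)
qed

end

lemma (in gmodule) int_span_act:
  assumes "x \<in> int_span S" "S \<subseteq> carrier N" "\<And>s. s \<in> S \<Longrightarrow> rho g s \<in> S" "g \<in> carrier G"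
  shows "rho g x \<in> int_span S"
  using assms(1)
proof induction
  case zero
  then show ?case using act_zero[OF assms(4)] int_span.zero[of S] by metis
next
  case (plus s x)
  then have "s \<in> carrier N" "x \<in> carrier N"
    using assms int_span_subset by blast+
  then show ?case
    using plus assms act_add int_span.plus by simp
qed

subsection \<open>Vanishing for free groups\<close>

text \<open>Cosets of the trivial subgroup are points, so this is the plain vanishing of the second
  cohomology of a free group.\<close>

lemma (in free_gmodule) trivial_family:
  "\<exists>K\<in>{{\<one>\<^bsub>F\<^esub>}}. \<exists>a\<in>lcochains F N 1. invariant_mod F K 1 a \<and>
     (\<forall>l. length l = 2 \<and> set l \<subseteq> carrier F \<longrightarrow> lcobdry F N \<rho> a l = c l)"
proof -
  have "{\<one>\<^bsub>F\<^esub>} #>\<^bsub>F\<^esub> x = {x}" if "x \<in> carrier F" for x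
    using that by (simp add: r_coset_def)
  then have "invariant_mod F {\<one>\<^bsub>F\<^esub>} 1 (\<lambda>l. word_val (hd l))"
    by (auto simp: invariant_mod_def length_Suc_conv)
  then show ?thesis
    using word_val_cochain word_val_cobdry by blast
qed

text \<open>On \<open>H\<close> the action is trivial and the cocycle constant, so
  \<open>word_val\<close> minus the constant \<open>?z\<close> is a homomorphism there. Its kernel
  \<open>K\<close> is normal in \<open>F\<close>. The quotient \<open>F/K\<close> injects into
  \<open>F/H\<close> times the finite span of the values of \<open>c\<close>, hence is finite, and
  it is a \<open>p\<close>-group because the homomorphism on \<open>H\<close> has values killed by
  \<open>p\<close>. Finally, multiplication by elements of \<open>K\<close> does not change
  \<open>word_val\<close>.\<close>

lemma (in free_gmodule) p_family:
  assumes p: "prime p" and H: "H \<in> finite_p_quotients p F"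
    and triv: "\<And>h x. h \<in> H \<Longrightarrow> x \<in> carrier N \<Longrightarrow> \<rho> h x = x"
    and tors: "\<And>x. x \<in> carrier N \<Longrightarrow> [p] \<cdot> x = \<zero>"
    and inv: "invariant_mod F H 2 c"
  shows "\<exists>K\<in>finite_p_quotients p F. \<exists>a\<in>lcochains F N 1. invariant_mod F K 1 a \<and>
     (\<forall>l. length l = 2 \<and> set l \<subseteq> carrier F \<longrightarrow> lcobdry F N \<rho> a l = c l)"
proof -
  have HF: "H \<lhd> F" and finH: "finite (carrier (F Mod H))"
    using H finite_p_quotients_iff[OF p] by auto
  interpret H: normal H F by (rule HF)
  have "p > 0" using p prime_gt_0_nat by blast
  let ?z = "c [[], []]"
  let ?q = "\<lambda>x. H #>\<^bsub>F\<^esub> x"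
  define rep where "rep = (\<lambda>C. SOME x. x \<in> carrier F \<and> ?q x = C)"
  have rep: "rep (?q x) \<in> carrier F \<and> ?q (rep (?q x)) = ?q x"
    if "x \<in> carrier F" for x
    unfolding rep_def by (rule someI[of _ x]) (use that in simp)
  define C where "C = carrier (F Mod H)"
  have C: "?q x \<in> C" if "x \<in> carrier F" for x
    using that by (simp add: C_def carrier_Mod)
  have cH: "c [x, y] = c [x', y']"
    if "x \<in> carrier F" "y \<in> carrier F" "x' \<in> carrier F" "y' \<in> carrier F"
      "?q x = ?q x'" "?q y = ?q y'" for x y x' y'
    by (rule invariant_modD[OF inv]) (use that in auto)
  have actH: "\<rho> x v = \<rho> y v"
    if "x \<in> carrier F" "y \<in> carrier F" "?q x = ?q y" "v \<in> carrier N" for x y v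
  proof -
    have "x \<otimes>\<^bsub>F\<^esub> inv\<^bsub>F\<^esub> y \<in> H"
      using that G.coset_eq_iff[OF H.subgroup_axioms that(1,2)] by blast
    then have "\<rho> (x \<otimes>\<^bsub>F\<^esub> inv\<^bsub>F\<^esub> y) (\<rho> y v) = \<rho> y v"
      using that triv by simp
    moreover have "\<rho> (x \<otimes>\<^bsub>F\<^esub> inv\<^bsub>F\<^esub> y) (\<rho> y v) = \<rho> ((x \<otimes>\<^bsub>F\<^esub> inv\<^bsub>F\<^esub> y) \<otimes>\<^bsub>F\<^esub> y) v"
      using that act_mult[of "x \<otimes>\<^bsub>F\<^esub> inv\<^bsub>F\<^esub> y" y v] by simp
    moreover have "(x \<otimes>\<^bsub>F\<^esub> inv\<^bsub>F\<^esub> y) \<otimes>\<^bsub>F\<^esub> y = x"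
      using that by (simp add: G.m_assoc)
    ultimately show ?thesis by simp
  qed
  \<comment> \<open>All translates of values of the cocycle. The set is finite because action and
    cocycle depend on cosets of \<open>H\<close> only, and it is stable under the action of
    \<open>F\<close>.\<close>
  define S where "S = (\<lambda>(A, B, D). \<rho> (rep A) (c [rep B, rep D])) ` (C \<times> C \<times> C)"
  have "finite S" using finH by (simp add: S_def C_def)
  have S: "\<rho> x (c [y, z]) \<in> S" if "x \<in> carrier F" "y \<in> carrier F" "z \<in> carrier F" for x y z
  proof -
    let ?x = "rep (?q x)" and ?y = "rep (?q y)" and ?z = "rep (?q z)"
    have "c [y, z] = c [?y, ?z]"
      by (rule cH) (use that rep in auto)
    moreover have "\<rho> x (c [?y, ?z]) = \<rho> ?x (c [?y, ?z])"
      by (rule actH) (use that rep in auto)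
    ultimately have "\<rho> x (c [y, z]) = (\<lambda>(A, B, D). \<rho> (rep A) (c [rep B, rep D])) (?q x, ?q y, ?q z)"
      by simp
    moreover have "(?q x, ?q y, ?q z) \<in> C \<times> C \<times> C"
      using that C by simp
    ultimately show ?thesis
      unfolding S_def by (rule image_eqI)
  qed
  have S': "\<exists>x\<in>carrier F. \<exists>y\<in>carrier F. \<exists>z\<in>carrier F. s = \<rho> x (c [y, z])" if s: "s \<in> S" for s
  proof -
    obtain x y z where "x \<in> carrier F" "y \<in> carrier F" "z \<in> carrier F"
      "s = \<rho> (rep (?q x)) (c [rep (?q y), rep (?q z)])"
      using s by (auto simp: S_def C_def carrier_Mod)
    then show ?thesis
      using rep by blast
  qed
  have SN: "S \<subseteq> carrier N"
  proof
    fix s assume "s \<in> S"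
    from S'[OF this] obtain x y z where "x \<in> carrier F" "y \<in> carrier F" "z \<in> carrier F"
        "s = \<rho> x (c [y, z])"
      by (elim bexE)
    then show "s \<in> carrier N" by simp
  qed
  have Sact: "\<rho> g s \<in> S" if "g \<in> carrier F" and s: "s \<in> S" for g s
  proof -
    obtain x y z where xyz: "x \<in> carrier F" "y \<in> carrier F" "z \<in> carrier F" "s = \<rho> x (c [y, z])"
      using S'[OF s] by (elim bexE)
    then have "\<rho> g s = \<rho> (g \<otimes>\<^bsub>F\<^esub> x) (c [y, z])"
      using that by (simp add: act_mult)
    then show ?thesis
      using S[of "g \<otimes>\<^bsub>F\<^esub> x" y z] that xyz by simp
  qed
  have val: "word_val w \<in> int_span S" if "w \<in> carrier F" for w
  proof (rule word_val_in[OF that])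
    fix x y assume xy: "x \<in> carrier F" "y \<in> carrier F"
    then have "c [x, y] \<in> S"
      using S[of "[]" x y] by simp
    then show "c [x, y] \<in> int_span S"
      using int_span_incl SN by blast
  qed (use int_span.zero int_span_add SN int_span_minus[OF _ SN tors \<open>p > 0\<close>] int_span_act[OF _ SN] Sact in auto)
  \<comment> \<open>In either argument of \<open>c\<close>, an element of \<open>H\<close> may be
    replaced by the empty word.\<close>
  have cl: "c [h, g] = ?z" "c [g, h] = \<rho> g ?z" if "h \<in> H" "g \<in> carrier F" for h g
  proof -
    have h: "h \<in> carrier F" "?q h = H #>\<^bsub>F\<^esub> []"
      using that H.subset G.coset_join2[OF _ H.subgroup_axioms that(1)] G.coset_mult_one[OF H.subset]
      by (auto simp: one_free_group)
    show "c [h, g] = ?z" "c [g, h] = \<rho> g ?z"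
      using cH[of h g "[]" g] cH[of g h g "[]"] h that c_one_left[OF that(2)] c_one_right[OF that(2)]
      by auto
  qed
  have vl: "word_val (h \<otimes>\<^bsub>F\<^esub> g) = word_val h \<oplus> word_val g \<ominus> ?z"
    and vr: "word_val (g \<otimes>\<^bsub>F\<^esub> h) = word_val g \<oplus> \<rho> g (word_val h \<ominus> ?z)"
    if "h \<in> H" "g \<in> carrier F" for h g
  proof -
    have h: "h \<in> carrier F" using that H.subset by blast
    show "word_val (h \<otimes>\<^bsub>F\<^esub> g) = word_val h \<oplus> word_val g \<ominus> ?z"
      using word_val_mult[OF h that(2)] cl[OF that] triv that by simp
    show "word_val (g \<otimes>\<^bsub>F\<^esub> h) = word_val g \<oplus> \<rho> g (word_val h \<ominus> ?z)"
      unfolding act_diff[OF that(2) word_val_closed[OF h] c_closed[OF one_in one_in]]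
      using word_val_mult[OF that(2) h] cl[OF that] h that by (simp add: a_assoc minus_eq)
  qed
  have eqz: "b = ?z" if "v = b \<oplus> v \<ominus> ?z" "v \<in> carrier N" "b \<in> carrier N" for v b
  proof -
    have "b \<ominus> ?z = (b \<oplus> v \<ominus> ?z) \<ominus> v"
      using that(2,3) c_closed[OF one_in one_in] by algebra
    also have "\<dots> = \<zero>"
      using that by (metis minus_eq r_neg)
    finally show ?thesis
      using eq_of_diff_zero that by simp
  qed
  \<comment> \<open>The comparison is with \<open>?z\<close> rather than \<open>\<zero>\<close>,
    since \<open>?z\<close> is the first component of the unit of the extension.\<close>
  define K where "K = {h \<in> H. word_val h = ?z}"
  have KH: "K \<subseteq> H" by (auto simp: K_def)
  have zz: "?z \<oplus> v \<ominus> ?z = v" "v \<oplus> (?z \<ominus> ?z) = v" if "v \<in> carrier N" for v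
    using that c_closed[OF one_in one_in] by algebra+
  have Kl: "word_val (h \<otimes>\<^bsub>F\<^esub> g) = word_val g" if "h \<in> K" "g \<in> carrier F" for h g
    using vl[of h g] that zz by (simp add: K_def)
  have Kr: "word_val (g \<otimes>\<^bsub>F\<^esub> h) = word_val g" if "h \<in> K" "g \<in> carrier F" for h g
    using vr[of h g] that by (simp add: K_def r_neg minus_eq)
  \<comment> \<open>One \<open>g\<close> suffices to recognise an element of \<open>K\<close> inside
    \<open>H\<close>. Taking \<open>g\<close> to be the element itself gives inverses, and taking it
    to be the conjugating element gives normality.\<close>
  have KI: "h \<in> K" if "h \<in> H" "g \<in> carrier F" "word_val (h \<otimes>\<^bsub>F\<^esub> g) = word_val g" for h g
  proof -
    have "h \<in> carrier F" using that H.subset by blast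
    then show ?thesis
      using eqz[of "word_val g" "word_val h"] vl[OF that(1,2)] that by (simp add: K_def)
  qed
  have "subgroup K F"
  proof (rule G.subgroupI)
    show "K \<subseteq> carrier F" using KH H.subset by blast
    have "[] \<in> K"
      using H.one_closed by (simp add: K_def one_free_group)
    then show "K \<noteq> {}" by blast
    fix h assume h: "h \<in> K"
    then have hF: "h \<in> carrier F" "h \<in> H" using KH H.subset by auto
    have "word_val (inv\<^bsub>F\<^esub> h \<otimes>\<^bsub>F\<^esub> h) = word_val h"
      using hF h by (simp add: one_free_group K_def)
    then show "inv\<^bsub>F\<^esub> h \<in> K"
      using KI[of "inv\<^bsub>F\<^esub> h" h] hF by simp
    fix k assume k: "k \<in> K"
    then have kF: "k \<in> carrier F" "k \<in> H" using KH H.subset by auto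
    show "h \<otimes>\<^bsub>F\<^esub> k \<in> K"
      using Kl[OF h kF(1)] k hF kF by (simp add: K_def)
  qed
  moreover have "x \<otimes>\<^bsub>F\<^esub> h \<otimes>\<^bsub>F\<^esub> inv\<^bsub>F\<^esub> x \<in> K" if "x \<in> carrier F" "h \<in> K" for x h
  proof (rule KI)
    have hF: "h \<in> carrier F" "h \<in> H" using that KH H.subset by auto
    show "x \<otimes>\<^bsub>F\<^esub> h \<otimes>\<^bsub>F\<^esub> inv\<^bsub>F\<^esub> x \<in> H"
      using H.inv_op_closed2 that hF by simp
    have "x \<otimes>\<^bsub>F\<^esub> h \<otimes>\<^bsub>F\<^esub> inv\<^bsub>F\<^esub> x \<otimes>\<^bsub>F\<^esub> x = x \<otimes>\<^bsub>F\<^esub> h"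
      using that hF by (simp add: G.m_assoc)
    then show "word_val (x \<otimes>\<^bsub>F\<^esub> h \<otimes>\<^bsub>F\<^esub> inv\<^bsub>F\<^esub> x \<otimes>\<^bsub>F\<^esub> x) = word_val x"
      using Kr that by simp
  qed (rule that(1))
  ultimately have KF: "K \<lhd> F"
    using G.normal_inv_iff by blast
  interpret K: normal K F by (rule KF)
  have Kfam: "K \<in> finite_p_quotients p F"
  proof (rule finite_p_quotientsI[OF p KF, where f = "\<lambda>x. (?q x, word_val x)"])
    have "(\<lambda>x. (?q x, word_val x)) ` carrier F \<subseteq> C \<times> int_span S"
      using C val by auto
    then show "finite ((\<lambda>x. (?q x, word_val x)) ` carrier F)"
      by (rule finite_subset)
        (use finH finite_int_span[OF \<open>finite S\<close> SN tors \<open>p > 0\<close>] in \<open>simp add: C_def\<close>)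
  next
    fix x y assume xy: "x \<in> carrier F" "y \<in> carrier F" "(?q x, word_val x) = (?q y, word_val y)"
    then have "x \<otimes>\<^bsub>F\<^esub> inv\<^bsub>F\<^esub> y \<in> H"
      using G.coset_eq_iff[OF H.subgroup_axioms xy(1,2)] by simp
    moreover have "x \<otimes>\<^bsub>F\<^esub> inv\<^bsub>F\<^esub> y \<otimes>\<^bsub>F\<^esub> y = x"
      using xy by (simp add: G.m_assoc)
    ultimately have "x \<otimes>\<^bsub>F\<^esub> inv\<^bsub>F\<^esub> y \<in> K"
      using KI[of "x \<otimes>\<^bsub>F\<^esub> inv\<^bsub>F\<^esub> y" y] xy by simp
    then show "K #>\<^bsub>F\<^esub> x = K #>\<^bsub>F\<^esub> y"
      using G.coset_eq_iff[OF K.subgroup_axioms xy(1,2)] by blast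
  next
    fix x assume x: "x \<in> carrier F"
    have "\<exists>k::nat. x [^]\<^bsub>F\<^esub> (p ^ k) \<in> H"
      using H x unfolding finite_p_quotients_iff[OF p] by blast
    then obtain k :: nat where k: "x [^]\<^bsub>F\<^esub> (p ^ k) \<in> H" ..
    define h where "h = x [^]\<^bsub>F\<^esub> (p ^ k)"
    have h: "h \<in> H" "h \<in> carrier F" using k x by (auto simp: h_def)
    have hp: "h [^]\<^bsub>F\<^esub> i \<in> H" for i :: nat
      by (induction i) (use h H.one_closed in auto)
    \<comment> \<open>Additivity on \<open>H\<close> turns a \<open>p\<close>-th power into a
      \<open>p\<close>-fold sum, which is zero; so one further factor \<open>p\<close> in the
      exponent leads from \<open>H\<close> into \<open>K\<close>.\<close>
    have "word_val (h [^]\<^bsub>F\<^esub> i) \<ominus> ?z = [i] \<cdot> (word_val h \<ominus> ?z)" for i :: nat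
    proof (induction i)
      case 0
      then show ?case
        by (simp add: one_free_group r_neg minus_eq)
    next
      case (Suc i)
      have "a \<oplus> b \<ominus> e \<ominus> e = (a \<ominus> e) \<oplus> (b \<ominus> e)"
        if "a \<in> carrier N" "b \<in> carrier N" "e \<in> carrier N" for a b e
        using that by algebra
      then have "word_val (h [^]\<^bsub>F\<^esub> Suc i) \<ominus> ?z = (word_val (h [^]\<^bsub>F\<^esub> i) \<ominus> ?z) \<oplus> (word_val h \<ominus> ?z)"
        using vl[OF hp h(2), of i] h by simp
      then show ?case using Suc h by simp
    qed
    from this[of p] have "word_val (h [^]\<^bsub>F\<^esub> p) \<ominus> ?z = \<zero>"
      using tors h by simp
    then have "word_val (h [^]\<^bsub>F\<^esub> p) = ?z"
      by (rule eq_of_diff_zero[rotated 2]) (use h in simp_all)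
    then have "h [^]\<^bsub>F\<^esub> p \<in> K" using hp by (simp add: K_def)
    moreover have "h [^]\<^bsub>F\<^esub> p = x [^]\<^bsub>F\<^esub> (p ^ Suc k)"
      using x by (simp add: h_def G.nat_pow_pow mult.commute)
    ultimately show "\<exists>k::nat. x [^]\<^bsub>F\<^esub> (p ^ k) \<in> K" by metis
  qed
  have "word_val x = word_val y"
    if "x \<in> carrier F" "y \<in> carrier F" "K #>\<^bsub>F\<^esub> x = K #>\<^bsub>F\<^esub> y" for x y
  proof -
    have "x \<otimes>\<^bsub>F\<^esub> inv\<^bsub>F\<^esub> y \<in> K"
      using G.coset_eq_iff[OF K.subgroup_axioms that(1,2)] that(3) by blast
    moreover have "x \<otimes>\<^bsub>F\<^esub> inv\<^bsub>F\<^esub> y \<otimes>\<^bsub>F\<^esub> y = x"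
      using that by (simp add: G.m_assoc)
    ultimately show ?thesis
      using Kl[of "x \<otimes>\<^bsub>F\<^esub> inv\<^bsub>F\<^esub> y" y] that by simp
  qed
  note val_eq = this
  have "invariant_mod F K 1 (\<lambda>l. word_val (hd l))"
    unfolding invariant_mod_def
  proof (intro allI impI; elim conjE)
    fix l l' :: "(bool \<times> nat) list list"
    assume l: "length l = 1" "set l \<subseteq> carrier F" "set l' \<subseteq> carrier F"
      "map (\<lambda>x. K #>\<^bsub>F\<^esub> x) l = map (\<lambda>x. K #>\<^bsub>F\<^esub> x) l'"
    then obtain x y where "l = [x]" "l' = [y]"
      by (auto simp: length_Suc_conv)
    then show "word_val (hd l) = word_val (hd l')"
      using val_eq[of x y] l by simp
  qed
  then show ?thesis
    using Kfam word_val_cochain word_val_cobdry by blast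
qed

text \<open>The two families for which the induction is run: the trivial subgroup yields the
  cohomology of \<open>F\<close>, the \<open>p\<close>-quotients that of the pro-space.\<close>

definition good_family :: "nat \<Rightarrow> nat \<Rightarrow> (bool \<times> nat) list set set \<Rightarrow> bool" where
  "good_family p n \<H> \<longleftrightarrow> \<H> = {{\<one>\<^bsub>free_group n\<^esub>}} \<or> \<H> = finite_p_quotients p (free_group n)"

lemma vanishes_free_group:
  fixes enc :: "((bool \<times> nat) list \<Rightarrow> 'a) \<Rightarrow> 'a"
  assumes dec_enc: "\<And>f. dec (enc f) = f" and "prime p" "good_family p n \<H>" "m \<ge> 2"
  shows "vanishes TYPE('a) p (free_group n) \<H> m"
  using \<open>m \<ge> 2\<close>
proof (induction m rule: dec_induct)
  case base
  show ?case
    unfolding vanishes_def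
  proof (intro allI impI)
    fix N :: "'a ring" and \<rho> H c
    assume *: "H \<in> \<H>" "gmodule N (free_group n) \<rho>" "\<forall>h\<in>H. \<forall>x\<in>carrier N. \<rho> h x = x"
      "\<forall>x\<in>carrier N. [p] \<cdot>\<^bsub>N\<^esub> x = \<zero>\<^bsub>N\<^esub>" "lcocycle (free_group n) N \<rho> 2 c" "invariant_mod (free_group n) H 2 c"
    interpret free_gmodule N n \<rho> c
      using * by (simp add: free_gmodule_def free_gmodule_axioms_def)
    show "cobounds F N \<rho> \<H> 2 c"
      using assms(3) trivial_family p_family[OF assms(2), of H] * unfolding good_family_def by auto
  qed
next
  case (step m)
  interpret group "free_group n" by (rule group_free_group)
  have "{\<one>\<^bsub>free_group n\<^esub>} \<lhd> free_group n"
    by (rule one_is_normal)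
  moreover have "H \<lhd> free_group n" if "H \<in> finite_p_quotients p (free_group n)" for H
    using that by (simp add: finite_p_quotients_def)
  ultimately have "H \<lhd> free_group n" "H \<inter> K \<in> \<H>" if "H \<in> \<H>" "K \<in> \<H>" for H K
    using that assms(3) finite_p_quotients_Int[OF assms(2)] unfolding good_family_def by auto
  moreover have "Suc (m - 1) = m" using step by simp
  ultimately have "vanishes TYPE('a) p (free_group n) \<H> (Suc (Suc (m - 1)))"
    using step.IH by (intro vanishes_Suc[OF dec_enc]) auto
  then show ?case using step by simp
qed

lemma (in abelian_group) gmodule_trivial:
  assumes "group F" shows "gmodule G F (\<lambda>_ x. x)"
  using assms abelian_group_axioms by (simp add: gmodule_def gmodule_axioms_def)

text \<open>Shifting requires functions from words to coefficients to be coded as coefficients. This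
  is achieved by regarding \<open>M\<close> as the group of constant functions on lists of words: a
  function \<open>f\<close> from words to such functions is coded by
  \<open>x # k \<mapsto> f x k\<close>. The remaining work is the translation of cochains between
  \<open>M\<close> and its copy \<open>N\<close>.\<close>

theorem list_cocycle_vanishes:
  fixes M :: "('m, 'c) ring_scheme"
  defines "F \<equiv> free_group"
  assumes M: "abelian_group M" and tors: "\<And>x. x \<in> carrier M \<Longrightarrow> [p] \<cdot>\<^bsub>M\<^esub> x = \<zero>\<^bsub>M\<^esub>"
    and p: "prime p" and fam: "good_family p n \<H>" "m \<ge> 2" "H \<in> \<H>"
    and c: "lcocycle (F n) M (\<lambda>_ x. x) m c" "invariant_mod (F n) H m c"
  shows "cobounds (F n) M (\<lambda>_ x. x) \<H> m c"
proof -
  interpret M: abelian_group M by fact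
  interpret F: group "F n" unfolding F_def by (rule group_free_group)
  define N :: "((bool \<times> nat) list list \<Rightarrow> 'm) ring" where
    "N = \<lparr>carrier = (\<lambda>m _. m) ` carrier M, monoid.mult = (\<lambda>_ _. undefined), one = undefined,
          zero = (\<lambda>_. \<zero>\<^bsub>M\<^esub>), add = (\<lambda>f g k. f k \<oplus>\<^bsub>M\<^esub> g k)\<rparr>"
  have N: "carrier N = (\<lambda>m _. m) ` carrier M" "\<zero>\<^bsub>N\<^esub> = (\<lambda>_. \<zero>\<^bsub>M\<^esub>)"
    "\<And>f g. f \<oplus>\<^bsub>N\<^esub> g = (\<lambda>k. f k \<oplus>\<^bsub>M\<^esub> g k)"
    by (simp_all add: N_def)
  have "abelian_group N"
  proof (rule abelian_groupI)
    fix x assume "x \<in> carrier N"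
    then obtain y where "x = (\<lambda>_. y)" "y \<in> carrier M" by (auto simp: N)
    then show "\<exists>y\<in>carrier N. y \<oplus>\<^bsub>N\<^esub> x = \<zero>\<^bsub>N\<^esub>"
      by (intro bexI[of _ "\<lambda>_. \<ominus>\<^bsub>M\<^esub> y"]) (auto simp: N M.l_neg)
  qed (auto simp: N M.a_ac)
  then interpret N: abelian_group N .
  have minus: "(\<lambda>_. x) \<ominus>\<^bsub>N\<^esub> (\<lambda>_. y) = (\<lambda>_. x \<ominus>\<^bsub>M\<^esub> y)" if "x \<in> carrier M" "y \<in> carrier M" for x y
  proof -
    have "\<ominus>\<^bsub>N\<^esub> (\<lambda>_. y) = (\<lambda>_. \<ominus>\<^bsub>M\<^esub> y)"
      by (rule N.minus_equality) (use that in \<open>auto simp: M.l_neg N\<close>)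
    then show ?thesis
      by (simp add: a_minus_def N)
  qed
  interpret gM: gmodule M "F n" "\<lambda>_ x. x"
    by (rule M.gmodule_trivial[OF F.is_group])
  interpret gN: gmodule N "F n" "\<lambda>_ x. x"
    by (rule N.gmodule_trivial[OF F.is_group])
  have lift: "(\<lambda>l _. d l) \<in> lcochains (F n) N k" if "d \<in> lcochains (F n) M k" for d k
    using that by (simp add: lcochains_def N)
  have tau: "tau (F n) N (\<lambda>l _. d l) l = (\<lambda>_. tau (F n) M d l)"
    if "d \<in> lcochains (F n) M k" "length l = Suc k" "set l \<subseteq> carrier (F n)" for d k l
    using that
  proof (induction k arbitrary: d l)
    case 0
    then obtain g where "l = [g]"
      by (auto simp: length_Suc_conv)
    then show ?case by simp
  next
    case (Suc k)
    then obtain g h j where l: "l = g # h # j"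
      by (auto simp: length_Suc_conv)
    have g: "g \<in> carrier (F n)" "h \<in> carrier (F n)" "set j \<subseteq> carrier (F n)" "length j = k"
      using Suc.prems l by auto
    note dg = lcochains_Cons[OF Suc.prems(1) g(1)]
    have "tau (F n) N (\<lambda>l _. d (g # l)) (h # j) = (\<lambda>_. tau (F n) M (\<lambda>l. d (g # l)) (h # j))"
      by (rule Suc.IH[OF dg]) (use g in auto)
    then show ?case
      unfolding l tau.simps
      using minus[OF lcochainsD[OF Suc.prems(1), of "(g \<otimes>\<^bsub>F n\<^esub> h) # j"] gM.tau_closed[OF dg, of "h # j"]] g
      by simp
  qed
  have cob: "lcobdry (F n) N (\<lambda>_ x. x) (\<lambda>l _. d l) l = (\<lambda>_. lcobdry (F n) M (\<lambda>_ x. x) d l)"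
    if "d \<in> lcochains (F n) M k" "length l = Suc k" "set l \<subseteq> carrier (F n)" for d k l
  proof -
    have "d (tl l) \<in> carrier M"
      by (rule lcochainsD[OF that(1)]) (use that in \<open>auto dest: list.set_sel(2)\<close>, cases l, auto)
    then show ?thesis
      using tau[OF that] minus gM.tau_closed[OF that] by (simp add: lcobdry_def)
  qed
  have cM: "c \<in> lcochains (F n) M m" using c by (simp add: lcocycle_def)
  have "lcocycle (F n) N (\<lambda>_ x. x) m (\<lambda>l _. c l)"
    using c(1) lift[OF cM] cob[OF cM] by (simp add: lcocycle_def N)
  moreover have "invariant_mod (F n) H m (\<lambda>l (_ :: (bool \<times> nat) list list). c l)"
    using c(2) unfolding invariant_mod_def by blast
  moreover have "[p] \<cdot>\<^bsub>N\<^esub> x = \<zero>\<^bsub>N\<^esub>" if "x \<in> carrier N" for x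
  proof -
    obtain y where y: "x = (\<lambda>_. y)" "y \<in> carrier M"
      using \<open>x \<in> carrier N\<close> by (auto simp: N)
    have "[k] \<cdot>\<^bsub>N\<^esub> (\<lambda>_. y) = (\<lambda>_. [k] \<cdot>\<^bsub>M\<^esub> y)" for k :: nat
      by (induction k) (auto simp: N)
    then show ?thesis using tors y by (simp add: N)
  qed
  moreover have "vanishes TYPE((bool \<times> nat) list list \<Rightarrow> 'm) p (F n) \<H> m"
    unfolding F_def
    by (rule vanishes_free_group[where dec = "\<lambda>\<phi> x k. \<phi> (x # k)" and
          enc = "\<lambda>f l. case l of [] \<Rightarrow> undefined | x # k \<Rightarrow> f x k"]) (use p fam in auto)
  ultimately have "cobounds (F n) N (\<lambda>_ x. x) \<H> m (\<lambda>l _. c l)"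
    by (intro vanishesD[OF _ fam(3) gN.gmodule_axioms]) simp_all
  then obtain K a where K: "K \<in> \<H>" "a \<in> lcochains (F n) N (m - 1)" "invariant_mod (F n) K (m - 1) a"
      and Da: "\<And>l. length l = m \<Longrightarrow> set l \<subseteq> carrier (F n) \<Longrightarrow> lcobdry (F n) N (\<lambda>_ x. x) a l = (\<lambda>_. c l)"
    by (elim bexE conjE) simp
  \<comment> \<open>Elements of \<open>N\<close> are constant functions, so evaluation at the empty
    list returns to \<open>M\<close>.\<close>
  define b where "b = (\<lambda>l. a l [])"
  have ab: "a l = (\<lambda>_. b l)" "b l \<in> carrier M" if "length l = m - 1" "set l \<subseteq> carrier (F n)" for l
    using lcochainsD[OF K(2) that] by (auto simp: b_def N)
  have bM: "b \<in> lcochains (F n) M (m - 1)"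
    using ab by (auto simp: lcochains_def)
  have "lcobdry (F n) M (\<lambda>_ x. x) b l = c l" if l: "length l = m" "set l \<subseteq> carrier (F n)" for l
  proof -
    have l': "length l = Suc (m - 1)" using l fam by simp
    have "set (tl l) \<subseteq> carrier (F n)"
      using l by (cases l) auto
    then have "a (tl l) = (\<lambda>_. b (tl l))"
      using ab(1)[of "tl l"] l by simp
    moreover have "tau (F n) N a l = tau (F n) N (\<lambda>l _. b l) l"
      by (rule gN.tau_cong[OF _ l' l(2)]) (use ab in simp)
    ultimately have "lcobdry (F n) N (\<lambda>_ x. x) a l = (\<lambda>_. lcobdry (F n) M (\<lambda>_ x. x) b l)"
      using cob[OF bM l' l(2)] by (simp add: lcobdry_def)
    then show ?thesis
      using Da[OF l] by metis
  qed
  moreover have "invariant_mod (F n) K (m - 1) b"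
    using K(3) unfolding invariant_mod_def b_def by metis
  ultimately show ?thesis
    using K(1) bM by blast
qed

section \<open>Nerves\<close>

lemma deltaD:
  assumes "\<theta> \<in> delta m n"
  shows "length \<theta> = Suc m" "i \<le> m \<Longrightarrow> \<theta> ! i \<le> n" "i \<le> j \<Longrightarrow> j \<le> m \<Longrightarrow> \<theta> ! i \<le> \<theta> ! j"
proof -
  show len: "length \<theta> = Suc m" using assms by (simp add: delta_def)
  show "\<theta> ! i \<le> n" if "i \<le> m"
  proof -
    have "\<theta> ! i \<in> set \<theta>" using that len by simp
    then show ?thesis using assms by (auto simp: delta_def)
  qed
  show "\<theta> ! i \<le> \<theta> ! j" if "i \<le> j" "j \<le> m"
    using assms len that by (auto simp: delta_def intro: sorted_nth_mono)
qed

lemma deltaI: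
  assumes "length \<theta> = Suc m" "\<And>i j. i \<le> j \<Longrightarrow> j \<le> m \<Longrightarrow> \<theta> ! i \<le> \<theta> ! j" "\<theta> ! m \<le> n"
  shows "\<theta> \<in> delta m n"
proof -
  have "x \<le> n" if "x \<in> set \<theta>" for x
  proof -
    obtain i where "i < length \<theta>" "x = \<theta> ! i"
      using \<open>x \<in> set \<theta>\<close> by (metis in_set_conv_nth)
    then show ?thesis using assms(1,3) assms(2)[of i m] by simp
  qed
  moreover have "sorted \<theta>"
    using assms(1,2) by (auto simp: sorted_iff_nth_mono)
  ultimately show ?thesis using assms(1) by (auto simp: delta_def)
qed

lemma delta_comp:
  assumes "\<theta> \<in> delta m n" "\<phi> \<in> delta l m"
  shows "map ((!) \<theta>) \<phi> \<in> delta l n"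
proof (rule deltaI)
  show "length (map ((!) \<theta>) \<phi>) = Suc l" using deltaD[OF assms(2)] by simp
  show "map ((!) \<theta>) \<phi> ! i \<le> map ((!) \<theta>) \<phi> ! j" if "i \<le> j" "j \<le> l" for i j
    using deltaD[OF assms(2)] deltaD(3)[OF assms(1), of "\<phi> ! i" "\<phi> ! j"] that by simp
  show "map ((!) \<theta>) \<phi> ! l \<le> n"
    using deltaD[OF assms(2)] deltaD(2)[OF assms(1), of "\<phi> ! l"] by simp
qed

lemma delta_id: "[0..<Suc n] \<in> delta n n"
  by (rule deltaI) (simp_all del: upt_Suc)

lemma coface_nth:
  assumes "i \<le> Suc m" "t \<le> m"
  shows "coface m i ! t = (if t < i then t else Suc t)"
    and length_coface: "length (coface m i) = Suc m"
proof -
  have "[0..<m + 2] = [0..<i] @ i # [Suc i..<m + 2]"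
    using assms upt_add_eq_append[of 0 i "m + 2 - i"] upt_conv_Cons[of i "m + 2"] by simp
  then have "coface m i = [0..<i] @ [Suc i..<m + 2]"
    unfolding coface_def by (simp only: filter_append) (auto simp: filter_id_conv simp del: upt_Suc)
  then show "coface m i ! t = (if t < i then t else Suc t)" "length (coface m i) = Suc m"
    using assms by (auto simp: nth_append simp del: upt_Suc)
qed

lemma coface_delta: "i \<le> Suc m \<Longrightarrow> coface m i \<in> delta m (Suc m)"
  using length_coface[of i m 0] by (intro deltaI) (auto simp: coface_nth)

section \<open>Simplicial maps as extensional families\<close>

lemma smapsD:
  assumes "f \<in> smaps S T"
  shows "x \<in> simp S n \<Longrightarrow> f n x \<in> simp T n"
    "\<theta> \<in> delta m n \<Longrightarrow> x \<in> simp S n \<Longrightarrow> f m (act S n \<theta> x) = act T n \<theta> (f n x)"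
    "f n \<in> extensional (simp S n)"
  using assms by (auto simp: smaps_def PiE_def)

lemma smapsI:
  assumes "\<And>n x. x \<in> simp S n \<Longrightarrow> f n x \<in> simp T n"
    "\<And>m n \<theta> x. \<theta> \<in> delta m n \<Longrightarrow> x \<in> simp S n \<Longrightarrow> f m (act S n \<theta> x) = act T n \<theta> (f n x)"
    "\<And>n. f n \<in> extensional (simp S n)"
  shows "f \<in> smaps S T"
  using assms by (auto simp: smaps_def PiE_def)

lemma simplicial_setD:
  assumes "simplicial_set S"
  shows "\<theta> \<in> delta m n \<Longrightarrow> x \<in> simp S n \<Longrightarrow> act S n \<theta> x \<in> simp S m"
    "x \<in> simp S n \<Longrightarrow> act S n [0..<Suc n] x = x"
    "\<theta> \<in> delta m n \<Longrightarrow> \<phi> \<in> delta l m \<Longrightarrow> x \<in> simp S n \<Longrightarrow>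
      act S m \<phi> (act S n \<theta> x) = act S n (map ((!) \<theta>) \<phi>) x"
  using assms unfolding simplicial_set_def by auto

lemma smaps_scomp:
  assumes "f \<in> smaps S T" "g \<in> smaps T U" "simplicial_set S"
  shows "scomp S g f \<in> smaps S U"
  unfolding scomp_def
  by (rule smapsI) (use smapsD[OF assms(1)] smapsD[OF assms(2)] simplicial_setD(1)[OF assms(3)] in
    \<open>auto simp: compose_def\<close>)

lemma smaps_sid: "simplicial_set S \<Longrightarrow> sid S \<in> smaps S S"
  unfolding sid_def by (rule smapsI) (auto simp: simplicial_setD(1))

lemma smaps_eqI:
  assumes "f \<in> smaps S T" "g \<in> smaps S U" "\<And>n x. x \<in> simp S n \<Longrightarrow> f n x = g n x"
  shows "f = g"
proof
  fix n show "f n = g n"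
    using extensionalityI[OF smapsD(3)[OF assms(1)] smapsD(3)[OF assms(2)]] assms(3) by blast
qed

section \<open>Simplices and operators of the nerve\<close>

lemma nerve_simpI:
  assumes "\<And>i j. i \<le> j \<Longrightarrow> j \<le> n \<Longrightarrow> x (i, j) \<in> carrier G" "x \<in> extensional (ipairs n)"
    "\<And>i. i \<le> n \<Longrightarrow> x (i, i) = \<one>\<^bsub>G\<^esub>"
    "\<And>i j k. i \<le> j \<Longrightarrow> j \<le> k \<Longrightarrow> k \<le> n \<Longrightarrow> x (i, j) \<otimes>\<^bsub>G\<^esub> x (j, k) = x (i, k)"
  shows "x \<in> simp (nerve G) n"
  using assms by (auto simp: nerve_def ipairs_def PiE_def)

lemma nerve_simpD:
  assumes "x \<in> simp (nerve G) n"
  shows "i \<le> j \<Longrightarrow> j \<le> n \<Longrightarrow> x (i, j) \<in> carrier G" "x \<in> extensional (ipairs n)"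
    "i \<le> n \<Longrightarrow> x (i, i) = \<one>\<^bsub>G\<^esub>"
    "i \<le> j \<Longrightarrow> j \<le> k \<Longrightarrow> k \<le> n \<Longrightarrow> x (i, j) \<otimes>\<^bsub>G\<^esub> x (j, k) = x (i, k)"
  using assms by (auto simp: nerve_def ipairs_def PiE_def Pi_def)

lemma nerve_eqI:
  assumes "x \<in> extensional (ipairs n)" "y \<in> extensional (ipairs n)"
    "\<And>i j. i \<le> j \<Longrightarrow> j \<le> n \<Longrightarrow> x (i, j) = y (i, j)"
  shows "x = y"
  by (rule extensionalityI[OF assms(1,2)]) (use assms(3) in \<open>auto simp: ipairs_def\<close>)

lemma nerve_act:
  assumes "\<theta> \<in> delta m n"
  shows "act (nerve G) n \<theta> x = (\<lambda>(i, j)\<in>ipairs m. x (\<theta> ! i, \<theta> ! j))"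
  using deltaD[OF assms] by (simp add: nerve_def)

lemma nerve_act_apply:
  assumes "\<theta> \<in> delta m n" "i \<le> j" "j \<le> m"
  shows "act (nerve G) n \<theta> x (i, j) = x (\<theta> ! i, \<theta> ! j)"
  using assms by (simp add: nerve_act ipairs_def)

lemma nerve_act_ext: "\<theta> \<in> delta m n \<Longrightarrow> act (nerve G) n \<theta> x \<in> extensional (ipairs m)"
  by (simp add: nerve_act)

lemma nerve_act_in:
  assumes "\<theta> \<in> delta m n" "x \<in> simp (nerve G) n"
  shows "act (nerve G) n \<theta> x \<in> simp (nerve G) m"
  by (rule nerve_simpI)
    (use nerve_simpD[OF assms(2)] deltaD[OF assms(1)] in
      \<open>auto simp: nerve_act_apply[OF assms(1)] nerve_act_ext[OF assms(1)]\<close>)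

lemma simplicial_set_nerve: "simplicial_set (nerve G)"
  unfolding simplicial_set_def
proof (intro conjI allI ballI)
  fix l m n \<theta> \<phi> x
  assume *: "\<theta> \<in> delta m n" "\<phi> \<in> delta l m" "x \<in> simp (nerve G) n"
  show "act (nerve G) m \<phi> (act (nerve G) n \<theta> x) = act (nerve G) n (map ((!) \<theta>) \<phi>) x"
    by (rule nerve_eqI[where n = l])
      (use * deltaD[OF *(2)] in \<open>auto simp: nerve_act_ext[OF *(2)] nerve_act_ext[OF delta_comp[OF *(1,2)]]
        nerve_act_apply[OF *(2)] nerve_act_apply[OF *(1)] nerve_act_apply[OF delta_comp[OF *(1,2)]]\<close>)
next
  fix n x assume x: "x \<in> simp (nerve G) n"
  show "act (nerve G) n [0..<n + 1] x = x"
    by (rule nerve_eqI[where n = n]) (use nerve_simpD(2)[OF x] delta_id[of n] in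
      \<open>auto simp: nerve_act_apply nerve_act_ext simp del: upt_Suc\<close>)
qed (auto simp: nerve_act_in)

lemma nerve_map_apply:
  assumes "x \<in> simp (nerve G) n" "i \<le> j" "j \<le> n"
  shows "nerve_map G h n x (i, j) = h (x (i, j))"
  using assms by (simp add: nerve_map_def compose_def ipairs_def)

lemma nerve_map_ext: "x \<in> simp (nerve G) n \<Longrightarrow> nerve_map G h n x \<in> extensional (ipairs n)"
  by (simp add: nerve_map_def compose_def)

lemma nerve_map_in:
  assumes "group G" "group G'" "h \<in> hom G G'" "x \<in> simp (nerve G) n"
  shows "nerve_map G h n x \<in> simp (nerve G') n"
proof (rule nerve_simpI)
  note x = nerve_simpD[OF assms(4)]
  interpret group_hom G G' h
    using assms by (simp add: group_hom_def group_hom_axioms_def)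
  show "nerve_map G h n x (i, j) \<in> carrier G'" if "i \<le> j" "j \<le> n" for i j
    using hom_closed[OF x(1)[OF that]] nerve_map_apply[OF assms(4) that, of h] by simp
  show "nerve_map G h n x (i, i) = \<one>\<^bsub>G'\<^esub>" if "i \<le> n" for i
    using that x(3)[OF that] nerve_map_apply[OF assms(4), of _ _ h] by simp
  show "nerve_map G h n x (i, j) \<otimes>\<^bsub>G'\<^esub> nerve_map G h n x (j, k) = nerve_map G h n x (i, k)"
    if "i \<le> j" "j \<le> k" "k \<le> n" for i j k
    using that hom_mult[OF x(1)[of i j] x(1)[of j k]] x(4)[OF that] nerve_map_apply[OF assms(4), of _ _ h] by simp
qed (rule nerve_map_ext[OF assms(4)])

lemma nerve_map_smaps:
  assumes "group G" "group G'" "h \<in> hom G G'"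
  shows "nerve_map G h \<in> smaps (nerve G) (nerve G')"
proof (rule smapsI)
  fix m n \<theta> x assume *: "\<theta> \<in> delta m n" "x \<in> simp (nerve G) n"
  show "nerve_map G h m (act (nerve G) n \<theta> x) = act (nerve G') n \<theta> (nerve_map G h n x)"
    by (rule nerve_eqI[where n = m])
      (use * deltaD[OF *(1)] nerve_act_in[OF *] in
       \<open>auto simp: nerve_map_ext nerve_act_ext nerve_map_apply nerve_act_apply\<close>)
qed (auto simp: nerve_map_in[OF assms], simp add: nerve_map_def)

subsection \<open>Simplices as lists\<close>

definition edges :: "nat \<Rightarrow> (nat \<times> nat \<Rightarrow> 'g) \<Rightarrow> 'g list" where
  "edges n x = map (\<lambda>i. x (i, Suc i)) [0..<n]"

text \<open>Inverse to \<open>edges\<close>: a simplex of the nerve is determined by its consecutive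
  edges, and these may be arbitrary group elements. In these coordinates cochains on the nerve
  become inhomogeneous cochains.\<close>

definition simplex_of :: "('g, 'b) monoid_scheme \<Rightarrow> 'g list \<Rightarrow> nat \<times> nat \<Rightarrow> 'g" where
  "simplex_of G l = (\<lambda>(i, j)\<in>ipairs (length l). foldr (monoid.mult G) (take (j - i) (drop i l)) \<one>\<^bsub>G\<^esub>)"

lemma length_edges [simp]: "length (edges n x) = n"
  by (simp add: edges_def)

lemma edges_nth [simp]: "i < n \<Longrightarrow> edges n x ! i = x (i, Suc i)"
  by (simp add: edges_def)

lemma set_edges: "x \<in> simp (nerve G) n \<Longrightarrow> set (edges n x) \<subseteq> carrier G"
  by (auto simp: edges_def nerve_simpD(1))

lemma edges_inj:
  assumes "x \<in> simp (nerve G) n" "y \<in> simp (nerve G) n" "edges n x = edges n y"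
  shows "x = y"
proof (rule nerve_eqI[where n = n])
  have e: "x (i, Suc i) = y (i, Suc i)" if "i < n" for i
    using assms(3) that by (metis edges_nth)
  fix i j assume "i \<le> j" "j \<le> n"
  then show "x (i, j) = y (i, j)"
  proof (induction j rule: dec_induct)
    case base
    then show ?case using assms nerve_simpD(3) by metis
  next
    case (step j)
    then show ?case
      using nerve_simpD(4)[OF assms(1), of i j "Suc j"] nerve_simpD(4)[OF assms(2), of i j "Suc j"] e[of j]
      by simp
  qed
qed (use nerve_simpD(2)[OF assms(1)] nerve_simpD(2)[OF assms(2)] in auto)

context group
begin

lemma foldr_mult_closed: "set l \<subseteq> carrier G \<Longrightarrow> foldr (\<otimes>) l \<one> \<in> carrier G"
  by (induction l) auto

lemma foldr_mult_append:
  "set k \<subseteq> carrier G \<Longrightarrow> set l \<subseteq> carrier G \<Longrightarrow>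
   foldr (\<otimes>) (k @ l) \<one> = foldr (\<otimes>) k \<one> \<otimes> foldr (\<otimes>) l \<one>"
  by (induction k) (auto simp: m_assoc foldr_mult_closed simp del: foldr_append)

lemma simplex_of_in:
  assumes "set l \<subseteq> carrier G"
  shows "simplex_of G l \<in> simp (nerve G) (length l)"
proof (rule nerve_simpI)
  have sub: "set (take a (drop b l)) \<subseteq> carrier G" for a b
    using assms by (meson set_drop_subset set_take_subset subset_trans)
  show "simplex_of G l (i, j) \<in> carrier G" if "i \<le> j" "j \<le> length l" for i j
    using that foldr_mult_closed[OF sub] by (simp add: simplex_of_def ipairs_def)
  show "simplex_of G l (i, i) = \<one>" if "i \<le> length l" for i
    using that by (simp add: simplex_of_def ipairs_def)
  show "simplex_of G l (i, j) \<otimes> simplex_of G l (j, k) = simplex_of G l (i, k)"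
    if "i \<le> j" "j \<le> k" "k \<le> length l" for i j k
  proof -
    have "take (k - i) (drop i l) = take (j - i) (drop i l) @ take (k - j) (drop j l)"
      using that take_add[of "j - i" "k - j" "drop i l"] by simp
    then show ?thesis
      using that foldr_mult_append[OF sub sub] by (simp add: simplex_of_def ipairs_def del: foldr_append)
  qed
qed (simp add: simplex_of_def)

lemma edges_simplex_of:
  assumes "set l \<subseteq> carrier G"
  shows "edges (length l) (simplex_of G l) = l"
proof (rule nth_equalityI)
  fix i assume i: "i < length (edges (length l) (simplex_of G l))"
  then have "take 1 (drop i l) = [l ! i]"
    by (simp add: take_Suc hd_drop_conv_nth)
  then show "edges (length l) (simplex_of G l) ! i = l ! i"
    using i assms by (simp add: simplex_of_def ipairs_def subset_iff)
qed simp

lemma simplex_of_edges: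
  assumes "x \<in> simp (nerve G) n"
  shows "simplex_of G (edges n x) = x"
  using edges_inj[OF _ assms, of "simplex_of G (edges n x)"] simplex_of_in[OF set_edges[OF assms]]
    edges_simplex_of[OF set_edges[OF assms]] by simp

end

text \<open>The faces of the nerve in list coordinates: an inner face multiplies two neighbours, and
  the outer faces drop the first or the last letter. The equation for \<open>[g]\<close> is the one
  that produces the last face.\<close>

fun lface :: "('g, 'b) monoid_scheme \<Rightarrow> nat \<Rightarrow> 'g list \<Rightarrow> 'g list" where
  "lface G 0 l = tl l"
| "lface G (Suc i) [] = []"
| "lface G (Suc i) [g] = []"
| "lface G (Suc 0) (g # h # l) = (g \<otimes>\<^bsub>G\<^esub> h) # l"
| "lface G (Suc (Suc i)) (g # h # l) = g # lface G (Suc i) (h # l)"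

lemma length_lface [simp]: "length (lface G i l) = length l - 1"
  by (induction G i l rule: lface.induct) auto

lemma (in group) set_lface:
  assumes "set l \<subseteq> carrier G" shows "set (lface G i l) \<subseteq> carrier G"
  using is_monoid assms
proof (induction G i l rule: lface.induct)
  case (1 G l)
  then show ?case by (cases l) auto
qed (auto simp: monoid.m_closed)

lemma lface_nth:
  "length l = Suc m \<Longrightarrow> i \<le> Suc m \<Longrightarrow> t < m \<Longrightarrow> lface G i l ! t =
    (if Suc t < i then l ! t else if Suc t = i then l ! t \<otimes>\<^bsub>G\<^esub> l ! Suc t else l ! Suc t)"
proof (induction G i l arbitrary: m t rule: lface.induct)
  case (1 G l)
  then show ?case by (simp add: nth_tl)
next
  case (5 G i g h l)
  show ?case
  proof (cases t)
    case (Suc s)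
    then show ?thesis using 5(1)[of "m - 1" s] 5(2-) by simp
  qed simp
qed (auto simp: nth_Cons')

lemma edges_face:
  assumes "x \<in> simp (nerve G) (Suc m)" "i \<le> Suc m"
  shows "edges m (act (nerve G) (Suc m) (coface m i) x) = lface G i (edges (Suc m) x)"
proof (rule nth_equalityI)
  fix t assume "t < length (edges m (act (nerve G) (Suc m) (coface m i) x))"
  then have t: "t < m" by simp
  have "edges m (act (nerve G) (Suc m) (coface m i) x) ! t =
      x (if t < i then t else Suc t, if Suc t < i then Suc t else Suc (Suc t))"
    using t nerve_act_apply[OF coface_delta[OF assms(2)], of t "Suc t" G x] assms by (simp add: coface_nth)
  also have "\<dots> = lface G i (edges (Suc m) x) ! t"
    using lface_nth[of "edges (Suc m) x" m i t G] t assms nerve_simpD(4)[OF assms(1), of t "Suc t" "Suc (Suc t)"]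
    by auto
  finally show "edges m (act (nerve G) (Suc m) (coface m i) x) ! t = lface G i (edges (Suc m) x) ! t" .
qed (simp add: length_lface)

section \<open>Cohomology of nerves\<close>

lemma cochains_simps:
  "carrier (cochains M S m) = simp S m \<rightarrow>\<^sub>E carrier M"
  "c \<otimes>\<^bsub>cochains M S m\<^esub> d = (\<lambda>x\<in>simp S m. c x \<oplus>\<^bsub>M\<^esub> d x)"
  "\<one>\<^bsub>cochains M S m\<^esub> = (\<lambda>x\<in>simp S m. \<zero>\<^bsub>M\<^esub>)"
  by (simp_all add: cochains_def)

lemma cochains_eqI:
  assumes "c \<in> carrier (cochains M S m)" "d \<in> carrier (cochains M' S m)" "\<And>x. x \<in> simp S m \<Longrightarrow> c x = d x"
  shows "c = d"
proof (rule extensionalityI)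
  show "c \<in> extensional (simp S m)" "d \<in> extensional (simp S m)"
    using assms(1,2) by (simp_all add: cochains_simps PiE_def)
qed (rule assms(3))

context abelian_group
begin

lemma cobdry_closed:
  assumes "simplicial_set S" "c \<in> carrier (cochains G S m)"
  shows "cobdry G S m c \<in> carrier (cochains G S (m + 1))"
proof -
  have "c (act S (m + 1) (coface m i) x) \<in> carrier G" if "i \<le> m + 1" "x \<in> simp S (m + 1)" for i x
    using assms that simplicial_setD(1)[OF assms(1) coface_delta] by (auto simp: cochains_simps)
  then show ?thesis
    by (auto simp: cobdry_def cochains_simps intro!: finsum_closed)
qed

lemma pull_closed:
  assumes "f \<in> smaps S T" "c \<in> carrier (cochains G T m)"
  shows "compose (simp S m) c (f m) \<in> carrier (cochains G S m)"
  using assms smapsD(1)[OF assms(1)] by (auto simp: cochains_simps compose_def)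

lemma cobdry_pull:
  assumes "simplicial_set S" "simplicial_set T" "f \<in> smaps S T" "c \<in> carrier (cochains G T m)"
  shows "cobdry G S m (compose (simp S m) c (f m)) = compose (simp S (m + 1)) (cobdry G T m c) (f (m + 1))"
proof (rule cochains_eqI[OF cobdry_closed[OF assms(1) pull_closed[OF assms(3,4)]]
      pull_closed[OF assms(3) cobdry_closed[OF assms(2,4)]]])
  fix x assume x: "x \<in> simp S (m + 1)"
  have 1: "act S (m + 1) (coface m i) x \<in> simp S m"
    "f m (act S (m + 1) (coface m i) x) = act T (m + 1) (coface m i) (f (m + 1) x)"
    "c (act T (m + 1) (coface m i) (f (m + 1) x)) \<in> carrier G" if "i \<le> m + 1" for i
  proof -
    have i: "coface m i \<in> delta m (m + 1)" using that coface_delta by simp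
    show "act S (m + 1) (coface m i) x \<in> simp S m"
      by (rule simplicial_setD(1)[OF assms(1) i x])
    show "f m (act S (m + 1) (coface m i) x) = act T (m + 1) (coface m i) (f (m + 1) x)"
      by (rule smapsD(2)[OF assms(3) i x])
    show "c (act T (m + 1) (coface m i) (f (m + 1) x)) \<in> carrier G"
      using simplicial_setD(1)[OF assms(2) i smapsD(1)[OF assms(3) x]] assms(4) by (auto simp: cochains_simps)
  qed
  have "f (m + 1) x \<in> simp T (m + 1)"
    using smapsD(1)[OF assms(3) x] .
  then show "cobdry G S m (compose (simp S m) c (f m)) x =
      compose (simp S (m + 1)) (cobdry G T m c) (f (m + 1)) x"
    unfolding cobdry_def compose_def using x
    by (simp, intro finsum_cong') (use 1 in \<open>auto simp: compose_def\<close>)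
qed

lemma cocycles_pull:
  assumes "simplicial_set S" "simplicial_set T" "f \<in> smaps S T" "c \<in> cocycles G T m"
  shows "compose (simp S m) c (f m) \<in> cocycles G S m"
proof -
  have c: "c \<in> carrier (cochains G T m)" "cobdry G T m c = (\<lambda>x\<in>simp T (m + 1). \<zero>)"
    using assms(4) by (auto simp: cocycles_def cochains_simps)
  have "compose (simp S (m + 1)) (\<lambda>x\<in>simp T (m + 1). \<zero>) (f (m + 1)) = (\<lambda>x\<in>simp S (m + 1). \<zero>)"
    using smapsD(1)[OF assms(3)] by (auto simp: compose_def intro!: restrict_ext)
  then show ?thesis
    using cobdry_pull[OF assms(1-3) c(1)] c(2) pull_closed[OF assms(3) c(1)]
    by (simp add: cocycles_def cochains_simps(3))
qed

end

context gmodule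
begin

lemma tau_minus:
  "c \<in> lcochains G N m \<Longrightarrow> length l = Suc m \<Longrightarrow> set l \<subseteq> carrier G \<Longrightarrow>
   tau G N (\<lambda>k. \<ominus> c k) l = \<ominus> tau G N c l"
proof (induction m arbitrary: c l)
  case 0
  then obtain g where "l = [g]"
    by (auto simp: length_Suc_conv)
  then show ?case by simp
next
  case (Suc m)
  then obtain g h k where l: "l = g # h # k"
    by (auto simp: length_Suc_conv)
  have g: "g \<in> carrier G" "h \<in> carrier G" "set k \<subseteq> carrier G" "length k = m"
    using Suc.prems l by auto
  note c = lcochains_Cons[OF Suc.prems(1) g(1)]
  have "tau G N (\<lambda>k. \<ominus> c (g # k)) (h # k) = \<ominus> tau G N (\<lambda>k. c (g # k)) (h # k)"
    by (rule Suc.IH[OF c]) (use g in auto)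
  moreover have "\<ominus> a \<ominus> (\<ominus> b) = \<ominus> (a \<ominus> b)" if "a \<in> carrier N" "b \<in> carrier N" for a b
    using that by algebra
  ultimately show ?case
    unfolding l tau.simps
    using lcochainsD[OF Suc.prems(1), of "(g \<otimes>\<^bsub>G\<^esub> h) # k"] tau_closed[OF c, of "h # k"] g
    by simp
qed

text \<open>Split off the face that multiplies the first two letters; the remaining faces fix the
  first letter and have the opposite sign, which is the recursion of \<open>tau\<close>. The index
  \<open>Suc i\<close> leaves out the face that drops the first letter.\<close>

lemma tau_eq_finsum:
  "c \<in> lcochains G N m \<Longrightarrow> length l = Suc m \<Longrightarrow> set l \<subseteq> carrier G \<Longrightarrow>
   (\<Oplus>i\<in>{..m}. if even i then c (lface G (Suc i) l) else \<ominus> c (lface G (Suc i) l)) = tau G N c l"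
proof (induction m arbitrary: c l)
  case 0
  then obtain g where "l = [g]"
    by (auto simp: length_Suc_conv)
  then show ?case using 0 by (simp add: lcochains_def)
next
  case (Suc m)
  then obtain g h k where l: "l = g # h # k"
    by (auto simp: length_Suc_conv)
  have g: "g \<in> carrier G" "h \<in> carrier G" "set k \<subseteq> carrier G" "length k = m"
    using Suc.prems l by auto
  note cg = lcochains_Cons[OF Suc.prems(1) g(1)]
  have d: "(\<lambda>k. \<ominus> c (g # k)) \<in> lcochains G N m"
    using cg by (auto simp: lcochains_def)
  have cl: "c (lface G i l) \<in> carrier N" for i
    by (rule lcochainsD[OF Suc.prems(1)]) (use Suc.prems G.set_lface in auto)
  let ?f = "\<lambda>i. if even i then c (lface G (Suc i) l) else \<ominus> c (lface G (Suc i) l)"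
  have "(\<Oplus>i\<in>{..Suc m}. ?f i) = (\<Oplus>i\<in>{..m}. ?f (Suc i)) \<oplus> ?f 0"
    by (rule finsum_Suc2) (use cl in auto)
  also have "(\<Oplus>i\<in>{..m}. ?f (Suc i)) = (\<Oplus>i\<in>{..m}. if even i then \<ominus> c (g # lface G (Suc i) (h # k))
      else \<ominus> (\<ominus> c (g # lface G (Suc i) (h # k))))"
    by (rule finsum_cong') (use cl[of "Suc (Suc _)"] l in auto)
  also have "\<dots> = tau G N (\<lambda>k. \<ominus> c (g # k)) (h # k)"
    by (rule Suc.IH[OF d]) (use g in auto)
  also have "\<dots> = \<ominus> tau G N (\<lambda>k. c (g # k)) (h # k)"
    by (rule tau_minus[OF cg]) (use g in auto)
  finally show ?case
    using lcochainsD[OF Suc.prems(1), of "(g \<otimes>\<^bsub>G\<^esub> h) # k"] tau_closed[OF cg, of "h # k"] g l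
    by (simp add: minus_eq a_comm)
qed

lemma lcobdry_eq_finsum:
  assumes c: "c \<in> lcochains G N m" and l: "length l = Suc m" "set l \<subseteq> carrier G"
  shows "(\<Oplus>i\<in>{..Suc m}. if even i then c (lface G i l) else \<ominus> c (lface G i l)) = c (tl l) \<ominus> tau G N c l"
proof -
  have cl: "c (lface G i l) \<in> carrier N" for i
    by (rule lcochainsD[OF c]) (use l G.set_lface in auto)
  have d: "(\<lambda>k. \<ominus> c k) \<in> lcochains G N m"
    using c by (auto simp: lcochains_def)
  let ?f = "\<lambda>i. if even i then c (lface G i l) else \<ominus> c (lface G i l)"
  have "(\<Oplus>i\<in>{..Suc m}. ?f i) = (\<Oplus>i\<in>{..m}. ?f (Suc i)) \<oplus> ?f 0"
    by (rule finsum_Suc2) (use cl in auto)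
  also have "(\<Oplus>i\<in>{..m}. ?f (Suc i)) =
      (\<Oplus>i\<in>{..m}. if even i then \<ominus> c (lface G (Suc i) l) else \<ominus> (\<ominus> c (lface G (Suc i) l)))"
    by (rule finsum_cong') (use cl in auto)
  also have "\<dots> = \<ominus> tau G N c l"
    using tau_eq_finsum[OF d l] tau_minus[OF c l] by simp
  finally show ?thesis
    using tau_closed[OF c l] cl[of 0] by (simp add: minus_eq a_comm)
qed

text \<open>The bridge between the two calculi: the simplicial coboundary on the nerve is the
  inhomogeneous coboundary for the trivial action.\<close>

lemma cobdry_nerve:
  assumes c: "c \<in> carrier (cochains N (nerve G) m)" and x: "x \<in> simp (nerve G) (Suc m)"
  shows "cobdry N (nerve G) m c x = lcobdry G N (\<lambda>_ x. x) (\<lambda>l. c (simplex_of G l)) (edges (Suc m) x)"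
proof -
  have c': "(\<lambda>l. c (simplex_of G l)) \<in> lcochains G N m"
    using c G.simplex_of_in by (auto simp: lcochains_def cochains_simps)
  have face: "act (nerve G) (Suc m) (coface m i) x = simplex_of G (lface G i (edges (Suc m) x))" if "i \<le> Suc m" for i
    using G.simplex_of_edges[OF nerve_act_in[OF coface_delta[OF that] x]] edges_face[OF x that] by simp
  have cl: "c (simplex_of G (lface G i (edges (Suc m) x))) \<in> carrier N" for i
    by (rule lcochainsD[OF c']) (use set_edges[OF x] G.set_lface in auto)
  have "cobdry N (nerve G) m c x = (\<Oplus>i\<in>{..Suc m}. if even i then c (simplex_of G (lface G i (edges (Suc m) x)))
      else \<ominus> c (simplex_of G (lface G i (edges (Suc m) x))))"
    unfolding cobdry_def using x by (simp, intro finsum_cong') (use cl face in auto)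
  also have "\<dots> = c (simplex_of G (tl (edges (Suc m) x))) \<ominus> tau G N (\<lambda>l. c (simplex_of G l)) (edges (Suc m) x)"
    using lcobdry_eq_finsum[OF c', of "edges (Suc m) x"] set_edges[OF x] by simp
  finally show ?thesis by (simp add: lcobdry_def)
qed

end

subsection \<open>Descending cochains to a quotient\<close>

lemma edges_nerve_map: "x \<in> simp (nerve G) m \<Longrightarrow> edges m (nerve_map G h m x) = map h (edges m x)"
  by (simp add: edges_def nerve_map_apply)

abbreviation quot_map where
  "quot_map G H \<equiv> nerve_map G (\<lambda>x. H #>\<^bsub>G\<^esub> x)"

abbreviation trans_map where
  "trans_map G K H \<equiv> nerve_map (G Mod K) (\<lambda>C. H <#>\<^bsub>G\<^esub> C)"

lemma (in normal) Mod_hom: "(\<lambda>x. H #> x) \<in> hom G (G Mod H)"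
  by (rule r_coset_hom_Mod)

text \<open>Lift the consecutive edges one by one; any list of group elements is the list of edges
  of a simplex.\<close>

lemma (in normal) nerve_map_Mod_surj:
  assumes "y \<in> simp (nerve (G Mod H)) m"
  obtains x where "x \<in> simp (nerve G) m" "quot_map G H m x = y"
proof -
  have "\<exists>l. length l = length k \<and> set l \<subseteq> carrier G \<and> map (\<lambda>x. H #> x) l = k"
    if "set k \<subseteq> carrier (G Mod H)" for k
    using that
  proof (induction k)
    case (Cons C k)
    then obtain l g where "length l = length k" "set l \<subseteq> carrier G" "map (\<lambda>x. H #> x) l = k"
      "g \<in> carrier G" "C = H #> g"
      by (auto simp: carrier_Mod)
    then show ?case
      by (intro exI[of _ "g # l"]) simp
  qed simp
  then obtain l where l: "length l = m" "set l \<subseteq> carrier G" "map (\<lambda>x. H #> x) l = edges m y"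
    using set_edges[OF assms] by (metis length_edges)
  let ?x = "simplex_of G l"
  have x: "?x \<in> simp (nerve G) m"
    using simplex_of_in[OF l(2)] l(1) by simp
  have "quot_map G H m ?x = y"
    by (rule edges_inj[OF nerve_map_in[OF is_group factorgroup_is_group Mod_hom x] assms])
      (use l edges_nerve_map[OF x, of "\<lambda>x. H #> x"] edges_simplex_of[OF l(2)] in auto)
  then show thesis using x that by blast
qed

text \<open>Reads an inflated cochain on the quotient by evaluating it on a chosen lift of the
  simplex; invariance makes the value independent of the choice, see
  \<open>descend_apply\<close>.\<close>

definition descend :: "('g, 'b) monoid_scheme \<Rightarrow> 'g set \<Rightarrow> nat \<Rightarrow> ('g list \<Rightarrow> 'm) \<Rightarrow>
    (nat \<times> nat \<Rightarrow> 'g set) \<Rightarrow> 'm" where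
  "descend G H m a = (\<lambda>y\<in>simp (nerve (G Mod H)) m.
     a (edges m (SOME x. x \<in> simp (nerve G) m \<and> quot_map G H m x = y)))"

lemma (in normal) descend_apply:
  assumes "invariant_mod G H m a" "x \<in> simp (nerve G) m"
  shows "descend G H m a (quot_map G H m x) = a (edges m x)"
proof -
  let ?y = "quot_map G H m x"
  let ?z = "SOME z. z \<in> simp (nerve G) m \<and> quot_map G H m z = ?y"
  have z: "?z \<in> simp (nerve G) m \<and> quot_map G H m ?z = ?y"
    by (rule someI[of _ x]) (use assms in simp)
  have "a (edges m ?z) = a (edges m x)"
  proof (rule invariant_modD[OF assms(1)])
    show "map (\<lambda>x. H #> x) (edges m ?z) = map (\<lambda>x. H #> x) (edges m x)"
      using conjunct2[OF z] edges_nerve_map[OF conjunct1[OF z], of "\<lambda>x. H #> x"]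
        edges_nerve_map[OF assms(2), of "\<lambda>x. H #> x"] by simp
  qed (use z assms set_edges in auto)
  then show ?thesis
    using nerve_map_in[OF is_group factorgroup_is_group Mod_hom assms(2)] by (simp add: descend_def)
qed

lemma (in gmodule) lcobdry_cong:
  assumes "\<And>k. length k = m \<Longrightarrow> set k \<subseteq> carrier G \<Longrightarrow> c k = d k" "length l = Suc m" "set l \<subseteq> carrier G"
  shows "lcobdry G N rho c l = lcobdry G N rho d l"
proof -
  have "set (tl l) \<subseteq> carrier G"
    using assms by (cases l) auto
  then show ?thesis
    using assms tau_cong[of m c d l] by (simp add: lcobdry_def)
qed

locale trivial_module = abelian_group M + group G
  for M :: "('m, 'c) ring_scheme" and G :: "('g, 'b) monoid_scheme" (structure)
begin

sublocale gmodule M G "\<lambda>_ x. x"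
  by (rule gmodule_trivial[OF is_group])

text \<open>For the trivial action these rules are tautologies that make the simplifier loop.\<close>

declare act_closed [simp del, rule del] act_one [simp del] act_zero [simp del]

lemma edges_cochain:
  assumes "a \<in> lcochains G M m"
  shows "(\<lambda>x\<in>simp (nerve G) m. a (edges m x)) \<in> carrier (cochains M (nerve G) m)"
proof -
  have "a (edges m x) \<in> carrier M" if "x \<in> simp (nerve G) m" for x
    using lcochainsD[OF assms length_edges set_edges[OF that]] .
  then show ?thesis by (simp add: cochains_simps)
qed

lemma cobdry_edges:
  assumes "a \<in> lcochains G M m" "x \<in> simp (nerve G) (Suc m)"
  shows "cobdry M (nerve G) m (\<lambda>x\<in>simp (nerve G) m. a (edges m x)) x = lcobdry G M (\<lambda>_ x. x) a (edges (Suc m) x)"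
proof -
  let ?c = "\<lambda>x\<in>simp (nerve G) m. a (edges m x)"
  have "?c \<in> carrier (cochains M (nerve G) m)"
    by (rule edges_cochain[OF assms(1)])
  then have "cobdry M (nerve G) m ?c x = lcobdry G M (\<lambda>_ x. x) (\<lambda>l. ?c (simplex_of G l)) (edges (Suc m) x)"
    using cobdry_nerve assms by blast
  also have "\<dots> = lcobdry G M (\<lambda>_ x. x) a (edges (Suc m) x)"
    by (rule lcobdry_cong[where m = m])
      (use set_edges[OF assms(2)] simplex_of_in edges_simplex_of in auto)
  finally show ?thesis .
qed

lemma lcochain_of_cochain:
  assumes "c \<in> carrier (cochains M (nerve G) m)"
  shows "(\<lambda>l. c (simplex_of G l)) \<in> lcochains G M m"
  using assms simplex_of_in by (auto simp: lcochains_def cochains_simps)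

lemma lcocycle_of_cocycle:
  assumes "c \<in> cocycles M (nerve G) m"
  shows "lcocycle G M (\<lambda>_ x. x) m (\<lambda>l. c (simplex_of G l))"
  unfolding lcocycle_def
proof (intro conjI allI impI; (elim conjE)?)
  have c: "c \<in> carrier (cochains M (nerve G) m)" "cobdry M (nerve G) m c = (\<lambda>x\<in>simp (nerve G) (m + 1). \<zero>\<^bsub>M\<^esub>)"
    using assms by (auto simp: cocycles_def cochains_simps(3))
  show "(\<lambda>l. c (simplex_of G l)) \<in> lcochains G M m"
    using lcochain_of_cochain[OF c(1)] .
  fix l assume l: "length l = Suc m" "set l \<subseteq> carrier G"
  have "simplex_of G l \<in> simp (nerve G) (Suc m)"
    using simplex_of_in l by metis
  then show "lcobdry G M (\<lambda>_ x. x) (\<lambda>l. c (simplex_of G l)) l = \<zero>\<^bsub>M\<^esub>"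
    using cobdry_nerve[OF c(1), of "simplex_of G l"] c(2) edges_simplex_of[OF l(2)] l by simp
qed

lemma descend_in:
  assumes "H \<lhd> G" "a \<in> lcochains G M m"
  shows "descend G H m a \<in> carrier (cochains M (nerve (G Mod H)) m)"
proof -
  interpret normal H G by fact
  have "descend G H m a y \<in> carrier M" if y: "y \<in> simp (nerve (G Mod H)) m" for y
  proof -
    let ?P = "\<lambda>x. x \<in> simp (nerve G) m \<and> quot_map G H m x = y"
    obtain x where "?P x" using nerve_map_Mod_surj[OF y] by blast
    then have "?P (SOME x. ?P x)" by (rule someI[where P = ?P])
    then show ?thesis
      using lcochainsD[OF assms(2) length_edges set_edges[of "SOME x. ?P x" G m]] y
      by (simp add: descend_def)
  qed
  then show ?thesis
    by (auto simp: cochains_simps descend_def)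
qed

lemma pull_descend:
  assumes "H \<lhd> G" "invariant_mod G H m a"
  shows "compose (simp (nerve G) m) (descend G H m a) (quot_map G H m) =
    (\<lambda>x\<in>simp (nerve G) m. a (edges m x))"
  unfolding compose_def by (rule restrict_ext) (use normal.descend_apply assms in blast)

lemma cobdry_descend:
  assumes H: "H \<lhd> G" and a: "a \<in> lcochains G M m" "invariant_mod G H m a"
    and x: "x \<in> simp (nerve G) (Suc m)"
  shows "cobdry M (nerve (G Mod H)) m (descend G H m a) (quot_map G H (Suc m) x) =
    lcobdry G M (\<lambda>_ x. x) a (edges (Suc m) x)"
proof -
  interpret normal H G by fact
  have f: "quot_map G H \<in> smaps (nerve G) (nerve (G Mod H))"
    by (rule nerve_map_smaps[OF is_group factorgroup_is_group Mod_hom])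
  have "cobdry M (nerve (G Mod H)) m (descend G H m a) (quot_map G H (Suc m) x) =
      cobdry M (nerve G) m (compose (simp (nerve G) m) (descend G H m a) (quot_map G H m)) x"
    using cobdry_pull[OF simplicial_set_nerve simplicial_set_nerve f descend_in[OF H a(1)]] x
    by (simp add: compose_def)
  also have "\<dots> = lcobdry G M (\<lambda>_ x. x) a (edges (Suc m) x)"
    unfolding pull_descend[OF H a(2)] by (rule cobdry_edges[OF a(1) x])
  finally show ?thesis .
qed

lemma zero_cocycle: "(\<lambda>x\<in>simp S m. \<zero>\<^bsub>M\<^esub>) \<in> cocycles M S m" if "simplicial_set S"
proof -
  have face: "act S (m + 1) (coface m i) x \<in> simp S m" if "i \<le> m + 1" "x \<in> simp S (m + 1)" for i x
    using simplicial_setD(1)[OF \<open>simplicial_set S\<close> coface_delta] that by simp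
  have "cobdry M S m (\<lambda>x\<in>simp S m. \<zero>\<^bsub>M\<^esub>) x = \<zero>\<^bsub>M\<^esub>" if "x \<in> simp S (m + 1)" for x
  proof -
    have "cobdry M S m (\<lambda>x\<in>simp S m. \<zero>\<^bsub>M\<^esub>) x = (\<Oplus>\<^bsub>M\<^esub>i\<in>{..m + 1}. \<zero>\<^bsub>M\<^esub>)"
      unfolding cobdry_def restrict_apply'[OF \<open>x \<in> simp S (m + 1)\<close>]
      by (rule finsum_cong') (use face \<open>x \<in> simp S (m + 1)\<close> in auto)
    then show ?thesis by (simp add: finsum_zero)
  qed
  then have "cobdry M S m (\<lambda>x\<in>simp S m. \<zero>\<^bsub>M\<^esub>) = (\<lambda>x\<in>simp S (m + 1). \<zero>\<^bsub>M\<^esub>)"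
    by (intro extensionalityI[of _ "simp S (m + 1)"]) (auto simp: cobdry_def)
  then show ?thesis
    by (simp add: cocycles_def cochains_simps)
qed

text \<open>The nerve has a single vertex and the action is trivial, so the two faces of an edge
  contribute the same value and every 0-cochain is a cocycle. In degrees 0 and 1 cohomology classes
  are therefore cocycles.\<close>

lemma coboundaries_low:
  assumes "m \<le> 1"
  shows "coboundaries M (nerve G) m = {\<lambda>x\<in>simp (nerve G) m. \<zero>\<^bsub>M\<^esub>}"
proof (cases m)
  case 0
  then show ?thesis by (simp add: coboundaries_def cochains_simps)
next
  case (Suc k)
  then have m: "m = 1" using assms by simp
  have "cobdry M (nerve G) 0 c = (\<lambda>x\<in>simp (nerve G) 1. \<zero>\<^bsub>M\<^esub>)" if c: "c \<in> carrier (cochains M (nerve G) 0)" for c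
  proof (rule extensionalityI[of _ "simp (nerve G) 1"])
    show "cobdry M (nerve G) 0 c \<in> extensional (simp (nerve G) 1)"
      by (simp add: cobdry_def)
    fix x assume x: "x \<in> simp (nerve G) 1"
    have "c (simplex_of G []) \<in> carrier M"
      using lcochainsD[OF lcochain_of_cochain[OF c], of "[]"] by simp
    moreover have "edges 1 x = [x (0, 1)]" by (simp add: edges_def)
    ultimately show "cobdry M (nerve G) 0 c x = (\<lambda>x\<in>simp (nerve G) 1. \<zero>\<^bsub>M\<^esub>) x"
      using cobdry_nerve[OF c, of x] x by (simp add: lcobdry_def minus_eq r_neg)
  qed simp
  moreover have "(\<lambda>x\<in>simp (nerve G) 0. \<zero>\<^bsub>M\<^esub>) \<in> carrier (cochains M (nerve G) 0)"
    by (simp add: cochains_simps)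
  ultimately show ?thesis
    unfolding m coboundaries_def by (auto simp: image_iff)
qed

end

section \<open>Transition maps between quotients\<close>

lemma (in normal) transition:
  assumes "K \<lhd> G" "K \<subseteq> H" "x \<in> carrier G"
  shows "H <#> (K #> x) = H #> x"
proof -
  interpret K: normal K G by fact
  have "H <#> K = H"
  proof
    show "H <#> K \<subseteq> H"
      using assms subset by (auto simp: set_mult_def)
    show "H \<subseteq> H <#> K"
    proof
      fix x assume "x \<in> H"
      then have "x = x \<otimes> \<one>" using subset by auto
      then show "x \<in> H <#> K"
        using K.one_closed \<open>x \<in> H\<close> unfolding set_mult_def by blast
    qed
  qed
  then show ?thesis
    using setmult_rcos_assoc[OF subset K.subset assms(3)] by simp
qed

lemma (in normal) transition_hom:
  assumes "K \<lhd> G" "K \<subseteq> H"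
  shows "(\<lambda>C. H <#> C) \<in> hom (G Mod K) (G Mod H)"
proof -
  interpret K: normal K G by fact
  show ?thesis
    by (rule homI) (auto simp: carrier_Mod transition[OF assms] rcos_sum K.rcos_sum)
qed

lemma (in normal) transition_nerve:
  assumes "K \<lhd> G" "K \<subseteq> H" "x \<in> simp (nerve G) m"
  shows "trans_map G K H m (quot_map G K m x) = quot_map G H m x"
proof -
  interpret K: normal K G by fact
  have y: "quot_map G K m x \<in> simp (nerve (G Mod K)) m"
    by (rule nerve_map_in[OF is_group K.factorgroup_is_group K.Mod_hom assms(3)])
  show ?thesis
    by (rule nerve_eqI[where n = m]) (auto simp: nerve_map_ext[OF y] nerve_map_ext[OF assms(3)]
      nerve_map_apply[OF y] nerve_map_apply[OF assms(3)] transition[OF assms(1,2)] nerve_simpD(1)[OF assms(3)])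
qed

subsection \<open>Comparison of the free group with its \<open>p\<close>-group quotients\<close>

locale comparison = abelian_group M for M :: "('m, 'c) ring_scheme" (structure) +
  fixes p n :: nat
  assumes p: "prime p" and tors: "\<And>x. x \<in> carrier M \<Longrightarrow> [p] \<cdot> x = \<zero>"
begin

abbreviation F where "F \<equiv> free_group n"

sublocale trivial_module M F
  by (intro trivial_module.intro abelian_group_axioms group_free_group)

text \<open>Injectivity on the colimit. In degrees 0 and 1 the only coboundary is zero and pulling
  back along the surjection from \<open>F\<close> is injective, so \<open>H\<close> itself serves as
  \<open>K\<close>. From degree 2 on, the vanishing theorem gives a primitive of the inflated
  cocycle over some \<open>K0\<close>, and both it and the cocycle descend to
  \<open>K0 \<inter> H\<close>.\<close>

lemma pull_coboundary:
  assumes H: "H \<in> finite_p_quotients p F" and c: "c \<in> cocycles M (nerve (F Mod H)) m"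
    and cob: "compose (simp (nerve F) m) c (quot_map F H m) \<in> coboundaries M (nerve F) m"
  shows "\<exists>K\<in>finite_p_quotients p F. K \<subseteq> H \<and>
    compose (simp (nerve (F Mod K)) m) c (trans_map F K H m)
      \<in> coboundaries M (nerve (F Mod K)) m"
proof -
  have HF: "H \<lhd> F" using H by (simp add: finite_p_quotients_def)
  interpret H: normal H F by (rule HF)
  let ?pc = "compose (simp (nerve F) m) c (quot_map F H m)"
  have f: "quot_map F H \<in> smaps (nerve F) (nerve (F Mod H))"
    by (rule nerve_map_smaps[OF is_group H.factorgroup_is_group H.Mod_hom])
  have pc: "?pc \<in> cocycles M (nerve F) m"
    by (rule cocycles_pull[OF simplicial_set_nerve simplicial_set_nerve f c])
  show ?thesis
  proof (cases "m \<le> 1")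
    case True
    then have pc0: "?pc = (\<lambda>x\<in>simp (nerve F) m. \<zero>)"
      using cob coboundaries_low by blast
    have c0: "c y = \<zero>" if "y \<in> simp (nerve (F Mod H)) m" for y
    proof -
      obtain x where "x \<in> simp (nerve F) m" "quot_map F H m x = y"
        using H.nerve_map_Mod_surj[OF \<open>y \<in> _\<close>] by blast
      then show ?thesis
        using fun_cong[OF pc0, of x] by (simp add: compose_def)
    qed
    have t: "trans_map F H H \<in> smaps (nerve (F Mod H)) (nerve (F Mod H))"
      by (rule nerve_map_smaps[OF H.factorgroup_is_group H.factorgroup_is_group H.transition_hom[OF HF]]) simp
    have "compose (simp (nerve (F Mod H)) m) c (trans_map F H H m) =
        (\<lambda>x\<in>simp (nerve (F Mod H)) m. \<zero>)"
      unfolding compose_def by (rule restrict_ext) (use c0 smapsD(1)[OF t] in simp)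
    moreover have "trivial_module M (F Mod H)"
      by (intro trivial_module.intro abelian_group_axioms H.factorgroup_is_group)
    ultimately show ?thesis
      using trivial_module.coboundaries_low[OF _ True] H by blast
  next
    case False
    define c' where "c' = (\<lambda>l. ?pc (simplex_of F l))"
    have c': "lcocycle F M (\<lambda>_ x. x) m c'"
      unfolding c'_def by (rule lcocycle_of_cocycle[OF pc])
    have inv: "invariant_mod F H m c'"
      unfolding invariant_mod_def
    proof (intro allI impI; elim conjE)
      fix l l' :: "(bool \<times> nat) list list"
      assume l: "length l = m" "set l \<subseteq> carrier F" "set l' \<subseteq> carrier F"
        "map (\<lambda>x. H #>\<^bsub>F\<^esub> x) l = map (\<lambda>x. H #>\<^bsub>F\<^esub> x) l'"
      then have l': "length l' = m" using map_eq_imp_length_eq by metis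
      note x = simplex_of_in[OF l(2), unfolded l(1)] simplex_of_in[OF l(3), unfolded l']
      have "quot_map F H m (simplex_of F l) = quot_map F H m (simplex_of F l')"
        by (rule edges_inj[OF smapsD(1)[OF f x(1)] smapsD(1)[OF f x(2)]])
          (use l l' edges_nerve_map[OF x(1)] edges_nerve_map[OF x(2)] edges_simplex_of[OF l(2)]
            edges_simplex_of[OF l(3)] in metis)
      then show "c' l = c' l'"
        using x by (simp add: c'_def compose_def)
    qed
    have fam: "good_family p n (finite_p_quotients p F)" by (simp add: good_family_def)
    have m2: "m \<ge> 2" using False by simp
    obtain K0 a where K0: "K0 \<in> finite_p_quotients p F" "a \<in> lcochains F M (m - 1)"
        "invariant_mod F K0 (m - 1) a"
      and Da: "\<And>l. length l = m \<Longrightarrow> set l \<subseteq> carrier F \<Longrightarrow> lcobdry F M (\<lambda>_ x. x) a l = c' l"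
      using list_cocycle_vanishes[OF abelian_group_axioms tors p fam m2 H c' inv] by blast
    define K where "K = K0 \<inter> H"
    have K: "K \<in> finite_p_quotients p F" "K \<subseteq> H"
      using finite_p_quotients_Int[OF p K0(1) H] by (auto simp: K_def)
    then have KF: "K \<lhd> F" "K0 \<lhd> F" using K0 by (auto simp: finite_p_quotients_def)
    interpret K: normal K F by (rule KF)
    have aK: "invariant_mod F K (m - 1) a"
      by (rule invariant_mod_mono[OF K0(3) K.subgroup_axioms normal_imp_subgroup[OF KF(2)]])
        (simp add: K_def)
    have t: "trans_map F K H \<in> smaps (nerve (F Mod K)) (nerve (F Mod H))"
      by (rule nerve_map_smaps[OF K.factorgroup_is_group H.factorgroup_is_group H.transition_hom[OF KF(1) K(2)]])
    have cc: "c \<in> carrier (cochains M (nerve (F Mod H)) m)"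
      using c by (simp add: cocycles_def)
    have m1: "Suc (m - 1) = m" "m - 1 + 1 = m" using m2 by auto
    have "cobdry M (nerve (F Mod K)) (m - 1) (descend F K (m - 1) a) =
      compose (simp (nerve (F Mod K)) m) c (trans_map F K H m)"
    proof (rule cochains_eqI)
      show "cobdry M (nerve (F Mod K)) (m - 1) (descend F K (m - 1) a) \<in> carrier (cochains M (nerve (F Mod K)) m)"
        using cobdry_closed[OF simplicial_set_nerve descend_in[OF KF(1) K0(2)]] m1 by simp
      show "compose (simp (nerve (F Mod K)) m) c (trans_map F K H m)
          \<in> carrier (cochains M (nerve (F Mod K)) m)"
        by (rule pull_closed[OF t cc])
      fix y assume y: "y \<in> simp (nerve (F Mod K)) m"
      obtain x where x: "x \<in> simp (nerve F) m" "quot_map F K m x = y"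
        using K.nerve_map_Mod_surj[OF y] by blast
      have "cobdry M (nerve (F Mod K)) (m - 1) (descend F K (m - 1) a) y = lcobdry F M (\<lambda>_ x. x) a (edges m x)"
        using cobdry_descend[OF KF(1) K0(2) aK, of x] x m1 by simp
      also have "\<dots> = c' (edges m x)"
        by (rule Da) (use set_edges[OF x(1)] in auto)
      also have "\<dots> = c (quot_map F H m x)"
        using x(1) by (simp add: c'_def simplex_of_edges compose_def)
      also have "\<dots> = c (trans_map F K H m y)"
        using H.transition_nerve[OF KF(1) K(2) x(1)] x(2) by simp
      finally show "cobdry M (nerve (F Mod K)) (m - 1) (descend F K (m - 1) a) y =
          compose (simp (nerve (F Mod K)) m) c (trans_map F K H m) y"
        using y by (simp add: compose_def)
    qed
    then have "compose (simp (nerve (F Mod K)) m) c (trans_map F K H m)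
        \<in> coboundaries M (nerve (F Mod K)) (Suc (m - 1))"
      unfolding coboundaries_def using descend_in[OF KF(1) K0(2)] by (simp, metis imageI)
    then show ?thesis
      using K m1 by auto
  qed
qed

text \<open>The vanishing theorem for the trivial subgroup: the free group has no cohomology with
  these coefficients above degree 1.\<close>

lemma coboundary_free:
  assumes c: "c \<in> cocycles M (nerve F) m" and m: "m \<ge> 2"
  shows "c \<in> coboundaries M (nerve F) m"
proof -
  define c' where "c' = (\<lambda>l. c (simplex_of F l))"
  have c': "lcocycle F M (\<lambda>_ x. x) m c'"
    unfolding c'_def by (rule lcocycle_of_cocycle[OF c])
  have "{\<one>\<^bsub>F\<^esub>} #>\<^bsub>F\<^esub> x = {x}" if "x \<in> carrier F" for x
    using that by (simp add: r_coset_def)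
  then have "l = l'" if "map (\<lambda>x. {\<one>\<^bsub>F\<^esub>} #>\<^bsub>F\<^esub> x) l = map (\<lambda>x. {\<one>\<^bsub>F\<^esub>} #>\<^bsub>F\<^esub> x) l'"
    "set l \<subseteq> carrier F" "set l' \<subseteq> carrier F" for l l'
    using that by (auto simp: list_eq_iff_nth_eq subset_iff)
  then have inv: "invariant_mod F {\<one>\<^bsub>F\<^esub>} m c'"
    unfolding invariant_mod_def by blast
  have fam: "good_family p n {{\<one>\<^bsub>F\<^esub>}}" by (simp add: good_family_def)
  obtain a where a: "a \<in> lcochains F M (m - 1)"
    and Da: "\<And>l. length l = m \<Longrightarrow> set l \<subseteq> carrier F \<Longrightarrow> lcobdry F M (\<lambda>_ x. x) a l = c' l"
    using list_cocycle_vanishes[OF abelian_group_axioms tors p fam m _ c' inv] by blast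
  have m1: "Suc (m - 1) = m" "m - 1 + 1 = m" using m by auto
  let ?a = "\<lambda>x\<in>simp (nerve F) (m - 1). a (edges (m - 1) x)"
  have aM: "?a \<in> carrier (cochains M (nerve F) (m - 1))"
    by (rule edges_cochain[OF a])
  have "cobdry M (nerve F) (m - 1) ?a = c"
  proof (rule cochains_eqI)
    show "cobdry M (nerve F) (m - 1) ?a \<in> carrier (cochains M (nerve F) m)"
      using cobdry_closed[OF simplicial_set_nerve aM] m1 by simp
    show "c \<in> carrier (cochains M (nerve F) m)" using c by (simp add: cocycles_def)
    fix x assume x: "x \<in> simp (nerve F) m"
    have "cobdry M (nerve F) (m - 1) ?a x = lcobdry F M (\<lambda>_ x. x) a (edges m x)"
      using cobdry_edges[OF a, of x] x m1 by simp
    also have "\<dots> = c' (edges m x)"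
      by (rule Da) (use set_edges[OF x] in auto)
    finally show "cobdry M (nerve F) (m - 1) ?a x = c x"
      using x by (simp add: c'_def simplex_of_edges)
  qed
  then have "c \<in> coboundaries M (nerve F) (Suc (m - 1))"
    unfolding coboundaries_def using aM by (simp, metis imageI)
  then show ?thesis using m1 by simp
qed

text \<open>A 0-cochain has only one value on the empty list, so all of \<open>F\<close> works. A
  1-cocycle is a homomorphism \<open>f\<close> to \<open>M\<close>; its image is spanned by the
  images of the letters and killed by \<open>p\<close>, hence finite, and its kernel is the required
  subgroup.\<close>

lemma invariant_low:
  assumes c: "lcocycle F M (\<lambda>_ x. x) m c" and m: "m \<le> 1"
  shows "\<exists>H\<in>finite_p_quotients p F. invariant_mod F H m c"
proof (cases m)
  case 0
  then have "invariant_mod F (carrier F) m c"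
    by (auto simp: invariant_mod_def)
  then show ?thesis
    using carrier_in_finite_p_quotients[OF p] by blast
next
  case (Suc k)
  then have m: "m = 1" using assms by simp
  have cM: "c \<in> lcochains F M 1"
    and Dc: "\<And>l. length l = 2 \<Longrightarrow> set l \<subseteq> carrier F \<Longrightarrow> lcobdry F M (\<lambda>_ x. x) c l = \<zero>"
    using c unfolding lcocycle_def m by auto
  define f where "f = (\<lambda>g. c [g])"
  have f: "f g \<in> carrier M" if "g \<in> carrier F" for g
    using lcochainsD[OF cM, of "[g]"] that unfolding f_def by simp
  have add: "f (g \<otimes>\<^bsub>F\<^esub> h) = f g \<oplus> f h" if "g \<in> carrier F" "h \<in> carrier F" for g h
  proof -
    have "f h \<ominus> (f (g \<otimes>\<^bsub>F\<^esub> h) \<ominus> f g) = \<zero>"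
    proof -
      have "lcobdry F M (\<lambda>_ x. x) c [g, h] = \<zero>"
        by (rule Dc) (simp_all add: that)
      then show ?thesis unfolding lcobdry_def f_def by (simp only: list.sel tau.simps)
    qed
    moreover note cl = f[OF that(1)] f[OF that(2)] f[OF m_closed[OF that]]
    then have "f h \<ominus> (f (g \<otimes>\<^bsub>F\<^esub> h) \<ominus> f g) = f g \<oplus> f h \<ominus> f (g \<otimes>\<^bsub>F\<^esub> h)"
      by algebra
    ultimately have "f g \<oplus> f h \<ominus> f (g \<otimes>\<^bsub>F\<^esub> h) = \<zero>"
      by metis
    then have "f g \<oplus> f h = f (g \<otimes>\<^bsub>F\<^esub> h)"
      by (rule eq_of_diff_zero[OF a_closed[OF cl(1,2)] cl(3)])
    then show ?thesis by simp
  qed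
  have f1: "f \<one>\<^bsub>F\<^esub> = \<zero>"
    using add[of "\<one>\<^bsub>F\<^esub>" "\<one>\<^bsub>F\<^esub>"] f[of "\<one>\<^bsub>F\<^esub>"] add.l_cancel_one by fastforce
  have finv: "f (inv\<^bsub>F\<^esub> g) = \<ominus> f g" if "g \<in> carrier F" for g
    using add[of "inv\<^bsub>F\<^esub> g" g] that f f1 minus_equality[of "f (inv\<^bsub>F\<^esub> g)" "f g"] by simp
  define K where "K = {g \<in> carrier F. f g = \<zero>}"
  have "subgroup K F"
    by (rule subgroupI) (use f1 add finv in \<open>auto simp: K_def\<close>)
  moreover have "x \<otimes>\<^bsub>F\<^esub> h \<otimes>\<^bsub>F\<^esub> inv\<^bsub>F\<^esub> x \<in> K" if "x \<in> carrier F" "h \<in> K" for x h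
  proof -
    have h: "h \<in> carrier F" "f h = \<zero>" using that by (auto simp: K_def)
    have "f (x \<otimes>\<^bsub>F\<^esub> h \<otimes>\<^bsub>F\<^esub> inv\<^bsub>F\<^esub> x) = f x \<oplus> f h \<oplus> \<ominus> f x"
      using add[OF m_closed[OF that(1) h(1)] inv_closed[OF that(1)]] add[OF that(1) h(1)] finv[OF that(1)]
      by simp
    also have "\<dots> = \<zero>"
      using h(2) f[OF that(1)] r_neg by simp
    finally show ?thesis
      using that(1) h(1) by (simp add: K_def)
  qed
  ultimately have KF: "K \<lhd> F"
    using normal_inv_iff by blast
  interpret K: normal K F by (rule KF)
  have coset: "K #>\<^bsub>F\<^esub> x = K #>\<^bsub>F\<^esub> y \<longleftrightarrow> f x = f y" if "x \<in> carrier F" "y \<in> carrier F" for x y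
  proof -
    have "f x \<oplus> \<ominus> f y = \<zero> \<longleftrightarrow> f x = f y"
      using eq_of_diff_zero[OF f[OF that(1)] f[OF that(2)]] r_neg[OF f[OF that(2)]]
      unfolding a_minus_def by metis
    moreover have "f (x \<otimes>\<^bsub>F\<^esub> inv\<^bsub>F\<^esub> y) = f x \<oplus> \<ominus> f y"
      using add[OF that(1) inv_closed[OF that(2)]] finv[OF that(2)] by (simp only:)
    moreover have "x \<otimes>\<^bsub>F\<^esub> inv\<^bsub>F\<^esub> y \<in> K \<longleftrightarrow> f (x \<otimes>\<^bsub>F\<^esub> inv\<^bsub>F\<^esub> y) = \<zero>"
      unfolding K_def using that by simp
    ultimately show ?thesis
      unfolding coset_eq_iff[OF K.subgroup_axioms that] by (simp only:)
  qed
  have "K \<in> finite_p_quotients p F"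
  proof (rule finite_p_quotientsI[OF p KF, where f = f])
    \<comment> \<open>\<open>letters n\<close> includes the inverse letters, so every value of
      \<open>f\<close> is a sum of elements of \<open>?S\<close>, as \<open>int_span\<close>
      requires.\<close>
    let ?S = "(\<lambda>x. f [x]) ` letters n"
    have S: "?S \<subseteq> carrier M"
      using f by (auto simp: carrier_free_group)
    have "f w \<in> int_span ?S" if "w \<in> carrier F" for w
      using that
    proof (induction w)
      case Nil
      then show ?case using f1 int_span.zero by (simp add: one_free_group)
    next
      case (Cons x w)
      note v = Cons_in_free_group[OF Cons.prems]
      have "x \<in> letters n" using Cons.prems by (auto simp: carrier_free_group)
      then have "f [x] \<oplus> f w \<in> int_span ?S"
        using Cons.IH[OF v(2)] by (intro int_span.plus) auto
      then show ?case using add[OF v(1,2)] v(3) by simp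
    qed
    then have "f ` carrier F \<subseteq> int_span ?S" by blast
    moreover have "finite (int_span ?S)"
      using finite_int_span[OF _ S tors] p prime_gt_0_nat finite_letters by simp
    ultimately show "finite (f ` carrier F)" by (rule finite_subset)
  next
    fix x assume x: "x \<in> carrier F"
    have "f (x [^]\<^bsub>F\<^esub> i) = [i] \<cdot> f x" for i :: nat
      by (induction i) (use f1 add x in auto)
    then have "f (x [^]\<^bsub>F\<^esub> p) = \<zero>"
      using tors[OF f[OF x]] by (simp only:)
    then have "x [^]\<^bsub>F\<^esub> (p ^ 1) \<in> K"
      unfolding K_def using x by simp
    then show "\<exists>k::nat. x [^]\<^bsub>F\<^esub> (p ^ k) \<in> K" by blast
  qed (use coset in blast)
  moreover have "invariant_mod F K m c"
    unfolding invariant_mod_def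
  proof (intro allI impI; elim conjE)
    fix l l' :: "(bool \<times> nat) list list"
    assume l: "length l = m" "set l \<subseteq> carrier F" "set l' \<subseteq> carrier F"
      "map (\<lambda>x. K #>\<^bsub>F\<^esub> x) l = map (\<lambda>x. K #>\<^bsub>F\<^esub> x) l'"
    then obtain x y where "l = [x]" "l' = [y]"
      using m by (auto simp: length_Suc_conv)
    then show "c l = c l'"
      using coset[of x y] l by (simp add: f_def)
  qed
  ultimately show ?thesis by blast
qed

text \<open>Surjectivity on the colimit. From degree 2 on the cocycle is itself a coboundary, and
  the zero cocycle on \<open>F/F\<close> is taken on the quotient. In degrees 0 and 1 the cocycle
  descends as it is, with zero coboundary.\<close>

lemma cocycle_from_quotient:
  assumes c: "c \<in> cocycles M (nerve F) m"
  shows "\<exists>H\<in>finite_p_quotients p F. \<exists>c'\<in>cocycles M (nerve (F Mod H)) m. \<exists>b\<in>coboundaries M (nerve F) m.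
    c = b \<otimes>\<^bsub>cochains M (nerve F) m\<^esub> compose (simp (nerve F) m) c' (quot_map F H m)"
proof -
  have cM: "c \<in> carrier (cochains M (nerve F) m)" using c by (simp add: cocycles_def)
  then have cx: "c x \<in> carrier M" if "x \<in> simp (nerve F) m" for x
    using that by (auto simp: cochains_simps)
  show ?thesis
  proof (cases "m \<le> 1")
    case False
    let ?H = "carrier F"
    have H: "?H \<in> finite_p_quotients p F" by (rule carrier_in_finite_p_quotients[OF p])
    then have "?H \<lhd> F" by (simp add: finite_p_quotients_def)
    then interpret H: normal ?H F .
    let ?z = "\<lambda>x\<in>simp (nerve (F Mod ?H)) m. \<zero>"
    have "c = c \<otimes>\<^bsub>cochains M (nerve F) m\<^esub> compose (simp (nerve F) m) ?z (quot_map F ?H m)"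
    proof (rule extensionalityI[of _ "simp (nerve F) m"])
      fix x assume x: "x \<in> simp (nerve F) m"
      show "c x = (c \<otimes>\<^bsub>cochains M (nerve F) m\<^esub> compose (simp (nerve F) m) ?z (quot_map F ?H m)) x"
        using x cx nerve_map_in[OF is_group H.factorgroup_is_group H.Mod_hom x]
        by (simp add: cochains_simps compose_def)
    qed (use cM in \<open>auto simp: cochains_simps PiE_def\<close>)
    moreover have "?z \<in> cocycles M (nerve (F Mod ?H)) m"
      by (rule zero_cocycle[OF simplicial_set_nerve])
    moreover have "c \<in> coboundaries M (nerve F) m"
      by (rule coboundary_free[OF c]) (use False in simp)
    ultimately show ?thesis using H by blast
  next
    case True
    define c' where "c' = (\<lambda>l. c (simplex_of F l))"
    have c': "lcocycle F M (\<lambda>_ x. x) m c'"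
      unfolding c'_def by (rule lcocycle_of_cocycle[OF c])
    then have c'M: "c' \<in> lcochains F M m" by (simp add: lcocycle_def)
    obtain H where H: "H \<in> finite_p_quotients p F" "invariant_mod F H m c'"
      using invariant_low[OF c' True] by blast
    then have HF: "H \<lhd> F" by (simp add: finite_p_quotients_def)
    then interpret H: normal H F .
    have "cobdry M (nerve (F Mod H)) m (descend F H m c') = \<one>\<^bsub>cochains M (nerve (F Mod H)) (m + 1)\<^esub>"
    proof (rule extensionalityI[of _ "simp (nerve (F Mod H)) (m + 1)"])
      fix y assume y: "y \<in> simp (nerve (F Mod H)) (m + 1)"
      then obtain x where x: "x \<in> simp (nerve F) (m + 1)" "quot_map F H (m + 1) x = y"
        using H.nerve_map_Mod_surj by blast
      have "lcobdry F M (\<lambda>_ x. x) c' (edges (Suc m) x) = \<zero>"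
        using c' set_edges[OF x(1)] by (simp add: lcocycle_def)
      then show "cobdry M (nerve (F Mod H)) m (descend F H m c') y = \<one>\<^bsub>cochains M (nerve (F Mod H)) (m + 1)\<^esub> y"
        using cobdry_descend[OF HF c'M H(2), of x] x y by (simp add: cochains_simps)
    qed (auto simp: cobdry_def cochains_simps)
    then have "descend F H m c' \<in> cocycles M (nerve (F Mod H)) m"
      using descend_in[OF HF c'M] by (simp add: cocycles_def)
    moreover have "c = (\<lambda>x\<in>simp (nerve F) m. \<zero>) \<otimes>\<^bsub>cochains M (nerve F) m\<^esub>
        compose (simp (nerve F) m) (descend F H m c') (quot_map F H m)"
      unfolding pull_descend[OF HF H(2)]
    proof (rule extensionalityI[of _ "simp (nerve F) m"])
      fix x assume x: "x \<in> simp (nerve F) m"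
      then show "c x = ((\<lambda>x\<in>simp (nerve F) m. \<zero>) \<otimes>\<^bsub>cochains M (nerve F) m\<^esub>
          (\<lambda>x\<in>simp (nerve F) m. c' (edges m x))) x"
        using cx by (simp add: cochains_simps c'_def simplex_of_edges)
    qed (use cM in \<open>auto simp: cochains_simps PiE_def\<close>)
    moreover have "(\<lambda>x\<in>simp (nerve F) m. \<zero>) \<in> coboundaries M (nerve F) m"
      using coboundaries_low[OF True] by simp
    ultimately show ?thesis using H(1) by blast
  qed
qed

end

section \<open>Cohomology of pro-spaces\<close>

abbreviation ccls :: "('m, 'x) ring_scheme \<Rightarrow> 'a sset \<Rightarrow> nat \<Rightarrow> ('a \<Rightarrow> 'm) \<Rightarrow> ('a \<Rightarrow> 'm) set" where
  "ccls M S m c \<equiv> coboundaries M S m #>\<^bsub>cochains M S m\<^esub> c"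

context abelian_group
begin

lemma comm_group_cochains: "comm_group (cochains G S m)"
proof (rule comm_groupI)
  fix c assume c: "c \<in> carrier (cochains G S m)"
  then have cx: "c x \<in> carrier G" if "x \<in> simp S m" for x
    using that by (auto simp: cochains_simps)
  show "\<exists>d\<in>carrier (cochains G S m). d \<otimes>\<^bsub>cochains G S m\<^esub> c = \<one>\<^bsub>cochains G S m\<^esub>"
  proof (rule bexI[of _ "\<lambda>x\<in>simp S m. \<ominus> c x"])
    show "(\<lambda>x\<in>simp S m. \<ominus> c x) \<otimes>\<^bsub>cochains G S m\<^esub> c = \<one>\<^bsub>cochains G S m\<^esub>"
      unfolding cochains_simps by (rule restrict_ext) (simp add: cx l_neg)
  qed (simp add: cochains_simps cx)
next
  fix c d e
  assume *: "c \<in> carrier (cochains G S m)" "d \<in> carrier (cochains G S m)" "e \<in> carrier (cochains G S m)"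
  show "c \<otimes>\<^bsub>cochains G S m\<^esub> d \<otimes>\<^bsub>cochains G S m\<^esub> e = c \<otimes>\<^bsub>cochains G S m\<^esub> (d \<otimes>\<^bsub>cochains G S m\<^esub> e)"
    unfolding cochains_simps by (rule restrict_ext) (use * in \<open>auto simp: cochains_simps intro!: a_assoc\<close>)
next
  fix c d
  assume *: "c \<in> carrier (cochains G S m)" "d \<in> carrier (cochains G S m)"
  show "c \<otimes>\<^bsub>cochains G S m\<^esub> d = d \<otimes>\<^bsub>cochains G S m\<^esub> c"
    unfolding cochains_simps by (rule restrict_ext) (use * in \<open>auto simp: cochains_simps intro!: a_comm\<close>)
next
  fix c
  assume c: "c \<in> carrier (cochains G S m)"
  show "\<one>\<^bsub>cochains G S m\<^esub> \<otimes>\<^bsub>cochains G S m\<^esub> c = c"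
  proof (rule extensionalityI[of _ "simp S m"])
    show "c \<in> extensional (simp S m)" using c by (simp add: cochains_simps PiE_def)
    fix x assume "x \<in> simp S m"
    moreover from this c have "c x \<in> carrier G" by (auto simp: cochains_simps)
    ultimately show "(\<one>\<^bsub>cochains G S m\<^esub> \<otimes>\<^bsub>cochains G S m\<^esub> c) x = c x"
      by (simp add: cochains_simps)
  qed (simp add: cochains_simps)
qed (auto simp: cochains_simps)

lemma pull_mult:
  assumes "f \<in> smaps S T"
  shows "compose (simp S m) (c \<otimes>\<^bsub>cochains G T m\<^esub> d) (f m) =
    compose (simp S m) c (f m) \<otimes>\<^bsub>cochains G S m\<^esub> compose (simp S m) d (f m)"
  unfolding cochains_simps compose_def
  by (rule restrict_ext) (use smapsD(1)[OF assms] in simp)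

lemma cobdry_mult:
  assumes S: "simplicial_set S" and c: "c \<in> carrier (cochains G S m)" and d: "d \<in> carrier (cochains G S m)"
  shows "cobdry G S m (c \<otimes>\<^bsub>cochains G S m\<^esub> d) = cobdry G S m c \<otimes>\<^bsub>cochains G S (m + 1)\<^esub> cobdry G S m d"
proof (rule extensionalityI[of _ "simp S (m + 1)"])
  fix x assume x: "x \<in> simp S (m + 1)"
  define y where "y = (\<lambda>i. act S (m + 1) (coface m i) x)"
  have y: "y i \<in> simp S m" "c (y i) \<in> carrier G" "d (y i) \<in> carrier G" if "i \<le> m + 1" for i
  proof -
    show "y i \<in> simp S m"
      unfolding y_def using simplicial_setD(1)[OF S coface_delta[of i m]] that x by simp
    then show "c (y i) \<in> carrier G" "d (y i) \<in> carrier G"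
      using c d by (auto simp: cochains_simps)
  qed
  have "cobdry G S m (c \<otimes>\<^bsub>cochains G S m\<^esub> d) x =
      (\<Oplus>i\<in>{..m + 1}. (if even i then c (y i) else \<ominus> c (y i)) \<oplus> (if even i then d (y i) else \<ominus> d (y i)))"
    unfolding cobdry_def restrict_apply'[OF x]
    by (rule finsum_cong') (use y in \<open>auto simp: y_def cochains_simps minus_add\<close>)
  also have "\<dots> = (\<Oplus>i\<in>{..m + 1}. if even i then c (y i) else \<ominus> c (y i)) \<oplus>
      (\<Oplus>i\<in>{..m + 1}. if even i then d (y i) else \<ominus> d (y i))"
    by (rule finsum_addf) (use y in auto)
  also have "\<dots> = (cobdry G S m c \<otimes>\<^bsub>cochains G S (m + 1)\<^esub> cobdry G S m d) x"
    unfolding cochains_simps cobdry_def restrict_apply'[OF x] y_def ..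
  finally show "cobdry G S m (c \<otimes>\<^bsub>cochains G S m\<^esub> d) x = (cobdry G S m c \<otimes>\<^bsub>cochains G S (m + 1)\<^esub> cobdry G S m d) x" .
qed (auto simp: cobdry_def cochains_simps)

lemma group_hom_cobdry:
  assumes "simplicial_set S"
  shows "group_hom (cochains G S m) (cochains G S (m + 1)) (cobdry G S m)"
proof -
  interpret A: comm_group "cochains G S m" by (rule comm_group_cochains)
  interpret B: comm_group "cochains G S (m + 1)" by (rule comm_group_cochains)
  show ?thesis
    by (intro group_hom.intro A.is_group B.is_group group_hom_axioms.intro homI)
      (use cobdry_closed[OF assms] cobdry_mult[OF assms] in auto)
qed

lemma subgroup_cocycles:
  assumes "simplicial_set S" shows "subgroup (cocycles G S m) (cochains G S m)"
  using group_hom.subgroup_kernel[OF group_hom_cobdry[OF assms, of m]]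
  by (simp add: kernel_def cocycles_def)

lemma subgroup_coboundaries:
  assumes "simplicial_set S" shows "subgroup (coboundaries G S m) (cochains G S m)"
proof (cases m)
  case 0
  interpret A: comm_group "cochains G S 0" by (rule comm_group_cochains)
  show ?thesis
    using A.triv_subgroup 0 by (simp add: coboundaries_def)
next
  case (Suc k)
  then show ?thesis
    using group_hom.img_is_subgroup[OF group_hom_cobdry[OF assms, of k]] by (simp add: coboundaries_def)
qed

lemma coboundaries_pull:
  assumes "simplicial_set S" "simplicial_set T" "f \<in> smaps S T" "b \<in> coboundaries G T m"
  shows "compose (simp S m) b (f m) \<in> coboundaries G S m"
proof (cases m)
  case 0
  have "compose (simp S 0) (\<lambda>x\<in>simp T 0. \<zero>) (f 0) = (\<lambda>x\<in>simp S 0. \<zero>)"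
    using smapsD(1)[OF assms(3)] by (auto simp: compose_def intro!: restrict_ext)
  then show ?thesis using assms(4) 0 by (simp add: coboundaries_def cochains_simps)
next
  case (Suc k)
  then obtain c where c: "c \<in> carrier (cochains G T k)" "b = cobdry G T k c"
    using assms(4) by (auto simp: coboundaries_def)
  then have "compose (simp S m) b (f m) = cobdry G S k (compose (simp S k) c (f k))"
    using cobdry_pull[OF assms(1-3) c(1)] Suc by simp
  then show ?thesis
    using pull_closed[OF assms(3) c(1)] Suc by (simp add: coboundaries_def)
qed

lemma carrier_cohom: "carrier (cohom G S m) = ccls G S m ` cocycles G S m"
  by (auto simp: cohom_def FactGroup_def RCOSETS_def r_coset_def)

lemma mult_cohom:
  assumes "simplicial_set S" "c \<in> carrier (cochains G S m)" "d \<in> carrier (cochains G S m)"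
  shows "ccls G S m c \<otimes>\<^bsub>cohom G S m\<^esub> ccls G S m d = ccls G S m (c \<otimes>\<^bsub>cochains G S m\<^esub> d)"
proof -
  interpret A: comm_group "cochains G S m" by (rule comm_group_cochains)
  have "coboundaries G S m \<lhd> cochains G S m"
    by (rule A.normal_iff_subgroup[THEN iffD2, OF subgroup_coboundaries[OF assms(1)]])
  then interpret B: normal "coboundaries G S m" "cochains G S m" .
  show ?thesis
    using B.rcos_sum[OF assms(2,3)] by (simp add: cohom_def FactGroup_def set_mult_def)
qed

lemma ccls_eq_iff:
  assumes "simplicial_set S" "c \<in> carrier (cochains G S m)" "d \<in> carrier (cochains G S m)"
  shows "ccls G S m c = ccls G S m d \<longleftrightarrow> c \<otimes>\<^bsub>cochains G S m\<^esub> inv\<^bsub>cochains G S m\<^esub> d \<in> coboundaries G S m"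
  using group.coset_eq_iff[OF comm_group.axioms(2)[OF comm_group_cochains] subgroup_coboundaries[OF assms(1)] assms(2,3)] .

lemma ccls_add:
  assumes "simplicial_set S" "c \<in> carrier (cochains G S m)" "b \<in> coboundaries G S m"
  shows "ccls G S m (b \<otimes>\<^bsub>cochains G S m\<^esub> c) = ccls G S m c"
proof -
  interpret A: comm_group "cochains G S m" by (rule comm_group_cochains)
  have b: "b \<in> carrier (cochains G S m)"
    using subgroup.mem_carrier[OF subgroup_coboundaries[OF assms(1)] assms(3)] .
  then have "b \<otimes>\<^bsub>cochains G S m\<^esub> c \<otimes>\<^bsub>cochains G S m\<^esub> inv\<^bsub>cochains G S m\<^esub> c = b"
    using assms(2) by (simp add: A.m_assoc)
  then show ?thesis
    using ccls_eq_iff[OF assms(1) A.m_closed[OF b assms(2)] assms(2)] assms(3) by simp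
qed

text \<open>\<open>cohom_map\<close> is a union over all representatives of a class; since
  coboundaries pull back to coboundaries, all members of the union are the same coset.\<close>

lemma cohom_map_ccls:
  assumes "simplicial_set S" "simplicial_set T" "f \<in> smaps S T" "c \<in> carrier (cochains G T m)"
  shows "cohom_map G S m f (ccls G T m c) = ccls G S m (compose (simp S m) c (f m))"
proof -
  have "ccls G S m (compose (simp S m) (b \<otimes>\<^bsub>cochains G T m\<^esub> c) (f m)) = ccls G S m (compose (simp S m) c (f m))"
    if "b \<in> coboundaries G T m" for b
    unfolding pull_mult[OF assms(3)]
    by (rule ccls_add[OF assms(1) pull_closed[OF assms(3,4)] coboundaries_pull[OF assms(1-3) that]])
  moreover have "coboundaries G T m \<noteq> {}"
    using subgroup.one_closed[OF subgroup_coboundaries[OF assms(2)]] by blast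
  moreover have "ccls G T m c = (\<lambda>b. b \<otimes>\<^bsub>cochains G T m\<^esub> c) ` coboundaries G T m"
    by (auto simp: r_coset_def)
  ultimately show ?thesis
    unfolding cohom_map_def by auto
qed

lemma cohom_map_closed:
  assumes "simplicial_set S" "simplicial_set T" "f \<in> smaps S T" "a \<in> carrier (cohom G T m)"
  shows "cohom_map G S m f a \<in> carrier (cohom G S m)"
proof -
  obtain c where c: "c \<in> cocycles G T m" "a = ccls G T m c"
    using assms(4) by (auto simp: carrier_cohom)
  then have "c \<in> carrier (cochains G T m)" by (simp add: cocycles_def)
  then show ?thesis
    using cohom_map_ccls[OF assms(1-3)] cocycles_pull[OF assms(1-3) c(1)] c(2) by (simp add: carrier_cohom)
qed

lemma cohom_map_mult:
  assumes "simplicial_set S" "simplicial_set T" "f \<in> smaps S T" "a \<in> carrier (cohom G T m)" "a' \<in> carrier (cohom G T m)"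
  shows "cohom_map G S m f (a \<otimes>\<^bsub>cohom G T m\<^esub> a') = cohom_map G S m f a \<otimes>\<^bsub>cohom G S m\<^esub> cohom_map G S m f a'"
proof -
  interpret A: comm_group "cochains G T m" by (rule comm_group_cochains)
  obtain c c' where c: "c \<in> cocycles G T m" "a = ccls G T m c" "c' \<in> cocycles G T m" "a' = ccls G T m c'"
    using assms(4,5) by (auto simp: carrier_cohom)
  then have cc: "c \<in> carrier (cochains G T m)" "c' \<in> carrier (cochains G T m)" by (simp_all add: cocycles_def)
  show ?thesis
    unfolding c mult_cohom[OF assms(2) cc] cohom_map_ccls[OF assms(1-3) cc(1)] cohom_map_ccls[OF assms(1-3) cc(2)]
      cohom_map_ccls[OF assms(1-3) A.m_closed[OF cc]] pull_mult[OF assms(3)]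
      mult_cohom[OF assms(1) pull_closed[OF assms(3) cc(1)] pull_closed[OF assms(3) cc(2)]] ..
qed

lemma cohom_mult_closed:
  assumes "simplicial_set S" "a \<in> carrier (cohom G S m)" "a' \<in> carrier (cohom G S m)"
  shows "a \<otimes>\<^bsub>cohom G S m\<^esub> a' \<in> carrier (cohom G S m)"
proof -
  obtain c c' where c: "c \<in> cocycles G S m" "a = ccls G S m c" "c' \<in> cocycles G S m" "a' = ccls G S m c'"
    using assms(2,3) by (auto simp: carrier_cohom)
  then have cc: "c \<in> carrier (cochains G S m)" "c' \<in> carrier (cochains G S m)" by (simp_all add: cocycles_def)
  show ?thesis
    using subgroup.m_closed[OF subgroup_cocycles[OF assms(1)] c(1,3)] mult_cohom[OF assms(1) cc] c
    by (simp add: carrier_cohom)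
qed

lemma cohom_map_comp:
  assumes "simplicial_set R" "simplicial_set S" "simplicial_set T" "f \<in> smaps R S" "g \<in> smaps S T"
    "a \<in> carrier (cohom G T m)"
  shows "cohom_map G R m f (cohom_map G S m g a) = cohom_map G R m (scomp R g f) a"
proof -
  obtain c where c: "c \<in> cocycles G T m" "a = ccls G T m c"
    using assms(6) by (auto simp: carrier_cohom)
  then have cc: "c \<in> carrier (cochains G T m)" by (simp add: cocycles_def)
  have "compose (simp R m) (compose (simp S m) c (g m)) (f m) = compose (simp R m) c (scomp R g f m)"
    unfolding compose_def scomp_def by (rule restrict_ext) (use smapsD(1)[OF assms(4)] in simp)
  then show ?thesis
    unfolding c(2) cohom_map_ccls[OF assms(2,3,5) cc] cohom_map_ccls[OF assms(1,2,4) pull_closed[OF assms(5) cc]]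
      cohom_map_ccls[OF assms(1,3) smaps_scomp[OF assms(4,5,1)] cc] by simp
qed

lemma cohom_map_sid:
  assumes "simplicial_set S" "a \<in> carrier (cohom G S m)"
  shows "cohom_map G S m (sid S) a = a"
proof -
  obtain c where c: "c \<in> cocycles G S m" "a = ccls G S m c"
    using assms(2) by (auto simp: carrier_cohom)
  then have cc: "c \<in> carrier (cochains G S m)" by (simp add: cocycles_def)
  have "compose (simp S m) c (sid S m) = c"
    by (rule extensionalityI[of _ "simp S m"]) (use cc in \<open>auto simp: compose_def sid_def cochains_simps PiE_def\<close>)
  then show ?thesis
    using cohom_map_ccls[OF assms(1,1) smaps_sid[OF assms(1)] cc] c(2) by simp
qed

end

section \<open>Colimits of cohomology groups over thin index categories\<close>

lemma pro_spaceD: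
  assumes "pro_space X"
  shows "s \<in> obs X \<Longrightarrow> simplicial_set (sp X s)"
    "e \<in> arrs X s t \<Longrightarrow> tr X e \<in> smaps (sp X s) (sp X t)"
    "s \<in> obs X \<Longrightarrow> tr X (ident (idx X) s) = sid (sp X s)"
    "e \<in> arrs X r s \<Longrightarrow> e' \<in> arrs X s t \<Longrightarrow> tr X (cmp (idx X) e' e) = scomp (sp X r) (tr X e') (tr X e)"
    "e \<in> arrs X s t \<Longrightarrow> s \<in> obs X \<and> t \<in> obs X"
    "s \<in> obs X \<Longrightarrow> ident (idx X) s \<in> arrs X s s"
    "e \<in> arrs X r s \<Longrightarrow> e' \<in> arrs X s t \<Longrightarrow> cmp (idx X) e' e \<in> arrs X r t"
    "s \<in> obs X \<Longrightarrow> t \<in> obs X \<Longrightarrow> \<exists>r\<in>obs X. \<exists>d e. d \<in> arrs X r s \<and> e \<in> arrs X r t"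
    "obs X \<noteq> {}"
proof -
  note P = assms[unfolded pro_space_def category_def cofiltered_def]
  have P1: "\<forall>e\<in>Ar (idx X). src (idx X) e \<in> obs X \<and> tgt (idx X) e \<in> obs X"
    using P by (elim conjE)
  have P2: "\<forall>s\<in>obs X. ident (idx X) s \<in> arrs X s s"
    using P by (elim conjE)
  have P3: "\<forall>r s t. \<forall>e\<in>arrs X r s. \<forall>e'\<in>arrs X s t. cmp (idx X) e' e \<in> arrs X r t"
    using P by (elim conjE)
  have P4: "\<forall>s\<in>obs X. simplicial_set (sp X s)"
    using P by (elim conjE)
  have P5: "\<forall>s t. \<forall>e\<in>arrs X s t. tr X e \<in> smaps (sp X s) (sp X t)"
    using P by (elim conjE)
  have P6: "\<forall>s\<in>obs X. tr X (ident (idx X) s) = sid (sp X s)"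
    using P by (elim conjE)
  have P7: "\<forall>r s t. \<forall>e\<in>arrs X r s. \<forall>e'\<in>arrs X s t.
      tr X (cmp (idx X) e' e) = scomp (sp X r) (tr X e') (tr X e)"
    using P by (elim conjE)
  have P8: "\<forall>s\<in>obs X. \<forall>t\<in>obs X. \<exists>r\<in>obs X. arrs X r s \<noteq> {} \<and> arrs X r t \<noteq> {}"
    using P by (elim conjE)
  have P9: "obs X \<noteq> {}"
    using P by (elim conjE)
  show "s \<in> obs X \<Longrightarrow> simplicial_set (sp X s)" using P4 by blast
  show "e \<in> arrs X s t \<Longrightarrow> tr X e \<in> smaps (sp X s) (sp X t)" using P5 by blast
  show "s \<in> obs X \<Longrightarrow> tr X (ident (idx X) s) = sid (sp X s)" using P6 by blast
  show "e \<in> arrs X r s \<Longrightarrow> e' \<in> arrs X s t \<Longrightarrow> tr X (cmp (idx X) e' e) = scomp (sp X r) (tr X e') (tr X e)"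
    using P7 by blast
  show "e \<in> arrs X s t \<Longrightarrow> s \<in> obs X \<and> t \<in> obs X"
    using P1 by (auto simp: hom_arr_def)
  show "s \<in> obs X \<Longrightarrow> ident (idx X) s \<in> arrs X s s" using P2 by blast
  show "e \<in> arrs X r s \<Longrightarrow> e' \<in> arrs X s t \<Longrightarrow> cmp (idx X) e' e \<in> arrs X r t" using P3 by blast
  show "s \<in> obs X \<Longrightarrow> t \<in> obs X \<Longrightarrow> \<exists>r\<in>obs X. \<exists>d e. d \<in> arrs X r s \<and> e \<in> arrs X r t"
    using P8 by blast
  show "obs X \<noteq> {}" by (rule P9)
qed

text \<open>All pro-spaces of the argument are indexed by preorders. Composites with the same ends
  then agree, so passing to a common lower index settles every comparison of restrictions.\<close>

locale thin_pro_space =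
  fixes X :: "('i, 'e, 'a) diagram"
  assumes pro: "pro_space X"
    and thin: "\<And>s t e e'. e \<in> arrs X s t \<Longrightarrow> e' \<in> arrs X s t \<Longrightarrow> e = e'"
begin

lemmas proD = pro_spaceD[OF pro]

end

locale thin_pro_cohom = abelian_group M + thin_pro_space X
  for M :: "('m, 'x) ring_scheme" (structure) and X :: "('i, 'e, 'a) diagram" +
  fixes m :: nat
begin

definition A where "A s = carrier (cohom M (sp X s) m)"

definition res where "res r e a = cohom_map M (sp X r) m (tr X e) a"

lemma res_closed: "e \<in> arrs X r s \<Longrightarrow> a \<in> A s \<Longrightarrow> res r e a \<in> A r"
  unfolding A_def res_def using cohom_map_closed proD(1,2,5) by blast

lemma res_mult:
  "e \<in> arrs X r s \<Longrightarrow> a \<in> A s \<Longrightarrow> a' \<in> A s \<Longrightarrow>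
   res r e (a \<otimes>\<^bsub>cohom M (sp X s) m\<^esub> a') = res r e a \<otimes>\<^bsub>cohom M (sp X r) m\<^esub> res r e a'"
  unfolding A_def res_def using cohom_map_mult proD(1,2,5) by blast

lemma res_res:
  assumes "e \<in> arrs X r s" "d \<in> arrs X q r" "f \<in> arrs X q s" "a \<in> A s"
  shows "res q d (res r e a) = res q f a"
proof -
  have "cmp (idx X) e d = f"
    using thin proD(7)[OF assms(2,1)] assms(3) by blast
  moreover have "cohom_map M (sp X q) m (tr X d) (cohom_map M (sp X r) m (tr X e) a) =
      cohom_map M (sp X q) m (scomp (sp X q) (tr X e) (tr X d)) a"
    by (rule cohom_map_comp[of "sp X q" "sp X r" "sp X s"])
      (use proD(1,2,5) assms in \<open>auto simp: A_def\<close>)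
  ultimately show ?thesis
    unfolding res_def using proD(4)[OF assms(2,1)] by simp
qed

lemma A_mult: "s \<in> obs X \<Longrightarrow> a \<in> A s \<Longrightarrow> a' \<in> A s \<Longrightarrow> a \<otimes>\<^bsub>cohom M (sp X s) m\<^esub> a' \<in> A s"
  unfolding A_def using cohom_mult_closed proD(1) by blast

definition pts where "pts = (SIGMA s:obs X. A s)"

abbreviation Gm where "Gm \<equiv> cohom_germ M X m"

lemma germ_iff:
  "((s, a), (s', a')) \<in> Gm \<longleftrightarrow> (s, a) \<in> pts \<and> (s', a') \<in> pts \<and>
     (\<exists>r e e'. e \<in> arrs X r s \<and> e' \<in> arrs X r s' \<and> res r e a = res r e' a')"
  unfolding cohom_germ_def pts_def A_def res_def using proD(5) by fastforce

lemma below: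
  assumes "s \<in> obs X" "t \<in> obs X"
  obtains r d e where "r \<in> obs X" "d \<in> arrs X r s" "e \<in> arrs X r t"
  using proD(8)[OF assms] by blast

lemma equiv_germ: "equiv pts Gm"
proof (rule equivI)
  show "Gm \<subseteq> pts \<times> pts" using germ_iff by auto
  show "refl_on pts Gm"
  proof (rule refl_onI)
    fix x assume x: "x \<in> pts"
    then obtain s a where "x = (s, a)" "s \<in> obs X" by (auto simp: pts_def)
    then show "(x, x) \<in> Gm" using x germ_iff proD(6) by blast
  qed
  show "sym Gm"
  proof (rule symI)
    fix x y assume "(x, y) \<in> Gm"
    then show "(y, x) \<in> Gm" 
      by (cases x; cases y) (use germ_iff in metis)
  qed
  show "trans Gm"
  proof (rule transI)
    fix x y z assume xy: "(x, y) \<in> Gm" and yz: "(y, z) \<in> Gm"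
    obtain s a t b u c where xyz: "x = (s, a)" "y = (t, b)" "z = (u, c)" by (cases x; cases y; cases z)
    obtain r e f where 1: "e \<in> arrs X r s" "f \<in> arrs X r t" "res r e a = res r f b"
      using xy xyz germ_iff by blast
    obtain q g h where 2: "g \<in> arrs X q t" "h \<in> arrs X q u" "res q g b = res q h c"
      using yz xyz germ_iff by blast
    obtain k d d' where k: "d \<in> arrs X k r" "d' \<in> arrs X k q"
      using below proD(5) 1 2 by metis
    have pts: "(s, a) \<in> pts" "(t, b) \<in> pts" "(u, c) \<in> pts"
      using xy yz xyz germ_iff by blast+
    then have abc: "a \<in> A s" "b \<in> A t" "c \<in> A u" by (auto simp: pts_def)
    note ks = proD(7)[OF k(1) 1(1)] proD(7)[OF k(1) 1(2)] proD(7)[OF k(2) 2(2)]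
    have "res k (cmp (idx X) e d) a = res k d (res r e a)"
      using res_res[OF 1(1) k(1) ks(1) abc(1)] by simp
    also have "\<dots> = res k (cmp (idx X) f d) b"
      using res_res[OF 1(2) k(1) ks(2) abc(2)] 1(3) by simp
    also have "\<dots> = res k d' (res q g b)"
      using res_res[OF 2(1) k(2) ks(2) abc(2)] by simp
    also have "\<dots> = res k (cmp (idx X) h d') c"
      using res_res[OF 2(2) k(2) ks(3) abc(3)] 2(3) by simp
    finally show "(x, z) \<in> Gm"
      using xyz pts ks germ_iff by blast
  qed
qed

lemma carrier_pro_cohom: "carrier (pro_cohom M X m) = pts // Gm"
  by (simp add: pro_cohom_def pts_def A_def)

text \<open>The product in \<open>pro_cohom\<close> is a union over all representatives and all
  common lower indices. Any two choices agree after restriction to an index below everything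
  involved, so the union is a single class.\<close>

lemma mult_class:
  assumes sa: "(s, a) \<in> pts" "(s', a') \<in> pts" and e: "e \<in> arrs X r s" "e' \<in> arrs X r s'"
  shows "Gm `` {(s, a)} \<otimes>\<^bsub>pro_cohom M X m\<^esub> Gm `` {(s', a')} =
    Gm `` {(r, res r e a \<otimes>\<^bsub>cohom M (sp X r) m\<^esub> res r e' a')}"
proof -
  let ?K = "Gm `` {(r, res r e a \<otimes>\<^bsub>cohom M (sp X r) m\<^esub> res r e' a')}"
  have a: "a \<in> A s" "a' \<in> A s'" using sa by (auto simp: pts_def)
  have K: "Gm `` {(q, res q f b \<otimes>\<^bsub>cohom M (sp X q) m\<^esub> res q f' b')} = ?K"
    if b: "((s, a), (t, b)) \<in> Gm" "((s', a'), (t', b')) \<in> Gm" and f: "f \<in> arrs X q t" "f' \<in> arrs X q t'"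
    for t b t' b' q f f'
  proof -
    have bA: "b \<in> A t" "b' \<in> A t'" using b germ_iff by (auto simp: pts_def)
    obtain u g h where 1: "g \<in> arrs X u s" "h \<in> arrs X u t" "res u g a = res u h b"
      using b(1) germ_iff by blast
    obtain u' g' h' where 2: "g' \<in> arrs X u' s'" "h' \<in> arrs X u' t'" "res u' g' a' = res u' h' b'"
      using b(2) germ_iff by blast
    \<comment> \<open>The index \<open>z\<close> found below lies under the two witnesses
      \<open>u\<close>, \<open>u'\<close> of equivalence and under the two places \<open>r\<close>,
      \<open>q\<close> where products are formed; thinness makes all routes to it agree.\<close>
    obtain v d1 d2 where v: "d1 \<in> arrs X v u" "d2 \<in> arrs X v u'"
      using below proD(5) 1 2 by metis
    obtain w d3 d4 where w: "d3 \<in> arrs X w r" "d4 \<in> arrs X w q"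
      using below proD(5) e f by metis
    obtain z x y where z: "x \<in> arrs X z v" "y \<in> arrs X z w"
      using below proD(5) v w by metis
    define zu where "zu = cmp (idx X) d1 x"
    define zu' where "zu' = cmp (idx X) d2 x"
    define zr where "zr = cmp (idx X) d3 y"
    define zq where "zq = cmp (idx X) d4 y"
    have arr: "zu \<in> arrs X z u" "zu' \<in> arrs X z u'" "zr \<in> arrs X z r" "zq \<in> arrs X z q"
      using v w z proD(7) unfolding zu_def zu'_def zr_def zq_def by blast+
    define zs where "zs = cmp (idx X) e zr"
    define zs' where "zs' = cmp (idx X) e' zr"
    define zt where "zt = cmp (idx X) f zq"
    define zt' where "zt' = cmp (idx X) f' zq"
    have arr': "zs \<in> arrs X z s" "zs' \<in> arrs X z s'" "zt \<in> arrs X z t" "zt' \<in> arrs X z t'"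
      using arr e f proD(7) unfolding zs_def zs'_def zt_def zt'_def by blast+
    have "res z zr (res r e a \<otimes>\<^bsub>cohom M (sp X r) m\<^esub> res r e' a') = res z zs a \<otimes>\<^bsub>cohom M (sp X z) m\<^esub> res z zs' a'"
      using res_mult[OF arr(3) res_closed[OF e(1) a(1)] res_closed[OF e(2) a(2)]]
        res_res[OF e(1) arr(3) arr'(1) a(1)] res_res[OF e(2) arr(3) arr'(2) a(2)] by simp
    also have "res z zs a = res z zt b"
      using res_res[OF 1(1) arr(1) arr'(1) a(1)] res_res[OF 1(2) arr(1) arr'(3) bA(1)] 1(3) by simp
    also have "res z zs' a' = res z zt' b'"
      using res_res[OF 2(1) arr(2) arr'(2) a(2)] res_res[OF 2(2) arr(2) arr'(4) bA(2)] 2(3) by simp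
    also have "res z zt b \<otimes>\<^bsub>cohom M (sp X z) m\<^esub> res z zt' b' = res z zq (res q f b \<otimes>\<^bsub>cohom M (sp X q) m\<^esub> res q f' b')"
      using res_mult[OF arr(4) res_closed[OF f(1) bA(1)] res_closed[OF f(2) bA(2)]]
        res_res[OF f(1) arr(4) arr'(3) bA(1)] res_res[OF f(2) arr(4) arr'(4) bA(2)] by simp
    finally have "res z zr (res r e a \<otimes>\<^bsub>cohom M (sp X r) m\<^esub> res r e' a') =
        res z zq (res q f b \<otimes>\<^bsub>cohom M (sp X q) m\<^esub> res q f' b')" .
    moreover have "(r, res r e a \<otimes>\<^bsub>cohom M (sp X r) m\<^esub> res r e' a') \<in> pts"
      "(q, res q f b \<otimes>\<^bsub>cohom M (sp X q) m\<^esub> res q f' b') \<in> pts"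
      using A_mult res_closed e f a bA proD(5) by (auto simp: pts_def)
    ultimately have "((r, res r e a \<otimes>\<^bsub>cohom M (sp X r) m\<^esub> res r e' a'),
        (q, res q f b \<otimes>\<^bsub>cohom M (sp X q) m\<^esub> res q f' b')) \<in> Gm"
      using arr germ_iff by blast
    then show ?thesis
      using equiv_class_eq[OF equiv_germ] by blast
  qed
  have "Gm `` {(s, a)} \<otimes>\<^bsub>pro_cohom M X m\<^esub> Gm `` {(s', a')} =
      (\<Union>(t, b)\<in>Gm `` {(s, a)}. \<Union>(t', b')\<in>Gm `` {(s', a')}. \<Union>q\<in>obs X. \<Union>f\<in>arrs X q t. \<Union>f'\<in>arrs X q t'.
        Gm `` {(q, res q f b \<otimes>\<^bsub>cohom M (sp X q) m\<^esub> res q f' b')})"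
    by (simp add: pro_cohom_def res_def)
  also have "\<dots> = ?K"
  proof
    show "(\<Union>(t, b)\<in>Gm `` {(s, a)}. \<Union>(t', b')\<in>Gm `` {(s', a')}. \<Union>q\<in>obs X. \<Union>f\<in>arrs X q t. \<Union>f'\<in>arrs X q t'.
        Gm `` {(q, res q f b \<otimes>\<^bsub>cohom M (sp X q) m\<^esub> res q f' b')}) \<subseteq> ?K"
    proof (intro UN_least; clarify)
      fix t b t' b' q f f' x y
      assume *: "((s, a), (t, b)) \<in> Gm" "((s', a'), (t', b')) \<in> Gm" "f \<in> arrs X q t" "f' \<in> arrs X q t'"
        "((q, res q f b \<otimes>\<^bsub>cohom M (sp X q) m\<^esub> res q f' b'), (x, y)) \<in> Gm"
      then show "((r, res r e a \<otimes>\<^bsub>cohom M (sp X r) m\<^esub> res r e' a'), x, y) \<in> Gm"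
        using K[OF *(1-4)] by blast
    qed
    have self: "(s, a) \<in> Gm `` {(s, a)}" "(s', a') \<in> Gm `` {(s', a')}"
      using sa equiv_class_self[OF equiv_germ] by blast+
    have "r \<in> obs X" using e proD(5) by blast
    then show "?K \<subseteq> (\<Union>(t, b)\<in>Gm `` {(s, a)}. \<Union>(t', b')\<in>Gm `` {(s', a')}. \<Union>q\<in>obs X. \<Union>f\<in>arrs X q t. \<Union>f'\<in>arrs X q t'.
        Gm `` {(q, res q f b \<otimes>\<^bsub>cohom M (sp X q) m\<^esub> res q f' b')})"
      using self e by blast
  qed
  finally show ?thesis .
qed

end

section \<open>Maps from a constant pro-space and the cohomology criterion\<close>

lemma const_pro_simps:
  "obs (const_pro S) = UNIV" "arrs (const_pro S) s t = UNIV" "sp (const_pro S) s = S"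
  "tr (const_pro S) e = sid S"
  by (auto simp: const_pro_def hom_arr_def)

lemma scomp_sid:
  assumes "f \<in> smaps S T"
  shows "scomp S f (sid S) = f" "scomp S (sid T) f = f"
proof -
  show "scomp S f (sid S) = f"
  proof
    fix n show "scomp S f (sid S) n = f n"
      by (rule extensionalityI[of _ "simp S n"]) (use smapsD(3)[OF assms] in \<open>auto simp: scomp_def sid_def compose_def\<close>)
  qed
  show "scomp S (sid T) f = f"
  proof
    fix n show "scomp S (sid T) f n = f n"
      by (rule extensionalityI[of _ "simp S n"])
        (use smapsD(3)[OF assms] smapsD(1)[OF assms] in \<open>auto simp: scomp_def sid_def compose_def\<close>)
  qed
qed

lemma pro_space_const: "simplicial_set S \<Longrightarrow> pro_space (const_pro S)"
  unfolding pro_space_def category_def cofiltered_def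
  by (auto simp: const_pro_simps smaps_sid scomp_sid[OF smaps_sid])

lemma germ_const:
  assumes "simplicial_set S" "f \<in> smaps S A"
  shows "germ (const_pro S) A `` {((), f)} = {((), f)}"
  using assms(2) by (auto simp: germ_def const_pro_simps scomp_sid)

text \<open>Bijectivity of \<open>colim H^m(Y_s) \<rightarrow> H^m(S)\<close> spelled out for
  cocycles, so that the assumptions to be verified for groups mention no quotients and no
  colimits.\<close>

locale const_comparison = Y: thin_pro_cohom M Y m
  for M :: "('m, 'x) ring_scheme" and Y :: "('j, 'd, 'b) diagram" and m :: nat +
  fixes S :: "'a sset" and \<phi> :: "'j \<Rightarrow> nat \<Rightarrow> 'a \<Rightarrow> 'b"
  assumes S: "simplicial_set S"
    and \<phi>: "\<And>s. s \<in> obs Y \<Longrightarrow> \<phi> s \<in> smaps S (sp Y s)"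
    and compat: "\<And>s t e. e \<in> arrs Y s t \<Longrightarrow> scomp S (tr Y e) (\<phi> s) = \<phi> t"
    and surj: "\<And>c. c \<in> cocycles M S m \<Longrightarrow> \<exists>s\<in>obs Y. \<exists>c'\<in>cocycles M (sp Y s) m. \<exists>b\<in>coboundaries M S m.
      c = b \<otimes>\<^bsub>cochains M S m\<^esub> compose (simp S m) c' (\<phi> s m)"
    and inj: "\<And>s c. s \<in> obs Y \<Longrightarrow> c \<in> cocycles M (sp Y s) m \<Longrightarrow>
      compose (simp S m) c (\<phi> s m) \<in> coboundaries M S m \<Longrightarrow>
      \<exists>r. \<exists>e\<in>arrs Y r s. compose (simp (sp Y r) m) c (tr Y e m) \<in> coboundaries M (sp Y r) m"
begin

sublocale S: thin_pro_cohom M "const_pro S" m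
  by unfold_locales (auto simp: pro_space_const[OF S])

definition pull where "pull s a = cohom_map M S m (\<phi> s) a"

lemma pull_in: "s \<in> obs Y \<Longrightarrow> a \<in> Y.A s \<Longrightarrow> pull s a \<in> carrier (cohom M S m)"
  unfolding Y.A_def pull_def using Y.cohom_map_closed S \<phi> Y.proD(1) by blast

lemma pull_mult: "s \<in> obs Y \<Longrightarrow> a \<in> Y.A s \<Longrightarrow> a' \<in> Y.A s \<Longrightarrow>
    pull s (a \<otimes>\<^bsub>cohom M (sp Y s) m\<^esub> a') = pull s a \<otimes>\<^bsub>cohom M S m\<^esub> pull s a'"
  unfolding Y.A_def pull_def using Y.cohom_map_mult S \<phi> Y.proD(1) by blast

lemma pull_res:
  assumes "e \<in> arrs Y r s" "a \<in> Y.A s" shows "pull r (Y.res r e a) = pull s a"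
  unfolding pull_def Y.res_def
  using Y.cohom_map_comp[OF S Y.proD(1) Y.proD(1) \<phi> Y.proD(2)[OF assms(1)], where a = a]
    Y.proD(5)[OF assms(1)] assms(2) compat[OF assms(1)] by (simp add: Y.A_def)

lemma pts_const: "S.pts = UNIV \<times> carrier (cohom M S m)"
  by (auto simp: S.pts_def S.A_def const_pro_simps)

text \<open>The only restriction map of a constant pro-space is the identity, so germs are
  singletons and the colimit is the cohomology group itself.\<close>

lemma germ_const_cohom:
  assumes "a \<in> carrier (cohom M S m)"
  shows "S.Gm `` {((), a)} = {((), a)}"
proof -
  have "((), b) \<in> S.Gm `` {((), a)} \<longleftrightarrow> b = a" for b
    unfolding Image_singleton_iff S.germ_iff
    using assms Y.cohom_map_sid[OF S] by (auto simp: pts_const S.res_def const_pro_simps)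
  then show ?thesis by auto
qed

lemma mult_const:
  assumes "a \<in> carrier (cohom M S m)" "a' \<in> carrier (cohom M S m)"
  shows "{((), a)} \<otimes>\<^bsub>pro_cohom M (const_pro S) m\<^esub> {((), a')} = {((), a \<otimes>\<^bsub>cohom M S m\<^esub> a')}"
  using S.mult_class[of "()" a "()" a' "()" "()" "()"] assms germ_const_cohom Y.cohom_map_sid[OF S]
    Y.cohom_mult_closed[OF S]
  by (auto simp: pts_const S.res_def const_pro_simps)

definition F where "F = (\<lambda>s\<in>obs Y. germ (const_pro S) (sp Y s) `` {((), \<phi> s)})"

lemma pull_germ:
  assumes "((s, a), (t, b)) \<in> Y.Gm" shows "pull s a = pull t b"
proof -
  obtain r e e' where "e \<in> arrs Y r s" "e' \<in> arrs Y r t" "Y.res r e a = Y.res r e' b" "a \<in> Y.A s" "b \<in> Y.A t"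
    using assms Y.germ_iff by (auto simp: Y.pts_def)
  then show ?thesis using pull_res by metis
qed

lemma map_class:
  assumes "(s, a) \<in> Y.pts"
  shows "pro_cohom_map M (const_pro S) m F (Y.Gm `` {(s, a)}) = {((), pull s a)}"
proof -
  have *: "(\<Union>(t, f)\<in>F s'. S.Gm `` {(t, cohom_map M (sp (const_pro S) t) m f b)}) = {((), pull s a)}"
    if b: "((s, a), (s', b)) \<in> Y.Gm" for s' b
  proof -
    have s': "s' \<in> obs Y" "b \<in> Y.A s'" using b Y.germ_iff by (auto simp: Y.pts_def)
    then have "F s' = {((), \<phi> s')}"
      using germ_const[OF S \<phi>] by (simp add: F_def)
    then show ?thesis
      using germ_const_cohom[OF pull_in[OF s']] pull_germ[OF b] by (simp add: const_pro_simps pull_def)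
  qed
  have "(s, a) \<in> Y.Gm `` {(s, a)}"
    using assms equiv_class_self[OF Y.equiv_germ] by blast
  moreover have "pro_cohom_map M (const_pro S) m F (Y.Gm `` {(s, a)}) =
      (\<Union>x\<in>Y.Gm `` {(s, a)}. {((), pull s a)})"
    unfolding pro_cohom_map_def
  proof (rule SUP_cong[OF refl])
    fix x assume x: "x \<in> Y.Gm `` {(s, a)}"
    obtain s' b where "x = (s', b)" by (cases x)
    then show "(case x of (s', b) \<Rightarrow> \<Union>(t, f)\<in>F s'. S.Gm `` {(t, cohom_map M (sp (const_pro S) t) m f b)}) =
        {((), pull s a)}"
      using *[of s' b] x by simp
  qed
  ultimately show ?thesis by blast
qed

text \<open>Restrict both classes to a common index \<open>r\<close> and take the difference of
  representatives there. It becomes a coboundary on \<open>S\<close>, so \<open>inj\<close> makes it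
  one at a further index \<open>q\<close>, where the two classes agree.\<close>

lemma pull_inj:
  assumes "(s, a) \<in> Y.pts" "(t, b) \<in> Y.pts" "pull s a = pull t b"
  shows "((s, a), (t, b)) \<in> Y.Gm"
proof -
  have st: "s \<in> obs Y" "t \<in> obs Y" "a \<in> Y.A s" "b \<in> Y.A t"
    using assms by (auto simp: Y.pts_def)
  obtain r e e' where r: "r \<in> obs Y" "e \<in> arrs Y r s" "e' \<in> arrs Y r t"
    using Y.below[OF st(1,2)] by blast
  note Sr = Y.proD(1)[OF r(1)]
  interpret C: comm_group "cochains M (sp Y r) m" by (rule Y.comm_group_cochains)
  interpret CS: comm_group "cochains M S m" by (rule Y.comm_group_cochains)
  obtain c where c: "c \<in> cocycles M (sp Y r) m" "Y.res r e a = ccls M (sp Y r) m c"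
    using Y.res_closed[OF r(2) st(3)] by (auto simp: Y.A_def Y.carrier_cohom)
  obtain d where d: "d \<in> cocycles M (sp Y r) m" "Y.res r e' b = ccls M (sp Y r) m d"
    using Y.res_closed[OF r(3) st(4)] by (auto simp: Y.A_def Y.carrier_cohom)
  have cd: "c \<in> carrier (cochains M (sp Y r) m)" "d \<in> carrier (cochains M (sp Y r) m)"
    using c d by (auto simp: cocycles_def)
  define g where "g = c \<otimes>\<^bsub>cochains M (sp Y r) m\<^esub> inv\<^bsub>cochains M (sp Y r) m\<^esub> d"
  have g: "g \<in> cocycles M (sp Y r) m"
    unfolding g_def using Y.subgroup_cocycles[OF Sr] c d by (simp add: subgroup.m_closed subgroup.m_inv_closed)
  let ?P = "\<lambda>c. compose (simp S m) c (\<phi> r m)"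
  interpret P: group_hom "cochains M (sp Y r) m" "cochains M S m" ?P
    by (intro group_hom.intro C.is_group CS.is_group group_hom_axioms.intro homI)
      (auto simp: Y.pull_closed[OF \<phi>[OF r(1)]] Y.pull_mult[OF \<phi>[OF r(1)]])
  have "pull r (Y.res r e a) = pull r (Y.res r e' b)"
    using pull_res r st assms(3) by metis
  then have "ccls M S m (?P c) = ccls M S m (?P d)"
    unfolding pull_def c(2) d(2) using Y.cohom_map_ccls[OF S Sr \<phi>[OF r(1)]] cd by simp
  then have "?P c \<otimes>\<^bsub>cochains M S m\<^esub> inv\<^bsub>cochains M S m\<^esub> ?P d \<in> coboundaries M S m"
    using Y.ccls_eq_iff[OF S] cd by simp
  then have "?P g \<in> coboundaries M S m"
    unfolding g_def using cd by simp
  then obtain q f where q: "f \<in> arrs Y q r" "compose (simp (sp Y q) m) g (tr Y f m) \<in> coboundaries M (sp Y q) m"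
    using inj[OF r(1) g] by blast
  have qo: "q \<in> obs Y" using q Y.proD(5) by blast
  note Sq = Y.proD(1)[OF qo]
  note tf = Y.proD(2)[OF q(1)]
  interpret Cq: comm_group "cochains M (sp Y q) m" by (rule Y.comm_group_cochains)
  let ?Q = "\<lambda>c. compose (simp (sp Y q) m) c (tr Y f m)"
  interpret Q: group_hom "cochains M (sp Y r) m" "cochains M (sp Y q) m" ?Q
    by (intro group_hom.intro C.is_group Cq.is_group group_hom_axioms.intro homI)
      (auto simp: Y.pull_closed[OF tf] Y.pull_mult[OF tf])
  have "?Q c \<otimes>\<^bsub>cochains M (sp Y q) m\<^esub> inv\<^bsub>cochains M (sp Y q) m\<^esub> ?Q d \<in> coboundaries M (sp Y q) m"
    using q(2) cd unfolding g_def by simp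
  then have "ccls M (sp Y q) m (?Q c) = ccls M (sp Y q) m (?Q d)"
    using Y.ccls_eq_iff[OF Sq] cd by simp
  then have "Y.res q f (Y.res r e a) = Y.res q f (Y.res r e' b)"
    unfolding c(2) d(2) unfolding Y.res_def using Y.cohom_map_ccls[OF Sq Sr tf] cd by simp
  moreover note k = Y.proD(7)[OF q(1) r(2)] Y.proD(7)[OF q(1) r(3)]
  ultimately have "Y.res q (cmp (idx Y) e f) a = Y.res q (cmp (idx Y) e' f) b"
    using Y.res_res[OF r(2) q(1) k(1) st(3)] Y.res_res[OF r(3) q(1) k(2) st(4)] by simp
  then show ?thesis
    using Y.germ_iff assms k by blast
qed

theorem pro_cohom_iso: "pro_cohom_map M (const_pro S) m F \<in> iso (pro_cohom M Y m) (pro_cohom M (const_pro S) m)"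
  unfolding iso_def
proof (intro CollectI conjI)
  let ?h = "pro_cohom_map M (const_pro S) m F"
  have car: "carrier (pro_cohom M (const_pro S) m) = (\<lambda>a. {((), a)}) ` carrier (cohom M S m)"
    unfolding S.carrier_pro_cohom quotient_def pts_const using germ_const_cohom by auto
  have Ycar: "\<exists>s a. (s, a) \<in> Y.pts \<and> x = Y.Gm `` {(s, a)}" if "x \<in> carrier (pro_cohom M Y m)" for x
    using that unfolding Y.carrier_pro_cohom quotient_def by auto
  have hin: "?h x \<in> carrier (pro_cohom M (const_pro S) m)" if "x \<in> carrier (pro_cohom M Y m)" for x
  proof -
    obtain s a where "(s, a) \<in> Y.pts" "x = Y.Gm `` {(s, a)}"
      using Ycar[OF \<open>x \<in> _\<close>] by blast
    then show ?thesis
      using map_class car pull_in by (auto simp: Y.pts_def)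
  qed
  show "?h \<in> hom (pro_cohom M Y m) (pro_cohom M (const_pro S) m)"
  proof (rule homI)
    fix x y assume "x \<in> carrier (pro_cohom M Y m)" "y \<in> carrier (pro_cohom M Y m)"
    then obtain s a t b where x: "(s, a) \<in> Y.pts" "x = Y.Gm `` {(s, a)}" and y: "(t, b) \<in> Y.pts" "y = Y.Gm `` {(t, b)}"
      using Ycar by meson
    then have st: "s \<in> obs Y" "t \<in> obs Y" "a \<in> Y.A s" "b \<in> Y.A t"
      by (auto simp: Y.pts_def)
    obtain r e e' where r: "r \<in> obs Y" "e \<in> arrs Y r s" "e' \<in> arrs Y r t"
      using Y.below[OF st(1,2)] by blast
    note ra = Y.res_closed[OF r(2) st(3)] Y.res_closed[OF r(3) st(4)]
    have "(r, Y.res r e a \<otimes>\<^bsub>cohom M (sp Y r) m\<^esub> Y.res r e' b) \<in> Y.pts"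
      using Y.A_mult[OF r(1) ra] r by (simp add: Y.pts_def)
    then have "?h (x \<otimes>\<^bsub>pro_cohom M Y m\<^esub> y) = {((), pull r (Y.res r e a \<otimes>\<^bsub>cohom M (sp Y r) m\<^esub> Y.res r e' b))}"
      unfolding x(2) y(2) Y.mult_class[OF x(1) y(1) r(2,3)] by (rule map_class)
    also have "pull r (Y.res r e a \<otimes>\<^bsub>cohom M (sp Y r) m\<^esub> Y.res r e' b) = pull s a \<otimes>\<^bsub>cohom M S m\<^esub> pull t b"
      using pull_mult[OF r(1) ra] pull_res[OF r(2) st(3)] pull_res[OF r(3) st(4)] by simp
    finally show "?h (x \<otimes>\<^bsub>pro_cohom M Y m\<^esub> y) = ?h x \<otimes>\<^bsub>pro_cohom M (const_pro S) m\<^esub> ?h y"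
      unfolding x(2) y(2) map_class[OF x(1)] map_class[OF y(1)] mult_const[OF pull_in[OF st(1,3)] pull_in[OF st(2,4)]] .
  qed (rule hin)
  show "bij_betw ?h (carrier (pro_cohom M Y m)) (carrier (pro_cohom M (const_pro S) m))"
    unfolding bij_betw_def
  proof
    show "inj_on ?h (carrier (pro_cohom M Y m))"
    proof (rule inj_onI)
      fix x y assume "x \<in> carrier (pro_cohom M Y m)" "y \<in> carrier (pro_cohom M Y m)" and eq: "?h x = ?h y"
      then obtain s a t b where x: "(s, a) \<in> Y.pts" "x = Y.Gm `` {(s, a)}" and y: "(t, b) \<in> Y.pts" "y = Y.Gm `` {(t, b)}"
        using Ycar by metis
      then have "pull s a = pull t b"
        using eq map_class[OF x(1)] map_class[OF y(1)] by simp
      then show "x = y"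
        using pull_inj[OF x(1) y(1)] equiv_class_eq[OF Y.equiv_germ] x y by simp
    qed
    have "{((), a)} \<in> ?h ` carrier (pro_cohom M Y m)" if "a \<in> carrier (cohom M S m)" for a
    proof -
      obtain c where c: "c \<in> cocycles M S m" "a = ccls M S m c"
        using \<open>a \<in> _\<close> unfolding Y.carrier_cohom by blast
      obtain s c' b where s: "s \<in> obs Y" "c' \<in> cocycles M (sp Y s) m" "b \<in> coboundaries M S m"
        "c = b \<otimes>\<^bsub>cochains M S m\<^esub> compose (simp S m) c' (\<phi> s m)"
        using surj[OF c(1)] by blast
      have c'C: "c' \<in> carrier (cochains M (sp Y s) m)" using s by (simp add: cocycles_def)
      let ?a = "ccls M (sp Y s) m c'"
      have "pull s ?a = a"
        unfolding pull_def Y.cohom_map_ccls[OF S Y.proD(1)[OF s(1)] \<phi>[OF s(1)] c'C] c(2) s(4)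
        by (rule Y.ccls_add[OF S Y.pull_closed[OF \<phi>[OF s(1)] c'C] s(3), symmetric])
      moreover have "(s, ?a) \<in> Y.pts"
        using s by (simp add: Y.pts_def Y.A_def Y.carrier_cohom)
      ultimately have "{((), a)} = ?h (Y.Gm `` {(s, ?a)})" "Y.Gm `` {(s, ?a)} \<in> carrier (pro_cohom M Y m)"
        using map_class unfolding Y.carrier_pro_cohom by (auto intro: quotientI)
      then show ?thesis by blast
    qed
    then show "?h ` carrier (pro_cohom M Y m) = carrier (pro_cohom M (const_pro S) m)"
      using hin car by auto
  qed
qed

end

section \<open>Simplices, horns and homotopies\<close>

lemma std_simps [simp]: "simp (std_simplex k) n = delta n k" "act (std_simplex k) n \<theta> \<phi> = map ((!) \<phi>) \<theta>"
  by (simp_all add: std_simplex_def)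

lemma bdry_simps [simp]: "simp (bdry k) n = {\<phi>\<in>delta n k. set \<phi> \<noteq> {..k}}" "act (bdry k) n \<theta> \<phi> = map ((!) \<phi>) \<theta>"
  by (simp_all add: bdry_def)

lemma horn_simps [simp]: "simp (horn k j) n = {\<phi>\<in>delta n k. \<not> {..k} - {j} \<subseteq> set \<phi>}"
  "act (horn k j) n \<theta> \<phi> = map ((!) \<phi>) \<theta>"
  by (simp_all add: horn_def)

lemma sprod_simps [simp]: "simp (sprod S T) n = simp S n \<times> simp T n"
  "act (sprod S T) n \<theta> (x, y) = (act S n \<theta> x, act T n \<theta> y)"
  by (simp_all add: sprod_def)

lemma delta_set_le: "\<phi> \<in> delta m k \<Longrightarrow> set \<phi> \<subseteq> {..k}"
  by (simp add: delta_def)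

lemma map_nth_id: "\<phi> \<in> delta n k \<Longrightarrow> map ((!) \<phi>) [0..<Suc n] = \<phi>"
  using deltaD(1) map_nth by metis

lemma map_nth_comp: "\<theta> \<in> delta m n \<Longrightarrow> \<phi> \<in> delta l m \<Longrightarrow> map ((!) (map ((!) \<psi>) \<theta>)) \<phi> = map ((!) \<psi>) (map ((!) \<theta>) \<phi>)"
  using delta_set_le[of \<phi> l m] deltaD(1)[of \<theta> m n] by auto

lemma simplicial_set_std: "simplicial_set (std_simplex k)"
  unfolding simplicial_set_def
  by (auto simp: delta_comp map_nth_id map_nth_comp simp del: upt_Suc map_map)

lemma set_map_nth_subset: "\<theta> \<in> delta m n \<Longrightarrow> \<phi> \<in> delta n k \<Longrightarrow> set (map ((!) \<phi>) \<theta>) \<subseteq> set \<phi>"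
  using delta_set_le[of \<theta> m n] deltaD(1)[of \<phi> n k] by force

lemma simplicial_set_bdry: "simplicial_set (bdry k)"
proof -
  have "set (map ((!) \<phi>) \<theta>) \<noteq> {..k}" if "\<theta> \<in> delta m n" "\<phi> \<in> delta n k" "set \<phi> \<noteq> {..k}" for m n \<theta> \<phi>
    using set_map_nth_subset[OF that(1,2)] delta_set_le[OF that(2)] that(3) by blast
  then show ?thesis
    unfolding simplicial_set_def
    by (auto simp: delta_comp map_nth_id map_nth_comp simp del: upt_Suc map_map)
qed

lemma horn_closed:
  assumes "\<theta> \<in> delta m n" "\<phi> \<in> simp (horn k j) n"
  shows "map ((!) \<phi>) \<theta> \<in> simp (horn k j) m"
  using set_map_nth_subset[OF assms(1), of \<phi> k] assms by (auto simp: delta_comp simp del: set_map)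

lemma simplicial_set_sprod:
  assumes "simplicial_set S" "simplicial_set T" shows "simplicial_set (sprod S T)"
  using simplicial_setD[OF assms(1)] simplicial_setD[OF assms(2)]
  unfolding simplicial_set_def by auto

section \<open>Homotopy relative to the boundary and weak equivalences\<close>

lemma hrelI:
  assumes "a \<in> simp S n" "b \<in> simp S n" "h \<in> smaps (sprod (std_simplex n) (std_simplex 1)) S"
    "\<And>m \<phi>. \<phi> \<in> delta m n \<Longrightarrow> h m (\<phi>, replicate (m + 1) 0) = act S n \<phi> a"
    "\<And>m \<phi>. \<phi> \<in> delta m n \<Longrightarrow> h m (\<phi>, replicate (m + 1) 1) = act S n \<phi> b"
    "\<And>m \<phi> \<tau>. \<phi> \<in> simp (bdry n) m \<Longrightarrow> \<tau> \<in> delta m 1 \<Longrightarrow> h m (\<phi>, \<tau>) = act S n \<phi> a"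
  shows "(a, b) \<in> hrel S n"
  using assms unfolding hrel_def by blast

lemma hrelE:
  assumes "(a, b) \<in> hrel S n"
  obtains h where "a \<in> simp S n" "b \<in> simp S n" "h \<in> smaps (sprod (std_simplex n) (std_simplex 1)) S"
    "\<And>m \<phi>. \<phi> \<in> delta m n \<Longrightarrow> h m (\<phi>, replicate (m + 1) 0) = act S n \<phi> a"
    "\<And>m \<phi>. \<phi> \<in> delta m n \<Longrightarrow> h m (\<phi>, replicate (m + 1) 1) = act S n \<phi> b"
    "\<And>m \<phi> \<tau>. \<phi> \<in> simp (bdry n) m \<Longrightarrow> \<tau> \<in> delta m 1 \<Longrightarrow> h m (\<phi>, \<tau>) = act S n \<phi> a"
  using assms unfolding hrel_def by blast

lemma replicate_delta: "c \<le> k \<Longrightarrow> replicate (m + 1) c \<in> delta m k"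
  by (rule deltaI) (simp_all del: replicate_Suc)

lemma hrel_bdry:
  assumes "(a, b) \<in> hrel S n" "\<phi> \<in> simp (bdry n) m"
  shows "act S n \<phi> a = act S n \<phi> b"
proof -
  obtain h where "\<And>m \<phi>. \<phi> \<in> delta m n \<Longrightarrow> h m (\<phi>, replicate (m + 1) 1) = act S n \<phi> b"
    "\<And>m \<phi> \<tau>. \<phi> \<in> simp (bdry n) m \<Longrightarrow> \<tau> \<in> delta m 1 \<Longrightarrow> h m (\<phi>, \<tau>) = act S n \<phi> a"
    using hrelE[OF assms(1)] by metis
  then show ?thesis
    using assms(2) replicate_delta[of 1 1 m] by (metis (no_types, lifting) bdry_simps(1) mem_Collect_eq order_refl)
qed

lemma hrel_map:
  assumes f: "f \<in> smaps S T" and ab: "(a, b) \<in> hrel S n"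
  shows "(f n a, f n b) \<in> hrel T n"
proof -
  let ?P = "sprod (std_simplex n) (std_simplex 1)"
  obtain h where h: "a \<in> simp S n" "b \<in> simp S n" "h \<in> smaps ?P S"
    "\<And>m \<phi>. \<phi> \<in> delta m n \<Longrightarrow> h m (\<phi>, replicate (m + 1) 0) = act S n \<phi> a"
    "\<And>m \<phi>. \<phi> \<in> delta m n \<Longrightarrow> h m (\<phi>, replicate (m + 1) 1) = act S n \<phi> b"
    "\<And>m \<phi> \<tau>. \<phi> \<in> simp (bdry n) m \<Longrightarrow> \<tau> \<in> delta m 1 \<Longrightarrow> h m (\<phi>, \<tau>) = act S n \<phi> a"
    using hrelE[OF ab] by metis
  have fa: "f m (act S n \<phi> c) = act T n \<phi> (f n c)" if "\<phi> \<in> delta m n" "c \<in> simp S n" for m \<phi> c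
    by (rule smapsD(2)[OF f that])
  have sc: "scomp ?P f h m (\<phi>, \<tau>) = f m (h m (\<phi>, \<tau>))" if "\<phi> \<in> delta m n" "\<tau> \<in> delta m 1" for m \<phi> \<tau>
    using that by (simp add: scomp_def compose_def)
  show ?thesis
  proof (rule hrelI[where h = "scomp ?P f h"])
    show "scomp ?P f h \<in> smaps ?P T"
      by (rule smaps_scomp[OF h(3) f simplicial_set_sprod[OF simplicial_set_std simplicial_set_std]])
    fix m \<phi>
    show "scomp ?P f h m (\<phi>, replicate (m + 1) 0) = act T n \<phi> (f n a)" if "\<phi> \<in> delta m n"
      using sc[OF that replicate_delta[of 0]] h(4)[OF that] fa[OF that h(1)] by simp
    show "scomp ?P f h m (\<phi>, replicate (m + 1) 1) = act T n \<phi> (f n b)" if "\<phi> \<in> delta m n"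
      using sc[OF that replicate_delta[of 1]] h(5)[OF that] fa[OF that h(2)] by simp
    fix \<tau> assume "\<phi> \<in> simp (bdry n) m" "\<tau> \<in> delta m 1"
    then show "scomp ?P f h m (\<phi>, \<tau>) = act T n \<phi> (f n a)"
      using sc[of \<phi> m \<tau>] h(6)[of \<phi> m \<tau>] fa[of \<phi> m a] h(1) by simp
  qed (use h smapsD(1)[OF f] in auto)
qed

lemma hrel_refl:
  assumes S: "simplicial_set S" and a: "a \<in> simp S n"
  shows "(a, a) \<in> hrel S n"
proof (rule hrelI[where h = "\<lambda>m. \<lambda>(\<phi>, \<tau>)\<in>delta m n \<times> delta m 1. act S n \<phi> a"])
  show "(\<lambda>m. \<lambda>(\<phi>, \<tau>)\<in>delta m n \<times> delta m 1. act S n \<phi> a) \<in> smaps (sprod (std_simplex n) (std_simplex 1)) S"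
    by (rule smapsI) (auto simp: delta_comp simplicial_setD(1)[OF S _ a] simplicial_setD(3)[OF S _ _ a] simp del: map_map)
qed (use a replicate_delta[of 0 1] replicate_delta[of 1 1] in \<open>auto simp del: replicate_Suc\<close>)

text \<open>Meant for \<open>S\<close> a nerve and \<open>T\<close> its product with a contractible
  factor. By \<open>hS\<close> and \<open>hT\<close>, two simplices of \<open>T\<close> are
  homotopic exactly if they have the same image under \<open>r\<close> and the same boundary. With
  the boundary prescribed, \<open>s\<close> and \<open>r\<close> therefore induce mutually inverse
  maps on homotopy classes.\<close>

lemma weak_equiv_section:
  assumes S: "simplicial_set S" and T: "simplicial_set T"
    and r: "r \<in> smaps T S" and s: "s \<in> smaps S T"
    and rs: "\<And>n x. x \<in> simp S n \<Longrightarrow> r n (s n x) = x"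
    and hS: "\<And>n a b. (a, b) \<in> hrel S n \<Longrightarrow> a = b"
    and hT: "\<And>n b b'. b \<in> simp T n \<Longrightarrow> b' \<in> simp T n \<Longrightarrow> r n b = r n b' \<Longrightarrow>
      (\<And>m \<phi>. \<phi> \<in> simp (bdry n) m \<Longrightarrow> act T n \<phi> b = act T n \<phi> b') \<Longrightarrow> (b, b') \<in> hrel T n"
  shows "weak_equiv S T s"
proof -
  have hST: "hrel S n `` {a} = {a}" if "a \<in> simp S n" for n a
    using hrel_refl[OF S that] hS by auto
  have hTT: "(b, b') \<in> hrel T n \<longleftrightarrow> b \<in> simp T n \<and> b' \<in> simp T n \<and> r n b = r n b' \<and>
      (\<forall>m \<phi>. \<phi> \<in> simp (bdry n) m \<longrightarrow> act T n \<phi> b = act T n \<phi> b')" for n b b'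
  proof
    assume *: "(b, b') \<in> hrel T n"
    then have "b \<in> simp T n" "b' \<in> simp T n" by (auto simp: hrel_def)
    then show "b \<in> simp T n \<and> b' \<in> simp T n \<and> r n b = r n b' \<and>
      (\<forall>m \<phi>. \<phi> \<in> simp (bdry n) m \<longrightarrow> act T n \<phi> b = act T n \<phi> b')"
      using hS[OF hrel_map[OF r *]] hrel_bdry[OF *] by blast
  qed (use hT in blast)
  \<comment> \<open>Treats path components and homotopy sets together: \<open>P\<close> and
    \<open>P'\<close> are all vertices, or all spheres at corresponding base points.\<close>
  have key: "bij_betw (pi_map T s n) (P // hrel S n) (P' // hrel T n)"
    if P: "P \<subseteq> simp S n" "P' \<subseteq> simp T n" "\<And>x. x \<in> P \<Longrightarrow> s n x \<in> P'" "\<And>y. y \<in> P' \<Longrightarrow> r n y \<in> P"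
      and E: "\<And>y. y \<in> P' \<Longrightarrow> (y, s n (r n y)) \<in> hrel T n" for n P P'
  proof -
    have quot: "P // hrel S n = (\<lambda>x. {x}) ` P"
      unfolding quotient_def using hST P(1) by auto
    have pm: "pi_map T s n {x} = hrel T n `` {s n x}" for x
      by (simp add: pi_map_def)
    show ?thesis
      unfolding bij_betw_def quot
    proof
      show "inj_on (pi_map T s n) ((\<lambda>x. {x}) ` P)"
      proof (rule inj_onI)
        fix X Y assume XY: "X \<in> (\<lambda>x. {x}) ` P" "Y \<in> (\<lambda>x. {x}) ` P" "pi_map T s n X = pi_map T s n Y"
        then obtain x y where xy0: "X = {x}" "Y = {y}" "x \<in> P" "y \<in> P" by blast
        then have xy: "x \<in> P" "y \<in> P" "pi_map T s n {x} = pi_map T s n {y}"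
          using XY by auto
        have "(s n x, s n x) \<in> hrel T n"
          using hTT smapsD(1)[OF s] P(1) xy(1) by blast
        then have "(s n y, s n x) \<in> hrel T n"
          using xy(3) unfolding pm by blast
        then have "r n (s n y) = r n (s n x)"
          using hTT by blast
        then have "x = y"
          using rs P(1) xy(1,2) by (metis subsetD)
        then show "X = Y" using xy0 by simp
      qed
      have "hrel T n `` {y} = hrel T n `` {s n (r n y)}" if "y \<in> P'" for y
      proof -
        let ?y = "s n (r n y)"
        have e: "y \<in> simp T n" "?y \<in> simp T n" "r n y = r n ?y"
          "\<And>m \<phi>. \<phi> \<in> simp (bdry n) m \<Longrightarrow> act T n \<phi> y = act T n \<phi> ?y"
          using E[OF that] unfolding hTT by blast+
        show ?thesis
          unfolding set_eq_iff Image_singleton_iff hTT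
          using e(1,2) e(3)[symmetric] e(4) by (auto simp del: bdry_simps)
      qed
      then have "P' // hrel T n = (\<lambda>x. hrel T n `` {s n x}) ` P"
        unfolding quotient_def using P(3,4) by auto
      then show "pi_map T s n ` (\<lambda>x. {x}) ` P = P' // hrel T n"
        by (simp add: image_image pm)
    qed
  qed
  have sr: "s n x \<in> simp T n" if "x \<in> simp S n" for n x using smapsD(1)[OF s that] .
  have rr: "r n x \<in> simp S n" if "x \<in> simp T n" for n x using smapsD(1)[OF r that] .
  \<comment> \<open>For path components the boundary condition is void.\<close>
  have "simp (bdry 0) m = {}" for m
  proof -
    have "set \<phi> = {..0}" if "\<phi> \<in> delta m 0" for \<phi>
      using delta_set_le[OF that] deltaD(1)[OF that] by (cases \<phi>) auto
    then show ?thesis by auto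
  qed
  then have "bij_betw (pi_map T s 0) (pi0 S) (pi0 T)"
    unfolding pi0_def by (intro key) (auto simp: hTT sr rr rs)
  moreover have "bij_betw (pi_map T s n) (pi_n S n v) (pi_n T n (s 0 v))" if v: "v \<in> simp S 0" for n v
    unfolding pi_n_def
  proof (rule key)
    show "spheres S n v \<subseteq> simp S n" "spheres T n (s 0 v) \<subseteq> simp T n"
      by (auto simp: spheres_def)
    have z: "replicate (m + 1) 0 \<in> delta m 0" for m
      by (rule replicate_delta) simp
    have bd: "\<phi> \<in> delta m n" if "\<phi> \<in> simp (bdry n) m" for m \<phi>
      using that by simp
    show "s n x \<in> spheres T n (s 0 v)" if "x \<in> spheres S n v" for x
    proof -
      have x: "x \<in> simp S n" "\<And>m \<phi>. \<phi> \<in> simp (bdry n) m \<Longrightarrow> act S n \<phi> x = act S 0 (replicate (m + 1) 0) v"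
        using that unfolding spheres_def by blast+
      have "act T n \<phi> (s n x) = act T 0 (replicate (m + 1) 0) (s 0 v)" if "\<phi> \<in> simp (bdry n) m" for m \<phi>
        using smapsD(2)[OF s bd[OF that] x(1)] x(2)[OF that] smapsD(2)[OF s z v, of m] by simp
      then show ?thesis
        using sr[OF x(1)] unfolding spheres_def by blast
    qed
    have ry: "r n y \<in> spheres S n v" if "y \<in> spheres T n (s 0 v)" for y
    proof -
      have y: "y \<in> simp T n" "\<And>m \<phi>. \<phi> \<in> simp (bdry n) m \<Longrightarrow> act T n \<phi> y = act T 0 (replicate (m + 1) 0) (s 0 v)"
        using that unfolding spheres_def by blast+
      have "act S n \<phi> (r n y) = act S 0 (replicate (m + 1) 0) v" if "\<phi> \<in> simp (bdry n) m" for m \<phi>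
        using smapsD(2)[OF r bd[OF that] y(1)] y(2)[OF that] smapsD(2)[OF r z sr[OF v], of m] rs[OF v] by simp
      then show ?thesis
        using rr[OF y(1)] unfolding spheres_def by blast
    qed
    then show "\<And>y. y \<in> spheres T n (s 0 v) \<Longrightarrow> r n y \<in> spheres S n v" .
    fix y assume "y \<in> spheres T n (s 0 v)"
    note y_sphere = this
    show "(y, s n (r n y)) \<in> hrel T n"
    proof -
      have y: "y \<in> simp T n" "\<And>m \<phi>. \<phi> \<in> simp (bdry n) m \<Longrightarrow> act T n \<phi> y = act T 0 (replicate (m + 1) 0) (s 0 v)"
        using y_sphere unfolding spheres_def by blast+
      have q: "r n y \<in> simp S n" "\<And>m \<phi>. \<phi> \<in> simp (bdry n) m \<Longrightarrow> act S n \<phi> (r n y) = act S 0 (replicate (m + 1) 0) v"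
        using ry[OF y_sphere] unfolding spheres_def by blast+
      have "act T n \<phi> (s n (r n y)) = act T n \<phi> y" if "\<phi> \<in> simp (bdry n) m" for m \<phi>
        using smapsD(2)[OF s bd[OF that] q(1)] q(2)[OF that] smapsD(2)[OF s z v, of m] y(2)[OF that] by simp
      then show ?thesis
        unfolding hTT using y(1) sr[OF q(1)] rs[OF q(1)] by (auto simp del: bdry_simps)
    qed
  qed
  ultimately show ?thesis
    unfolding weak_equiv_def using s by blast
qed

subsection \<open>Kan complexes\<close>

text \<open>By the Yoneda lemma a map out of \<open>std_simplex k\<close> is a
  \<open>k\<close>-simplex, so fillers may be given as simplices.\<close>

lemma kanI:
  assumes S: "simplicial_set S"
    and fill: "\<And>k j f. k \<ge> 1 \<Longrightarrow> j \<le> k \<Longrightarrow> f \<in> smaps (horn k j) S \<Longrightarrow>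
      \<exists>g\<in>simp S k. \<forall>m. \<forall>\<phi>\<in>simp (horn k j) m. act S k \<phi> g = f m \<phi>"
  shows "kan S"
  unfolding kan_def
proof (intro conjI S allI impI ballI)
  fix k j :: nat and f assume "k \<ge> 1" "j \<le> k" "f \<in> smaps (horn k j) S"
  then obtain g where g: "g \<in> simp S k" "\<forall>m. \<forall>\<phi>\<in>simp (horn k j) m. act S k \<phi> g = f m \<phi>"
    using fill by blast
  have "(\<lambda>m. \<lambda>\<phi>\<in>delta m k. act S k \<phi> g) \<in> smaps (std_simplex k) S"
    by (rule smapsI) (auto simp: delta_comp simplicial_setD(1)[OF S _ g(1)] simplicial_setD(3)[OF S _ _ g(1)] simp del: map_map)
  moreover have "\<forall>m. \<forall>\<phi>\<in>simp (horn k j) m. (\<lambda>\<phi>\<in>delta m k. act S k \<phi> g) \<phi> = f m \<phi>"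
    using g(2) by simp
  ultimately show "\<exists>g\<in>smaps (std_simplex k) S. \<forall>m. \<forall>\<phi>\<in>simp (horn k j) m. g m \<phi> = f m \<phi>"
    by (intro bexI[of _ "\<lambda>m. \<lambda>\<phi>\<in>delta m k. act S k \<phi> g"])
qed

lemma kan_filler:
  assumes "kan S" "k \<ge> 1" "j \<le> k" "f \<in> smaps (horn k j) S"
  obtains g where "g \<in> simp S k" "\<And>m \<phi>. \<phi> \<in> simp (horn k j) m \<Longrightarrow> act S k \<phi> g = f m \<phi>"
proof -
  obtain h where h: "h \<in> smaps (std_simplex k) S" "\<forall>m. \<forall>\<phi>\<in>simp (horn k j) m. h m \<phi> = f m \<phi>"
    using assms unfolding kan_def by blast
  have i: "[0..<Suc k] \<in> delta k k" by (rule delta_id)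
  have "act S k \<phi> (h k [0..<Suc k]) = f m \<phi>" if "\<phi> \<in> simp (horn k j) m" for m \<phi>
  proof -
    have \<phi>: "\<phi> \<in> delta m k" using that by simp
    have "map ((!) [0..<Suc k]) \<phi> = \<phi>"
      using delta_set_le[OF \<phi>] by (auto intro!: map_idI simp del: upt_Suc)
    then have "h m \<phi> = act S k \<phi> (h k [0..<Suc k])"
      using smapsD(2)[OF h(1) \<phi>, of "[0..<Suc k]"] i by (simp del: upt_Suc)
    then show ?thesis using h(2) that by simp
  qed
  moreover have "h k [0..<Suc k] \<in> simp S k"
    using smapsD(1)[OF h(1), of "[0..<Suc k]" k] i by (simp del: upt_Suc)
  ultimately show thesis using that by blast
qed

text \<open>
  A Mal'cev operation, such as \<open>a + b - c\<close> on a simplicial abelian group, allows to correct a candidate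
  filler face by face.  The vertex \<open>i\<close> opposite to the face is moved by \<open>\<rho>\<close> one step towards \<open>j\<close>; faces that
  are correct stay correct if those far from \<open>j\<close> are treated first.
\<close>

lemma malcev_filler:
  assumes S: "simplicial_set S" and ne: "simp S k \<noteq> {}"
    and t: "\<And>n a b c. a \<in> simp S n \<Longrightarrow> b \<in> simp S n \<Longrightarrow> c \<in> simp S n \<Longrightarrow> t n a b c \<in> simp S n"
    and nat: "\<And>m n \<theta> a b c. \<theta> \<in> delta m n \<Longrightarrow> a \<in> simp S n \<Longrightarrow> b \<in> simp S n \<Longrightarrow> c \<in> simp S n \<Longrightarrow>
      act S n \<theta> (t n a b c) = t m (act S n \<theta> a) (act S n \<theta> b) (act S n \<theta> c)"
    and malcev: "\<And>n a b. a \<in> simp S n \<Longrightarrow> b \<in> simp S n \<Longrightarrow> t n a b a = b"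
      "\<And>n a b. a \<in> simp S n \<Longrightarrow> b \<in> simp S n \<Longrightarrow> t n a b b = a"
    and j: "j \<le> k" and f: "f \<in> smaps (horn k j) S"
  shows "\<exists>g\<in>simp S k. \<forall>m. \<forall>\<phi>\<in>simp (horn k j) m. act S k \<phi> g = f m \<phi>"
proof -
  define good where "good = (\<lambda>I g. g \<in> simp S k \<and>
    (\<forall>i\<in>I. \<forall>m. \<forall>\<phi>\<in>delta m k. i \<notin> set \<phi> \<longrightarrow> act S k \<phi> g = f m \<phi>))"
  have step: "\<exists>g. good (insert i I) g"
    if g: "good I g" and i: "i \<le> k" "i \<noteq> j" "I \<subseteq> {..k} - {j}" and c: "c \<le> k" "c \<notin> I" "c = Suc i \<or> Suc c = i"
    for I g i c
  proof -
    define \<rho> where "\<rho> = map (\<lambda>x. if x = i then c else x) [0..<Suc k]"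
    have \<rho>: "\<rho> \<in> delta k k"
      by (rule deltaI) (use c i in \<open>auto simp: \<rho>_def simp del: upt_Suc\<close>)
    have \<rho>_nth: "\<rho> ! x = (if x = i then c else x)" if "x \<le> k" for x
      using that by (simp add: \<rho>_def del: upt_Suc)
    have i\<rho>: "i \<notin> set \<rho>" using c by (auto simp: \<rho>_def)
    have horn: "\<phi> \<in> simp (horn k j) m" if "\<phi> \<in> delta m k" "x \<le> k" "x \<noteq> j" "x \<notin> set \<phi>" for \<phi> m x
      using that by auto
    have \<rho>h: "\<rho> \<in> simp (horn k j) k" by (rule horn[OF \<rho> i(1,2) i\<rho>])
    have gS: "g \<in> simp S k" using g by (simp add: good_def)
    have fr: "f k \<rho> \<in> simp S k" by (rule smapsD(1)[OF f \<rho>h])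
    have gr: "act S k \<rho> g \<in> simp S k" by (rule simplicial_setD(1)[OF S \<rho> gS])
    \<comment> \<open>On simplices avoiding \<open>i\<close>, \<open>\<rho>\<close> acts as the
      identity, and \<open>t a b a = b\<close> turns \<open>g\<close> into \<open>f\<close>. On a
      face treated before, \<open>f\<close> and \<open>g\<close> also agree after
      \<open>\<rho>\<close>, because \<open>\<rho>\<close> maps onto the vertex \<open>c\<close> and
      not onto the treated ones; there \<open>t a b b = a\<close> preserves
      \<open>g\<close>.\<close>
    define g' where "g' = t k g (f k \<rho>) (act S k \<rho> g)"
    have g': "act S k \<phi> g' = t m (act S k \<phi> g) (f m (map ((!) \<rho>) \<phi>)) (act S k (map ((!) \<rho>) \<phi>) g)"
      if "\<phi> \<in> delta m k" for m \<phi>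
      using nat[OF that gS fr gr] smapsD(2)[OF f that \<rho>h] simplicial_setD(3)[OF S \<rho> that gS]
      by (simp add: g'_def)
    have "act S k \<phi> g' = f m \<phi>" if \<phi>: "\<phi> \<in> delta m k" and x: "x \<in> insert i I" "x \<notin> set \<phi>" for x m \<phi>
    proof -
      have \<rho>\<phi>: "map ((!) \<rho>) \<phi> \<in> delta m k" by (rule delta_comp[OF \<rho> \<phi>])
      have phi_in: "act S k \<phi> g \<in> simp S m" by (rule simplicial_setD(1)[OF S \<phi> gS])
      have set\<phi>: "set \<phi> \<subseteq> {..k}" by (rule delta_set_le[OF \<phi>])
      show ?thesis
      proof (cases "x = i")
        case True
        then have "map ((!) \<rho>) \<phi> = \<phi>"
          using x set\<phi> \<rho>_nth by (intro map_idI) auto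
        moreover have "f m \<phi> \<in> simp S m"
          by (rule smapsD(1)[OF f horn[OF \<phi> i(1,2)]]) (use x True in simp)
        ultimately show ?thesis
          using g'[OF \<phi>] malcev(1)[OF phi_in] by simp
      next
        case False
        then have xI: "x \<in> I" "x \<le> k" "x \<noteq> j" using x i by auto
        have "x \<notin> set (map ((!) \<rho>) \<phi>)"
        proof
          assume "x \<in> set (map ((!) \<rho>) \<phi>)"
          then obtain y where y: "y \<in> set \<phi>" "x = \<rho> ! y" by auto
          then have "y \<le> k" using set\<phi> by auto
          then show False using y \<rho>_nth[of y] x xI c(2) by (auto split: if_splits)
        qed
        then have "act S k (map ((!) \<rho>) \<phi>) g = f m (map ((!) \<rho>) \<phi>)"
          using g xI \<rho>\<phi> by (auto simp: good_def)
        moreover have "act S k (map ((!) \<rho>) \<phi>) g \<in> simp S m"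
          by (rule simplicial_setD(1)[OF S \<rho>\<phi> gS])
        moreover have "act S k \<phi> g = f m \<phi>"
          using g xI x \<phi> by (auto simp: good_def)
        ultimately show ?thesis
          using g'[OF \<phi>] malcev(2)[OF phi_in, of "f m (map ((!) \<rho>) \<phi>)"] by simp
      qed
    qed
    moreover have "g' \<in> simp S k"
      unfolding g'_def by (rule t[OF gS fr gr])
    ultimately have "good (insert i I) g'" by (auto simp: good_def)
    then show ?thesis by blast
  qed
  obtain g0 where "g0 \<in> simp S k" using ne by blast
  then have g0: "good {} g0" by (simp add: good_def)
  \<comment> \<open>Vertices below \<open>j\<close> are treated in increasing order, each moved to
    its upper neighbour, whose face is still untreated.\<close>
  have A: "x \<le> j \<Longrightarrow> \<exists>g. good {..<x} g" for x
  proof (induction x)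
    case (Suc x)
    then obtain g where "good {..<x} g" by auto
    moreover have "{..<x} \<subseteq> {..k} - {j}" using Suc.prems j by auto
    ultimately have "\<exists>g. good (insert x {..<x}) g"
      using step[of "{..<x}" g x "Suc x"] Suc.prems j by auto
    then show ?case by (simp add: lessThan_Suc)
  qed (use g0 in auto)
  \<comment> \<open>Vertices above \<open>j\<close> are treated from \<open>k\<close> downwards,
    each moved to its lower neighbour.\<close>
  have B: "x \<le> k - j \<Longrightarrow> \<exists>g. good ({..<j} \<union> {k - x<..k}) g" for x
  proof (induction x)
    case (Suc x)
    then obtain g where g: "good ({..<j} \<union> {k - x<..k}) g" by auto
    have "insert (k - x) ({..<j} \<union> {k - x<..k}) = {..<j} \<union> {k - Suc x<..k}"
      using Suc.prems by auto
    moreover have "\<exists>g. good (insert (k - x) ({..<j} \<union> {k - x<..k})) g"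
      by (rule step[OF g, where c = "k - Suc x"]) (use Suc.prems in auto)
    ultimately show ?case by simp
  qed (use A[of j] in auto)
  obtain g where g: "good ({..<j} \<union> {k - (k - j)<..k}) g"
    using B[of "k - j"] by auto
  have "act S k \<phi> g = f m \<phi>" if \<phi>: "\<phi> \<in> simp (horn k j) m" for m \<phi>
  proof -
    obtain x where "x \<le> k" "x \<noteq> j" "x \<notin> set \<phi>" using \<phi> by auto
    moreover from this have "x \<in> {..<j} \<union> {k - (k - j)<..k}" using j by auto
    ultimately show ?thesis using g \<phi> unfolding good_def by (metis (no_types, lifting) horn_simps(1) mem_Collect_eq)
  qed
  then show ?thesis using g unfolding good_def by blast
qed

section \<open>Horn filling and homotopies in nerves\<close>

lemma delta1_iff: "[i, j] \<in> delta (Suc 0) n \<longleftrightarrow> i \<le> j \<and> j \<le> n"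
  and delta2_iff: "[i, j, l] \<in> delta 2 n \<longleftrightarrow> i \<le> j \<and> j \<le> l \<and> l \<le> n"
  and delta3_iff: "[i, j, l, k] \<in> delta 3 n \<longleftrightarrow> i \<le> j \<and> j \<le> l \<and> l \<le> k \<and> k \<le> n"
  by (auto simp: delta_def)

lemma delta2E:
  assumes "\<phi> \<in> delta 2 n" obtains i j l where "\<phi> = [i, j, l]" "i \<le> j" "j \<le> l" "l \<le> n"
proof -
  have "length \<phi> = 3" using deltaD(1)[OF assms] by simp
  then obtain i j l where "\<phi> = [i, j, l]"
    by (auto simp: length_Suc_conv numeral_3_eq_3)
  then show thesis using that assms delta2_iff by metis
qed

text \<open>The edges joining \<open>j\<close> to the other vertices define a potential
  \<open>u\<close>, and the filler has edges \<open>inv u a \<otimes> u b\<close>. An edge from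
  \<open>x\<close> to \<open>y\<close> that occurs in the horn lies in a horn face missing a vertex
  \<open>w \<noteq> j\<close>; this face contains the triangle on \<open>x\<close>,
  \<open>y\<close>, \<open>j\<close>, whose relation identifies the given edge with that of the
  filler.\<close>

lemma (in group) kan_nerve: "kan (nerve G)"
proof (rule kanI[OF simplicial_set_nerve])
  fix k j :: nat and f assume k: "k \<ge> 1" and j: "j \<le> k" and f: "f \<in> smaps (horn k j) (nerve G)"
  define ed where "ed = (\<lambda>x y. f 1 [x, y] (0, 1))"
  have f_ed: "f m \<phi> (a, b) = ed (\<phi> ! a) (\<phi> ! b)" if \<phi>: "\<phi> \<in> simp (horn k j) m" "a \<le> b" "b \<le> m" for m \<phi> a b
  proof -
    have ab: "[a, b] \<in> delta 1 m" using that by (simp add: delta1_iff)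
    show ?thesis
      using smapsD(2)[OF f ab \<phi>(1)] nerve_act_apply[OF ab, of 0 1 G "f m \<phi>"] by (simp add: ed_def)
  qed
  have horn: "\<phi> \<in> simp (horn k j) m" if "\<phi> \<in> delta m k" "x \<le> k" "x \<noteq> j" "x \<notin> set \<phi>" for \<phi> m x
    using that by auto
  have tri: "ed x y \<in> carrier G" "ed y z \<in> carrier G" "ed x z \<in> carrier G" "ed x y \<otimes> ed y z = ed x z"
    if "x \<le> y" "y \<le> z" "z \<le> k" "w \<le> k" "w \<noteq> j" "w \<notin> {x, y, z}" for x y z w
  proof -
    have h: "[x, y, z] \<in> simp (horn k j) 2"
      by (rule horn[of _ _ w]) (use that in \<open>auto simp: delta2_iff\<close>)
    note s = nerve_simpD[OF smapsD(1)[OF f h]]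
    show "ed x y \<in> carrier G" using s(1)[of 0 1] f_ed[OF h, of 0 1] by simp
    show "ed y z \<in> carrier G" using s(1)[of 1 2] f_ed[OF h, of 1 2] by simp
    show "ed x z \<in> carrier G" using s(1)[of 0 2] f_ed[OF h, of 0 2] by simp
    show "ed x y \<otimes> ed y z = ed x z"
      using s(4)[of 0 1 2] f_ed[OF h, of 0 1] f_ed[OF h, of 1 2] f_ed[OF h, of 0 2] by simp
  qed
  have deg: "ed x x = \<one>" if "x \<le> k" "w \<le> k" "w \<noteq> j" "w \<noteq> x" for x w
  proof -
    have h: "[x, x] \<in> simp (horn k j) 1"
      by (rule horn[of _ _ w]) (use that in \<open>auto simp: delta1_iff\<close>)
    show ?thesis
      using nerve_simpD(3)[OF smapsD(1)[OF f h], of 0] f_ed[OF h, of 0 0] by simp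
  qed
  \<comment> \<open>In dimension 1 the horn is a single vertex, and the potential is taken
    constant.\<close>
  define u where "u = (\<lambda>x. if k = 1 then \<one> else if j \<le> x then ed j x else inv ed x j)"
  have spare: "\<exists>w\<le>k. w \<noteq> j \<and> w \<noteq> x" if "k \<noteq> 1" for x
  proof -
    have "\<exists>w\<in>{0, 1, 2}. w \<noteq> j \<and> w \<noteq> x" by auto
    then obtain w where "w \<in> {0, 1, 2}" "w \<noteq> j" "w \<noteq> x" by blast
    moreover from this have "w \<le> k" using k that by auto
    ultimately show ?thesis by blast
  qed
  have u: "u x \<in> carrier G" if x: "x \<le> k" for x
  proof (cases "k = 1")
    case False
    then obtain w where w: "w \<le> k" "w \<noteq> j" "w \<noteq> x" using spare by blast
    show ?thesis
      using tri(1)[of j x x w] tri(1)[of x j j w] w x j by (auto simp: u_def)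
  qed (simp add: u_def)
  define g where "g = (\<lambda>(a, b)\<in>ipairs k. inv u a \<otimes> u b)"
  have gab: "g (a, b) = inv u a \<otimes> u b" if "a \<le> b" "b \<le> k" for a b
    using that by (simp add: g_def ipairs_def)
  have ucancel: "inv a \<otimes> b \<otimes> (inv b \<otimes> c) = inv a \<otimes> c"
    if "a \<in> carrier G" "b \<in> carrier G" "c \<in> carrier G" for a b c
  proof -
    have "b \<otimes> (inv b \<otimes> c) = c"
      using that by (simp flip: m_assoc)
    then show ?thesis using that by (simp add: m_assoc)
  qed
  have "g \<in> simp (nerve G) k"
    by (rule nerve_simpI) (use gab u ucancel in \<open>auto simp: g_def\<close>)
  moreover have "act (nerve G) k \<phi> g = f m \<phi>" if \<phi>: "\<phi> \<in> simp (horn k j) m" for m \<phi>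
  proof (rule nerve_eqI[where n = m])
    have \<phi>d: "\<phi> \<in> delta m k" using \<phi> by simp
    show "act (nerve G) k \<phi> g \<in> extensional (ipairs m)" by (rule nerve_act_ext[OF \<phi>d])
    show "f m \<phi> \<in> extensional (ipairs m)" using nerve_simpD(2)[OF smapsD(1)[OF f \<phi>]] .
    fix a b assume ab: "a \<le> b" "b \<le> m"
    let ?x = "\<phi> ! a" and ?y = "\<phi> ! b"
    have xy: "?x \<le> ?y" "?y \<le> k" "?x \<le> k" using deltaD[OF \<phi>d] ab by auto
    obtain w where w: "w \<le> k" "w \<noteq> j" "w \<notin> set \<phi>" using \<phi> by auto
    have "?x \<in> set \<phi>" "?y \<in> set \<phi>" using deltaD(1)[OF \<phi>d] ab by auto
    then have wxy: "w \<noteq> ?x" "w \<noteq> ?y" using w by auto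
    have "ed ?x ?y = inv u ?x \<otimes> u ?y"
    proof (cases "k = 1")
      case True
      then have "?x = j" "?y = j" using w wxy xy j by auto
      then show ?thesis
        using deg[of j w] w j True by (simp add: u_def)
    next
      case False
      consider "j \<le> ?x" | "?x < j" "j \<le> ?y" | "?y < j" by linarith
      then show ?thesis
      proof cases
        case 1
        note t = tri[of j ?x ?y w]
        have "u ?x = ed j ?x" "u ?y = ed j ?y" using 1 xy False by (simp_all add: u_def)
        moreover have "inv (ed j ?x) \<otimes> (ed j ?x \<otimes> ed ?x ?y) = ed ?x ?y"
          using t(1-3) 1 xy w wxy by (simp flip: m_assoc)
        moreover have "ed j ?x \<otimes> ed ?x ?y = ed j ?y"
          using t(4) 1 xy w wxy by simp
        ultimately show ?thesis by simp
      next
        case 2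
        note t = tri[of ?x j ?y w]
        have "u ?x = inv (ed ?x j)" "u ?y = ed j ?y" using 2 xy False by (simp_all add: u_def)
        then show ?thesis using t 2 xy w wxy by simp
      next
        case 3
        note t = tri[of ?x ?y j w]
        have "u ?x = inv (ed ?x j)" "u ?y = inv (ed ?y j)" using 3 xy False by (simp_all add: u_def)
        moreover have "ed ?x ?y \<otimes> ed ?y j \<otimes> inv (ed ?y j) = ed ?x ?y"
          using t(1-3) 3 xy w wxy j by (simp add: m_assoc)
        moreover have "ed ?x ?y \<otimes> ed ?y j = ed ?x j"
          using t(4) 3 xy w wxy j by simp
        ultimately show ?thesis using t(2,3) 3 xy w wxy j by simp
      qed
    qed
    then show "act (nerve G) k \<phi> g (a, b) = f m \<phi> (a, b)"
      using nerve_act_apply[OF \<phi>d ab, of G g] gab[OF xy(1,2)] f_ed[OF \<phi> ab] by simp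
  qed
  ultimately show "\<exists>g\<in>simp (nerve G) k. \<forall>m. \<forall>\<phi>\<in>simp (horn k j) m. act (nerve G) k \<phi> g = f m \<phi>"
    by blast
qed

text \<open>A homotopy between simplices of a nerve is given by its edges over the vertices. For
  \<open>n > 0\<close> every vertex lies in the boundary, where the homotopy is constant, so these
  edges are trivial and the squares over the edges of the simplex force equality. In dimension 0 the
  nerve has one simplex.\<close>

lemma (in group) hrel_nerve:
  assumes ab: "(a, b) \<in> hrel (nerve G) n"
  shows "a = b"
proof -
  let ?P = "sprod (std_simplex n) (std_simplex 1)"
  obtain h where h: "a \<in> simp (nerve G) n" "b \<in> simp (nerve G) n" "h \<in> smaps ?P (nerve G)"
    "\<And>m \<phi>. \<phi> \<in> delta m n \<Longrightarrow> h m (\<phi>, replicate (m + 1) 0) = act (nerve G) n \<phi> a"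
    "\<And>m \<phi>. \<phi> \<in> delta m n \<Longrightarrow> h m (\<phi>, replicate (m + 1) 1) = act (nerve G) n \<phi> b"
    "\<And>m \<phi> \<tau>. \<phi> \<in> simp (bdry n) m \<Longrightarrow> \<tau> \<in> delta m 1 \<Longrightarrow> h m (\<phi>, \<tau>) = act (nerve G) n \<phi> a"
    using hrelE[OF ab] by metis
  show ?thesis
  proof (rule nerve_eqI[OF nerve_simpD(2)[OF h(1)] nerve_simpD(2)[OF h(2)]])
    fix i j assume ij: "i \<le> j" "j \<le> n"
    show "a (i, j) = b (i, j)"
    proof (cases "n = 0")
      case True
      then show ?thesis using ij nerve_simpD(3)[OF h(1)] nerve_simpD(3)[OF h(2)] by simp
    next
      case False
      define E where "E = (\<lambda>x y c d. h 1 ([x, y], [c, d]) (0, 1))"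
      have tri: "E x y c d \<otimes> E y z d e = E x z c e"
        "E x y c d \<in> carrier G" "E y z d e \<in> carrier G"
        if "x \<le> y" "y \<le> z" "z \<le> n" "c \<le> d" "d \<le> e" "e \<le> 1" for x y z c d e
      proof -
        have p: "([x, y, z], [c, d, e]) \<in> simp ?P 2" using that by (simp add: delta2_iff)
        have d: "[0, 1] \<in> delta 1 2" "[1, 2] \<in> delta 1 2" "[0, 2] \<in> delta 1 2" by (simp_all add: delta1_iff)
        note s = nerve_simpD[OF smapsD(1)[OF h(3) p]]
        have "E x y c d = h 2 ([x, y, z], [c, d, e]) (0, 1)"
          using smapsD(2)[OF h(3) d(1) p] nerve_act_apply[OF d(1), of 0 1 G] by (simp add: E_def)
        moreover have "E y z d e = h 2 ([x, y, z], [c, d, e]) (1, 2)"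
          using smapsD(2)[OF h(3) d(2) p] nerve_act_apply[OF d(2), of 0 1 G] by (simp add: E_def)
        moreover have "E x z c e = h 2 ([x, y, z], [c, d, e]) (0, 2)"
          using smapsD(2)[OF h(3) d(3) p] nerve_act_apply[OF d(3), of 0 1 G] by (simp add: E_def)
        ultimately show "E x y c d \<otimes> E y z d e = E x z c e"
          "E x y c d \<in> carrier G" "E y z d e \<in> carrier G"
          using s(4)[of 0 1 2] s(1)[of 0 1] s(1)[of 1 2] by simp_all
      qed
      have e00: "E i j 0 0 = a (i, j)" and e11: "E i j 1 1 = b (i, j)"
        using h(4)[of "[i, j]" 1] h(5)[of "[i, j]" 1] ij nerve_act_apply[of "[i, j]" 1 n 0 1 G a]
          nerve_act_apply[of "[i, j]" 1 n 0 1 G b]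
        by (simp_all add: E_def delta1_iff)
      have one: "E x x 0 1 = \<one>" if "x \<le> n" for x
      proof -
        have "n \<notin> {x} \<or> 0 \<notin> {x}" using False by auto
        then have "[x, x] \<in> simp (bdry n) 1"
          using that by (auto simp: delta1_iff)
        then show ?thesis
          using h(6)[of "[x, x]" 1 "[0, 1]"] that nerve_act_apply[of "[x, x]" 1 n 0 1 G a] nerve_simpD(3)[OF h(1), of x]
          by (simp add: E_def delta1_iff)
      qed
      \<comment> \<open>Both sides equal the diagonal \<open>E i j 0 1\<close> of the square over
        the edge from \<open>i\<close> to \<open>j\<close>.\<close>
      have "E i i 0 1 \<otimes> E i j 1 1 = E i j 0 0 \<otimes> E j j 0 1"
        using tri(1)[of i i j 0 1 1] tri(1)[of i j j 0 0 1] ij by simp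
      then show ?thesis
        using one[of i] one[of j] ij e00 e11 nerve_simpD(1)[OF h(1) ij] nerve_simpD(1)[OF h(2) ij] by simp
    qed
  qed
qed

section \<open>Normalized two-cocycles\<close>

text \<open>The two operators are the degeneracies of an edge. Normalized cocycles on
  \<open>B\<close> are the same as maps from \<open>B\<close> to \<open>K(M, 2)\<close>, and this is
  the form in which such maps are handled below.\<close>

definition nz2 :: "('m, 'x) ring_scheme \<Rightarrow> 'a sset \<Rightarrow> ('a \<Rightarrow> 'm) set" where
  "nz2 M B = {c\<in>cocycles M B 2. \<forall>y\<in>simp B 1.
     c (act B 1 [0, 0, 1] y) = \<zero>\<^bsub>M\<^esub> \<and> c (act B 1 [0, 1, 1] y) = \<zero>\<^bsub>M\<^esub>}"

lemma coface_2: "coface 2 0 = [1, 2, 3]" "coface 2 1 = [0, 2, 3]" "coface 2 2 = [0, 1, 3]" "coface 2 3 = [0, 1, 2]"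
  by (simp_all add: coface_def upt_rec)

context abelian_group
begin

abbreviation cob2 :: "'s sset \<Rightarrow> ('s \<Rightarrow> 'a) \<Rightarrow> 's \<Rightarrow> 'a" where
  "cob2 B c x \<equiv> c (act B 3 [1, 2, 3] x) \<ominus> c (act B 3 [0, 2, 3] x) \<oplus> c (act B 3 [0, 1, 3] x)
    \<ominus> c (act B 3 [0, 1, 2] x)"

lemma cobdry_2:
  assumes B: "simplicial_set B" and c: "c \<in> carrier (cochains G B 2)" and x: "x \<in> simp B 3"
  shows "cobdry G B 2 c x = cob2 B c x"
proof -
  have cl: "c (act B 3 (coface 2 i) x) \<in> carrier G" if "i \<le> 3" for i
  proof -
    have "coface 2 i \<in> delta 2 3" using coface_delta[of i 2] that by simp
    then show ?thesis
      using simplicial_setD(1)[OF B _ x] c by (auto simp: cochains_simps)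
  qed
  let ?g = "\<lambda>i. if even i then c (act B 3 (coface 2 i) x) else \<ominus> c (act B 3 (coface 2 i) x)"
  have e: "(2::nat) + 1 = 3" by simp
  have "cobdry G B 2 c x = (\<Oplus>i\<in>{..3}. ?g i)"
    unfolding cobdry_def e restrict_apply'[OF x] ..
  also have "\<dots> = ?g 3 \<oplus> (?g 2 \<oplus> (?g 1 \<oplus> ?g 0))"
  proof -
    have g: "?g \<in> {..k} \<rightarrow> carrier G" if "k \<le> 3" for k using cl that by auto
    have "(\<Oplus>i\<in>{..Suc (Suc (Suc 0))}. ?g i) = ?g (Suc (Suc (Suc 0))) \<oplus> (?g (Suc (Suc 0)) \<oplus> (?g (Suc 0) \<oplus> ?g 0))"
      using finsum_Suc[of ?g 2] finsum_Suc[of ?g 1] finsum_Suc[of ?g 0] finsum_0[of ?g] g[of 3] g[of 2] g[of 1] g[of 0]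
      by (simp add: numeral_3_eq_3 numeral_2_eq_2)
    then show ?thesis by (simp add: numeral_3_eq_3 numeral_2_eq_2)
  qed
  also have "\<dots> = \<ominus> c (act B 3 [0, 1, 2] x) \<oplus> (c (act B 3 [0, 1, 3] x) \<oplus> (\<ominus> c (act B 3 [0, 2, 3] x) \<oplus> c (act B 3 [1, 2, 3] x)))"
    by (simp add: coface_2 coface_2(2)[unfolded One_nat_def])
  also have "\<dots> = cob2 B c x"
    using cl[of 0] cl[of 1] cl[of 2] cl[of 3] by (simp add: coface_2 coface_2(2)[unfolded One_nat_def] a_ac minus_eq)
  finally show ?thesis .
qed

lemma nz2_iff:
  assumes B: "simplicial_set B"
  shows "c \<in> nz2 G B \<longleftrightarrow> c \<in> simp B 2 \<rightarrow>\<^sub>E carrier G \<and>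
    (\<forall>x\<in>simp B 3. cob2 B c x = \<zero>) \<and>
    (\<forall>y\<in>simp B 1. c (act B 1 [0, 0, 1] y) = \<zero> \<and> c (act B 1 [0, 1, 1] y) = \<zero>)"
proof -
  have A: "cobdry G B 2 c = \<one>\<^bsub>cochains G B (2 + 1)\<^esub> \<longleftrightarrow> (\<forall>x\<in>simp B 3. cob2 B c x = \<zero>)" (is "?l \<longleftrightarrow> ?r") if c: "c \<in> carrier (cochains G B 2)"
  proof
    assume l: ?l
    show ?r
    proof
      fix x assume x: "x \<in> simp B 3"
      show "cob2 B c x = \<zero>"
        unfolding cobdry_2[OF B c x, symmetric] l using x by (simp add: cochains_simps)
    qed
  next
    assume r: ?r
    have "cobdry G B 2 c x = \<zero>" if "x \<in> simp B 3" for x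
      unfolding cobdry_2[OF B c that] using r that by blast
    then show ?l
      by (intro extensionalityI[of _ "simp B 3"]) (auto simp: cobdry_def cochains_simps)
  qed
  have C: "c \<in> simp B 2 \<rightarrow>\<^sub>E carrier G \<longleftrightarrow> c \<in> carrier (cochains G B 2)" by (simp add: cochains_simps)
  have L: "(P \<Longrightarrow> p \<longleftrightarrow> q) \<Longrightarrow> (P \<and> p) \<and> r \<longleftrightarrow> P \<and> q \<and> r" for P p q r by blast
  show ?thesis unfolding nz2_def cocycles_def mem_Collect_eq C by (rule L[OF A])
qed

end

text \<open>A monotone triple with a repetition has the form \<open>[i, i, l]\<close> or
  \<open>[i, l, l]\<close>, that is, it is a degeneracy of the edge \<open>[i, l]\<close>.\<close>

lemma simp_EM2: "simp (EM M 2) n = nz2 M (std_simplex n)"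
proof -
  have "(\<forall>\<phi>\<in>delta 2 n. \<not> distinct \<phi> \<longrightarrow> c \<phi> = \<zero>\<^bsub>M\<^esub>) \<longleftrightarrow>
    (\<forall>y\<in>delta 1 n. c (map ((!) y) [0, 0, 1]) = \<zero>\<^bsub>M\<^esub> \<and> c (map ((!) y) [0, 1, 1]) = \<zero>\<^bsub>M\<^esub>)" (is "?L \<longleftrightarrow> ?R")
    for c :: "nat list \<Rightarrow> 'a"
  proof
    assume L: ?L
    show ?R
    proof (intro ballI conjI)
      fix y assume y: "y \<in> delta 1 n"
      then have "map ((!) y) [0, 0, 1] \<in> delta 2 n" "map ((!) y) [0, 1, 1] \<in> delta 2 n"
        by (rule delta_comp, simp add: delta2_iff)+
      then show "c (map ((!) y) [0, 0, 1]) = \<zero>\<^bsub>M\<^esub>" "c (map ((!) y) [0, 1, 1]) = \<zero>\<^bsub>M\<^esub>"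
        using L by auto
    qed
  next
    assume R: ?R
    show ?L
    proof (intro ballI impI)
      fix \<phi> assume \<phi>: "\<phi> \<in> delta 2 n" "\<not> distinct \<phi>"
      then obtain i j l where ijl: "\<phi> = [i, j, l]" "i \<le> j" "j \<le> l" "l \<le> n" by (elim delta2E)
      then have "[i, l] \<in> delta 1 n" by (simp add: delta1_iff)
      moreover have "j = i \<or> j = l" using \<phi> ijl by auto
      ultimately show "c \<phi> = \<zero>\<^bsub>M\<^esub>" using R ijl by (auto dest!: bspec[of _ _ "[i, l]"])
    qed
  qed
  then show ?thesis
    by (simp add: EM_def nz2_def)
qed

lemma act_EM2: "\<theta> \<in> delta m n \<Longrightarrow> act (EM M 2) n \<theta> c = (\<lambda>\<psi>\<in>delta 2 m. c (map ((!) \<theta>) \<psi>))"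
  using deltaD(1)[of \<theta> m n] by (simp add: EM_def)

subsection \<open>Cocycles on prisms\<close>

abbreviation prism :: "nat \<Rightarrow> (nat list \<times> nat list) sset" where
  "prism n \<equiv> sprod (std_simplex n) (std_simplex 1)"

lemma simplicial_set_prism: "simplicial_set (prism n)"
  by (rule simplicial_set_sprod[OF simplicial_set_std simplicial_set_std])

lemma prism_faces:
  "act (prism n) 3 [1, 2, 3] ([i, j, k, l], [a, b, c, d]) = ([j, k, l], [b, c, d])"
  "act (prism n) 3 [0, 2, 3] ([i, j, k, l], [a, b, c, d]) = ([i, k, l], [a, c, d])"
  "act (prism n) 3 [0, 1, 3] ([i, j, k, l], [a, b, c, d]) = ([i, j, l], [a, b, d])"
  "act (prism n) 3 [0, 1, 2] ([i, j, k, l], [a, b, c, d]) = ([i, j, k], [a, b, c])"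
  "act (prism n) 1 [0, 0, 1] ([i, l], [a, c]) = ([i, i, l], [a, a, c])"
  "act (prism n) 1 [0, 1, 1] ([i, l], [a, c]) = ([i, l, l], [a, c, c])"
  by (simp_all add: sprod_def)

lemma delta3E:
  assumes "\<phi> \<in> delta 3 n" obtains i j k l where "\<phi> = [i, j, k, l]" "i \<le> j" "j \<le> k" "k \<le> l" "l \<le> n"
proof -
  have "length \<phi> = Suc (Suc (Suc (Suc 0)))" using deltaD(1)[OF assms] by simp
  then obtain i j k l where "\<phi> = [i, j, k, l]"
    by (auto simp: length_Suc_conv)
  then show thesis using that assms delta3_iff by metis
qed

lemma delta1E:
  assumes "\<phi> \<in> delta 1 n" obtains i j where "\<phi> = [i, j]" "i \<le> j" "j \<le> n"
proof -
  have "length \<phi> = Suc (Suc 0)" using deltaD(1)[OF assms] by simp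
  then obtain i j where "\<phi> = [i, j]"
    by (auto simp: length_Suc_conv)
  then show thesis using that assms by (auto simp: delta1_iff)
qed

lemma prism_eqI:
  assumes "h \<in> extensional (delta 2 n \<times> delta 2 1)" "h' \<in> extensional (delta 2 n \<times> delta 2 1)"
    "\<And>i j l a b c. i \<le> j \<Longrightarrow> j \<le> l \<Longrightarrow> l \<le> n \<Longrightarrow> a \<le> b \<Longrightarrow> b \<le> c \<Longrightarrow> c \<le> 1 \<Longrightarrow>
      h ([i, j, l], [a, b, c]) = h' ([i, j, l], [a, b, c])"
  shows "h = h'"
proof (rule extensionalityI[OF assms(1,2)])
  fix x assume "x \<in> delta 2 n \<times> delta 2 1"
  then obtain \<phi> \<tau> where x: "x = (\<phi>, \<tau>)" "\<phi> \<in> delta 2 n" "\<tau> \<in> delta 2 1" by auto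
  obtain i j l where "\<phi> = [i, j, l]" "i \<le> j" "j \<le> l" "l \<le> n" using delta2E[OF x(2)] .
  moreover obtain a b c where "\<tau> = [a, b, c]" "a \<le> b" "b \<le> c" "c \<le> 1" using delta2E[OF x(3)] .
  ultimately show "h x = h' x" using assms(3) x(1) by simp
qed

context abelian_group
begin

abbreviation PZ where "PZ n \<equiv> nz2 G (prism n)"

text \<open>The conditions in coordinates: a simplex of the prism is a pair of monotone lists of
  equal length, one with entries up to \<open>n\<close>, the other with entries 0 and 1.\<close>

lemma PZD:
  assumes "h \<in> PZ n"
  shows "h \<in> extensional (delta 2 n \<times> delta 2 1)"
    "i \<le> j \<Longrightarrow> j \<le> l \<Longrightarrow> l \<le> n \<Longrightarrow> a \<le> b \<Longrightarrow> b \<le> c \<Longrightarrow> c \<le> 1 \<Longrightarrow> h ([i, j, l], [a, b, c]) \<in> carrier G"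
    "i \<le> j \<Longrightarrow> j \<le> k \<Longrightarrow> k \<le> l \<Longrightarrow> l \<le> n \<Longrightarrow> a \<le> b \<Longrightarrow> b \<le> c \<Longrightarrow> c \<le> d \<Longrightarrow> d \<le> 1 \<Longrightarrow>
      h ([j, k, l], [b, c, d]) \<ominus> h ([i, k, l], [a, c, d]) \<oplus> h ([i, j, l], [a, b, d]) \<ominus> h ([i, j, k], [a, b, c]) = \<zero>"
    "i \<le> l \<Longrightarrow> l \<le> n \<Longrightarrow> a \<le> c \<Longrightarrow> c \<le> 1 \<Longrightarrow> h ([i, i, l], [a, a, c]) = \<zero>"
    "i \<le> l \<Longrightarrow> l \<le> n \<Longrightarrow> a \<le> c \<Longrightarrow> c \<le> 1 \<Longrightarrow> h ([i, l, l], [a, c, c]) = \<zero>"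
proof -
  note * = assms[unfolded nz2_iff[OF simplicial_set_prism]]
  show "h \<in> extensional (delta 2 n \<times> delta 2 1)" using * by (simp add: PiE_def)
  show "i \<le> j \<Longrightarrow> j \<le> l \<Longrightarrow> l \<le> n \<Longrightarrow> a \<le> b \<Longrightarrow> b \<le> c \<Longrightarrow> c \<le> 1 \<Longrightarrow> h ([i, j, l], [a, b, c]) \<in> carrier G"
    using * by (auto simp: delta2_iff)
  show "h ([j, k, l], [b, c, d]) \<ominus> h ([i, k, l], [a, c, d]) \<oplus> h ([i, j, l], [a, b, d]) \<ominus> h ([i, j, k], [a, b, c]) = \<zero>"
    if "i \<le> j" "j \<le> k" "k \<le> l" "l \<le> n" "a \<le> b" "b \<le> c" "c \<le> d" "d \<le> 1"
  proof -
    have "([i, j, k, l], [a, b, c, d]) \<in> simp (prism n) 3" using that by (simp add: delta3_iff)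
    from *[THEN conjunct2, THEN conjunct1, THEN bspec, OF this]
    show ?thesis unfolding prism_faces .
  qed
  have "([i, l], [a, c]) \<in> simp (prism n) 1" if "i \<le> l" "l \<le> n" "a \<le> c" "c \<le> 1"
    using that by (simp add: delta1_iff)
  from *[THEN conjunct2, THEN conjunct2, THEN bspec, OF this]
  show "h ([i, i, l], [a, a, c]) = \<zero>" "h ([i, l, l], [a, c, c]) = \<zero>" if "i \<le> l" "l \<le> n" "a \<le> c" "c \<le> 1"
    using that unfolding prism_faces by blast+
qed

lemma PZI:
  assumes "h \<in> extensional (delta 2 n \<times> delta 2 1)"
    "\<And>i j l a b c. i \<le> j \<Longrightarrow> j \<le> l \<Longrightarrow> l \<le> n \<Longrightarrow> a \<le> b \<Longrightarrow> b \<le> c \<Longrightarrow> c \<le> 1 \<Longrightarrow> h ([i, j, l], [a, b, c]) \<in> carrier G"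
    "\<And>i j k l a b c d. i \<le> j \<Longrightarrow> j \<le> k \<Longrightarrow> k \<le> l \<Longrightarrow> l \<le> n \<Longrightarrow> a \<le> b \<Longrightarrow> b \<le> c \<Longrightarrow> c \<le> d \<Longrightarrow> d \<le> 1 \<Longrightarrow>
      h ([j, k, l], [b, c, d]) \<ominus> h ([i, k, l], [a, c, d]) \<oplus> h ([i, j, l], [a, b, d]) \<ominus> h ([i, j, k], [a, b, c]) = \<zero>"
    "\<And>i l a c. i \<le> l \<Longrightarrow> l \<le> n \<Longrightarrow> a \<le> c \<Longrightarrow> c \<le> 1 \<Longrightarrow> h ([i, i, l], [a, a, c]) = \<zero>"
    "\<And>i l a c. i \<le> l \<Longrightarrow> l \<le> n \<Longrightarrow> a \<le> c \<Longrightarrow> c \<le> 1 \<Longrightarrow> h ([i, l, l], [a, c, c]) = \<zero>"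
  shows "h \<in> PZ n"
  unfolding nz2_iff[OF simplicial_set_prism]
proof (intro conjI ballI)
  show "h \<in> simp (prism n) 2 \<rightarrow>\<^sub>E carrier G"
  proof (rule PiE_I)
    fix x assume "x \<in> simp (prism n) 2"
    then obtain \<phi> \<tau> where x: "x = (\<phi>, \<tau>)" "\<phi> \<in> delta 2 n" "\<tau> \<in> delta 2 1" by auto
    obtain i j l where "\<phi> = [i, j, l]" "i \<le> j" "j \<le> l" "l \<le> n" using delta2E[OF x(2)] .
    moreover obtain a b c where "\<tau> = [a, b, c]" "a \<le> b" "b \<le> c" "c \<le> 1" using delta2E[OF x(3)] .
    ultimately show "h x \<in> carrier G" using assms(2) x(1) by simp
  next
    fix x assume "x \<notin> simp (prism n) 2"
    then show "h x = undefined"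
      using extensional_arb[OF assms(1), of x] by simp
  qed
next
  fix x assume "x \<in> simp (prism n) 3"
  then obtain \<phi> \<tau> where x: "x = (\<phi>, \<tau>)" "\<phi> \<in> delta 3 n" "\<tau> \<in> delta 3 1" by auto
  obtain i j k l where 1: "\<phi> = [i, j, k, l]" "i \<le> j" "j \<le> k" "k \<le> l" "l \<le> n" using delta3E[OF x(2)] .
  obtain a b c d where 2: "\<tau> = [a, b, c, d]" "a \<le> b" "b \<le> c" "c \<le> d" "d \<le> 1" using delta3E[OF x(3)] .
  show "cob2 (prism n) h x = \<zero>"
    unfolding x(1) 1(1) 2(1) prism_faces by (rule assms(3)[OF 1(2-5) 2(2-5)])
next
  fix y assume "y \<in> simp (prism n) 1"
  then obtain \<phi> \<tau> where x: "y = (\<phi>, \<tau>)" "\<phi> \<in> delta 1 n" "\<tau> \<in> delta 1 1" by auto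
  obtain i l where 1: "\<phi> = [i, l]" "i \<le> l" "l \<le> n" using delta1E[OF x(2)] .
  obtain a c where 2: "\<tau> = [a, c]" "a \<le> c" "c \<le> 1" using delta1E[OF x(3)] .
  show "h (act (prism n) 1 [0, 0, 1] y) = \<zero>" "h (act (prism n) 1 [0, 1, 1] y) = \<zero>"
    unfolding x(1) 1(1) 2(1) prism_faces using assms(4,5)[OF 1(2,3) 2(2,3)] by blast+
qed

text \<open>The coboundary of a normalized one-cochain on the prism.\<close>

definition dv :: "nat \<Rightarrow> (nat \<Rightarrow> nat \<Rightarrow> nat \<Rightarrow> nat \<Rightarrow> 'a) \<Rightarrow> nat list \<times> nat list \<Rightarrow> 'a" where
  "dv n v = (\<lambda>(\<phi>, \<tau>)\<in>delta 2 n \<times> delta 2 1. v (\<phi> ! 1) (\<phi> ! 2) (\<tau> ! 1) (\<tau> ! 2) \<ominus>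
     v (\<phi> ! 0) (\<phi> ! 2) (\<tau> ! 0) (\<tau> ! 2) \<oplus> v (\<phi> ! 0) (\<phi> ! 1) (\<tau> ! 0) (\<tau> ! 1))"

lemma dv_apply:
  "i \<le> j \<Longrightarrow> j \<le> l \<Longrightarrow> l \<le> n \<Longrightarrow> a \<le> b \<Longrightarrow> b \<le> c \<Longrightarrow> c \<le> 1 \<Longrightarrow>
   dv n v ([i, j, l], [a, b, c]) = v j l b c \<ominus> v i l a c \<oplus> v i j a b"
  by (simp add: dv_def delta2_iff)

lemma dv_ext: "dv n v \<in> extensional (delta 2 n \<times> delta 2 1)"
  by (simp add: dv_def)

lemma dv_PZ:
  assumes v: "\<And>i j a b. i \<le> j \<Longrightarrow> j \<le> n \<Longrightarrow> a \<le> b \<Longrightarrow> b \<le> 1 \<Longrightarrow> v i j a b \<in> carrier G"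
    and z: "\<And>i a. i \<le> n \<Longrightarrow> a \<le> 1 \<Longrightarrow> v i i a a = \<zero>"
  shows "dv n v \<in> PZ n"
proof (rule PZI[OF dv_ext])
  fix i j k l a b c d :: nat
  assume *: "i \<le> j" "j \<le> k" "k \<le> l" "l \<le> n" "a \<le> b" "b \<le> c" "c \<le> d" "d \<le> 1"
  have id: "(kl \<ominus> jl \<oplus> jk) \<ominus> (kl \<ominus> il \<oplus> ik) \<oplus> (jl \<ominus> il \<oplus> ij) \<ominus> (jk \<ominus> ik \<oplus> ij) = \<zero>"
    if "kl \<in> carrier G" "jl \<in> carrier G" "jk \<in> carrier G" "il \<in> carrier G" "ik \<in> carrier G" "ij \<in> carrier G"
    for kl jl jk il ik ij
    using that by algebra
  have "dv n v ([j, k, l], [b, c, d]) = v k l c d \<ominus> v j l b d \<oplus> v j k b c"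
    "dv n v ([i, k, l], [a, c, d]) = v k l c d \<ominus> v i l a d \<oplus> v i k a c"
    "dv n v ([i, j, l], [a, b, d]) = v j l b d \<ominus> v i l a d \<oplus> v i j a b"
    "dv n v ([i, j, k], [a, b, c]) = v j k b c \<ominus> v i k a c \<oplus> v i j a b"
    using * by (simp_all add: dv_apply)
  then show "dv n v ([j, k, l], [b, c, d]) \<ominus> dv n v ([i, k, l], [a, c, d]) \<oplus>
      dv n v ([i, j, l], [a, b, d]) \<ominus> dv n v ([i, j, k], [a, b, c]) = \<zero>"
    using * by (simp add: id v)
qed (use v z in \<open>auto simp: dv_apply minus_eq r_neg l_neg\<close>)

subsection \<open>Maps to \<open>K(M, 2)\<close> as cocycles\<close>

text \<open>\<open>K(M, 2)\<close> represents normalized 2-cocycles: a simplex \<open>x\<close> is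
  sent to the pullback of \<open>c\<close> along the map from a standard simplex that classifies
  \<open>x\<close>. The inverse \<open>ofMap\<close> evaluates at the fundamental triangle
  \<open>[0, 1, 2]\<close>.\<close>

definition toMap :: "'s sset \<Rightarrow> ('s \<Rightarrow> 'a) \<Rightarrow> nat \<Rightarrow> 's \<Rightarrow> nat list \<Rightarrow> 'a" where
  "toMap B c = (\<lambda>m. \<lambda>x\<in>simp B m. \<lambda>\<psi>\<in>delta 2 m. c (act B m \<psi> x))"

lemma toMap_apply: "x \<in> simp B m \<Longrightarrow> \<psi> \<in> delta 2 m \<Longrightarrow> toMap B c m x \<psi> = c (act B m \<psi> x)"
  by (simp add: toMap_def)

lemma nz2D:
  assumes B: "simplicial_set B" and c: "c \<in> nz2 G B"
  shows "c \<in> extensional (simp B 2)" "x \<in> simp B 2 \<Longrightarrow> c x \<in> carrier G"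
    "y \<in> simp B 3 \<Longrightarrow> cob2 B c y = \<zero>"
    "z \<in> simp B 1 \<Longrightarrow> c (act B 1 [0, 0, 1] z) = \<zero>" "z \<in> simp B 1 \<Longrightarrow> c (act B 1 [0, 1, 1] z) = \<zero>"
  using c[unfolded nz2_iff[OF B]] by (auto simp only: PiE_iff)

lemma nz2I:
  assumes B: "simplicial_set B"
    and "c \<in> extensional (simp B 2)" "\<And>x. x \<in> simp B 2 \<Longrightarrow> c x \<in> carrier G"
    "\<And>y. y \<in> simp B 3 \<Longrightarrow> cob2 B c y = \<zero>"
    "\<And>z. z \<in> simp B 1 \<Longrightarrow> c (act B 1 [0, 0, 1] z) = \<zero>" "\<And>z. z \<in> simp B 1 \<Longrightarrow> c (act B 1 [0, 1, 1] z) = \<zero>"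
  shows "c \<in> nz2 G B"
  unfolding nz2_iff[OF B] PiE_iff using assms(2-) by blast

lemma faces_delta:
  "[1, 2, 3] \<in> delta 2 3" "[0, 2, 3] \<in> delta 2 3" "[0, 1, 3] \<in> delta 2 3" "[0, 1, 2] \<in> delta 2 3"
  "[0, 0, 1] \<in> delta 2 1" "[0, 1, 1] \<in> delta 2 1" "[0, 1, 2] \<in> delta 2 2" "[0, 1, 2, 3] \<in> delta 3 3"
  "[0, 1] \<in> delta 1 1"
  by (simp_all add: delta2_iff delta3_iff delta1_iff)

lemma toMap_smaps:
  assumes B: "simplicial_set B" and c: "c \<in> nz2 G B"
  shows "toMap B c \<in> smaps B (EM G 2)"
proof (rule smapsI)
  fix m x assume x: "x \<in> simp B m"
  have "(\<lambda>\<psi>\<in>delta 2 m. c (act B m \<psi> x)) \<in> nz2 G (std_simplex m)"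
  proof (rule nz2I[OF simplicial_set_std])
    fix \<psi> assume "\<psi> \<in> simp (std_simplex m) 2"
    then show "(\<lambda>\<psi>\<in>delta 2 m. c (act B m \<psi> x)) \<psi> \<in> carrier G"
      using nz2D(2)[OF B c] simplicial_setD(1)[OF B _ x] by simp
  next
    fix \<psi> assume "\<psi> \<in> simp (std_simplex m) 3"
    then have \<psi>: "\<psi> \<in> delta 3 m" by simp
    have e: "(\<lambda>\<psi>\<in>delta 2 m. c (act B m \<psi> x)) (act (std_simplex m) 3 \<theta> \<psi>) = c (act B 3 \<theta> (act B m \<psi> x))"
      if "\<theta> \<in> delta 2 3" for \<theta>
      using delta_comp[OF \<psi> that] simplicial_setD(3)[OF B \<psi> that x] by (simp del: map_map)
    show "(\<lambda>\<psi>\<in>delta 2 m. c (act B m \<psi> x)) (act (std_simplex m) 3 [1, 2, 3] \<psi>) \<ominus>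
         (\<lambda>\<psi>\<in>delta 2 m. c (act B m \<psi> x)) (act (std_simplex m) 3 [0, 2, 3] \<psi>) \<oplus>
         (\<lambda>\<psi>\<in>delta 2 m. c (act B m \<psi> x)) (act (std_simplex m) 3 [0, 1, 3] \<psi>) \<ominus>
         (\<lambda>\<psi>\<in>delta 2 m. c (act B m \<psi> x)) (act (std_simplex m) 3 [0, 1, 2] \<psi>) = \<zero>"
      unfolding e[OF faces_delta(1)] e[OF faces_delta(2)] e[OF faces_delta(3)] e[OF faces_delta(4)]
      by (rule nz2D(3)[OF B c simplicial_setD(1)[OF B \<psi> x]])
  next
    fix \<psi> assume "\<psi> \<in> simp (std_simplex m) 1"
    then have \<psi>: "\<psi> \<in> delta 1 m" by simp
    have e: "(\<lambda>\<psi>\<in>delta 2 m. c (act B m \<psi> x)) (act (std_simplex m) 1 \<theta> \<psi>) = c (act B 1 \<theta> (act B m \<psi> x))"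
      if "\<theta> \<in> delta 2 1" for \<theta>
      using delta_comp[OF \<psi> that] simplicial_setD(3)[OF B \<psi> that x] by (simp del: map_map)
    show "(\<lambda>\<psi>\<in>delta 2 m. c (act B m \<psi> x)) (act (std_simplex m) 1 [0, 0, 1] \<psi>) = \<zero>"
      unfolding e[OF faces_delta(5)] by (rule nz2D(4)[OF B c simplicial_setD(1)[OF B \<psi> x]])
    show "(\<lambda>\<psi>\<in>delta 2 m. c (act B m \<psi> x)) (act (std_simplex m) 1 [0, 1, 1] \<psi>) = \<zero>"
      unfolding e[OF faces_delta(6)] by (rule nz2D(5)[OF B c simplicial_setD(1)[OF B \<psi> x]])
  qed simp
  then show "toMap B c m x \<in> simp (EM G 2) m"
    unfolding simp_EM2 toMap_def restrict_apply'[OF x] .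
next
  fix m show "toMap B c m \<in> extensional (simp B m)" by (simp add: toMap_def)
next
  fix m n \<theta> x assume \<theta>: "\<theta> \<in> delta m n" and x: "x \<in> simp B n"
  show "toMap B c m (act B n \<theta> x) = act (EM G 2) n \<theta> (toMap B c n x)"
    unfolding act_EM2[OF \<theta>] toMap_def restrict_apply'[OF x] restrict_apply'[OF simplicial_setD(1)[OF B \<theta> x]]
    by (rule restrict_ext) (simp add: delta_comp[OF \<theta>] simplicial_setD(3)[OF B \<theta> _ x] del: map_map)
qed

definition ofMap :: "'s sset \<Rightarrow> (nat \<Rightarrow> 's \<Rightarrow> nat list \<Rightarrow> 'a) \<Rightarrow> 's \<Rightarrow> 'a" where
  "ofMap B F = (\<lambda>x\<in>simp B 2. F 2 x [0, 1, 2])"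

lemma map_nth_012: "\<psi> \<in> delta 2 m \<Longrightarrow> map ((!) \<psi>) [0, 1, 2] = \<psi>"
  using map_nth_id[of \<psi> 2 m] by (simp add: upt_rec numeral_2_eq_2)

lemma ofMap_act:
  assumes B: "simplicial_set B" and F: "F \<in> smaps B (EM G 2)" and x: "x \<in> simp B m" and \<psi>: "\<psi> \<in> delta 2 m"
  shows "ofMap B F (act B m \<psi> x) = F m x \<psi>"
proof -
  have "ofMap B F (act B m \<psi> x) = F 2 (act B m \<psi> x) [0, 1, 2]"
    unfolding ofMap_def restrict_apply'[OF simplicial_setD(1)[OF B \<psi> x]] ..
  also have "\<dots> = F m x (map ((!) \<psi>) [0, 1, 2])"
    unfolding smapsD(2)[OF F \<psi> x] act_EM2[OF \<psi>] restrict_apply'[OF faces_delta(7)] ..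
  finally show ?thesis unfolding map_nth_012[OF \<psi>] .
qed

lemma ofMap_nz2:
  assumes B: "simplicial_set B" and F: "F \<in> smaps B (EM G 2)"
  shows "ofMap B F \<in> nz2 G B"
proof -
  have Fm: "F m x \<in> nz2 G (std_simplex m)" if "x \<in> simp B m" for m x
    using smapsD(1)[OF F that] unfolding simp_EM2 .
  note D = nz2D[OF simplicial_set_std Fm]
  have s3: "act (std_simplex 3) 3 [1, 2, 3] [0, 1, 2, 3] = [1, 2, 3]" "act (std_simplex 3) 3 [0, 2, 3] [0, 1, 2, 3] = [0, 2, 3]"
    "act (std_simplex 3) 3 [0, 1, 3] [0, 1, 2, 3] = [0, 1, 3]" "act (std_simplex 3) 3 [0, 1, 2] [0, 1, 2, 3] = [0, 1, 2]"
    "act (std_simplex 1) 1 [0, 0, 1] [0, 1] = [0, 0, 1]" "act (std_simplex 1) 1 [0, 1, 1] [0, 1] = [0, 1, 1]"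
    by (simp_all add: std_simplex_def)
  have f: "[0, 1, 2, 3] \<in> simp (std_simplex 3) 3" "[0, 1] \<in> simp (std_simplex 1) 1" "[0, 1, 2] \<in> simp (std_simplex 2) 2"
    unfolding std_simps by (rule faces_delta)+
  note A = ofMap_act[OF B F]
  show ?thesis
  proof (rule nz2I[OF B])
    fix x assume x: "x \<in> simp B 2"
    show "ofMap B F x \<in> carrier G"
      unfolding ofMap_def restrict_apply'[OF x] by (rule D(2)[OF x f(3)])
  next
    fix y assume y: "y \<in> simp B 3"
    show "cob2 B (ofMap B F) y = \<zero>"
      unfolding A[OF y faces_delta(1)] A[OF y faces_delta(2)] A[OF y faces_delta(3)] A[OF y faces_delta(4)]
      using D(3)[OF y f(1)] unfolding s3 .
  next
    fix y assume y: "y \<in> simp B 1"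
    show "ofMap B F (act B 1 [0, 0, 1] y) = \<zero>" "ofMap B F (act B 1 [0, 1, 1] y) = \<zero>"
      unfolding A[OF y faces_delta(5)] A[OF y faces_delta(6)]
      using D(4,5)[OF y f(2)] unfolding s3 .
  qed (simp add: ofMap_def)
qed

lemma toMap_ofMap:
  assumes B: "simplicial_set B" and F: "F \<in> smaps B (EM G 2)"
  shows "toMap B (ofMap B F) = F"
proof (rule ext)
  fix m
  show "toMap B (ofMap B F) m = F m"
  proof (rule extensionalityI)
    show "toMap B (ofMap B F) m \<in> extensional (simp B m)" by (simp add: toMap_def)
    show "F m \<in> extensional (simp B m)" by (rule smapsD(3)[OF F])
    fix x assume x: "x \<in> simp B m"
    have "F m x \<in> nz2 G (std_simplex m)"
      using smapsD(1)[OF F x] unfolding simp_EM2 .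
    then have "F m x \<in> extensional (delta 2 m)"
      using nz2D(1)[OF simplicial_set_std] by fastforce
    then show "toMap B (ofMap B F) m x = F m x"
      by (intro extensionalityI[of _ "delta 2 m"]) (simp_all add: toMap_def x ofMap_act[OF B F x])
  qed
qed

lemma ofMap_toMap:
  assumes B: "simplicial_set B" and c: "c \<in> nz2 G B"
  shows "ofMap B (toMap B c) = c"
proof (rule extensionalityI[OF _ nz2D(1)[OF B c]])
  fix x assume x: "x \<in> simp B 2"
  have "[0, 1, 2] = [0..<2 + 1]" by (simp add: upt_rec)
  then show "ofMap B (toMap B c) x = c x"
    unfolding ofMap_def restrict_apply'[OF x] toMap_apply[OF x faces_delta(7)]
    using simplicial_setD(2)[OF B x] by simp
qed (simp add: ofMap_def)

end

section \<open>Copies, products and mapping spaces\<close>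

lemma simplicial_set_horn: "simplicial_set (horn k j)"
  unfolding simplicial_set_def
proof (intro conjI allI ballI)
  fix m n \<theta> \<phi> assume "\<theta> \<in> delta m n" "\<phi> \<in> simp (horn k j) n"
  then show "act (horn k j) n \<theta> \<phi> \<in> simp (horn k j) m"
    using horn_closed by (simp only: horn_simps(2))
qed (auto simp: map_nth_id map_nth_comp simp del: upt_Suc map_map)

lemma sisoI:
  assumes f: "f \<in> smaps S T" and g: "\<And>n y. y \<in> simp T n \<Longrightarrow> g n y \<in> simp S n"
    and fg: "\<And>n y. y \<in> simp T n \<Longrightarrow> f n (g n y) = y" and gf: "\<And>n x. x \<in> simp S n \<Longrightarrow> g n (f n x) = x"
  shows "siso S T"
  unfolding siso_def
proof (intro bexI[OF _ f] allI)
  fix n show "bij_betw (f n) (sset.simp S n) (sset.simp T n)"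
    by (rule bij_betw_byWitness[where f' = "g n"]) (use g fg gf smapsD(1)[OF f] in auto)
qed

lemma sisoE:
  assumes S: "simplicial_set S" and "siso S T"
  obtains f g where "f \<in> smaps S T" "g \<in> smaps T S"
    "\<And>n x. x \<in> simp S n \<Longrightarrow> g n (f n x) = x" "\<And>n y. y \<in> simp T n \<Longrightarrow> f n (g n y) = y"
proof -
  obtain f where f: "f \<in> smaps S T" and b: "\<And>n. bij_betw (f n) (sset.simp S n) (sset.simp T n)"
    using assms(2) unfolding siso_def by blast
  define g where "g = (\<lambda>n. \<lambda>y\<in>simp T n. inv_into (sset.simp S n) (f n) y)"
  have gf: "g n (f n x) = x" if "x \<in> simp S n" for n x
    using that bij_betw_imp_inj_on[OF b] smapsD(1)[OF f that] by (simp add: g_def)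
  have fg: "f n (g n y) = y" and gT: "g n y \<in> simp S n" if "y \<in> simp T n" for n y
    using that bij_betw_inv_into_right[OF b] bij_betw_apply[OF bij_betw_inv_into[OF b]] by (simp_all add: g_def)
  have "g \<in> smaps T S"
  proof (rule smapsI)
    fix m n \<theta> y assume \<theta>: "\<theta> \<in> delta m n" and y: "y \<in> simp T n"
    have "act T n \<theta> y = f m (act S n \<theta> (g n y))"
      using smapsD(2)[OF f \<theta> gT[OF y]] fg[OF y] by simp
    then show "g m (act T n \<theta> y) = act S n \<theta> (g n y)"
      using gf[OF simplicial_setD(1)[OF S \<theta> gT[OF y]]] by simp
  qed (auto simp: gT, simp add: g_def)
  then show thesis using that f gf fg by blast
qed

lemma siso_sym: "simplicial_set S \<Longrightarrow> siso S T \<Longrightarrow> siso T S"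
  by (erule (1) sisoE) (rule sisoI, auto dest: smapsD(1))

lemma siso_trans:
  assumes S: "simplicial_set S" and T: "simplicial_set T" and "siso S T" "siso T U"
  shows "siso S U"
proof -
  obtain f g where f: "f \<in> smaps S T" "g \<in> smaps T S"
    "\<And>n x. x \<in> simp S n \<Longrightarrow> g n (f n x) = x" "\<And>n y. y \<in> simp T n \<Longrightarrow> f n (g n y) = y"
    by (fact sisoE[OF S assms(3)])
  obtain h k where h: "h \<in> smaps T U" "k \<in> smaps U T"
    "\<And>n x. x \<in> simp T n \<Longrightarrow> k n (h n x) = x" "\<And>n y. y \<in> simp U n \<Longrightarrow> h n (k n y) = y"
    by (fact sisoE[OF T assms(4)])
  show ?thesis
    by (rule sisoI[OF smaps_scomp[OF f(1) h(1) S], of "\<lambda>n y. g n (k n y)"])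
      (simp_all add: scomp_def compose_def f(3,4) h(3,4) smapsD(1)[OF f(1)] smapsD(1)[OF f(2)] smapsD(1)[OF h(2)])
qed

lemma kanD: "kan S \<Longrightarrow> simplicial_set S"
  by (simp add: kan_def)

lemma kan_siso:
  assumes S: "simplicial_set S" and "siso S T" and T: "kan T"
  shows "kan S"
proof (rule kanI[OF S])
  obtain f g where f: "f \<in> smaps S T" "g \<in> smaps T S" "\<And>n x. x \<in> simp S n \<Longrightarrow> g n (f n x) = x"
    "\<And>n y. y \<in> simp T n \<Longrightarrow> f n (g n y) = y"
    by (fact sisoE[OF S assms(2)])
  fix k j :: nat and a assume k: "k \<ge> 1" "j \<le> k" and a: "a \<in> smaps (horn k j) S"
  obtain y where y: "y \<in> simp T k" "\<And>m \<phi>. \<phi> \<in> simp (horn k j) m \<Longrightarrow> act T k \<phi> y = scomp (horn k j) f a m \<phi>"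
    using kan_filler[OF T k smaps_scomp[OF a f(1) simplicial_set_horn]] by blast
  show "\<exists>x\<in>simp S k. \<forall>m. \<forall>\<phi>\<in>simp (horn k j) m. act S k \<phi> x = a m \<phi>"
  proof (intro bexI[of _ "g k y"] allI ballI)
    fix m \<phi> assume \<phi>: "\<phi> \<in> simp (horn k j) m"
    then have \<phi>': "\<phi> \<in> delta m k" by simp
    have "act S k \<phi> (g k y) = g m (scomp (horn k j) f a m \<phi>)"
      using smapsD(2)[OF f(2) \<phi>' y(1)] y(2)[OF \<phi>] by simp
    also have "\<dots> = g m (f m (a m \<phi>))" unfolding scomp_def compose_def restrict_apply'[OF \<phi>] ..
    finally show "act S k \<phi> (g k y) = a m \<phi>" using f(3)[OF smapsD(1)[OF a \<phi>]] by simp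
  qed (rule smapsD(1)[OF f(2) y(1)])
qed

section \<open>Products of Kan complexes\<close>

lemma act_sprod: "act (sprod S T) n \<theta> y = (act S n \<theta> (fst y), act T n \<theta> (snd y))"
  by (cases y) simp

abbreviation "sfst S T \<equiv> \<lambda>n. \<lambda>z\<in>simp (sprod S T) n. fst z"
abbreviation "ssnd S T \<equiv> \<lambda>n. \<lambda>z\<in>simp (sprod S T) n. snd z"

lemma sprod_fst: "simplicial_set S \<Longrightarrow> simplicial_set T \<Longrightarrow> sfst S T \<in> smaps (sprod S T) S"
  and sprod_snd: "simplicial_set S \<Longrightarrow> simplicial_set T \<Longrightarrow> ssnd S T \<in> smaps (sprod S T) T"
  by (rule smapsI; use simplicial_setD(1)[of S] simplicial_setD(1)[of T] in auto)+

lemma kan_sprod: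
  assumes S: "kan S" and T: "kan T" shows "kan (sprod S T)"
proof (rule kanI)
  show "simplicial_set (sprod S T)" by (rule simplicial_set_sprod[OF kanD[OF S] kanD[OF T]])
  fix k j :: nat and f assume k: "k \<ge> 1" "j \<le> k" and f: "f \<in> smaps (horn k j) (sprod S T)"
  note p = sprod_fst[OF kanD[OF S] kanD[OF T]] and q = sprod_snd[OF kanD[OF S] kanD[OF T]]
  obtain x where x: "x \<in> simp S k" "\<And>m \<phi>. \<phi> \<in> simp (horn k j) m \<Longrightarrow> act S k \<phi> x = scomp (horn k j) (sfst S T) f m \<phi>"
    using kan_filler[OF S k smaps_scomp[OF f p simplicial_set_horn]] by blast
  obtain y where y: "y \<in> simp T k" "\<And>m \<phi>. \<phi> \<in> simp (horn k j) m \<Longrightarrow> act T k \<phi> y = scomp (horn k j) (ssnd S T) f m \<phi>"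
    using kan_filler[OF T k smaps_scomp[OF f q simplicial_set_horn]] by blast
  show "\<exists>g\<in>simp (sprod S T) k. \<forall>m. \<forall>\<phi>\<in>simp (horn k j) m. act (sprod S T) k \<phi> g = f m \<phi>"
  proof (intro bexI[of _ "(x, y)"] allI ballI)
    fix m \<phi> assume \<phi>: "\<phi> \<in> simp (horn k j) m"
    then show "act (sprod S T) k \<phi> (x, y) = f m \<phi>"
      using smapsD(1)[OF f \<phi>] by (simp add: x(2)[OF \<phi>] y(2)[OF \<phi>] scomp_def compose_def del: horn_simps)
  qed (use x y in simp)
qed

text \<open>Each finite level embeds into an infinite type. Codes of different levels may overlap,
  which the encoding permits because operators are told the dimension of their argument and read
  that of the result off the length of the operator.\<close>

lemma ex_copy:
  fixes S :: "'a sset"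
  assumes inf: "infinite (UNIV :: 'u set)" and S: "simplicial_set S" and fin: "\<And>n. finite (sset.simp S n)"
  obtains Y :: "'u sset" where "simplicial_set Y" "siso Y S"
proof -
  have "\<exists>e :: 'a \<Rightarrow> 'u. inj_on e (sset.simp S n)" for n
  proof -
    obtain B :: "'u set" where "finite B" "card B = card (sset.simp S n)"
      using infinite_arbitrarily_large[OF inf] by blast
    then show ?thesis using finite_same_card_bij[OF fin] unfolding bij_betw_def by metis
  qed
  then obtain e :: "nat \<Rightarrow> 'a \<Rightarrow> 'u" where e: "\<And>n. inj_on (e n) (sset.simp S n)" by metis
  define d where "d = (\<lambda>n. inv_into (sset.simp S n) (e n))"
  have d: "d n (e n x) = x" if "x \<in> simp S n" for n x
    unfolding d_def by (rule inv_into_f_f[OF e that])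
  define Y where "Y = \<lparr>simp = (\<lambda>n. e n ` simp S n), act = (\<lambda>n \<theta> y. e (length \<theta> - 1) (act S n \<theta> (d n y)))\<rparr>"
  have Ys: "simp Y n = e n ` simp S n" for n by (simp add: Y_def)
  have Ya: "act Y n \<theta> (e n x) = e m (act S n \<theta> x)" if "\<theta> \<in> delta m n" "x \<in> simp S n" for m n \<theta> x
    using deltaD(1)[OF that(1)] d[OF that(2)] by (simp add: Y_def)
  have Y: "simplicial_set Y"
    unfolding simplicial_set_def
  proof (intro conjI allI ballI)
    fix m n \<theta> y assume \<theta>: "\<theta> \<in> delta m n" and "y \<in> simp Y n"
    then obtain x where x: "x \<in> simp S n" "y = e n x" unfolding Ys by blast
    show "act Y n \<theta> y \<in> simp Y m"
      unfolding x(2) Ya[OF \<theta> x(1)] Ys using simplicial_setD(1)[OF S \<theta> x(1)] by blast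
  next
    fix n y assume "y \<in> simp Y n"
    then obtain x where x: "x \<in> simp S n" "y = e n x" unfolding Ys by blast
    have "[0..<n + 1] \<in> delta n n" using delta_id by simp
    then show "act Y n [0..<n + 1] y = y"
      unfolding x(2) using Ya[OF _ x(1)] simplicial_setD(2)[OF S x(1)] by simp
  next
    fix l m n \<theta> \<phi> y assume \<theta>: "\<theta> \<in> delta m n" "\<phi> \<in> delta l m" and "y \<in> simp Y n"
    then obtain x where x: "x \<in> simp S n" "y = e n x" unfolding Ys by blast
    show "act Y m \<phi> (act Y n \<theta> y) = act Y n (map ((!) \<theta>) \<phi>) y"
      unfolding x(2) Ya[OF \<theta>(1) x(1)] Ya[OF \<theta>(2) simplicial_setD(1)[OF S \<theta>(1) x(1)]]
        Ya[OF delta_comp[OF \<theta>] x(1)] simplicial_setD(3)[OF S \<theta> x(1)] ..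
  qed
  have "(\<lambda>n. \<lambda>x\<in>simp S n. e n x) \<in> smaps S Y"
    by (rule smapsI) (auto simp: Ys Ya simplicial_setD(1)[OF S])
  then have "siso S Y"
    by (rule sisoI[where g = d]) (auto simp: Ys d)
  then show thesis using that[OF Y siso_sym[OF S]] by blast
qed

text \<open>Transport of \<open>weak_equiv_section\<close> along isomorphisms, since the nilpotent
  spaces live in the universe and the nerves do not.\<close>

lemma weak_equiv_section_copies:
  assumes Y: "simplicial_set Y" "siso Y S" and W: "simplicial_set W" "siso W T"
    and S: "simplicial_set S" and T: "simplicial_set T" and r: "r \<in> smaps T S" and s: "s \<in> smaps S T"
    and rs: "\<And>n x. x \<in> simp S n \<Longrightarrow> r n (s n x) = x"
    and hS: "\<And>n a b. (a, b) \<in> hrel S n \<Longrightarrow> a = b"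
    and hT: "\<And>n b b'. b \<in> simp T n \<Longrightarrow> b' \<in> simp T n \<Longrightarrow> r n b = r n b' \<Longrightarrow>
      (\<And>m \<phi>. \<phi> \<in> simp (bdry n) m \<Longrightarrow> act T n \<phi> b = act T n \<phi> b') \<Longrightarrow> (b, b') \<in> hrel T n"
  shows "\<exists>f. weak_equiv Y W f"
proof -
  obtain f g where f: "f \<in> smaps Y S" "g \<in> smaps S Y"
    "\<And>n x. x \<in> simp Y n \<Longrightarrow> g n (f n x) = x" "\<And>n y. y \<in> simp S n \<Longrightarrow> f n (g n y) = y"
    by (fact sisoE[OF Y])
  obtain h k where h: "h \<in> smaps W T" "k \<in> smaps T W"
    "\<And>n x. x \<in> simp W n \<Longrightarrow> k n (h n x) = x" "\<And>n y. y \<in> simp T n \<Longrightarrow> h n (k n y) = y"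
    by (fact sisoE[OF W])
  note fD = smapsD[OF f(1)] note gD = smapsD[OF f(2)] note hD = smapsD[OF h(1)] note kD = smapsD[OF h(2)]
  have rW: "scomp W g (scomp W r h) \<in> smaps W Y"
    by (intro smaps_scomp[OF _ f(2)] smaps_scomp[OF h(1) r] W(1))
  have sY: "scomp Y k (scomp Y s f) \<in> smaps Y W"
    by (intro smaps_scomp[OF _ h(2)] smaps_scomp[OF f(1) s] Y(1))
  have rW': "scomp W g (scomp W r h) n w = g n (r n (h n w))" if "w \<in> simp W n" for n w
    using that by (simp add: scomp_def compose_def)
  have sY': "scomp Y k (scomp Y s f) n y = k n (s n (f n y))" if "y \<in> simp Y n" for n y
    using that by (simp add: scomp_def compose_def)
  have "weak_equiv Y W (scomp Y k (scomp Y s f))"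
  proof (rule weak_equiv_section[OF Y(1) W(1) rW sY])
    fix n y assume y: "y \<in> simp Y n"
    note sy = smapsD(1)[OF s fD(1)[OF y]]
    show "scomp W g (scomp W r h) n (scomp Y k (scomp Y s f) n y) = y"
      unfolding sY'[OF y] rW'[OF kD(1)[OF sy]] h(4)[OF sy] rs[OF fD(1)[OF y]] by (rule f(3)[OF y])
  next
    fix n a b assume ab: "(a, b) \<in> hrel Y n"
    then have "a \<in> simp Y n" "b \<in> simp Y n" unfolding hrel_def by auto
    then show "a = b" using hS[OF hrel_map[OF f(1) ab]] f(3) by metis
  next
    fix n b b' assume b: "b \<in> simp W n" "b' \<in> simp W n"
      and req: "scomp W g (scomp W r h) n b = scomp W g (scomp W r h) n b'"
      and bd: "\<And>m \<phi>. \<phi> \<in> simp (bdry n) m \<Longrightarrow> act W n \<phi> b = act W n \<phi> b'"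
    have "r n (h n b) = r n (h n b')"
      using req f(4)[OF smapsD(1)[OF r hD(1)[OF b(1)]]] f(4)[OF smapsD(1)[OF r hD(1)[OF b(2)]]]
      unfolding rW'[OF b(1)] rW'[OF b(2)] by metis
    moreover have "act T n \<phi> (h n b) = act T n \<phi> (h n b')" if \<phi>: "\<phi> \<in> simp (bdry n) m" for m \<phi>
    proof -
      have \<phi>': "\<phi> \<in> delta m n" using \<phi> by simp
      show ?thesis unfolding hD(2)[OF \<phi>' b(1), symmetric] hD(2)[OF \<phi>' b(2), symmetric] bd[OF \<phi>] ..
    qed
    ultimately have "(h n b, h n b') \<in> hrel T n"
      using hT[OF hD(1)[OF b(1)] hD(1)[OF b(2)]] by blast
    from hrel_map[OF h(2) this] show "(b, b') \<in> hrel W n"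
      unfolding h(3)[OF b(1)] h(3)[OF b(2)] .
  qed
  then show ?thesis by blast
qed

subsection \<open>The simplicial set of one-cochains\<close>

text \<open>Contractible: it is the total space of the path fibration over \<open>K(M, 2)\<close>.\<close>

definition onecochains :: "('m, 'x) ring_scheme \<Rightarrow> (nat \<times> nat \<Rightarrow> 'm) sset" where
  "onecochains M = \<lparr>simp = (\<lambda>n. {c\<in>ipairs n \<rightarrow>\<^sub>E carrier M. \<forall>i\<le>n. c (i, i) = \<zero>\<^bsub>M\<^esub>}),
     act = act (nerve (add_monoid M))\<rparr>"

lemma act_onecochains [simp]: "act (onecochains M) = act (nerve (add_monoid M))"
  by (simp add: onecochains_def)

lemma onecochainsI:
  assumes "\<And>i j. i \<le> j \<Longrightarrow> j \<le> n \<Longrightarrow> c (i, j) \<in> carrier M" "c \<in> extensional (ipairs n)"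
    "\<And>i. i \<le> n \<Longrightarrow> c (i, i) = \<zero>\<^bsub>M\<^esub>"
  shows "c \<in> simp (onecochains M) n"
  using assms by (auto simp: onecochains_def PiE_iff ipairs_def)

lemma onecochainsD:
  assumes "c \<in> simp (onecochains M) n"
  shows "i \<le> j \<Longrightarrow> j \<le> n \<Longrightarrow> c (i, j) \<in> carrier M" "c \<in> extensional (ipairs n)"
    "i \<le> n \<Longrightarrow> c (i, i) = \<zero>\<^bsub>M\<^esub>"
  using assms by (auto simp: onecochains_def PiE_iff ipairs_def)

lemma onecochains_act_in:
  assumes "\<theta> \<in> delta m n" "c \<in> simp (onecochains M) n"
  shows "act (nerve (add_monoid M)) n \<theta> c \<in> simp (onecochains M) m"
  by (rule onecochainsI)
    (use onecochainsD[OF assms(2)] deltaD[OF assms(1)] in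
      \<open>auto simp: nerve_act_apply[OF assms(1)] nerve_act_ext[OF assms(1)]\<close>)

lemma simplicial_set_onecochains: "simplicial_set (onecochains M)"
  unfolding simplicial_set_def act_onecochains
proof (intro conjI allI ballI)
  fix l m n \<theta> \<phi> x
  assume *: "\<theta> \<in> delta m n" "\<phi> \<in> delta l m" "x \<in> simp (onecochains M) n"
  show "act (nerve (add_monoid M)) m \<phi> (act (nerve (add_monoid M)) n \<theta> x) = act (nerve (add_monoid M)) n (map ((!) \<theta>) \<phi>) x"
    by (rule nerve_eqI[OF nerve_act_ext[OF *(2)] nerve_act_ext[OF delta_comp[OF *(1,2)]]])
      (use deltaD[OF *(2)] in \<open>auto simp: nerve_act_apply[OF *(1)] nerve_act_apply[OF *(2)] nerve_act_apply[OF delta_comp[OF *(1,2)]]\<close>)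
next
  fix n x assume x: "x \<in> simp (onecochains M) n"
  have i: "[0..<Suc n] \<in> delta n n" by (rule delta_id)
  show "act (nerve (add_monoid M)) n [0..<n + 1] x = x"
    unfolding Suc_eq_plus1[symmetric]
    by (rule nerve_eqI[OF nerve_act_ext[OF i] onecochainsD(2)[OF x]])
      (use nerve_act_apply[OF i] in \<open>simp del: upt_Suc\<close>)
qed (rule onecochains_act_in)

text \<open>The one-cochains form a simplicial abelian group, and
  \<open>a \<oplus> b \<ominus> c\<close> is a natural Mal'cev operation on it.\<close>

lemma (in abelian_group) kan_onecochains: "kan (onecochains G)"
proof (rule kanI[OF simplicial_set_onecochains])
  fix k j :: nat and f assume j: "j \<le> k" and f: "f \<in> smaps (horn k j) (onecochains G)"
  show "\<exists>g\<in>simp (onecochains G) k. \<forall>m. \<forall>\<phi>\<in>simp (horn k j) m. act (onecochains G) k \<phi> g = f m \<phi>"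
  proof (rule malcev_filler[OF simplicial_set_onecochains _ _ _ _ _ j f,
        where t = "\<lambda>n a b c. \<lambda>(i, j)\<in>ipairs n. a (i, j) \<oplus> b (i, j) \<ominus> c (i, j)"])
    have "(\<lambda>_\<in>ipairs k. \<zero>) \<in> simp (onecochains G) k"
      by (rule onecochainsI) (auto simp: ipairs_def)
    then show "simp (onecochains G) k \<noteq> {}" by blast
  next
    fix n a b c assume "a \<in> simp (onecochains G) n" "b \<in> simp (onecochains G) n" "c \<in> simp (onecochains G) n"
    note D = onecochainsD[OF this(1)] onecochainsD[OF this(2)] onecochainsD[OF this(3)]
    show "(\<lambda>(i, j)\<in>ipairs n. a (i, j) \<oplus> b (i, j) \<ominus> c (i, j)) \<in> simp (onecochains G) n"
      by (rule onecochainsI) (use D in \<open>auto simp: ipairs_def minus_eq\<close>)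
  next
    fix m n \<theta> a b c assume \<theta>: "\<theta> \<in> delta m n"
    show "act (onecochains G) n \<theta> (\<lambda>(i, j)\<in>ipairs n. a (i, j) \<oplus> b (i, j) \<ominus> c (i, j)) =
      (\<lambda>(i, j)\<in>ipairs m. act (onecochains G) n \<theta> a (i, j) \<oplus> act (onecochains G) n \<theta> b (i, j) \<ominus> act (onecochains G) n \<theta> c (i, j))"
      unfolding act_onecochains
      by (rule nerve_eqI[OF nerve_act_ext[OF \<theta>]])
        (use deltaD[OF \<theta>] in \<open>auto simp: nerve_act_apply[OF \<theta>] ipairs_def\<close>)
  next
    fix n a b assume "a \<in> simp (onecochains G) n" "b \<in> simp (onecochains G) n"
    note D = onecochainsD[OF this(1)] onecochainsD[OF this(2)]
    have id: "x \<oplus> y \<ominus> x = y" "x \<oplus> y \<ominus> y = x" if "x \<in> carrier G" "y \<in> carrier G" for x y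
      using that by algebra+
    show "(\<lambda>(i, j)\<in>ipairs n. a (i, j) \<oplus> b (i, j) \<ominus> a (i, j)) = b"
      by (rule nerve_eqI[OF _ D(5)]) (use D in \<open>auto simp: ipairs_def id\<close>)
    show "(\<lambda>(i, j)\<in>ipairs n. a (i, j) \<oplus> b (i, j) \<ominus> b (i, j)) = a"
      by (rule nerve_eqI[OF _ D(2)]) (use D in \<open>auto simp: ipairs_def id\<close>)
  qed
qed

text \<open>One-cochains satisfy no cocycle condition, so the homotopy may jump: an edge takes its
  value from \<open>c\<close> if it starts over 0 and from \<open>c'\<close> if it starts over 1. On
  the boundary both agree, and the homotopy is constant there.\<close>

lemma hrel_sprod_onecochains:
  assumes S: "simplicial_set S" and q: "q \<in> simp S n" and c: "c \<in> simp (onecochains M) n" "c' \<in> simp (onecochains M) n"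
    and bd: "\<And>m \<phi>. \<phi> \<in> simp (bdry n) m \<Longrightarrow> act (onecochains M) n \<phi> c = act (onecochains M) n \<phi> c'"
  shows "((q, c), (q, c')) \<in> hrel (sprod S (onecochains M)) n"
proof -
  let ?N = "nerve (add_monoid M)"
  define E where "E = (\<lambda>m \<phi> \<tau>. \<lambda>(i, j)\<in>ipairs m. if \<tau> ! i = (0::nat) then c (\<phi> ! i, \<phi> ! j) else c' (\<phi> ! i, \<phi> ! j))"
  have E_apply: "E m \<phi> \<tau> (i, j) = (if \<tau> ! i = 0 then c (\<phi> ! i, \<phi> ! j) else c' (\<phi> ! i, \<phi> ! j))" if "i \<le> j" "j \<le> m" for m \<phi> \<tau> i j
    using that by (simp add: E_def ipairs_def)
  have E_ext: "E m \<phi> \<tau> \<in> extensional (ipairs m)" for m \<phi> \<tau> by (simp add: E_def)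
  have E_in: "E m \<phi> \<tau> \<in> simp (onecochains M) m" if "\<phi> \<in> delta m n" for m \<phi> \<tau>
    by (rule onecochainsI[OF _ E_ext]) (use onecochainsD[OF c(1)] onecochainsD[OF c(2)] deltaD[OF that] in \<open>auto simp: E_apply\<close>)
  have E_act: "E l (map ((!) \<phi>) \<theta>) (map ((!) \<tau>) \<theta>) = act ?N m \<theta> (E m \<phi> \<tau>)" if \<theta>: "\<theta> \<in> delta l m" for l m \<theta> \<phi> \<tau>
    by (rule nerve_eqI[OF E_ext nerve_act_ext[OF \<theta>]])
      (use deltaD[OF \<theta>] in \<open>auto simp: nerve_act_apply[OF \<theta>] E_apply\<close>)
  show ?thesis
  proof (rule hrelI[where h = "\<lambda>m. \<lambda>(\<phi>, \<tau>)\<in>delta m n \<times> delta m 1. (act S n \<phi> q, E m \<phi> \<tau>)"])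
    show "(\<lambda>m. \<lambda>(\<phi>, \<tau>)\<in>delta m n \<times> delta m 1. (act S n \<phi> q, E m \<phi> \<tau>)) \<in> smaps (prism n) (sprod S (onecochains M))"
      by (rule smapsI) (auto simp: delta_comp simplicial_setD(1)[OF S _ q] simplicial_setD(3)[OF S _ _ q] E_in E_act simp del: map_map)
  next
    fix m \<phi> assume \<phi>: "\<phi> \<in> delta m n"
    have 0: "E m \<phi> (replicate (m + 1) 0) = act ?N n \<phi> c"
      by (rule nerve_eqI[OF E_ext nerve_act_ext[OF \<phi>]]) (auto simp: nerve_act_apply[OF \<phi>] E_apply simp del: replicate_Suc)
    have 1: "E m \<phi> (replicate (m + 1) 1) = act ?N n \<phi> c'"
      by (rule nerve_eqI[OF E_ext nerve_act_ext[OF \<phi>]]) (auto simp: nerve_act_apply[OF \<phi>] E_apply simp del: replicate_Suc)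
    have r: "(\<phi>, replicate (m + 1) (0::nat)) \<in> delta m n \<times> delta m 1" "(\<phi>, replicate (m + 1) (1::nat)) \<in> delta m n \<times> delta m 1"
      using \<phi> replicate_delta[of 0 1 m] replicate_delta[of 1 1 m] by blast+
    show "(\<lambda>(\<phi>, \<tau>)\<in>delta m n \<times> delta m 1. (act S n \<phi> q, E m \<phi> \<tau>)) (\<phi>, replicate (m + 1) 0) = act (sprod S (onecochains M)) n \<phi> (q, c)"
      unfolding restrict_apply'[OF r(1)] by (simp add: 0[simplified])
    show "(\<lambda>(\<phi>, \<tau>)\<in>delta m n \<times> delta m 1. (act S n \<phi> q, E m \<phi> \<tau>)) (\<phi>, replicate (m + 1) 1) = act (sprod S (onecochains M)) n \<phi> (q, c')"
      unfolding restrict_apply'[OF r(2)] by (simp add: 1[simplified])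
  next
    fix m \<phi> \<tau> assume \<phi>: "\<phi> \<in> simp (bdry n) m" and \<tau>: "\<tau> \<in> delta m 1"
    have \<phi>': "\<phi> \<in> delta m n" using \<phi> by simp
    have eq: "c (\<phi> ! i, \<phi> ! j) = c' (\<phi> ! i, \<phi> ! j)" if "i \<le> j" "j \<le> m" for i j
      using fun_cong[OF bd[OF \<phi>], of "(i, j)"] unfolding act_onecochains nerve_act_apply[OF \<phi>' that] .
    have "E m \<phi> \<tau> = act ?N n \<phi> c"
      by (rule nerve_eqI[OF E_ext nerve_act_ext[OF \<phi>']]) (auto simp: nerve_act_apply[OF \<phi>'] E_apply eq)
    then show "(\<lambda>(\<phi>, \<tau>)\<in>delta m n \<times> delta m 1. (act S n \<phi> q, E m \<phi> \<tau>)) (\<phi>, \<tau>) = act (sprod S (onecochains M)) n \<phi> (q, c)"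
      using \<phi>' \<tau> by simp
  qed (use q c in simp_all)
qed

subsection \<open>Restriction of mapping spaces\<close>

lemma simp_mapsp [simp]: "simp (mapsp B A) n = smaps (sprod (std_simplex n) B) A"
  by (simp add: mapsp_def)

lemma act_mapsp:
  "\<theta> \<in> delta m n \<Longrightarrow> act (mapsp B A) n \<theta> f l = (\<lambda>(\<phi>, b)\<in>delta l m \<times> simp B l. f l (map ((!) \<theta>) \<phi>, b))"
  using deltaD(1)[of \<theta> m n] by (simp add: mapsp_def)

lemma mapsp_restr_smaps:
  assumes B: "simplicial_set B" and C: "simplicial_set C" and CB: "\<And>n. simp C n \<subseteq> simp B n" "act C = act B"
  shows "mapsp_restr C B A \<in> smaps (mapsp B A) (mapsp C A)"
proof (rule smapsI)
  fix n y assume "y \<in> simp (mapsp B A) n"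
  then have y: "y \<in> smaps (sprod (std_simplex n) B) A" by simp
  show "mapsp_restr C B A n y \<in> simp (mapsp C A) n"
    unfolding simp_mapsp
  proof (rule smapsI)
    fix l x assume x: "x \<in> simp (sprod (std_simplex n) C) l"
    then have x': "x \<in> simp (sprod (std_simplex n) B) l" using CB(1) by auto
    show "mapsp_restr C B A n y l x \<in> simp A l"
      using smapsD(1)[OF y x'] x y by (simp add: mapsp_restr_def)
  next
    fix k l \<theta> x assume \<theta>: "\<theta> \<in> delta k l" and x: "x \<in> simp (sprod (std_simplex n) C) l"
    then have x': "x \<in> simp (sprod (std_simplex n) B) l" using CB(1) by auto
    have "act (sprod (std_simplex n) C) l \<theta> x \<in> simp (sprod (std_simplex n) C) k"
      by (rule simplicial_setD(1)[OF simplicial_set_sprod[OF simplicial_set_std C] \<theta> x])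
    moreover have "act (sprod (std_simplex n) C) l \<theta> x = act (sprod (std_simplex n) B) l \<theta> x"
      by (simp add: act_sprod CB(2))
    ultimately show "mapsp_restr C B A n y k (act (sprod (std_simplex n) C) l \<theta> x) = act A l \<theta> (mapsp_restr C B A n y l x)"
      using smapsD(2)[OF y \<theta> x'] x y by (simp add: mapsp_restr_def)
  qed (simp add: mapsp_restr_def y)
next
  fix m n \<theta> y assume \<theta>: "\<theta> \<in> delta m n" and "y \<in> simp (mapsp B A) n"
  then have y: "y \<in> smaps (sprod (std_simplex n) B) A" by simp
  have "act (mapsp B A) n \<theta> y \<in> smaps (sprod (std_simplex m) B) A"
  proof (rule smapsI)
    fix l x assume "x \<in> simp (sprod (std_simplex m) B) l"
    then obtain \<phi> b where x: "x = (\<phi>, b)" "\<phi> \<in> delta l m" "b \<in> simp B l" by auto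
    then show "act (mapsp B A) n \<theta> y l x \<in> simp A l"
      unfolding act_mapsp[OF \<theta>] using smapsD(1)[OF y, of "(map ((!) \<theta>) \<phi>, b)" l] delta_comp[OF \<theta> x(2)] by simp
  next
    show "act (mapsp B A) n \<theta> y l \<in> extensional (simp (sprod (std_simplex m) B) l)" for l
      unfolding act_mapsp[OF \<theta>] by simp
  next
    fix k l \<psi> x assume \<psi>: "\<psi> \<in> delta k l" and "x \<in> simp (sprod (std_simplex m) B) l"
    then obtain \<phi> b where x: "x = (\<phi>, b)" "\<phi> \<in> delta l m" "b \<in> simp B l" by auto
    have bB: "act B l \<psi> b \<in> simp B k" by (rule simplicial_setD(1)[OF B \<psi> x(3)])
    show "act (mapsp B A) n \<theta> y k (act (sprod (std_simplex m) B) l \<psi> x) = act A l \<psi> (act (mapsp B A) n \<theta> y l x)"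
      using smapsD(2)[OF y \<psi>, of "(map ((!) \<theta>) \<phi>, b)"] delta_comp[OF \<theta> x(2)] delta_comp[OF x(2) \<psi>] x bB
      by (simp add: act_mapsp[OF \<theta>] map_nth_comp[OF x(2) \<psi>] del: map_map)
  qed
  then show "mapsp_restr C B A m (act (mapsp B A) n \<theta> y) = act (mapsp C A) n \<theta> (mapsp_restr C B A n y)"
    using y CB(1) delta_comp[OF \<theta>]
    by (auto simp: mapsp_restr_def act_mapsp[OF \<theta>] fun_eq_iff)
qed (simp add: mapsp_restr_def)

section \<open>Central extensions\<close>

text \<open>Nilpotency is defined for spaces in the universe \<open>'u\<close>, whereas nerves have
  simplices of another type; the property is therefore stated for all isomorphic copies in
  \<open>'u\<close>.\<close>

definition copies_nilpotent :: "'u itself \<Rightarrow> 'k sset set \<Rightarrow> 'a sset \<Rightarrow> bool" where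
  "copies_nilpotent U K S \<longleftrightarrow> (\<forall>Y :: 'u sset. simplicial_set Y \<longrightarrow> siso Y S \<longrightarrow> nilpotent K Y)"

lemma finite_ipairs: "finite (ipairs n)"
  by (rule finite_subset[of _ "{..n} \<times> {..n}"]) (auto simp: ipairs_def)

lemma finite_nerve: "finite (carrier Q) \<Longrightarrow> finite (simp (nerve Q) n)"
  by (rule finite_subset[of _ "ipairs n \<rightarrow>\<^sub>E carrier Q"]) (auto simp: nerve_def finite_ipairs intro!: finite_PiE)

lemma finite_onecochains: "finite (carrier M) \<Longrightarrow> finite (simp (onecochains M) n)"
  by (rule finite_subset[of _ "ipairs n \<rightarrow>\<^sub>E carrier M"]) (auto simp: onecochains_def finite_ipairs intro!: finite_PiE)

text \<open>Keeps the vertex \<open>1\<close> of \<open>\<Delta>\<^sup>1\<close> a numeral.\<close>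

declare One_nat_def [simp del]

lemma tau_cases:
  assumes "a \<le> b" "b \<le> c" "c \<le> (1::nat)"
  obtains "a = 0" "b = 0" "c = 0" | "a = 0" "b = 0" "c = 1" | "a = 0" "b = 1" "c = 1" | "a = 1" "b = 1" "c = 1"
  using assms by linarith

lemma bdry_1_cases:
  assumes "\<tau> \<in> simp (bdry 1) l"
  obtains "\<And>i. i \<le> l \<Longrightarrow> \<tau> ! i = 0" | "\<And>i. i \<le> l \<Longrightarrow> \<tau> ! i = 1"
proof -
  have s: "set \<tau> \<subseteq> {..1}" "set \<tau> \<noteq> {..1}" and l: "length \<tau> = Suc l"
    using assms by (auto simp: delta_def)
  have e: "{..1::nat} = {0, 1}" by auto
  have "\<tau> ! i \<in> set \<tau>" if "i \<le> l" for i using that l by simp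
  then have "\<tau> ! i = 0 \<or> \<tau> ! i = 1" "\<tau> ! i \<in> set \<tau>" if "i \<le> l" for i
    using that s(1) unfolding e by blast+
  moreover have "0 \<notin> set \<tau> \<or> 1 \<notin> set \<tau>" using s unfolding e by blast
  ultimately have "(\<forall>i\<le>l. \<tau> ! i = 0) \<or> (\<forall>i\<le>l. \<tau> ! i = 1)" by metis
  then show thesis using that by blast
qed

lemma bdry_1_subset: "simp (bdry 1) l \<subseteq> simp (std_simplex 1) l"
  by auto

lemma const_in_bdry_1: "[0, 0, 0] \<in> simp (bdry 1) 2" "[1, 1, 1] \<in> simp (bdry 1) 2"
proof -
  have "{..1::nat} = {0, 1}" by auto
  then show "[0, 0, 0] \<in> simp (bdry 1) 2" "[1, 1, 1] \<in> simp (bdry 1) 2" by (simp_all add: delta2_iff)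
qed

text \<open>A central extension of \<open>Q'\<close> by \<open>M\<close> with a set-theoretic
  section \<open>\<sigma>\<close>. The section is normalized at the unit so that the resulting
  cocycle is normalized and defines a map to \<open>K(M, 2)\<close>.\<close>

locale central_ext = abelian_group M + Q: group Q + Q': group Q'
  for M (structure) and Q and Q' +
  fixes \<pi> and \<sigma> and \<iota>
  assumes pi_hom: "\<pi> \<in> hom Q Q'"
    and sigma_closed: "x \<in> carrier Q' \<Longrightarrow> \<sigma> x \<in> carrier Q" and pi_sigma: "x \<in> carrier Q' \<Longrightarrow> \<pi> (\<sigma> x) = x"
    and sigma_one: "\<sigma> \<one>\<^bsub>Q'\<^esub> = \<one>\<^bsub>Q\<^esub>"
    and iota_bij: "bij_betw \<iota> (carrier M) {q\<in>carrier Q. \<pi> q = \<one>\<^bsub>Q'\<^esub>}"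
    and iota_add: "a \<in> carrier M \<Longrightarrow> b \<in> carrier M \<Longrightarrow> \<iota> (a \<oplus> b) = \<iota> a \<otimes>\<^bsub>Q\<^esub> \<iota> b"
    and central: "a \<in> carrier M \<Longrightarrow> q \<in> carrier Q \<Longrightarrow> \<iota> a \<otimes>\<^bsub>Q\<^esub> q = q \<otimes>\<^bsub>Q\<^esub> \<iota> a"
begin

lemma iota_closed [simp]: "a \<in> carrier M \<Longrightarrow> \<iota> a \<in> carrier Q"
  and pi_iota: "a \<in> carrier M \<Longrightarrow> \<pi> (\<iota> a) = \<one>\<^bsub>Q'\<^esub>"
  using bij_betw_apply[OF iota_bij] by auto

declare sigma_closed [simp]

lemma pi_closed [simp]: "q \<in> carrier Q \<Longrightarrow> \<pi> q \<in> carrier Q'"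
  using pi_hom by (auto simp: hom_def)

lemma pi_mult: "q \<in> carrier Q \<Longrightarrow> r \<in> carrier Q \<Longrightarrow> \<pi> (q \<otimes>\<^bsub>Q\<^esub> r) = \<pi> q \<otimes>\<^bsub>Q'\<^esub> \<pi> r"
  using pi_hom by (auto simp: hom_def)

lemma iota_zero: "\<iota> \<zero> = \<one>\<^bsub>Q\<^esub>"
  using iota_add[of \<zero> \<zero>] Q.l_cancel_one'[of "\<iota> \<zero>" "\<iota> \<zero>"] by simp

lemma pi_inv: "q \<in> carrier Q \<Longrightarrow> \<pi> (inv\<^bsub>Q\<^esub> q) = inv\<^bsub>Q'\<^esub> (\<pi> q)"
  by (rule group_hom.hom_inv[of Q Q' \<pi>]) (simp_all add: group_hom_def group_hom_axioms_def Q.is_group Q'.is_group pi_hom)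

text \<open>The fibre coordinate: every \<open>q\<close> is \<open>\<iota> (u q)\<close> times
  \<open>\<sigma> (\<pi> q)\<close>, which identifies \<open>Q\<close> with
  \<open>M \<times> Q'\<close> as a set.\<close>

definition u where "u q = inv_into (carrier M) \<iota> (q \<otimes>\<^bsub>Q\<^esub> inv\<^bsub>Q\<^esub> (\<sigma> (\<pi> q)))"

lemma u_closed [simp]: "q \<in> carrier Q \<Longrightarrow> u q \<in> carrier M"
  and u_decomp: "q \<in> carrier Q \<Longrightarrow> \<iota> (u q) \<otimes>\<^bsub>Q\<^esub> \<sigma> (\<pi> q) = q"
proof -
  assume q: "q \<in> carrier Q"
  have k: "q \<otimes>\<^bsub>Q\<^esub> inv\<^bsub>Q\<^esub> (\<sigma> (\<pi> q)) \<in> {q\<in>carrier Q. \<pi> q = \<one>\<^bsub>Q'\<^esub>}"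
    using q by (simp add: pi_mult pi_inv pi_sigma)
  show "u q \<in> carrier M"
    unfolding u_def using bij_betw_apply[OF bij_betw_inv_into[OF iota_bij] k] .
  show "\<iota> (u q) \<otimes>\<^bsub>Q\<^esub> \<sigma> (\<pi> q) = q"
    unfolding u_def bij_betw_inv_into_right[OF iota_bij k] using q by (simp add: Q.m_assoc)
qed

lemma pi_decomp: "a \<in> carrier M \<Longrightarrow> x \<in> carrier Q' \<Longrightarrow> \<pi> (\<iota> a \<otimes>\<^bsub>Q\<^esub> \<sigma> x) = x"
  by (simp add: pi_mult pi_iota pi_sigma)

lemma u_eqI: "a \<in> carrier M \<Longrightarrow> x \<in> carrier Q' \<Longrightarrow> u (\<iota> a \<otimes>\<^bsub>Q\<^esub> \<sigma> x) = a"
  unfolding u_def pi_decomp using bij_betw_imp_inj_on[OF iota_bij]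
  by (simp add: Q.m_assoc)

text \<open>The factor set of the extension: \<open>\<sigma> x\<close> times
  \<open>\<sigma> y\<close> differs from \<open>\<sigma> (x y)\<close> by
  \<open>\<iota> (\<kappa> x y)\<close>.\<close>

definition \<kappa> where "\<kappa> x y = u (\<sigma> x \<otimes>\<^bsub>Q\<^esub> \<sigma> y)"

lemma kappa_closed [simp]: "x \<in> carrier Q' \<Longrightarrow> y \<in> carrier Q' \<Longrightarrow> \<kappa> x y \<in> carrier M"
  by (simp add: \<kappa>_def)

lemma ext_mult:
  assumes a: "a \<in> carrier M" "b \<in> carrier M" and x: "x \<in> carrier Q'" "y \<in> carrier Q'"
  shows "(\<iota> a \<otimes>\<^bsub>Q\<^esub> \<sigma> x) \<otimes>\<^bsub>Q\<^esub> (\<iota> b \<otimes>\<^bsub>Q\<^esub> \<sigma> y) = \<iota> (a \<oplus> b \<oplus> \<kappa> x y) \<otimes>\<^bsub>Q\<^esub> \<sigma> (x \<otimes>\<^bsub>Q'\<^esub> y)"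
proof -
  have "\<sigma> x \<otimes>\<^bsub>Q\<^esub> \<sigma> y = \<iota> (\<kappa> x y) \<otimes>\<^bsub>Q\<^esub> \<sigma> (x \<otimes>\<^bsub>Q'\<^esub> y)"
    using u_decomp[of "\<sigma> x \<otimes>\<^bsub>Q\<^esub> \<sigma> y"] x by (simp add: \<kappa>_def pi_mult pi_sigma)
  then have "(\<iota> a \<otimes>\<^bsub>Q\<^esub> \<iota> b) \<otimes>\<^bsub>Q\<^esub> (\<sigma> x \<otimes>\<^bsub>Q\<^esub> \<sigma> y) = \<iota> (a \<oplus> b \<oplus> \<kappa> x y) \<otimes>\<^bsub>Q\<^esub> \<sigma> (x \<otimes>\<^bsub>Q'\<^esub> y)"
    using a x by (simp add: iota_add Q.m_assoc)
  moreover have "(\<iota> a \<otimes>\<^bsub>Q\<^esub> \<sigma> x) \<otimes>\<^bsub>Q\<^esub> (\<iota> b \<otimes>\<^bsub>Q\<^esub> \<sigma> y) = \<iota> a \<otimes>\<^bsub>Q\<^esub> (\<sigma> x \<otimes>\<^bsub>Q\<^esub> \<iota> b) \<otimes>\<^bsub>Q\<^esub> \<sigma> y"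
    using a x by (simp add: Q.m_assoc)
  moreover have "\<sigma> x \<otimes>\<^bsub>Q\<^esub> \<iota> b = \<iota> b \<otimes>\<^bsub>Q\<^esub> \<sigma> x" using central[OF a(2)] x by simp
  ultimately show ?thesis using a x by (simp add: Q.m_assoc)
qed

text \<open>Pulled back to \<open>Q\<close>, the factor set is the coboundary of \<open>-u\<close>;
  this is the origin of the sign in \<open>vv\<close>.\<close>

lemma u_mult:
  assumes "q \<in> carrier Q" "r \<in> carrier Q"
  shows "u (q \<otimes>\<^bsub>Q\<^esub> r) = u q \<oplus> u r \<oplus> \<kappa> (\<pi> q) (\<pi> r)"
  using ext_mult[of "u q" "u r" "\<pi> q" "\<pi> r"] u_eqI[of "u q \<oplus> u r \<oplus> \<kappa> (\<pi> q) (\<pi> r)" "\<pi> q \<otimes>\<^bsub>Q'\<^esub> \<pi> r"] assms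
  by (simp add: u_decomp)

lemma u_one: "u \<one>\<^bsub>Q\<^esub> = \<zero>"
  using u_eqI[of \<zero> "\<one>\<^bsub>Q'\<^esub>"] by (simp add: iota_zero sigma_one)

text \<open>
  The coboundary of \<open>vv q c\<close> vanishes on \<open>\<Delta>\<^sup>n \<times> {0}\<close> and is the class of the extension on \<open>\<Delta>\<^sup>n \<times> {1}\<close>.
\<close>

definition vv where
  "vv q c i j a b = (if b = (0::nat) then \<zero> else if a = (0::nat) then c (i, j) else \<ominus> u (q (i, j)))"

abbreviation hh where "hh n q c \<equiv> dv n (vv q c)"

lemma hh_apply:
  assumes "q \<in> simp (nerve Q) n" "c \<in> simp (onecochains M) n" "i \<le> j" "j \<le> l" "l \<le> n"
  shows "hh n q c ([i, j, l], [0, 0, 0]) = \<zero>"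
    "hh n q c ([i, j, l], [0, 0, 1]) = c (j, l) \<ominus> c (i, l)"
    "hh n q c ([i, j, l], [0, 1, 1]) = \<ominus> u (q (j, l)) \<ominus> c (i, l) \<oplus> c (i, j)"
    "hh n q c ([i, j, l], [1, 1, 1]) = \<kappa> (\<pi> (q (i, j))) (\<pi> (q (j, l)))"
proof -
  note D = nerve_simpD[OF assms(1)] onecochainsD[OF assms(2)]
  have *: "q (i, j) \<in> carrier Q" "q (j, l) \<in> carrier Q" "q (i, j) \<otimes>\<^bsub>Q\<^esub> q (j, l) = q (i, l)"
    "c (j, l) \<in> carrier M" "c (i, l) \<in> carrier M" "c (i, j) \<in> carrier M"
    using D(1,4,5) assms(3-5) by auto
  have id: "\<ominus> y \<ominus> \<ominus> (x \<oplus> y \<oplus> z) \<oplus> \<ominus> x = z" if "x \<in> carrier M" "y \<in> carrier M" "z \<in> carrier M" for x y z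
    using that by algebra
  show "hh n q c ([i, j, l], [1, 1, 1]) = \<kappa> (\<pi> (q (i, j))) (\<pi> (q (j, l)))"
    using id[of "u (q (i, j))" "u (q (j, l))" "\<kappa> (\<pi> (q (i, j))) (\<pi> (q (j, l)))"] u_mult[OF *(1,2)] * assms(3-5)
    by (simp add: dv_apply vv_def)
qed (use assms(3-5) onecochainsD(1)[OF assms(2)] in \<open>simp_all add: dv_apply vv_def minus_eq\<close>)

lemma hh_PZ:
  assumes "q \<in> simp (nerve Q) n" "c \<in> simp (onecochains M) n"
  shows "hh n q c \<in> PZ n"
proof (rule dv_PZ)
  note D = nerve_simpD[OF assms(1)] onecochainsD[OF assms(2)]
  show "vv q c i j a b \<in> carrier M" if "i \<le> j" "j \<le> n" "a \<le> b" "b \<le> 1" for i j a b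
    using that D by (auto simp: vv_def)
  show "vv q c i i a a = \<zero>" if "i \<le> n" "a \<le> 1" for i a
    using that D by (auto simp: vv_def u_one)
qed

lemma hh_nat:
  assumes \<theta>: "\<theta> \<in> delta m n" and \<phi>: "\<phi> \<in> delta 2 m" and \<tau>: "\<tau> \<in> delta 2 1"
  shows "hh m (act (nerve Q) n \<theta> q) (act (nerve (add_monoid M)) n \<theta> c) (\<phi>, \<tau>) = hh n q c (map ((!) \<theta>) \<phi>, \<tau>)"
proof -
  obtain i j l where 1: "\<phi> = [i, j, l]" "i \<le> j" "j \<le> l" "l \<le> m" using delta2E[OF \<phi>] .
  obtain a b d where 2: "\<tau> = [a, b, d]" "a \<le> b" "b \<le> d" "d \<le> 1" using delta2E[OF \<tau>] .
  have "\<theta> ! i \<le> \<theta> ! j" "\<theta> ! j \<le> \<theta> ! l" "\<theta> ! l \<le> n" using deltaD[OF \<theta>] 1 by auto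
  then show ?thesis
    unfolding 1(1) 2(1) using 1 2 by (simp add: dv_apply vv_def nerve_act_apply[OF \<theta>])
qed

text \<open>A cocycle on the prism that vanishes on the bottom triangles is determined by its values
  on the two triangles that cut each vertical square. The first two formulas recover the triangles
  with mixed second coordinate; the third expresses the top triangle as the defect of additivity of
  the difference of the two square values, which is what makes \<open>qof\<close>
  multiplicative.\<close>

lemma kernel_formulas:
  assumes h: "h \<in> PZ n" and ijl: "i \<le> j" "j \<le> l" "l \<le> n" and z: "h ([i, j, l], [0, 0, 0]) = \<zero>"
  shows "h ([i, j, l], [0, 0, 1]) = h ([i, l, l], [0, 0, 1]) \<ominus> h ([j, l, l], [0, 0, 1])"
    "h ([i, j, l], [0, 1, 1]) = h ([j, j, l], [0, 1, 1]) \<oplus> (h ([i, l, l], [0, 0, 1]) \<ominus> h ([j, l, l], [0, 0, 1])) \<ominus> h ([i, j, j], [0, 0, 1])"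
    "h ([i, l, l], [0, 0, 1]) \<ominus> h ([i, i, l], [0, 1, 1]) = (h ([i, j, j], [0, 0, 1]) \<ominus> h ([i, i, j], [0, 1, 1])) \<oplus>
      (h ([j, l, l], [0, 0, 1]) \<ominus> h ([j, j, l], [0, 1, 1])) \<oplus> h ([i, j, l], [1, 1, 1])"
proof -
  note D = PZD(2)[OF h] PZD(3)[OF h]
  have solve: "c = b \<ominus> a" if "a \<ominus> b \<oplus> c \<ominus> \<zero> = \<zero>" "a \<in> carrier M" "b \<in> carrier M" "c \<in> carrier M" for a b c
  proof -
    have "c = (a \<ominus> b \<oplus> c \<ominus> \<zero>) \<oplus> (b \<ominus> a)" using that(2-) by algebra
    then show ?thesis unfolding that(1) using that(2-) by simp
  qed
  have solve2: "b = a \<oplus> c \<ominus> d" if "a \<ominus> b \<oplus> c \<ominus> d = \<zero>" "a \<in> carrier M" "b \<in> carrier M" "c \<in> carrier M" "d \<in> carrier M" for a b c d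
  proof -
    have "a \<oplus> c \<ominus> d = (a \<ominus> b \<oplus> c \<ominus> d) \<oplus> b" using that(2-) by algebra
    then show ?thesis unfolding that(1) using that(2-) by simp
  qed
  \<comment> \<open>The cocycle identity on the three tetrahedra into which the prism over
    \<open>[i, j, l]\<close> decomposes.\<close>
  have E1: "h ([j, l, l], [0, 0, 1]) \<ominus> h ([i, l, l], [0, 0, 1]) \<oplus> h ([i, j, l], [0, 0, 1]) \<ominus> h ([i, j, l], [0, 0, 0]) = \<zero>"
    "h ([j, j, l], [0, 1, 1]) \<ominus> h ([i, j, l], [0, 1, 1]) \<oplus> h ([i, j, l], [0, 0, 1]) \<ominus> h ([i, j, j], [0, 0, 1]) = \<zero>"
    "h ([i, j, l], [1, 1, 1]) \<ominus> h ([i, j, l], [0, 1, 1]) \<oplus> h ([i, i, l], [0, 1, 1]) \<ominus> h ([i, i, j], [0, 1, 1]) = \<zero>"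
    using ijl by (auto intro!: PZD(3)[OF h])
  have c: "h ([j, l, l], [0, 0, 1]) \<in> carrier M" "h ([i, l, l], [0, 0, 1]) \<in> carrier M" "h ([i, j, l], [0, 0, 1]) \<in> carrier M"
    "h ([j, j, l], [0, 1, 1]) \<in> carrier M" "h ([i, j, l], [0, 1, 1]) \<in> carrier M" "h ([i, j, j], [0, 0, 1]) \<in> carrier M"
    "h ([i, j, l], [1, 1, 1]) \<in> carrier M" "h ([i, i, l], [0, 1, 1]) \<in> carrier M" "h ([i, i, j], [0, 1, 1]) \<in> carrier M"
    using ijl by (auto intro!: PZD(2)[OF h])
  show 1: "h ([i, j, l], [0, 0, 1]) = h ([i, l, l], [0, 0, 1]) \<ominus> h ([j, l, l], [0, 0, 1])"
    by (rule solve[OF E1(1)[unfolded z] c(1-3)])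
  show 2: "h ([i, j, l], [0, 1, 1]) = h ([j, j, l], [0, 1, 1]) \<oplus> (h ([i, l, l], [0, 0, 1]) \<ominus> h ([j, l, l], [0, 0, 1])) \<ominus> h ([i, j, j], [0, 0, 1])"
    using solve2[OF E1(2) c(4,5,3,6)] unfolding 1 .
  have id: "B \<ominus> I = (N \<ominus> J) \<oplus> (A \<ominus> E) \<oplus> H"
    if "H \<ominus> (E \<oplus> (B \<ominus> A) \<ominus> N) \<oplus> I \<ominus> J = \<zero>" "B \<in> carrier M" "I \<in> carrier M" "N \<in> carrier M" "J \<in> carrier M"
      "A \<in> carrier M" "E \<in> carrier M" "H \<in> carrier M" for A B E H I J N
  proof -
    have "H \<ominus> Y \<ominus> J = (H \<ominus> Y \<oplus> I \<ominus> J) \<oplus> (\<ominus> I)" if "Y \<in> carrier M" for Y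
      using that \<open>I \<in> carrier M\<close> \<open>J \<in> carrier M\<close> \<open>H \<in> carrier M\<close> by algebra
    from this[of "E \<oplus> (B \<ominus> A) \<ominus> N"] have "\<ominus> I = H \<ominus> (E \<oplus> (B \<ominus> A) \<ominus> N) \<ominus> J"
      unfolding that(1) using that(2-) by simp
    then have "B \<ominus> I = B \<oplus> (H \<ominus> (E \<oplus> (B \<ominus> A) \<ominus> N) \<ominus> J)"
      by (simp only: minus_eq)
    also have "H \<ominus> (E \<oplus> (B \<ominus> A) \<ominus> N) \<ominus> J = (N \<ominus> J) \<oplus> (A \<ominus> E) \<oplus> H \<ominus> B"
      using that(2-) by algebra
    also have "B \<oplus> \<dots> = (N \<ominus> J) \<oplus> (A \<ominus> E) \<oplus> H"
    proof -
      have "B \<oplus> (X \<ominus> B) = X" if "X \<in> carrier M" for X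
        using that \<open>B \<in> carrier M\<close> by algebra
      then show ?thesis using that(2-) by simp
    qed
    finally show ?thesis .
  qed
  show "h ([i, l, l], [0, 0, 1]) \<ominus> h ([i, i, l], [0, 1, 1]) = (h ([i, j, j], [0, 0, 1]) \<ominus> h ([i, i, j], [0, 1, 1])) \<oplus>
      (h ([j, l, l], [0, 0, 1]) \<ominus> h ([j, j, l], [0, 1, 1])) \<oplus> h ([i, j, l], [1, 1, 1])"
    by (rule id[OF E1(3)[unfolded 2] c(2,8,6,9,1,4,7)])
qed

text \<open>The inverse of \<open>hh\<close>. On the triangle \<open>([i, j, j], [0, 0, 1])\<close>
  the cocycle \<open>hh n q c\<close> takes the value \<open>-c (i, j)\<close>, and on
  \<open>([i, i, j], [0, 1, 1])\<close> the value \<open>-u (q (i, j)) - c (i, j)\<close>. So the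
  difference is the fibre coordinate of \<open>q (i, j)\<close>, and the first value alone gives
  \<open>cof\<close>.\<close>

definition qof where
  "qof n x h = (\<lambda>(i, j)\<in>ipairs n. \<iota> (h ([i, j, j], [0, 0, 1::nat]) \<ominus> h ([i, i, j], [0, 1::nat, 1::nat])) \<otimes>\<^bsub>Q\<^esub> \<sigma> (x (i, j)))"

definition cof where "cof n h = (\<lambda>(i, j)\<in>ipairs n. \<ominus> h ([i, j, j], [0, 0, 1::nat]))"

lemma qof_apply: "i \<le> j \<Longrightarrow> j \<le> n \<Longrightarrow> qof n x h (i, j) = \<iota> (h ([i, j, j], [0, 0, 1]) \<ominus> h ([i, i, j], [0, 1, 1])) \<otimes>\<^bsub>Q\<^esub> \<sigma> (x (i, j))"
  and cof_apply: "i \<le> j \<Longrightarrow> j \<le> n \<Longrightarrow> cof n h (i, j) = \<ominus> h ([i, j, j], [0, 0, 1])"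
  by (simp_all add: qof_def cof_def ipairs_def)

lemma qof_ext: "qof n x h \<in> extensional (ipairs n)" and cof_ext: "cof n h \<in> extensional (ipairs n)"
  by (simp_all add: qof_def cof_def)

lemma qof_hh:
  assumes q: "q \<in> simp (nerve Q) n" and c: "c \<in> simp (onecochains M) n"
  shows "qof n (nerve_map Q \<pi> n q) (hh n q c) = q" "cof n (hh n q c) = c"
proof -
  note Dq = nerve_simpD[OF q] and Dc = onecochainsD[OF c]
  have id: "(\<zero> \<ominus> y) \<ominus> (\<ominus> x \<ominus> y \<oplus> \<zero>) = x" "\<ominus> (\<zero> \<ominus> y) = y" if "x \<in> carrier M" "y \<in> carrier M" for x y
    using that by algebra+
  show "qof n (nerve_map Q \<pi> n q) (hh n q c) = q"
  proof (rule nerve_eqI[OF qof_ext Dq(2)])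
    fix i j assume ij: "i \<le> j" "j \<le> n"
    have e: "hh n q c ([i, j, j], [0, 0, 1]) \<ominus> hh n q c ([i, i, j], [0, 1, 1]) = u (q (i, j))"
      using hh_apply(2)[OF q c ij(1) order_refl ij(2)] hh_apply(3)[OF q c order_refl ij] ij Dc(1)[OF ij] Dc(3)[of i] Dc(3)[of j]
        id(1)[of "u (q (i, j))" "c (i, j)"] Dq(1)[OF ij] by simp
    show "qof n (nerve_map Q \<pi> n q) (hh n q c) (i, j) = q (i, j)"
      unfolding qof_apply[OF ij] e nerve_map_apply[OF q ij] by (rule u_decomp[OF Dq(1)[OF ij]])
  qed
  show "cof n (hh n q c) = c"
  proof (rule nerve_eqI[OF cof_ext Dc(2)])
    fix i j assume ij: "i \<le> j" "j \<le> n"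
    show "cof n (hh n q c) (i, j) = c (i, j)"
      unfolding cof_apply[OF ij] using hh_apply(2)[OF q c ij(1) order_refl ij(2)] Dc(1)[OF ij] Dc(3)[OF ij(2)] id(2)[of "c (i, j)" "c (i, j)"] by simp
  qed
qed

text \<open>The assumptions \<open>z\<close> and \<open>k\<close> are the pullback condition:
  \<open>h\<close> is zero on one end of the prism and the factor set of \<open>x\<close> on the
  other. With \<open>k\<close>, the third kernel formula becomes the multiplication rule
  \<open>ext_mult\<close> for \<open>qof\<close>.\<close>

lemma hh_qof:
  assumes x: "x \<in> simp (nerve Q') n" and h: "h \<in> PZ n"
    and z: "\<And>i j l. i \<le> j \<Longrightarrow> j \<le> l \<Longrightarrow> l \<le> n \<Longrightarrow> h ([i, j, l], [0, 0, 0]) = \<zero>"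
    and k: "\<And>i j l. i \<le> j \<Longrightarrow> j \<le> l \<Longrightarrow> l \<le> n \<Longrightarrow> h ([i, j, l], [1, 1, 1]) = \<kappa> (x (i, j)) (x (j, l))"
  shows "qof n x h \<in> simp (nerve Q) n" "cof n h \<in> simp (onecochains M) n"
    "nerve_map Q \<pi> n (qof n x h) = x" "hh n (qof n x h) (cof n h) = h"
proof -
  note Dx = nerve_simpD[OF x]
  have hc: "h ([i, j, l], [a, b, c]) \<in> carrier M" if "i \<le> j" "j \<le> l" "l \<le> n" "a \<le> b" "b \<le> c" "c \<le> 1" for i j l a b c
    using PZD(2)[OF h that] .
  have d: "h ([i, j, j], [0, 0, 1]) \<ominus> h ([i, i, j], [0, 1, 1]) \<in> carrier M" if "i \<le> j" "j \<le> n" for i j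
    using that by (simp add: hc)
  have dz: "h ([i, i, i], [0, 0, 1]) = \<zero>" "h ([i, i, i], [0, 1, 1]) = \<zero>" if "i \<le> n" for i
    using PZD(4,5)[OF h order_refl that] by simp_all
  show q: "qof n x h \<in> simp (nerve Q) n"
  proof (rule nerve_simpI[OF _ qof_ext])
    show "qof n x h (i, j) \<in> carrier Q" if "i \<le> j" "j \<le> n" for i j
      using d[OF that] Dx(1)[OF that] by (simp add: qof_apply[OF that])
    show "qof n x h (i, i) = \<one>\<^bsub>Q\<^esub>" if "i \<le> n" for i
      by (simp add: qof_apply[OF order_refl that] dz[OF that] minus_eq Dx(3)[OF that] iota_zero sigma_one)
    show "qof n x h (i, j) \<otimes>\<^bsub>Q\<^esub> qof n x h (j, l) = qof n x h (i, l)" if ijl: "i \<le> j" "j \<le> l" "l \<le> n" for i j l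
    proof -
      have 1: "j \<le> n" "i \<le> l" using ijl by auto
      show ?thesis
        unfolding qof_apply[OF ijl(1) 1(1)] qof_apply[OF ijl(2,3)] qof_apply[OF 1(2) ijl(3)]
          ext_mult[OF d[OF ijl(1) 1(1)] d[OF ijl(2,3)] Dx(1)[OF ijl(1) 1(1)] Dx(1)[OF ijl(2,3)]]
          kernel_formulas(3)[OF h ijl z[OF ijl]] k[OF ijl] Dx(4)[OF ijl] ..
    qed
  qed
  show c: "cof n h \<in> simp (onecochains M) n"
    by (rule onecochainsI[OF _ cof_ext]) (simp_all add: cof_apply hc dz)
  have uq: "u (qof n x h (i, j)) = h ([i, j, j], [0, 0, 1]) \<ominus> h ([i, i, j], [0, 1, 1])"
    and pq: "\<pi> (qof n x h (i, j)) = x (i, j)" if "i \<le> j" "j \<le> n" for i j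
    unfolding qof_apply[OF that] using u_eqI pi_decomp d[OF that] Dx(1)[OF that] by blast+
  show "nerve_map Q \<pi> n (qof n x h) = x"
    by (rule nerve_eqI[OF nerve_map_ext[OF q] Dx(2)]) (simp add: nerve_map_apply[OF q] pq)
  show "hh n (qof n x h) (cof n h) = h"
  proof (rule prism_eqI[OF dv_ext PZD(1)[OF h]])
    fix i j l a b e :: nat
    assume ijl: "i \<le> j" "j \<le> l" "l \<le> n" and abe: "a \<le> b" "b \<le> e" "e \<le> 1"
    have 1: "j \<le> n" "i \<le> l" using ijl by auto
    have id: "\<ominus> A \<ominus> \<ominus> B = B \<ominus> A" "\<ominus> (A \<ominus> E) \<ominus> \<ominus> B \<oplus> \<ominus> N = E \<oplus> (B \<ominus> A) \<ominus> N"
      if "A \<in> carrier M" "B \<in> carrier M" "E \<in> carrier M" "N \<in> carrier M" for A B E N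
      using that by algebra+
    note F = hh_apply[OF q c ijl]
    have cl: "h ([j, l, l], [0, 0, 1]) \<in> carrier M" "h ([i, l, l], [0, 0, 1]) \<in> carrier M"
       "h ([j, j, l], [0, 1, 1]) \<in> carrier M" "h ([i, j, j], [0, 0, 1]) \<in> carrier M"
      using ijl by (simp_all add: hc)
    show "hh n (qof n x h) (cof n h) ([i, j, l], [a, b, e]) = h ([i, j, l], [a, b, e])"
      using abe
    proof (cases rule: tau_cases)
      case 1 then show ?thesis using F(1) z[OF ijl] by simp
    next
      case 2 then show ?thesis
        using F(2) kernel_formulas(1)[OF h ijl z[OF ijl]] id(1)[OF cl]
        by (simp add: cof_apply[OF ijl(2,3)] cof_apply[OF \<open>i \<le> l\<close> ijl(3)])
    next
      case 3 then show ?thesis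
        using F(3) kernel_formulas(2)[OF h ijl z[OF ijl]] id(2)[OF cl]
        by (simp add: uq[OF ijl(2,3)] cof_apply[OF \<open>i \<le> l\<close> ijl(3)] cof_apply[OF ijl(1) \<open>j \<le> n\<close>])
    next
      case 4 then show ?thesis
        using F(4) k[OF ijl] by (simp add: pq[OF ijl(1) \<open>j \<le> n\<close>] pq[OF ijl(2,3)])
    qed
  qed
qed

text \<open>Lifts the products \<open>x (0, i)\<close> from the initial vertex and takes their
  quotients. The lift need not commute with faces; only its image under the restriction to the ends
  of the prism will matter, and that depends on \<open>x\<close> alone by
  \<open>restr_hh_eq\<close>.\<close>

definition lft where "lft n x = (\<lambda>(i, j)\<in>ipairs n. inv\<^bsub>Q\<^esub> (\<sigma> (x (0, i))) \<otimes>\<^bsub>Q\<^esub> \<sigma> (x (0::nat, j)))"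

lemma lft:
  assumes x: "x \<in> simp (nerve Q') n"
  shows "lft n x \<in> simp (nerve Q) n" "nerve_map Q \<pi> n (lft n x) = x"
proof -
  note Dx = nerve_simpD[OF x]
  have a: "lft n x (i, j) = inv\<^bsub>Q\<^esub> (\<sigma> (x (0, i))) \<otimes>\<^bsub>Q\<^esub> \<sigma> (x (0, j))" if "i \<le> j" "j \<le> n" for i j
    using that by (simp add: lft_def ipairs_def)
  have c: "x (0, i) \<in> carrier Q'" if "i \<le> n" for i using that Dx(1)[of 0 i] by simp
  show l: "lft n x \<in> simp (nerve Q) n"
  proof (rule nerve_simpI)
    show "lft n x (i, j) \<otimes>\<^bsub>Q\<^esub> lft n x (j, k) = lft n x (i, k)" if "i \<le> j" "j \<le> k" "k \<le> n" for i j k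
    proof -
      have e: "(inv\<^bsub>Q\<^esub> A \<otimes>\<^bsub>Q\<^esub> B) \<otimes>\<^bsub>Q\<^esub> (inv\<^bsub>Q\<^esub> B \<otimes>\<^bsub>Q\<^esub> C) = inv\<^bsub>Q\<^esub> A \<otimes>\<^bsub>Q\<^esub> C"
        if "A \<in> carrier Q" "B \<in> carrier Q" "C \<in> carrier Q" for A B C
        using that by (simp add: Q.m_assoc Q.inv_solve_left[symmetric] flip: Q.m_assoc[of B])
      show ?thesis using e[of "\<sigma> (x (0, i))" "\<sigma> (x (0, j))" "\<sigma> (x (0, k))"] that by (simp add: a c)
    qed
  qed (use c a in \<open>simp_all add: lft_def\<close>)
  show "nerve_map Q \<pi> n (lft n x) = x"
  proof (rule nerve_eqI[OF nerve_map_ext[OF l] Dx(2)])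
    fix i j assume ij: "i \<le> j" "j \<le> n"
    have "\<pi> (lft n x (i, j)) = inv\<^bsub>Q'\<^esub> (x (0, i)) \<otimes>\<^bsub>Q'\<^esub> x (0, j)"
      using ij by (simp add: a c pi_mult pi_inv pi_sigma)
    also have "\<dots> = inv\<^bsub>Q'\<^esub> (x (0, i)) \<otimes>\<^bsub>Q'\<^esub> (x (0, i) \<otimes>\<^bsub>Q'\<^esub> x (i, j))"
      using Dx(4)[of 0 i j] ij by simp
    also have "\<dots> = x (i, j)"
      using ij c[of i] Dx(1)[OF ij] by (simp flip: Q'.m_assoc)
    finally show "nerve_map Q \<pi> n (lft n x) (i, j) = x (i, j)" by (simp add: nerve_map_apply[OF l ij])
  qed
qed

section \<open>The pullback defined by a central extension\<close>

abbreviation AA where "AA \<equiv> EM M 2"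
abbreviation restr where "restr \<equiv> mapsp_restr (bdry 1) (std_simplex 1) AA"
abbreviation TT where "TT \<equiv> sprod (nerve Q) (onecochains M)"

lemma restr_smaps: "restr \<in> smaps (mapsp (std_simplex 1) AA) (mapsp (bdry 1) AA)"
  by (rule mapsp_restr_smaps[OF simplicial_set_std simplicial_set_bdry bdry_1_subset])
    (simp add: bdry_def)

lemma restr_apply:
  "y \<in> smaps (prism n) AA \<Longrightarrow> \<phi> \<in> delta l n \<Longrightarrow> \<tau> \<in> simp (bdry 1) l \<Longrightarrow> restr n y l (\<phi>, \<tau>) = y l (\<phi>, \<tau>)"
  by (simp add: mapsp_restr_def)

text \<open>The boundary of the interval consists of its two ends, and a map to
  \<open>K(M, 2)\<close> is determined by its cocycle; so equality after restriction is equality of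
  the cocycles on the triangles over 0 and over 1.\<close>

lemma restr_eq_iff:
  assumes h: "h \<in> PZ n" and h': "h' \<in> PZ n"
  shows "restr n (toMap (prism n) h) = restr n (toMap (prism n) h') \<longleftrightarrow>
    (\<forall>i j l. i \<le> j \<longrightarrow> j \<le> l \<longrightarrow> l \<le> n \<longrightarrow>
      h ([i, j, l], [0, 0, 0]) = h' ([i, j, l], [0, 0, 0]) \<and> h ([i, j, l], [1, 1, 1]) = h' ([i, j, l], [1, 1, 1]))"
    (is "?L \<longleftrightarrow> ?R")
proof -
  note P = simplicial_set_prism
  note y = toMap_smaps[OF P h] and y' = toMap_smaps[OF P h']
  show ?thesis
  proof
    assume L: ?L
    have "h ([i, j, l], \<tau>) = h' ([i, j, l], \<tau>)" if "i \<le> j" "j \<le> l" "l \<le> n" "\<tau> \<in> simp (bdry 1) 2" for i j l \<tau>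
    proof -
      have d: "[i, j, l] \<in> delta 2 n" using that by (simp add: delta2_iff)
      have s: "([i, j, l], \<tau>) \<in> simp (prism n) 2" using d that(4) by simp
      have "toMap (prism n) h 2 ([i, j, l], \<tau>) = toMap (prism n) h' 2 ([i, j, l], \<tau>)"
        using fun_cong[OF fun_cong[OF L, of 2], of "([i, j, l], \<tau>)"]
        unfolding restr_apply[OF y d that(4)] restr_apply[OF y' d that(4)] .
      then have "ofMap (prism n) (toMap (prism n) h) ([i, j, l], \<tau>) = ofMap (prism n) (toMap (prism n) h') ([i, j, l], \<tau>)"
        unfolding ofMap_def restrict_apply'[OF s] by simp
      then show ?thesis unfolding ofMap_toMap[OF P h] ofMap_toMap[OF P h'] .
    qed
    then show ?R using const_in_bdry_1 by blast
  next
    assume R: ?R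
    have "toMap (prism n) h l (\<phi>, \<tau>) = toMap (prism n) h' l (\<phi>, \<tau>)" if \<phi>: "\<phi> \<in> delta l n" and \<tau>: "\<tau> \<in> simp (bdry 1) l" for l \<phi> \<tau>
    proof -
      have s: "(\<phi>, \<tau>) \<in> simp (prism n) l" using \<phi> \<tau> by simp
      show ?thesis
        unfolding toMap_def restrict_apply'[OF s]
      proof (rule restrict_ext)
        fix \<psi> assume "\<psi> \<in> delta 2 l"
        then obtain i j k where \<psi>: "\<psi> = [i, j, k]" "i \<le> j" "j \<le> k" "k \<le> l" by (elim delta2E)
        have "\<phi> ! i \<le> \<phi> ! j" "\<phi> ! j \<le> \<phi> ! k" "\<phi> ! k \<le> n" using deltaD[OF \<phi>] \<psi> by auto
        note R' = R[rule_format, OF this]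
        from \<tau> show "h (act (prism n) l \<psi> (\<phi>, \<tau>)) = h' (act (prism n) l \<psi> (\<phi>, \<tau>))"
          by (cases rule: bdry_1_cases) (use R' \<psi> in simp_all)
      qed
    qed
    then show ?L
      using y y' by (auto simp: mapsp_restr_def fun_eq_iff restrict_def)
  qed
qed

lemma toMap_hh_nat:
  assumes \<theta>: "\<theta> \<in> delta m n"
  shows "toMap (prism m) (hh m (act (nerve Q) n \<theta> q) (act (nerve (add_monoid M)) n \<theta> c)) =
    act (mapsp (std_simplex 1) AA) n \<theta> (toMap (prism n) (hh n q c))" (is "?L = ?R")
proof (rule ext)
  fix l
  show "?L l = ?R l"
  proof (rule extensionalityI)
    show "?L l \<in> extensional (delta l m \<times> delta l 1)" by (simp add: toMap_def)
    show "?R l \<in> extensional (delta l m \<times> delta l 1)" unfolding act_mapsp[OF \<theta>] by simp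
    fix x assume "x \<in> delta l m \<times> delta l 1"
    then obtain \<phi> \<tau> where x: "x = (\<phi>, \<tau>)" "\<phi> \<in> delta l m" "\<tau> \<in> delta l 1" by auto
    have s: "(\<phi>, \<tau>) \<in> simp (prism m) l" "(map ((!) \<theta>) \<phi>, \<tau>) \<in> simp (prism n) l" "(\<phi>, \<tau>) \<in> delta l m \<times> simp (std_simplex 1) l"
      using x delta_comp[OF \<theta> x(2)] by simp_all
    have R: "?R l x = toMap (prism n) (hh n q c) l (map ((!) \<theta>) \<phi>, \<tau>)"
      unfolding x(1) act_mapsp[OF \<theta>] restrict_apply'[OF s(3)] by simp
    show "?L l x = ?R l x"
      unfolding R unfolding x(1) toMap_def restrict_apply'[OF s(1)] restrict_apply'[OF s(2)]
    proof (rule restrict_ext)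
      fix \<psi> assume \<psi>: "\<psi> \<in> delta 2 l"
      show "hh m (act (nerve Q) n \<theta> q) (act (nerve (add_monoid M)) n \<theta> c) (act (prism m) l \<psi> (\<phi>, \<tau>)) =
        hh n q c (act (prism n) l \<psi> (map ((!) \<theta>) \<phi>, \<tau>))"
        using hh_nat[OF \<theta> delta_comp[OF x(2) \<psi>] delta_comp[OF x(3) \<psi>], of q c]
        by (simp add: map_nth_comp[OF x(2) \<psi>] del: map_map)
    qed
  qed
qed

lemma toMap_hh_smaps:
  "q \<in> simp (nerve Q) n \<Longrightarrow> c \<in> simp (onecochains M) n \<Longrightarrow> toMap (prism n) (hh n q c) \<in> smaps (prism n) AA"
  by (rule toMap_smaps[OF simplicial_set_prism hh_PZ])

text \<open>On the ends of the prism \<open>hh\<close> is zero and the factor set of the projected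
  edges; neither sees the fibre coordinate of \<open>q\<close> or the cochain
  \<open>c\<close>.\<close>

lemma restr_hh_eq:
  assumes "q \<in> simp (nerve Q) n" "c \<in> simp (onecochains M) n" "q' \<in> simp (nerve Q) n" "c' \<in> simp (onecochains M) n"
    and "nerve_map Q \<pi> n q = nerve_map Q \<pi> n q'"
  shows "restr n (toMap (prism n) (hh n q c)) = restr n (toMap (prism n) (hh n q' c'))"
proof -
  have "\<pi> (q (i, j)) = \<pi> (q' (i, j))" if "i \<le> j" "j \<le> n" for i j
    using fun_cong[OF assms(5), of "(i, j)"] unfolding nerve_map_apply[OF assms(1) that] nerve_map_apply[OF assms(3) that] .
  note e = this
  show ?thesis
    unfolding restr_eq_iff[OF hh_PZ[OF assms(1,2)] hh_PZ[OF assms(3,4)]]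
  proof (intro allI impI)
    fix i j l assume ijl: "i \<le> j" "j \<le> l" "l \<le> n"
    have "\<pi> (q (i, j)) = \<pi> (q' (i, j))" "\<pi> (q (j, l)) = \<pi> (q' (j, l))" using e ijl by simp_all
    then show "hh n q c ([i, j, l], [0, 0, 0]) = hh n q' c' ([i, j, l], [0, 0, 0]) \<and>
        hh n q c ([i, j, l], [1, 1, 1]) = hh n q' c' ([i, j, l], [1, 1, 1])"
      using hh_apply(1,4)[OF assms(1,2) ijl] hh_apply(1,4)[OF assms(3,4) ijl] by simp
  qed
qed

abbreviation zero1 :: "nat \<Rightarrow> nat \<times> nat \<Rightarrow> 'a" where "zero1 n \<equiv> (\<lambda>_\<in>ipairs n. \<zero>)"

lemma zero1_in: "zero1 n \<in> simp (onecochains M) n"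
  by (rule onecochainsI) (auto simp: ipairs_def)

lemma zero1_nat: "\<theta> \<in> delta m n \<Longrightarrow> act (nerve (add_monoid M)) n \<theta> (zero1 n) = zero1 m"
  by (rule nerve_eqI[OF nerve_act_ext]) (auto simp: nerve_act_apply ipairs_def deltaD)

text \<open>The map \<open>f\<close> has components zero and the class of the extension. It is
  obtained by restricting \<open>hh\<close> of an arbitrary lift, so that compatibility of
  \<open>\<Theta>\<close> with the pullback and naturality of \<open>f\<close> both follow from
  independence of the lift. The inverse of \<open>\<Theta>\<close> passes to cocycles by
  \<open>ofMap\<close> and applies \<open>qof\<close> and \<open>cof\<close>. \<open>X\<close> is a
  copy of the nerve of \<open>Q'\<close>, identified with it by \<open>e\<close> and
  \<open>e'\<close>.\<close>

lemma siso_pullback: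
  assumes e: "e \<in> smaps X (nerve Q')" and e': "e' \<in> smaps (nerve Q') X" and X: "simplicial_set X"
    and ee: "\<And>n x. x \<in> simp X n \<Longrightarrow> e' n (e n x) = x" "\<And>n y. y \<in> simp (nerve Q') n \<Longrightarrow> e n (e' n y) = y"
  shows "\<exists>f\<in>smaps X (mapsp (bdry 1) AA). siso TT (pullback X f restr (mapsp (std_simplex 1) AA))"
proof
  define f where "f = (\<lambda>n. \<lambda>x\<in>simp X n. restr n (toMap (prism n) (hh n (lft n (e n x)) (zero1 n))))"
  note eD = smapsD[OF e] and e'D = smapsD[OF e']
  have f_eq: "f n x = restr n (toMap (prism n) (hh n q c))"
    if "x \<in> simp X n" "q \<in> simp (nerve Q) n" "c \<in> simp (onecochains M) n" "nerve_map Q \<pi> n q = e n x" for n x q c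
    unfolding f_def restrict_apply'[OF that(1)]
    by (rule restr_hh_eq[OF lft(1)[OF eD(1)[OF that(1)]] zero1_in that(2,3)])
      (simp add: lft(2)[OF eD(1)[OF that(1)]] that(4))
  have pm: "nerve_map Q \<pi> \<in> smaps (nerve Q) (nerve Q')"
    by (rule nerve_map_smaps[OF Q.is_group Q'.is_group pi_hom])
  note pmD = smapsD[OF pm]
  show f: "f \<in> smaps X (mapsp (bdry 1) AA)"
  proof (rule smapsI)
    show "f n \<in> extensional (simp X n)" for n by (simp add: f_def)
    fix n x assume x: "x \<in> simp X n"
    note l = lft[OF eD(1)[OF x]]
    have y: "toMap (prism n) (hh n (lft n (e n x)) (zero1 n)) \<in> simp (mapsp (std_simplex 1) AA) n"
      unfolding simp_mapsp by (rule toMap_hh_smaps[OF l(1) zero1_in])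
    show "f n x \<in> simp (mapsp (bdry 1) AA) n"
      unfolding f_def restrict_apply'[OF x] by (rule smapsD(1)[OF restr_smaps y])
    fix m \<theta> assume \<theta>: "\<theta> \<in> delta m n"
    have "f m (act X n \<theta> x) = restr m (toMap (prism m) (hh m (act (nerve Q) n \<theta> (lft n (e n x))) (act (nerve (add_monoid M)) n \<theta> (zero1 n))))"
    proof (rule f_eq[OF simplicial_setD(1)[OF X \<theta> x] nerve_act_in[OF \<theta> l(1)] onecochains_act_in[OF \<theta> zero1_in]])
      show "nerve_map Q \<pi> m (act (nerve Q) n \<theta> (lft n (e n x))) = e m (act X n \<theta> x)"
        unfolding pmD(2)[OF \<theta> l(1)] l(2) eD(2)[OF \<theta> x] ..
    qed
    also have "\<dots> = act (mapsp (bdry 1) AA) n \<theta> (f n x)"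
      unfolding toMap_hh_nat[OF \<theta>] smapsD(2)[OF restr_smaps \<theta> y] f_def restrict_apply'[OF x] ..
    finally show "f m (act X n \<theta> x) = act (mapsp (bdry 1) AA) n \<theta> (f n x)" .
  qed
  let ?P = "pullback X f restr (mapsp (std_simplex 1) AA)"
  have P: "simp ?P n = {(x, y). x \<in> simp X n \<and> y \<in> smaps (prism n) AA \<and> f n x = restr n y}" for n
    by (simp add: pullback_def)
  define \<Theta> where "\<Theta> = (\<lambda>n. \<lambda>(q, c)\<in>simp TT n. (e' n (nerve_map Q \<pi> n q), toMap (prism n) (hh n q c)))"
  have \<Theta>_apply: "\<Theta> n (q, c) = (e' n (nerve_map Q \<pi> n q), toMap (prism n) (hh n q c))"
    if "q \<in> simp (nerve Q) n" "c \<in> simp (onecochains M) n" for n q c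
    using that by (simp add: \<Theta>_def)
  have \<Theta>: "\<Theta> \<in> smaps TT ?P"
  proof (rule smapsI)
    show "\<Theta> n \<in> extensional (simp TT n)" for n by (simp add: \<Theta>_def)
    fix n z assume "z \<in> simp TT n"
    then obtain q c where z: "z = (q, c)" and q: "q \<in> simp (nerve Q) n" and c: "c \<in> simp (onecochains M) n" by auto
    note x = e'D(1)[OF pmD(1)[OF q]]
    show "\<Theta> n z \<in> simp ?P n"
      unfolding P z \<Theta>_apply[OF q c]
      using x toMap_hh_smaps[OF q c] f_eq[OF x q c] ee(2)[OF pmD(1)[OF q]] by simp
    fix m \<theta> assume \<theta>: "\<theta> \<in> delta m n"
    show "\<Theta> m (act TT n \<theta> z) = act ?P n \<theta> (\<Theta> n z)"
      unfolding z \<Theta>_apply[OF q c] sprod_simps act_onecochains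
        \<Theta>_apply[OF nerve_act_in[OF \<theta> q] onecochains_act_in[OF \<theta> c]]
        pmD(2)[OF \<theta> q] e'D(2)[OF \<theta> pmD(1)[OF q]] toMap_hh_nat[OF \<theta>]
      by (simp add: pullback_def)
  qed
  let ?g = "\<lambda>n (x, y). (qof n (e n x) (ofMap (prism n) y), cof n (ofMap (prism n) y))"
  show "siso TT ?P"
  proof (rule sisoI[OF \<Theta>, where g = ?g])
    fix n z assume "z \<in> simp TT n"
    then obtain q c where z: "z = (q, c)" and q: "q \<in> simp (nerve Q) n" and c: "c \<in> simp (onecochains M) n" by auto
    show "?g n (\<Theta> n z) = z"
      unfolding z \<Theta>_apply[OF q c] prod.case ee(2)[OF pmD(1)[OF q]]
        ofMap_toMap[OF simplicial_set_prism hh_PZ[OF q c]] qof_hh[OF q c] ..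
  next
    fix n z assume "z \<in> simp ?P n"
    then obtain x y where z: "z = (x, y)" and x: "x \<in> simp X n" and y: "y \<in> smaps (prism n) AA" and fy: "f n x = restr n y"
      unfolding P by blast
    note ex = eD(1)[OF x]
    note l = lft[OF ex]
    define h where "h = ofMap (prism n) y"
    have h: "h \<in> PZ n" unfolding h_def by (rule ofMap_nz2[OF simplicial_set_prism y])
    have yh: "y = toMap (prism n) h" unfolding h_def toMap_ofMap[OF simplicial_set_prism y] ..
    have "restr n (toMap (prism n) h) = restr n (toMap (prism n) (hh n (lft n (e n x)) (zero1 n)))"
      using fy unfolding yh f_def restrict_apply'[OF x] ..
    note eq = this[unfolded restr_eq_iff[OF h hh_PZ[OF l(1) zero1_in]]]
    have pl: "\<pi> (lft n (e n x) (i, j)) = e n x (i, j)" if "i \<le> j" "j \<le> n" for i j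
      using fun_cong[OF l(2), of "(i, j)"] unfolding nerve_map_apply[OF l(1) that] .
    have 0: "h ([i, j, k], [0, 0, 0]) = \<zero>" if "i \<le> j" "j \<le> k" "k \<le> n" for i j k
      using eq that hh_apply(1)[OF l(1) zero1_in that] by simp
    have 1: "h ([i, j, k], [1, 1, 1]) = \<kappa> (e n x (i, j)) (e n x (j, k))" if "i \<le> j" "j \<le> k" "k \<le> n" for i j k
      using eq that hh_apply(4)[OF l(1) zero1_in that] pl[of i j] pl[of j k] by simp
    have r: "qof n (e n x) h \<in> simp (nerve Q) n" "cof n h \<in> simp (onecochains M) n"
      "nerve_map Q \<pi> n (qof n (e n x) h) = e n x" "hh n (qof n (e n x) h) (cof n h) = h"
      by (rule hh_qof[OF ex h 0 1]; assumption)+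
    show "?g n z \<in> simp TT n"
      unfolding z prod.case h_def[symmetric] using r(1,2) by simp
    show "\<Theta> n (?g n z) = z"
      unfolding z prod.case h_def[symmetric] \<Theta>_apply[OF r(1,2)] r(3,4) ee(1)[OF x] yh[symmetric] ..
  qed
qed

text \<open>The nilpotent pullback is a copy \<open>W\<close> of the product of the nerve of
  \<open>Q\<close> with the one-cochains. The section \<open>q \<mapsto> (q, 0)\<close> is a weak
  equivalence of Kan complexes, so nilpotency goes back from \<open>W\<close> to the copy
  \<open>Y\<close> of the nerve.\<close>

theorem copies_nilpotent_extension:
  assumes inf: "infinite (UNIV :: 'u set)" and fin: "finite (carrier Q)" "finite (carrier Q')" "finite (carrier M)"
    and K: "EM M 2 \<in> K" and nil: "copies_nilpotent TYPE('u) K (nerve Q')"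
  shows "copies_nilpotent TYPE('u) K (nerve Q)"
  unfolding copies_nilpotent_def
proof (intro allI impI)
  fix Y :: "'u sset" assume Y: "simplicial_set Y" "siso Y (nerve Q)"
  obtain X :: "'u sset" where X: "simplicial_set X" "siso X (nerve Q')"
    by (rule ex_copy[OF inf simplicial_set_nerve finite_nerve[OF fin(2)]])
  have nX: "nilpotent K X" using nil X unfolding copies_nilpotent_def by blast
  have TTs: "simplicial_set TT" by (rule simplicial_set_sprod[OF simplicial_set_nerve simplicial_set_onecochains])
  obtain W :: "'u sset" where W: "simplicial_set W" "siso W TT"
    by (rule ex_copy[OF inf TTs]) (simp_all add: finite_nerve[OF fin(1)] finite_onecochains[OF fin(3)])
  obtain e e' where "e \<in> smaps X (nerve Q')" "e' \<in> smaps (nerve Q') X"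
    "\<And>n x. x \<in> simp X n \<Longrightarrow> e' n (e n x) = x" "\<And>n y. y \<in> simp (nerve Q') n \<Longrightarrow> e n (e' n y) = y"
    by (fact sisoE[OF X])
  from siso_pullback[OF this(1,2) X(1) this(3,4)]
  obtain f where f: "f \<in> smaps X (mapsp (bdry 1) AA)" "siso TT (pullback X f restr (mapsp (std_simplex 1) AA))"
    by blast
  have nW: "nilpotent K W"
    by (rule nilpotent.pullback[OF nX K f(1) W(1) siso_trans[OF W(1) TTs W(2) f(2)]])
  have "kan TT" by (rule kan_sprod[OF Q.kan_nerve kan_onecochains])
  then have kW: "kan W" by (rule kan_siso[OF W])
  have kY: "kan Y" by (rule kan_siso[OF Y Q.kan_nerve])
  have s: "(\<lambda>n. \<lambda>q\<in>simp (nerve Q) n. (q, zero1 n)) \<in> smaps (nerve Q) TT"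
    by (rule smapsI) (simp_all add: nerve_act_in zero1_in zero1_nat)
  have "\<exists>g. weak_equiv Y W g"
  proof (rule weak_equiv_section_copies[OF Y W simplicial_set_nerve TTs sprod_fst[OF simplicial_set_nerve simplicial_set_onecochains] s])
    show "sfst (nerve Q) (onecochains M) n ((\<lambda>q\<in>simp (nerve Q) n. (q, zero1 n)) q) = q" if "q \<in> simp (nerve Q) n" for n q
      using that zero1_in by simp
    show "a = b" if "(a, b) \<in> hrel (nerve Q) n" for n a b
      by (rule Q.hrel_nerve[OF that])
    fix n b b' assume "b \<in> simp TT n" "b' \<in> simp TT n" "sfst (nerve Q) (onecochains M) n b = sfst (nerve Q) (onecochains M) n b'"
      and bd: "\<And>m \<phi>. \<phi> \<in> simp (bdry n) m \<Longrightarrow> act TT n \<phi> b = act TT n \<phi> b'"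
    then obtain q c c' where b: "b = (q, c)" "b' = (q, c')" "q \<in> simp (nerve Q) n"
      "c \<in> simp (onecochains M) n" "c' \<in> simp (onecochains M) n"
      by auto
    show "(b, b') \<in> hrel TT n"
      unfolding b(1,2) by (rule hrel_sprod_onecochains[OF simplicial_set_nerve b(3-5)]) (use bd in \<open>simp add: b(1,2)\<close>)
  qed
  then show "nilpotent K Y" using nilpotent.weq_backward[OF nW kW kY] by blast
qed

end

declare One_nat_def [simp]

section \<open>Isomorphisms of thin pro-spaces\<close>

lemma scomp_apply: "x \<in> simp S n \<Longrightarrow> scomp S g f n x = g n (f n x)"
  by (simp add: scomp_def compose_def)

lemma scomp_eqI: "(\<And>n x. x \<in> simp S n \<Longrightarrow> g n (f n x) = g' n (f' n x)) \<Longrightarrow> scomp S g f = scomp S g' f'"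
  unfolding scomp_def compose_def by (rule ext, rule restrict_ext)

lemma scomp_eqD: "scomp S g f = scomp S g' f' \<Longrightarrow> x \<in> simp S n \<Longrightarrow> g n (f n x) = g' n (f' n x)"
  using scomp_apply[of x S n g f] scomp_apply[of x S n g' f'] by simp

text \<open>With at most one arrow between two indices, the unit and associativity laws and the
  equalizing condition of cofilteredness hold automatically.\<close>

lemma pro_space_thinI:
  assumes "\<And>e. e \<in> Ar (idx X) \<Longrightarrow> src (idx X) e \<in> obs X \<and> tgt (idx X) e \<in> obs X"
    and id: "\<And>s. s \<in> obs X \<Longrightarrow> ident (idx X) s \<in> arrs X s s"
    and cmp: "\<And>r s t e e'. e \<in> arrs X r s \<Longrightarrow> e' \<in> arrs X s t \<Longrightarrow> cmp (idx X) e' e \<in> arrs X r t"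
    and thin: "\<And>s t e e'. e \<in> arrs X s t \<Longrightarrow> e' \<in> arrs X s t \<Longrightarrow> e = e'"
    and ne: "obs X \<noteq> {}" and below: "\<And>s t. s \<in> obs X \<Longrightarrow> t \<in> obs X \<Longrightarrow> \<exists>r\<in>obs X. arrs X r s \<noteq> {} \<and> arrs X r t \<noteq> {}"
    and "\<And>s. s \<in> obs X \<Longrightarrow> simplicial_set (sp X s)"
    "\<And>s t e. e \<in> arrs X s t \<Longrightarrow> tr X e \<in> smaps (sp X s) (sp X t)"
    "\<And>s. s \<in> obs X \<Longrightarrow> tr X (ident (idx X) s) = sid (sp X s)"
    "\<And>r s t e e'. e \<in> arrs X r s \<Longrightarrow> e' \<in> arrs X s t \<Longrightarrow> tr X (cmp (idx X) e' e) = scomp (sp X r) (tr X e') (tr X e)"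
  shows "pro_space X"
proof -
  have ob: "s \<in> obs X \<and> t \<in> obs X" if "e \<in> arrs X s t" for e s t
    using that assms(1) unfolding hom_arr_def by blast
  have "category (idx X)"
    unfolding category_def
  proof (intro conjI allI ballI)
    fix s t e assume e: "e \<in> arrs X s t"
    have "ident (idx X) s \<in> arrs X s s" "ident (idx X) t \<in> arrs X t t" using id ob[OF e] by simp_all
    note thin[OF cmp[OF this(1) e] e] thin[OF cmp[OF e this(2)] e]
    then show "cmp (idx X) e (ident (idx X) s) = e" "cmp (idx X) (ident (idx X) t) e = e" by simp_all
  next
    fix q r s t e e' e'' assume e: "e \<in> arrs X q r" "e' \<in> arrs X r s" "e'' \<in> arrs X s t"
    show "cmp (idx X) e'' (cmp (idx X) e' e) = cmp (idx X) (cmp (idx X) e'' e') e"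
      by (rule thin[OF cmp[OF cmp[OF e(1,2)] e(3)] cmp[OF e(1) cmp[OF e(2,3)]]])
  next
    fix e assume "e \<in> Ar (idx X)"
    from assms(1)[OF this] show "src (idx X) e \<in> obs X" "tgt (idx X) e \<in> obs X" by simp_all
  qed (rule id cmp; assumption)+
  moreover have "cofiltered (idx X)"
    unfolding cofiltered_def
  proof (intro conjI ballI)
    fix s t e e' assume s: "s \<in> obs X" and "e \<in> arrs X s t" "e' \<in> arrs X s t"
    then have "e = e'" using thin by blast
    then show "\<exists>r\<in>obs X. \<exists>d\<in>arrs X r s. cmp (idx X) e d = cmp (idx X) e' d" using s id by blast
  qed (use ne below in auto)
  ultimately show ?thesis unfolding pro_space_def using assms(7-10) by blast
qed

context thin_pro_space
begin

lemmas sc = proD(1) and trs = proD(2)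
lemmas arr_obs = proD(5)[THEN conjunct1] proD(5)[THEN conjunct2]

lemma thin_tr:
  assumes "e \<in> arrs X r s" "d \<in> arrs X w r" "e' \<in> arrs X r' s" "d' \<in> arrs X w r'" "x \<in> simp (sp X w) n"
  shows "tr X e n (tr X d n x) = tr X e' n (tr X d' n x)"
proof -
  have "cmp (idx X) e d = cmp (idx X) e' d'"
    by (rule thin[OF proD(7)[OF assms(2,1)] proD(7)[OF assms(4,3)]])
  then have "scomp (sp X w) (tr X e) (tr X d) = scomp (sp X w) (tr X e') (tr X d')"
    using proD(4)[OF assms(2,1)] proD(4)[OF assms(4,3)] by simp
  then show ?thesis by (rule scomp_eqD) (rule assms(5))
qed

lemma below2:
  assumes "s \<in> obs X" "t \<in> obs X" obtains r d e where "d \<in> arrs X r s" "e \<in> arrs X r t"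
  using proD(8)[OF assms] by blast

lemma germI:
  assumes "f \<in> smaps (sp X t) A" "f' \<in> smaps (sp X t') A" "e \<in> arrs X r t" "e' \<in> arrs X r t'"
    "\<And>n x. x \<in> simp (sp X r) n \<Longrightarrow> f n (tr X e n x) = f' n (tr X e' n x)"
  shows "((t, f), (t', f')) \<in> germ X A"
proof -
  have "scomp (sp X r) f (tr X e) = scomp (sp X r) f' (tr X e')" by (rule scomp_eqI) (rule assms(5))
  then show ?thesis
    unfolding germ_def using assms(1-4) arr_obs[OF assms(3)] arr_obs[OF assms(4)] by blast
qed

lemma germE:
  assumes "((t, f), (t', f')) \<in> germ X A"
  obtains r e e' where "f \<in> smaps (sp X t) A" "f' \<in> smaps (sp X t') A" "e \<in> arrs X r t" "e' \<in> arrs X r t'"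
    "\<And>n x. x \<in> simp (sp X r) n \<Longrightarrow> f n (tr X e n x) = f' n (tr X e' n x)"
proof -
  obtain r e e' where *: "f \<in> smaps (sp X t) A" "f' \<in> smaps (sp X t') A" "e \<in> arrs X r t" "e' \<in> arrs X r t'"
    "scomp (sp X r) f (tr X e) = scomp (sp X r) f' (tr X e')"
    using assms unfolding germ_def by blast
  show thesis by (rule that[OF *(1-4) scomp_eqD[OF *(5)]])
qed

lemma equiv_hom_germ: "equiv (SIGMA t:obs X. smaps (sp X t) A) (germ X A)"
proof (rule equivI)
  show "germ X A \<subseteq> (SIGMA t:obs X. smaps (sp X t) A) \<times> (SIGMA t:obs X. smaps (sp X t) A)"
    by (auto simp: germ_def)
  show "refl_on (SIGMA t:obs X. smaps (sp X t) A) (germ X A)"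
    by (rule refl_onI) (use proD(6) in \<open>auto intro!: germI\<close>)
  show "sym (germ X A)"
    by (rule symI) (auto elim!: germE intro!: germI)
  show "trans (germ X A)"
  proof (rule transI)
    fix a b c assume ab: "(a, b) \<in> germ X A" "(b, c) \<in> germ X A"
    obtain t f t' f' t'' f'' where abc: "a = (t, f)" "b = (t', f')" "c = (t'', f'')" by (cases a; cases b; cases c)
    obtain r e e' where 1: "f \<in> smaps (sp X t) A" "f' \<in> smaps (sp X t') A" "e \<in> arrs X r t" "e' \<in> arrs X r t'"
      "\<And>n x. x \<in> simp (sp X r) n \<Longrightarrow> f n (tr X e n x) = f' n (tr X e' n x)"
      using ab(1) unfolding abc by (elim germE) (rule that)
    obtain q d d' where 2: "f' \<in> smaps (sp X t') A" "f'' \<in> smaps (sp X t'') A" "d \<in> arrs X q t'" "d' \<in> arrs X q t''"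
      "\<And>n x. x \<in> simp (sp X q) n \<Longrightarrow> f' n (tr X d n x) = f'' n (tr X d' n x)"
      using ab(2) unfolding abc by (elim germE) (rule that)
    obtain w h k where w: "h \<in> arrs X w r" "k \<in> arrs X w q" by (rule below2[OF arr_obs(1)[OF 1(3)] arr_obs(1)[OF 2(3)]])
    show "(a, c) \<in> germ X A"
      unfolding abc
    proof (rule germI[OF 1(1) 2(2) proD(7)[OF w(1) 1(3)] proD(7)[OF w(2) 2(4)]])
      fix n x assume x: "x \<in> simp (sp X w) n"
      show "f n (tr X (cmp (idx X) e h) n x) = f'' n (tr X (cmp (idx X) d' k) n x)"
        unfolding proD(4)[OF w(1) 1(3)] proD(4)[OF w(2) 2(4)] scomp_apply[OF x]
          1(5)[OF smapsD(1)[OF trs[OF w(1)] x]] thin_tr[OF 1(4) w(1) 2(3) w(2) x] 2(5)[OF smapsD(1)[OF trs[OF w(2)] x]] ..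
    qed
  qed
qed

end

text \<open>An isomorphism of diagrams along a bijection of indices. The assumptions are symmetric
  in \<open>X\<close> and \<open>Y\<close>, so that \<open>swap\<close> supplies one half of every
  statement about the inverse.\<close>

locale thin_pro_iso = X: thin_pro_space X + Y: thin_pro_space Y
  for X :: "('i, 'e, 'a) diagram" and Y :: "('j, 'd, 'b) diagram" +
  fixes \<alpha> \<alpha>' f g
  assumes \<alpha>: "s \<in> obs X \<Longrightarrow> \<alpha> s \<in> obs Y" "s \<in> obs X \<Longrightarrow> \<alpha>' (\<alpha> s) = s"
    and \<alpha>': "i \<in> obs Y \<Longrightarrow> \<alpha>' i \<in> obs X" "i \<in> obs Y \<Longrightarrow> \<alpha> (\<alpha>' i) = i"
    and f: "s \<in> obs X \<Longrightarrow> f s \<in> smaps (sp X s) (sp Y (\<alpha> s))"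
    and g: "i \<in> obs Y \<Longrightarrow> g i \<in> smaps (sp Y i) (sp X (\<alpha>' i))"
    and gf: "s \<in> obs X \<Longrightarrow> x \<in> simp (sp X s) n \<Longrightarrow> g (\<alpha> s) n (f s n x) = x"
    and fg: "i \<in> obs Y \<Longrightarrow> y \<in> simp (sp Y i) n \<Longrightarrow> f (\<alpha>' i) n (g i n y) = y"
    and arr: "e \<in> arrs X s t \<Longrightarrow> arrs Y (\<alpha> s) (\<alpha> t) \<noteq> {}"
    and arr': "d \<in> arrs Y i j \<Longrightarrow> arrs X (\<alpha>' i) (\<alpha>' j) \<noteq> {}"
    and f_nat: "e \<in> arrs X s t \<Longrightarrow> d \<in> arrs Y (\<alpha> s) (\<alpha> t) \<Longrightarrow> x \<in> simp (sp X s) n \<Longrightarrow>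
      tr Y d n (f s n x) = f t n (tr X e n x)"
    and g_nat: "d \<in> arrs Y i j \<Longrightarrow> e \<in> arrs X (\<alpha>' i) (\<alpha>' j) \<Longrightarrow> y \<in> simp (sp Y i) n \<Longrightarrow>
      tr X e n (g i n y) = g j n (tr Y d n y)"
begin

definition FF where "FF = (\<lambda>i\<in>obs Y. germ X (sp Y i) `` {(\<alpha>' i, f (\<alpha>' i))})"

lemma swap: "thin_pro_iso Y X \<alpha>' \<alpha> g f"
  by (intro thin_pro_iso.intro thin_pro_iso_axioms.intro X.thin_pro_space_axioms Y.thin_pro_space_axioms)
    (rule \<alpha> \<alpha>' f g gf fg arr arr' f_nat g_nat; assumption)+

lemma f': "i \<in> obs Y \<Longrightarrow> f (\<alpha>' i) \<in> smaps (sp X (\<alpha>' i)) (sp Y i)"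
  using f[OF \<alpha>'(1)] \<alpha>'(2) by simp

lemma FF_pro_hom: "FF \<in> pro_hom X Y"
  unfolding pro_hom_def
proof (intro CollectI conjI allI ballI)
  show "FF \<in> (\<Pi>\<^sub>E i\<in>obs Y. colim_hom X (sp Y i))"
    unfolding FF_def colim_hom_def by (auto intro!: quotientI f' \<alpha>'(1))
  fix i j d z assume d: "d \<in> arrs Y i j" and z: "z \<in> FF i"
  note ij = Y.arr_obs[OF d]
  obtain t h where th0: "z = (t, h)" by (cases z)
  have th: "z = (t, h)" "((\<alpha>' i, f (\<alpha>' i)), (t, h)) \<in> germ X (sp Y i)"
    using z unfolding th0 FF_def restrict_apply'[OF ij(1)] by simp_all
  obtain r e e' where r: "f (\<alpha>' i) \<in> smaps (sp X (\<alpha>' i)) (sp Y i)" "h \<in> smaps (sp X t) (sp Y i)"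
     "e \<in> arrs X r (\<alpha>' i)" "e' \<in> arrs X r t"
      "\<And>n x. x \<in> simp (sp X r) n \<Longrightarrow> f (\<alpha>' i) n (tr X e n x) = h n (tr X e' n x)"
    using th(2) by (elim X.germE) (rule that)
  obtain a where a: "a \<in> arrs X (\<alpha>' i) (\<alpha>' j)" using arr'[OF d] by blast
  have h: "scomp (sp X t) (tr Y d) h \<in> smaps (sp X t) (sp Y j)"
    by (rule smaps_scomp[OF r(2) Y.trs[OF d] X.sc[OF X.arr_obs(2)[OF r(4)]]])
  have "((\<alpha>' j, f (\<alpha>' j)), (t, scomp (sp X t) (tr Y d) h)) \<in> germ X (sp Y j)"
  proof (rule X.germI[OF f'[OF ij(2)] h X.proD(7)[OF r(3) a] r(4)])
    fix n x assume x: "x \<in> simp (sp X r) n"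
    have d': "d \<in> arrs Y (\<alpha> (\<alpha>' i)) (\<alpha> (\<alpha>' j))" using d \<alpha>'(2) ij by simp
    show "f (\<alpha>' j) n (tr X (cmp (idx X) a e) n x) = scomp (sp X t) (tr Y d) h n (tr X e' n x)"
      unfolding X.proD(4)[OF r(3) a] scomp_apply[OF x] scomp_apply[OF smapsD(1)[OF X.trs[OF r(4)] x]] r(5)[OF x, symmetric]
        f_nat[OF a d' smapsD(1)[OF X.trs[OF r(3)] x]] ..
  qed
  then show "case z of (t, f) \<Rightarrow> (t, scomp (sp X t) (tr Y d) f) \<in> FF j"
    using ij th(1) by (simp add: FF_def)
qed

end

text \<open>The composite is a union over all representatives of both germs. Any pair of
  representatives agrees with \<open>f\<close> and \<open>g\<close> at some lower indices; at a
  common index \<open>w\<close> below these, naturality reduces the composite to a transition map,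
  which is the germ of the identity.\<close>

lemma (in thin_pro_iso) comp_id: "pro_comp X X (thin_pro_iso.FF Y X \<alpha> g) FF = pro_id X"
proof -
  interpret S: thin_pro_iso Y X \<alpha>' \<alpha> g f by (rule swap)
  show ?thesis
    unfolding pro_comp_def pro_id_def
  proof (rule restrict_ext)
    fix s assume s: "s \<in> obs X"
    have one: "germ X (sp X s) `` {(t', scomp (sp X t') h k)} = germ X (sp X s) `` {(s, sid (sp X s))}"
      if h: "(t, h) \<in> S.FF s" and k: "(t', k) \<in> FF t" for t h t' k
    proof -
      have "((\<alpha> s, g (\<alpha> s)), (t, h)) \<in> germ Y (sp X s)" using h s by (simp add: S.FF_def)
      then obtain r a a' where 1: "g (\<alpha> s) \<in> smaps (sp Y (\<alpha> s)) (sp X s)" "h \<in> smaps (sp Y t) (sp X s)"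
        "a \<in> arrs Y r (\<alpha> s)" "a' \<in> arrs Y r t"
        "\<And>n x. x \<in> simp (sp Y r) n \<Longrightarrow> g (\<alpha> s) n (tr Y a n x) = h n (tr Y a' n x)"
        by (elim Y.germE) (rule that)
      note r = Y.arr_obs(1)[OF 1(3)] and t = Y.arr_obs(2)[OF 1(4)]
      have "((\<alpha>' t, f (\<alpha>' t)), (t', k)) \<in> germ X (sp Y t)" using k t by (simp add: FF_def)
      then obtain q b b' where 2: "f (\<alpha>' t) \<in> smaps (sp X (\<alpha>' t)) (sp Y t)" "k \<in> smaps (sp X t') (sp Y t)"
        "b \<in> arrs X q (\<alpha>' t)" "b' \<in> arrs X q t'"
        "\<And>n x. x \<in> simp (sp X q) n \<Longrightarrow> f (\<alpha>' t) n (tr X b n x) = k n (tr X b' n x)"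
        by (elim X.germE) (rule that)
      obtain c where c: "c \<in> arrs X (\<alpha>' r) s" using arr'[OF 1(3)] \<alpha>(2)[OF s] by auto
      obtain c' where c': "c' \<in> arrs X (\<alpha>' r) (\<alpha>' t)" using arr'[OF 1(4)] by blast
      obtain w u v where w: "u \<in> arrs X w (\<alpha>' r)" "v \<in> arrs X w q"
        by (rule X.below2[OF \<alpha>'(1)[OF r] X.arr_obs(1)[OF 2(3)]])
      have hk: "scomp (sp X t') h k \<in> smaps (sp X t') (sp X s)"
        by (rule smaps_scomp[OF 2(2) 1(2) X.sc[OF X.arr_obs(2)[OF 2(4)]]])
      have "((t', scomp (sp X t') h k), (s, sid (sp X s))) \<in> germ X (sp X s)"
      proof (rule X.germI[OF hk smaps_sid X.proD(7)[OF w(2) 2(4)] X.proD(7)[OF w(1) c]])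
        show "simplicial_set (sp X s)" by (rule X.sc[OF s])
      next
        fix n x assume x: "x \<in> simp (sp X w) n"
        note xu = smapsD(1)[OF X.trs[OF w(1)] x] and xv = smapsD(1)[OF X.trs[OF w(2)] x]
        note xv' = smapsD(1)[OF X.trs[OF 2(4)] xv] and xc = smapsD(1)[OF X.trs[OF c] xu]
        note fx = smapsD(1)[OF f'[OF r] xu]
        have a1: "a' \<in> arrs Y (\<alpha> (\<alpha>' r)) (\<alpha> (\<alpha>' t))" "a \<in> arrs Y (\<alpha> (\<alpha>' r)) (\<alpha> s)" using 1(3,4) \<alpha>'(2) r t by simp_all
        have "h n (k n (tr X b' n (tr X v n x))) = h n (f (\<alpha>' t) n (tr X c' n (tr X u n x)))"
          unfolding 2(5)[OF xv, symmetric] thin_pro_space.thin_tr[OF X.thin_pro_space_axioms 2(3) w(2) c' w(1) x] ..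
        also have "\<dots> = g (\<alpha> s) n (tr Y a n (f (\<alpha>' r) n (tr X u n x)))"
          unfolding f_nat[OF c' a1(1) xu, symmetric] 1(5)[OF fx] ..
        also have "\<dots> = tr X c n (tr X u n x)"
          unfolding f_nat[OF c a1(2) xu] gf[OF s xc] ..
        finally show "scomp (sp X t') h k n (tr X (cmp (idx X) b' v) n x) = sid (sp X s) n (tr X (cmp (idx X) c u) n x)"
          unfolding X.proD(4)[OF w(2) 2(4)] X.proD(4)[OF w(1) c] scomp_apply[OF x] scomp_apply[OF xv']
          by (simp add: sid_def xc)
      qed
      then show ?thesis by (rule equiv_class_eq[OF X.equiv_hom_germ])
    qed
    have 0: "(\<alpha> s, g (\<alpha> s)) \<in> S.FF s"
      unfolding S.FF_def restrict_apply'[OF s] using equiv_class_self[OF Y.equiv_hom_germ] \<alpha>(1)[OF s] S.f'[OF s] by blast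
    have 1: "(s, f s) \<in> FF (\<alpha> s)"
      unfolding FF_def restrict_apply'[OF \<alpha>(1)[OF s]] \<alpha>(2)[OF s]
      using equiv_class_self[OF X.equiv_hom_germ] s f[OF s] by blast
    show "(\<Union>(t, h)\<in>S.FF s. \<Union>(t', k)\<in>FF t. germ X (sp X s) `` {(t', scomp (sp X t') h k)}) =
        germ X (sp X s) `` {(s, sid (sp X s))}" (is "?L = ?R")
    proof (rule equalityI)
      show "?L \<subseteq> ?R"
      proof
        fix z assume "z \<in> ?L"
        then obtain v w where vw: "v \<in> S.FF s" "w \<in> FF (fst v)"
          "z \<in> germ X (sp X s) `` {(fst w, scomp (sp X (fst w)) (snd v) (snd w))}"
          unfolding split_def UN_iff by blast
        have "(fst v, snd v) \<in> S.FF s" "(fst w, snd w) \<in> FF (fst v)" using vw by simp_all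
        from vw(3)[unfolded one[OF this]] show "z \<in> ?R" .
      qed
      show "?R \<subseteq> ?L"
      proof
        fix z assume z: "z \<in> ?R"
        show "z \<in> ?L"
          by (rule UN_I[OF 0], unfold prod.case, rule UN_I[OF 1], unfold prod.case, unfold one[OF 0 1]) (rule z)
      qed
    qed
  qed
qed

lemma (in thin_pro_iso) pro_isomorphic: "pro_isomorphic X Y"
proof -
  interpret S: thin_pro_iso Y X \<alpha>' \<alpha> g f by (rule swap)
  show ?thesis
    unfolding pro_isomorphic_def using FF_pro_hom S.FF_pro_hom comp_id S.comp_id by blast
qed

text \<open>Moves a diagram into prescribed types: indices and arrows are renamed by injections,
  spaces are replaced by isomorphic copies, and the transition maps are conjugated by the
  isomorphisms \<open>h\<close> and \<open>k\<close>.\<close>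

lemma (in thin_pro_space) ex_copy:
  fixes C :: "'i \<Rightarrow> 'c sset" and \<alpha> :: "'i \<Rightarrow> 'j" and \<beta> :: "'e \<Rightarrow> 'd"
  assumes \<alpha>: "inj_on \<alpha> (obs X)" and \<beta>: "inj_on \<beta> (Ar (idx X))"
    and C: "\<And>s. s \<in> obs X \<Longrightarrow> simplicial_set (C s)" "\<And>s. s \<in> obs X \<Longrightarrow> siso (C s) (sp X s)"
  shows "\<exists>Y :: ('j, 'd, 'c) diagram. pro_space Y \<and> pro_isomorphic X Y \<and> (\<forall>i\<in>obs Y. \<exists>s\<in>obs X. sp Y i = C s)"
proof -
  have "\<forall>s. \<exists>h k. s \<in> obs X \<longrightarrow> h \<in> smaps (C s) (sp X s) \<and> k \<in> smaps (sp X s) (C s) \<and>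
    (\<forall>n. \<forall>x\<in>simp (C s) n. k n (h n x) = x) \<and> (\<forall>n. \<forall>y\<in>simp (sp X s) n. h n (k n y) = y)"
    using sisoE[OF C] by metis
  then obtain h k where hk: "\<And>s. s \<in> obs X \<Longrightarrow> h s \<in> smaps (C s) (sp X s)" "\<And>s. s \<in> obs X \<Longrightarrow> k s \<in> smaps (sp X s) (C s)"
    "\<And>s n x. s \<in> obs X \<Longrightarrow> x \<in> simp (C s) n \<Longrightarrow> k s n (h s n x) = x"
    "\<And>s n x. s \<in> obs X \<Longrightarrow> x \<in> simp (sp X s) n \<Longrightarrow> h s n (k s n x) = x"
    by metis
  define a where "a = inv_into (obs X) \<alpha>"
  define b where "b = inv_into (Ar (idx X)) \<beta>"
  have a: "a (\<alpha> s) = s" if "s \<in> obs X" for s unfolding a_def by (rule inv_into_f_f[OF \<alpha> that])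
  have b: "b (\<beta> x) = x" if "x \<in> Ar (idx X)" for x unfolding b_def by (rule inv_into_f_f[OF \<beta> that])
  define Y where "Y = \<lparr>idx = \<lparr>Ob = \<alpha> ` obs X, Ar = \<beta> ` Ar (idx X), src = (\<lambda>e. \<alpha> (src (idx X) (b e))), tgt = (\<lambda>e. \<alpha> (tgt (idx X) (b e))),
      ident = (\<lambda>i. \<beta> (ident (idx X) (a i))), cmp = (\<lambda>e' e. \<beta> (cmp (idx X) (b e') (b e)))\<rparr>,
    sp = (\<lambda>i. C (a i)), tr = (\<lambda>e. scomp (C (src (idx X) (b e))) (k (tgt (idx X) (b e))) (scomp (C (src (idx X) (b e))) (tr X (b e)) (h (src (idx X) (b e)))))\<rparr>"
  have YOb: "obs Y = \<alpha> ` obs X" by (simp add: Y_def)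
  have arrX: "x \<in> arrs X s t \<longleftrightarrow> x \<in> Ar (idx X) \<and> src (idx X) x = s \<and> tgt (idx X) x = t" for x s t
    by (auto simp: hom_arr_def)
  have xob: "src (idx X) x \<in> obs X" "tgt (idx X) x \<in> obs X" if "x \<in> Ar (idx X)" for x
    using arr_obs[of x "src (idx X) x" "tgt (idx X) x"] that unfolding arrX by blast+
  have Yarr: "\<exists>s t x. i = \<alpha> s \<and> j = \<alpha> t \<and> x \<in> arrs X s t \<and> d = \<beta> x \<and> s \<in> obs X \<and> t \<in> obs X" if "d \<in> arrs Y i j" for d i j
  proof -
    obtain x where x: "x \<in> Ar (idx X)" "d = \<beta> x" "\<alpha> (src (idx X) (b (\<beta> x))) = i" "\<alpha> (tgt (idx X) (b (\<beta> x))) = j"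
      using \<open>d \<in> arrs Y i j\<close> unfolding Y_def hom_arr_def by auto
    then show ?thesis unfolding b[OF x(1)] using xob[OF x(1)] arrX by blast
  qed
  have YarrI: "\<beta> x \<in> arrs Y (\<alpha> s) (\<alpha> t)" if "x \<in> arrs X s t" for x s t
    using that b[of x] unfolding arrX by (auto simp: Y_def hom_arr_def)
  have Ytr: "tr Y (\<beta> x) = scomp (C s) (k t) (scomp (C s) (tr X x) (h s))" if "x \<in> arrs X s t" for x s t
    using that b[of x] unfolding arrX by (auto simp: Y_def)
  have Ysp: "sp Y (\<alpha> s) = C s" if "s \<in> obs X" for s using a[OF that] by (simp add: Y_def)
  have Yid: "ident (idx Y) (\<alpha> s) = \<beta> (ident (idx X) s)" if "s \<in> obs X" for s using a[OF that] by (simp add: Y_def)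
  have Ycmp: "cmp (idx Y) (\<beta> x') (\<beta> x) = \<beta> (cmp (idx X) x' x)" if "x \<in> arrs X r s" "x' \<in> arrs X s' t" for x x' r s s' t
    using b[of x] b[of x'] that unfolding arrX by (simp add: Y_def)
  have trY: "tr Y (\<beta> x) \<in> smaps (C s) (C t)" if x: "x \<in> arrs X s t" for x s t
    unfolding Ytr[OF x] using arr_obs[OF x] by (intro smaps_scomp[OF smaps_scomp[OF hk(1) trs[OF x] C(1)] hk(2) C(1)])
  have trY_apply: "tr Y (\<beta> x) n y = k t n (tr X x n (h s n y))" if x: "x \<in> arrs X s t" "y \<in> simp (C s) n" for x s t n y
    unfolding Ytr[OF x(1)] scomp_apply[OF x(2)] ..
  have thinY: "e = e'" if e: "e \<in> arrs Y i j" "e' \<in> arrs Y i j" for i j e e'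
  proof -
    obtain s t x where 1: "i = \<alpha> s" "j = \<alpha> t" "x \<in> arrs X s t" "e = \<beta> x" "s \<in> obs X" "t \<in> obs X" using Yarr[OF e(1)] by blast
    obtain s' t' x' where 2: "i = \<alpha> s'" "j = \<alpha> t'" "x' \<in> arrs X s' t'" "e' = \<beta> x'" "s' \<in> obs X" "t' \<in> obs X" using Yarr[OF e(2)] by blast
    have "s = s'" "t = t'" using 1 2 \<alpha> by (auto dest: inj_onD)
    then show ?thesis using 1 2 thin by blast
  qed
  have "pro_space Y"
  proof (rule pro_space_thinI[OF _ _ _ thinY])
    fix e assume "e \<in> Ar (idx Y)"
    then have "e \<in> arrs Y (src (idx Y) e) (tgt (idx Y) e)" by (simp add: hom_arr_def)
    from Yarr[OF this] show "src (idx Y) e \<in> obs Y \<and> tgt (idx Y) e \<in> obs Y" unfolding YOb by blast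
  next
    fix i assume "i \<in> obs Y"
    then obtain s where s: "i = \<alpha> s" "s \<in> obs X" unfolding YOb by blast
    show "ident (idx Y) i \<in> arrs Y i i" unfolding s(1) Yid[OF s(2)] by (rule YarrI[OF proD(6)[OF s(2)]])
    show "simplicial_set (sp Y i)" unfolding s(1) Ysp[OF s(2)] by (rule C(1)[OF s(2)])
    note id = proD(6)[OF s(2)]
    show "tr Y (ident (idx Y) i) = sid (sp Y i)"
      unfolding s(1) Yid[OF s(2)] Ysp[OF s(2)]
      by (rule smaps_eqI[OF trY[OF id] smaps_sid[OF C(1)[OF s(2)]]])
        (use smapsD(1)[OF hk(1)[OF s(2)]] in \<open>simp add: trY_apply[OF id] proD(3)[OF s(2)] sid_def hk(3)[OF s(2)]\<close>)
  next
    fix i j l e e' assume e: "e \<in> arrs Y i j" "e' \<in> arrs Y j l"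
    obtain s t x where 1: "i = \<alpha> s" "j = \<alpha> t" "x \<in> arrs X s t" "e = \<beta> x" "s \<in> obs X" "t \<in> obs X" using Yarr[OF e(1)] by blast
    obtain t' u x' where 2: "j = \<alpha> t'" "l = \<alpha> u" "x' \<in> arrs X t' u" "e' = \<beta> x'" "t' \<in> obs X" "u \<in> obs X" using Yarr[OF e(2)] by blast
    have t: "t' = t" using 1 2 \<alpha> by (auto dest: inj_onD)
    note x' = 2(3)[unfolded t]
    show "cmp (idx Y) e' e \<in> arrs Y i l"
      unfolding 1(1,4) 2(2,4) Ycmp[OF 1(3) 2(3)] by (rule YarrI[OF proD(7)[OF 1(3) x']])
    show "tr Y (cmp (idx Y) e' e) = scomp (sp Y i) (tr Y e') (tr Y e)"
      unfolding 1(1,4) 2(2,4) Ycmp[OF 1(3) 2(3)] Ysp[OF 1(5)]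
    proof (rule smaps_eqI[OF trY[OF proD(7)[OF 1(3) x']] smaps_scomp[OF trY[OF 1(3)] trY[OF x'] C(1)[OF 1(5)]]])
      fix n y assume y: "y \<in> simp (C s) n"
      note hy = smapsD(1)[OF hk(1)[OF 1(5)] y]
      show "tr Y (\<beta> (cmp (idx X) x' x)) n y = scomp (C s) (tr Y (\<beta> x')) (tr Y (\<beta> x)) n y"
        unfolding scomp_apply[OF y] trY_apply[OF proD(7)[OF 1(3) x'] y] trY_apply[OF x' smapsD(1)[OF trY[OF 1(3)] y]]
        unfolding trY_apply[OF 1(3) y] hk(4)[OF 1(6) smapsD(1)[OF trs[OF 1(3)] hy]] proD(4)[OF 1(3) x'] scomp_apply[OF hy] ..
    qed
  next
    show "obs Y \<noteq> {}" unfolding YOb using proD(9) by simp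
  next
    fix i j assume "i \<in> obs Y" "j \<in> obs Y"
    then obtain s t where s: "i = \<alpha> s" "s \<in> obs X" and t: "j = \<alpha> t" "t \<in> obs X" unfolding YOb by blast
    obtain r d e where r: "d \<in> arrs X r s" "e \<in> arrs X r t" by (rule below2[OF s(2) t(2)])
    show "\<exists>r\<in>obs Y. arrs Y r i \<noteq> {} \<and> arrs Y r j \<noteq> {}"
      unfolding s(1) t(1) YOb using YarrI[OF r(1)] YarrI[OF r(2)] arr_obs(1)[OF r(1)] by blast
  next
    fix i j e assume e: "e \<in> arrs Y i j"
    obtain s t x where 1: "i = \<alpha> s" "j = \<alpha> t" "x \<in> arrs X s t" "e = \<beta> x" "s \<in> obs X" "t \<in> obs X" using Yarr[OF e(1)] by blast
    show "tr Y e \<in> smaps (sp Y i) (sp Y j)"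
      unfolding 1(1,2,4) Ysp[OF 1(5)] Ysp[OF 1(6)] by (rule trY[OF 1(3)])
  qed
  have Ytps: "thin_pro_space Y" by (rule thin_pro_space.intro) (use \<open>pro_space Y\<close> thinY in blast)+
  have "thin_pro_iso X Y \<alpha> a k (\<lambda>i. h (a i))"
  proof (intro thin_pro_iso.intro thin_pro_iso_axioms.intro Ytps thin_pro_space_axioms)
    fix d i j assume d: "d \<in> arrs Y i j"
    obtain s t x where 1: "i = \<alpha> s" "j = \<alpha> t" "x \<in> arrs X s t" "d = \<beta> x" "s \<in> obs X" "t \<in> obs X" using Yarr[OF d] by blast
    show "arrs X (a i) (a j) \<noteq> {}" unfolding 1(1,2) a[OF 1(5)] a[OF 1(6)] using 1(3) by blast
    fix e n y assume e: "e \<in> arrs X (a i) (a j)" and y: "y \<in> simp (sp Y i) n"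
    have ex: "e = x" using e 1(3) thin unfolding 1(1,2) a[OF 1(5)] a[OF 1(6)] by blast
    have y': "y \<in> simp (C s) n" using y unfolding 1(1) Ysp[OF 1(5)] .
    show "tr X e n (h (a i) n y) = h (a j) n (tr Y d n y)"
      unfolding ex 1(1,2,4) a[OF 1(5)] a[OF 1(6)] trY_apply[OF 1(3) y']
        hk(4)[OF 1(6) smapsD(1)[OF trs[OF 1(3)] smapsD(1)[OF hk(1)[OF 1(5)] y']]] ..
  next
    fix e s t assume "e \<in> arrs X s t"
    from YarrI[OF this] show "arrs Y (\<alpha> s) (\<alpha> t) \<noteq> {}" by blast
  next
    fix e s t d n x assume e: "e \<in> arrs X s t" and d: "d \<in> arrs Y (\<alpha> s) (\<alpha> t)" and x: "x \<in> simp (sp X s) n"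
    note st = arr_obs[OF e]
    have de: "d = \<beta> e" by (rule thinY[OF d YarrI[OF e]])
    show "tr Y d n (k s n x) = k t n (tr X e n x)"
      unfolding de trY_apply[OF e smapsD(1)[OF hk(2)[OF st(1)] x]] hk(4)[OF st(1) x] ..
  qed (use YOb a Ysp hk YarrI in auto)
  then have "pro_isomorphic X Y" by (rule thin_pro_iso.pro_isomorphic)
  moreover have "\<forall>i\<in>obs Y. \<exists>s\<in>obs X. sp Y i = C s" using YOb Ysp by auto
  ultimately show ?thesis using \<open>pro_space Y\<close> by blast
qed

section \<open>Nilpotency of the nerves of finite \<open>p\<close>-groups\<close>

text \<open>Identifies the powers of an element of order \<open>p\<close> with the residues, taken
  as integers to match the carrier of \<open>residue_ring\<close>.\<close>

lemma (in group) pow_mod_prime: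
  assumes "prime p" "z \<in> carrier G" "z \<noteq> \<one>" "z [^] (p::nat) = \<one>"
  shows "bij_betw (\<lambda>i::int. z [^] nat i) {0..<int p} (range (\<lambda>m::nat. z [^] m))"
    "z [^] ((m::nat) mod p) = z [^] m"
proof -
  have "ord z dvd p" using assms(2,4) pow_eq_id by blast
  moreover have "ord z \<noteq> 1" using assms(2,3) pow_eq_id[of z 1] by auto
  ultimately have o: "ord z = p" using assms(1) by (auto simp: prime_nat_iff)
  show m: "z [^] (m mod p) = z [^] m" for m :: nat
  proof -
    have "z [^] m = z [^] (p * (m div p) + m mod p)" by simp
    also have "\<dots> = (z [^] p) [^] (m div p) \<otimes> z [^] (m mod p)"
      using assms(2) by (simp only: nat_pow_mult[symmetric] nat_pow_pow)
    finally show ?thesis using assms(2,4) by simp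
  qed
  have "inj_on (\<lambda>i::int. z [^] nat i) {0..<int p}"
  proof (rule inj_onI)
    fix i j :: int assume ij: "i \<in> {0..<int p}" "j \<in> {0..<int p}" "z [^] nat i = z [^] nat j"
    have "nat i \<in> {0..ord z - 1}" "nat j \<in> {0..ord z - 1}" using ij(1,2) unfolding o by auto
    then have "nat i = nat j" using ord_inj[OF assms(2)] ij(3) by (auto dest: inj_onD)
    then show "i = j" using ij(1,2) by (simp add: eq_nat_nat_iff)
  qed
  moreover have "(\<lambda>i::int. z [^] nat i) ` {0..<int p} = range (\<lambda>m::nat. z [^] m)"
  proof (intro equalityI subsetI)
    fix x assume "x \<in> range (\<lambda>m::nat. z [^] m)"
    then obtain m :: nat where x: "x = z [^] m" by blast
    have "x = z [^] nat (int (m mod p))" unfolding x nat_int m ..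
    moreover have "int (m mod p) \<in> {0..<int p}" using prime_gt_0_nat[OF assms(1)] by simp
    ultimately show "x \<in> (\<lambda>i::int. z [^] nat i) ` {0..<int p}" by blast
  next
    fix x assume "x \<in> (\<lambda>i::int. z [^] nat i) ` {0..<int p}"
    then show "x \<in> range (\<lambda>m::nat. z [^] m)" by blast
  qed
  ultimately show "bij_betw (\<lambda>i::int. z [^] nat i) {0..<int p} (range (\<lambda>m::nat. z [^] m))"
    by (simp add: bij_betw_def)
qed

text \<open>Natural exponents give a subgroup because \<open>z\<close> has finite order: the inverse
  of the \<open>m\<close>-th power is the power with exponent \<open>m * (p - 1)\<close>.\<close>

lemma (in group) central_powers:
  assumes z: "z \<in> carrier G" "z [^] (p::nat) = \<one>" "p > 0"
  shows "subgroup (range (\<lambda>m::nat. z [^] m)) G"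
    "g \<in> carrier G \<Longrightarrow> g \<otimes> z = z \<otimes> g \<Longrightarrow> w \<in> range (\<lambda>m::nat. z [^] m) \<Longrightarrow> g \<otimes> w = w \<otimes> g"
proof -
  show "subgroup (range (\<lambda>m::nat. z [^] m)) G"
  proof (rule subgroupI)
    fix a assume "a \<in> range (\<lambda>m::nat. z [^] m)"
    then obtain m :: nat where a: "a = z [^] m" by blast
    have "m * (p - 1) + m = p * m" using z(3) by (cases p) auto
    then have "z [^] (m * (p - 1)) \<otimes> a = (z [^] p) [^] m"
      unfolding a nat_pow_mult[OF z(1)] nat_pow_pow[OF z(1)] by simp
    then have "inv a = z [^] (m * (p - 1))"
      using z by (intro inv_equality) (simp_all add: a)
    then show "inv a \<in> range (\<lambda>m::nat. z [^] m)" by blast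
  qed (use z(1) in \<open>auto simp: nat_pow_mult\<close>)
  assume g: "g \<in> carrier G" "g \<otimes> z = z \<otimes> g" and "w \<in> range (\<lambda>m::nat. z [^] m)"
  then obtain m :: nat where w: "w = z [^] m" by blast
  have "g \<otimes> z [^] m = z [^] m \<otimes> g" for m :: nat
  proof (induction m)
    case (Suc m)
    have "g \<otimes> z [^] Suc m = (g \<otimes> z [^] m) \<otimes> z" using g z by (simp add: m_assoc)
    also have "\<dots> = z [^] m \<otimes> (z \<otimes> g)" unfolding Suc.IH using g z by (simp add: m_assoc)
    finally show ?case using g z by (simp add: m_assoc)
  qed (simp add: g)
  then show "g \<otimes> w = w \<otimes> g" unfolding w .
qed

text \<open>Start of the induction: the nerve of the trivial group has one simplex in each
  dimension.\<close>

lemma nilpotent_trivial: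
  assumes "carrier Q = {\<one>\<^bsub>Q\<^esub>}" "group Q"
  shows "copies_nilpotent TYPE('u) K (nerve Q)"
  unfolding copies_nilpotent_def
proof (intro allI impI)
  fix Y :: "'u sset" assume Y: "simplicial_set Y" "siso Y (nerve Q)"
  interpret group Q by fact
  have s: "simp (nerve Q) n = {\<lambda>_\<in>ipairs n. \<one>\<^bsub>Q\<^esub>}" for n
  proof
    show "simp (nerve Q) n \<subseteq> {\<lambda>_\<in>ipairs n. \<one>\<^bsub>Q\<^esub>}"
    proof
      fix x assume x: "x \<in> simp (nerve Q) n"
      have "x = (\<lambda>_\<in>ipairs n. \<one>\<^bsub>Q\<^esub>)"
        by (rule nerve_eqI[OF nerve_simpD(2)[OF x]]) (use nerve_simpD(1)[OF x] assms(1) in \<open>auto simp: ipairs_def\<close>)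
      then show "x \<in> {\<lambda>_\<in>ipairs n. \<one>\<^bsub>Q\<^esub>}" by simp
    qed
    have "(\<lambda>_\<in>ipairs n. \<one>\<^bsub>Q\<^esub>) \<in> simp (nerve Q) n" by (rule nerve_simpI) (auto simp: ipairs_def)
    then show "{\<lambda>_\<in>ipairs n. \<one>\<^bsub>Q\<^esub>} \<subseteq> simp (nerve Q) n" by simp
  qed
  show "nilpotent K Y"
  proof (rule nilpotent.point[OF Y(1)])
    fix n
    obtain f where "bij_betw (f n) (sset.simp Y n) (sset.simp (nerve Q) n)" using Y(2) unfolding siso_def by blast
    then have "card (simp Y n) = 1" unfolding s by (simp add: bij_betw_same_card)
    then show "\<exists>x. simp Y n = {x}" by (rule card_1_singletonE) blast
  qed
qed

text \<open>Induction on the order of the quotient, removing a central subgroup of order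
  \<open>p\<close>. The coefficients \<open>M\<close> enter through an additive bijection
  \<open>j\<close> with the residues modulo \<open>p\<close>, so that the residue ring and its
  copies in other types are treated alike.\<close>

theorem (in group) copies_nilpotent_Mod:
  fixes M :: "('m, 'x) ring_scheme"
  assumes inf: "infinite (UNIV :: 'u set)" and p: "prime p" and M: "abelian_group M"
    and j: "bij_betw j {0..<int p} (carrier M)"
    and j_add: "\<And>a b. a \<in> {0..<int p} \<Longrightarrow> b \<in> {0..<int p} \<Longrightarrow> j ((a + b) mod int p) = j a \<oplus>\<^bsub>M\<^esub> j b"
    and K: "EM M 2 \<in> K"
  shows "H \<in> finite_p_quotients p G \<Longrightarrow> copies_nilpotent TYPE('u) K (nerve (G Mod H))"
proof (induction "card (carrier (G Mod H))" arbitrary: H rule: less_induct)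
  case less
  have H: "H \<lhd> G" "finite (carrier (G Mod H))" using less.prems finite_p_quotients_iff[OF p, of H G] by blast+
  obtain k where k: "order (G Mod H) = p ^ k" using less.prems by (auto simp: finite_p_quotients_def)
  interpret H: normal H G by (rule H(1))
  interpret Q: group "G Mod H" by (rule H.factorgroup_is_group)
  show ?case
  proof (cases "k = 0")
    case True
    then have "card (carrier (G Mod H)) = 1" using k by (simp add: order_def)
    then have "carrier (G Mod H) = {\<one>\<^bsub>G Mod H\<^esub>}"
      using Q.one_closed by (metis card_1_singletonE singletonD)
    then show ?thesis by (rule nilpotent_trivial) (rule Q.is_group)
  next
    case False
    then have "0 < k" by simp
    from Q.exists_central_of_order_p[OF p k this]
    obtain z where z: "z \<in> carrier (G Mod H)" "z \<noteq> \<one>\<^bsub>G Mod H\<^esub>" "z [^]\<^bsub>G Mod H\<^esub> p = \<one>\<^bsub>G Mod H\<^esub>"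
      and "\<forall>g\<in>carrier (G Mod H). g \<otimes>\<^bsub>G Mod H\<^esub> z = z \<otimes>\<^bsub>G Mod H\<^esub> g"
      by (elim bexE conjE) (rule that)
    note zc = bspec[OF this(4)]
    let ?Q = "G Mod H"
    define Z where "Z = range (\<lambda>m::nat. z [^]\<^bsub>?Q\<^esub> m)"
    note Zs = Q.central_powers(1)[OF z(1,3) prime_gt_0_nat[OF p], folded Z_def]
    have ZQ: "Z \<subseteq> carrier ?Q" by (rule subgroup.subset[OF Zs])
    have Zc: "g \<otimes>\<^bsub>?Q\<^esub> w = w \<otimes>\<^bsub>?Q\<^esub> g" if "g \<in> carrier ?Q" "w \<in> Z" for g w
      by (rule Q.central_powers(2)[OF z(1,3) prime_gt_0_nat[OF p] that(1) zc[OF that(1)] that(2)[unfolded Z_def]])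
    \<comment> \<open>The preimage of \<open>Z\<close> in \<open>G\<close>: the quotient of
      \<open>G/H\<close> by \<open>Z\<close> is then again of the form \<open>G/L\<close>, in the
      same type and in the same family.\<close>
    define L where "L = {x\<in>carrier G. H #> x \<in> Z}"
    have hQ: "H #> x \<in> carrier ?Q" if "x \<in> carrier G" for x using that by (simp add: carrier_Mod)
    have hm: "H #> (x \<otimes> y) = (H #> x) \<otimes>\<^bsub>?Q\<^esub> (H #> y)" if "x \<in> carrier G" "y \<in> carrier G" for x y
      using H.Mod_hom that unfolding hom_def by blast
    have h1: "H #> \<one> = \<one>\<^bsub>?Q\<^esub>" using H.subset by simp
    have hi: "H #> inv x = inv\<^bsub>?Q\<^esub> (H #> x)" if x: "x \<in> carrier G" for x
      using hm[of "inv x" x] x hQ h1 by (intro Q.inv_equality[symmetric]) simp_all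
    have HL: "H \<subseteq> L"
    proof
      fix x assume x: "x \<in> H"
      then have "H #> x = \<one>\<^bsub>?Q\<^esub>" using coset_join2[OF _ H.subgroup_axioms x] H.subset by auto
      then show "x \<in> L" using x H.subset subgroup.one_closed[OF Zs] by (auto simp: L_def)
    qed
    have LG: "L \<lhd> G"
      unfolding normal_inv_iff
    proof (intro conjI ballI)
      show "subgroup L G"
      proof (rule subgroupI)
        show "L \<noteq> {}" using HL H.one_closed by blast
        show "inv a \<in> L" if a: "a \<in> L" for a
          using a hi[of a] subgroup.m_inv_closed[OF Zs, of "H #> a"] by (simp only: L_def mem_Collect_eq inv_closed)
        show "a \<otimes> b \<in> L" if ab: "a \<in> L" "b \<in> L" for a b
          using ab hm[of a b] subgroup.m_closed[OF Zs, of "H #> a" "H #> b"] by (simp only: L_def mem_Collect_eq m_closed)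
      qed (simp add: L_def Collect_restrict)
      fix x h assume x: "x \<in> carrier G" and h: "h \<in> L"
      have hG: "h \<in> carrier G" "H #> h \<in> Z" using h by (auto simp: L_def)
      have "H #> (x \<otimes> h \<otimes> inv x) = ((H #> x) \<otimes>\<^bsub>?Q\<^esub> (H #> h)) \<otimes>\<^bsub>?Q\<^esub> inv\<^bsub>?Q\<^esub> (H #> x)"
        using x hG by (simp add: hm hi)
      also have "\<dots> = (H #> h) \<otimes>\<^bsub>?Q\<^esub> ((H #> x) \<otimes>\<^bsub>?Q\<^esub> inv\<^bsub>?Q\<^esub> (H #> x))"
        unfolding Zc[OF hQ[OF x] hG(2)] by (rule Q.m_assoc) (use x hG hQ in simp_all)
      also have "\<dots> = H #> h"
        unfolding Q.r_inv[OF hQ[OF x]] by (rule Q.r_one[OF hQ[OF hG(1)]])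
      finally show "x \<otimes> h \<otimes> inv x \<in> L" using x hG by (simp add: L_def)
    qed
    interpret L: normal L G by (rule LG)
    interpret Q': group "G Mod L" by (rule L.factorgroup_is_group)
    let ?\<pi> = "\<lambda>C. L <#> C"
    have \<pi>: "?\<pi> \<in> hom ?Q (G Mod L)" by (rule L.transition_hom[OF H(1) HL])
    have \<pi>_apply: "?\<pi> (H #> x) = L #> x" if "x \<in> carrier G" for x by (rule L.transition[OF H(1) HL that])
    have \<pi>_surj: "?\<pi> ` carrier ?Q = carrier (G Mod L)"
      unfolding carrier_Mod image_image by (rule image_cong) (simp_all add: \<pi>_apply)
    have fin: "finite (carrier (G Mod L))" unfolding \<pi>_surj[symmetric] using H(2) by blast
    have one: "?\<pi> \<one>\<^bsub>?Q\<^esub> = \<one>\<^bsub>G Mod L\<^esub>" by (rule hom_one[OF \<pi> Q.is_group Q'.is_group])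
    have ker: "{q\<in>carrier ?Q. ?\<pi> q = \<one>\<^bsub>G Mod L\<^esub>} = Z"
    proof (intro equalityI subsetI)
      fix q assume "q \<in> {q\<in>carrier ?Q. ?\<pi> q = \<one>\<^bsub>G Mod L\<^esub>}"
      then obtain x where x: "x \<in> carrier G" "q = H #> x" "L #> x = L" by (auto simp: carrier_Mod \<pi>_apply)
      have "x \<in> L" using x rcos_self[OF x(1) L.subgroup_axioms] by simp
      then show "q \<in> Z" unfolding x(2) L_def by blast
    next
      fix q assume q: "q \<in> Z"
      then obtain x where x: "x \<in> carrier G" "q = H #> x" using ZQ unfolding carrier_Mod by blast
      have "x \<in> L" using q x(1) unfolding x(2) L_def by blast
      then have "L #> x = L" by (rule coset_join2[OF x(1) L.subgroup_axioms])
      then show "q \<in> {q\<in>carrier ?Q. ?\<pi> q = \<one>\<^bsub>G Mod L\<^esub>}"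
        using hQ[OF x(1)] \<pi>_apply[OF x(1)] unfolding x(2) by simp
    qed
    have zZ: "z \<in> Z" unfolding Z_def using z(1) Q.nat_pow_eone by (metis rangeI)
    have LP: "L \<in> finite_p_quotients p G"
      unfolding finite_p_quotients_iff[OF p] using LG fin less.prems HL finite_p_quotients_iff[OF p, of H G] by blast
    have "card (carrier (G Mod L)) < card (carrier ?Q)"
    proof -
      have "\<not> inj_on ?\<pi> (carrier ?Q)"
        using zZ ker one z(1,2) by (auto dest!: inj_onD[of _ _ z "\<one>\<^bsub>?Q\<^esub>"])
      then have "card (?\<pi> ` carrier ?Q) \<noteq> card (carrier ?Q)" using H(2) eq_card_imp_inj_on by blast
      then show ?thesis unfolding \<pi>_surj[symmetric] using card_image_le[OF H(2), of ?\<pi>] by linarith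
    qed
    then have IH: "copies_nilpotent TYPE('u) K (nerve (G Mod L))" by (rule less.hyps[OF _ LP])
    \<comment> \<open>The value at the unit is set by hand, since \<open>central_ext\<close> asks
      for a normalized section and \<open>inv_into\<close> could return another element of the
      kernel.\<close>
    define \<sigma> where "\<sigma> = (\<lambda>x. if x = \<one>\<^bsub>G Mod L\<^esub> then \<one>\<^bsub>?Q\<^esub> else inv_into (carrier ?Q) ?\<pi> x)"
    have \<sigma>: "\<sigma> x \<in> carrier ?Q" "?\<pi> (\<sigma> x) = x" if "x \<in> carrier (G Mod L)" for x
    proof -
      have x: "x \<in> ?\<pi> ` carrier ?Q" using that unfolding \<pi>_surj .
      then show "\<sigma> x \<in> carrier ?Q" "?\<pi> (\<sigma> x) = x"
        by (cases "x = \<one>\<^bsub>G Mod L\<^esub>";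
            simp only: \<sigma>_def if_True if_False simp_thms Q.one_closed one inv_into_into f_inv_into_f)+
    qed
    define i where "i = inv_into {0..<int p} j"
    have ib: "bij_betw i (carrier M) {0..<int p}" unfolding i_def by (rule bij_betw_inv_into[OF j])
    have ji: "j (i a) = a" if "a \<in> carrier M" for a unfolding i_def by (rule bij_betw_inv_into_right[OF j that])
    have ij: "i (j a) = a" if "a \<in> {0..<int p}" for a unfolding i_def by (rule bij_betw_inv_into_left[OF j that])
    have iM: "i a \<in> {0..<int p}" if "a \<in> carrier M" for a by (rule bij_betw_apply[OF ib that])
    define \<iota> where "\<iota> = (\<lambda>a. z [^]\<^bsub>?Q\<^esub> nat (i a))"
    note pm = Q.pow_mod_prime[OF p z]
    have \<iota>b: "bij_betw \<iota> (carrier M) {q\<in>carrier ?Q. ?\<pi> q = \<one>\<^bsub>G Mod L\<^esub>}"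
      unfolding ker \<iota>_def Z_def using bij_betw_trans[OF ib pm(1)] by (simp add: comp_def)
    have \<iota>add: "\<iota> (a \<oplus>\<^bsub>M\<^esub> b) = \<iota> a \<otimes>\<^bsub>?Q\<^esub> \<iota> b" if a: "a \<in> carrier M" and b: "b \<in> carrier M" for a b
    proof -
      have "i (a \<oplus>\<^bsub>M\<^esub> b) = (i a + i b) mod int p"
        using j_add[OF iM[OF a] iM[OF b]] ij[of "(i a + i b) mod int p"] ji[OF a] ji[OF b] prime_gt_0_nat[OF p] by simp
      also have "\<dots> = int ((nat (i a) + nat (i b)) mod p)"
        using iM[OF a] iM[OF b] by (simp add: zmod_int)
      finally show ?thesis
        unfolding \<iota>_def Q.nat_pow_mult[OF z(1)] using pm(2) by simp
    qed
    interpret A: abelian_group M by (rule M)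
    have "central_ext M ?Q (G Mod L) ?\<pi> \<sigma> \<iota>"
    proof (intro central_ext.intro central_ext_axioms.intro M Q.is_group Q'.is_group \<pi> \<sigma> \<iota>b \<iota>add)
      show "\<sigma> \<one>\<^bsub>G Mod L\<^esub> = \<one>\<^bsub>?Q\<^esub>" by (simp add: \<sigma>_def)
      fix a q assume "a \<in> carrier M" "q \<in> carrier ?Q"
      then show "\<iota> a \<otimes>\<^bsub>?Q\<^esub> q = q \<otimes>\<^bsub>?Q\<^esub> \<iota> a"
        using Zc[of q "\<iota> a"] bij_betw_apply[OF \<iota>b, of a] unfolding ker by simp
    qed
    then show ?thesis
      by (rule central_ext.copies_nilpotent_extension[OF _ inf H(2) fin _ K IH]) (use bij_betw_finite[OF j] in simp)
  qed
qed

section \<open>The test modules\<close>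

lemma residue_ring_simps:
  "carrier (residue_ring (int p)) = {0..<int p}" "x \<oplus>\<^bsub>residue_ring (int p)\<^esub> y = (x + y) mod int p"
  "x \<otimes>\<^bsub>residue_ring (int p)\<^esub> y = (x * y) mod int p" "\<zero>\<^bsub>residue_ring (int p)\<^esub> = 0" "\<one>\<^bsub>residue_ring (int p)\<^esub> = 1"
  by (auto simp: residue_ring_def)

lemma cring_residue_ring: "prime p \<Longrightarrow> cring (residue_ring (int p))"
  using residues.cring[of "int p"] prime_gt_1_nat[of p] by (simp add: residues_def)

text \<open>A multiple by \<open>k\<close> is scalar multiplication by the residue of
  \<open>k\<close>, and the residue of \<open>p\<close> is zero.\<close>

lemma module_torsion:
  assumes p: "prime p" and M: "module (residue_ring (int p)) M" and x: "x \<in> carrier M"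
  shows "[p] \<cdot>\<^bsub>M\<^esub> x = \<zero>\<^bsub>M\<^esub>"
proof -
  interpret module "residue_ring (int p)" M by (rule M)
  have p1: "1 < int p" using prime_gt_1_nat[OF p] by simp
  have "[k] \<cdot>\<^bsub>M\<^esub> x = (int k mod int p) \<odot>\<^bsub>M\<^esub> x" for k :: nat
  proof (induction k)
    case 0 show ?case using x smult_l_null[OF x] by (simp add: residue_ring_simps)
  next
    case (Suc k)
    have e: "int (Suc k) mod int p = (int k mod int p) \<oplus>\<^bsub>residue_ring (int p)\<^esub> \<one>\<^bsub>residue_ring (int p)\<^esub>"
      by (simp add: residue_ring_simps mod_simps add.commute)
    have c: "int k mod int p \<in> carrier (residue_ring (int p))" "\<one>\<^bsub>residue_ring (int p)\<^esub> \<in> carrier (residue_ring (int p))"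
      using p1 by (simp_all add: residue_ring_simps)
    show ?case unfolding e smult_l_distr[OF c x] smult_one[OF x] Suc.IH[symmetric] using x by simp
  qed
  from this[of p] show ?thesis using smult_l_null[OF x] by (simp add: residue_ring_simps)
qed

lemma residue_ring_torsion:
  assumes p: "prime p" and x: "x \<in> carrier (residue_ring (int p))"
  shows "[p] \<cdot>\<^bsub>residue_ring (int p)\<^esub> x = \<zero>\<^bsub>residue_ring (int p)\<^esub>"
proof -
  interpret cring "residue_ring (int p)" by (rule cring_residue_ring[OF p])
  have "[k] \<cdot>\<^bsub>residue_ring (int p)\<^esub> x = (int k * x) mod int p" for k :: nat
  proof (induction k)
    case (Suc k)
    have "[Suc k] \<cdot>\<^bsub>residue_ring (int p)\<^esub> x = ([k] \<cdot>\<^bsub>residue_ring (int p)\<^esub> x) \<oplus>\<^bsub>residue_ring (int p)\<^esub> x"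
      by (rule add.nat_pow_Suc)
    also have "\<dots> = (int (Suc k) * x) mod int p"
      unfolding Suc.IH residue_ring_simps by (simp add: mod_simps algebra_simps)
    finally show ?case .
  qed (simp add: residue_ring_simps)
  from this[of p] show ?thesis by (simp add: residue_ring_simps)
qed

text \<open>\<open>K_homological\<close> contains only modules carried by the universe, so a copy of
  the residue ring is built there, together with the bijection \<open>j\<close> that
  \<open>copies_nilpotent_Mod\<close> expects.\<close>

lemma ex_module_copy:
  assumes p: "prime p" and inf: "infinite (UNIV :: 'u set)"
  obtains M :: "(int, 'u) module" and j where "module (residue_ring (int p)) M" "bij_betw j {0..<int p} (carrier M)"
    "\<And>a b. a \<in> {0..<int p} \<Longrightarrow> b \<in> {0..<int p} \<Longrightarrow> j ((a + b) mod int p) = j a \<oplus>\<^bsub>M\<^esub> j b"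
proof -
  obtain B :: "'u set" where B: "finite B" "card B = card {0..<int p}"
    using infinite_arbitrarily_large[OF inf] by blast
  obtain e where e: "bij_betw e {0..<int p} B" using finite_same_card_bij[OF finite_atLeastLessThan_int B(1) B(2)[symmetric]] by blast
  define d where "d = inv_into {0..<int p} e"
  have de: "d (e a) = a" if "a \<in> {0..<int p}" for a unfolding d_def by (rule bij_betw_inv_into_left[OF e that])
  have eB: "e a \<in> B" if "a \<in> {0..<int p}" for a by (rule bij_betw_apply[OF e that])
  have dB: "\<exists>a\<in>{0..<int p}. x = e a" if "x \<in> B" for x
    using that e unfolding bij_betw_def by blast
  define M :: "(int, 'u) module" where "M = \<lparr>carrier = B, monoid.mult = (\<lambda>x y. x), one = e 0, zero = e 0,
    add = (\<lambda>x y. e ((d x + d y) mod int p)), smult = (\<lambda>r x. e ((r * d x) mod int p))\<rparr>"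
  have Ms: "carrier M = B" "\<zero>\<^bsub>M\<^esub> = e 0" "x \<oplus>\<^bsub>M\<^esub> y = e ((d x + d y) mod int p)" "r \<odot>\<^bsub>M\<^esub> x = e ((r * d x) mod int p)" for x y r
    by (simp_all add: M_def)
  have p0: "0 < int p" using prime_gt_0_nat[OF p] by simp
  have md: "a mod int p \<in> {0..<int p}" for a using p0 by simp
  have m1: "(0::int) \<in> {0..<int p}" using p0 by simp
  note dm = de[OF md] and eb = eB[OF md]
  have ab: "abelian_group M"
  proof (rule abelian_groupI)
    fix x assume "x \<in> carrier M"
    then obtain a where a: "a \<in> {0..<int p}" "x = e a" using dB unfolding Ms by blast
    show "\<exists>y\<in>carrier M. y \<oplus>\<^bsub>M\<^esub> x = \<zero>\<^bsub>M\<^esub>"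
      unfolding a(2) Ms by (rule bexI[OF _ eb[of "- a"]]) (simp add: dm de[OF a(1)] mod_simps)
    show "\<zero>\<^bsub>M\<^esub> \<oplus>\<^bsub>M\<^esub> x = x" unfolding a(2) Ms de[OF a(1)] de[OF m1] using a(1) by simp
  next
    fix x y assume "x \<in> carrier M" "y \<in> carrier M"
    show "x \<oplus>\<^bsub>M\<^esub> y = y \<oplus>\<^bsub>M\<^esub> x" by (simp add: Ms add.commute)
  qed (auto simp: Ms eb eB[OF m1] dm mod_simps add.assoc)
  have "module (residue_ring (int p)) M"
  proof (rule moduleI[OF cring_residue_ring[OF p] ab])
    fix x assume "x \<in> carrier M"
    then obtain a where a: "a \<in> {0..<int p}" "x = e a" using dB unfolding Ms by blast
    show "\<one>\<^bsub>residue_ring (int p)\<^esub> \<odot>\<^bsub>M\<^esub> x = x" unfolding a(2) Ms residue_ring_simps de[OF a(1)] using a(1) by simp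
  qed (auto simp: Ms residue_ring_simps eb dm mod_simps algebra_simps)
  moreover have "e ((a + b) mod int p) = e a \<oplus>\<^bsub>M\<^esub> e b" if "a \<in> {0..<int p}" "b \<in> {0..<int p}" for a b
    unfolding Ms de[OF that(1)] de[OF that(2)] ..
  ultimately show thesis using that[of M e] e by (simp add: Ms)
qed

section \<open>The pro-\<open>p\<close> completion\<close>

lemma p_completion_simps:
  "obs (p_completion p G) = finite_p_quotients p G" "sp (p_completion p G) H = nerve (G Mod H)"
  "tr (p_completion p G) (H, H') = nerve_map (G Mod H) (\<lambda>C. H' <#>\<^bsub>G\<^esub> C)"
  "ident (idx (p_completion p G)) H = (H, H)" "cmp (idx (p_completion p G)) e' e = (fst e, snd e')"
  "Ar (idx (p_completion p G)) = {(H, H'). H \<in> finite_p_quotients p G \<and> H' \<in> finite_p_quotients p G \<and> H \<subseteq> H'}"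
  "src (idx (p_completion p G)) = fst" "tgt (idx (p_completion p G)) = snd"
  by (simp_all add: p_completion_def)

lemma arrs_p_completion:
  "e \<in> arrs (p_completion p G) H K \<longleftrightarrow> e = (H, K) \<and> H \<in> finite_p_quotients p G \<and> K \<in> finite_p_quotients p G \<and> H \<subseteq> K"
  by (cases e) (auto simp: hom_arr_def p_completion_simps)

text \<open>Cofilteredness is closure of the family under intersections. Functoriality is checked
  edgewise on cosets, where each transition map merely replaces the subgroup.\<close>

lemma (in group) thin_p_completion:
  assumes p: "prime p" shows "thin_pro_space (p_completion p G)"
proof (rule thin_pro_space.intro)
  let ?X = "p_completion p G" and ?fam = "finite_p_quotients p G"
  show thin: "e = e'" if "e \<in> arrs ?X s t" "e' \<in> arrs ?X s t" for e e' s t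
    using that unfolding arrs_p_completion by simp
  have norm: "H \<lhd> G" if "H \<in> ?fam" for H using that by (simp add: finite_p_quotients_def)
  have grp: "group (G Mod H)" if "H \<in> ?fam" for H by (rule normal.factorgroup_is_group[OF norm[OF that]])
  have hom: "(\<lambda>C. K <#> C) \<in> hom (G Mod H) (G Mod K)"
    if "H \<in> ?fam" "K \<in> ?fam" "H \<subseteq> K" for H K
    by (rule normal.transition_hom[OF norm[OF that(2)] norm[OF that(1)] that(3)])
  have sm: "trans_map G H K \<in> smaps (nerve (G Mod H)) (nerve (G Mod K))"
    if "H \<in> ?fam" "K \<in> ?fam" "H \<subseteq> K" for H K
    by (rule nerve_map_smaps[OF grp[OF that(1)] grp[OF that(2)] hom[OF that]])
  have tr: "L <#> (K <#> C) = L <#> C" if *: "H \<in> ?fam" "K \<in> ?fam" "H \<subseteq> K"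
    "L \<in> ?fam" "K \<subseteq> L" "C \<in> carrier (G Mod H)" for H K L C
  proof -
    obtain x where x: "x \<in> carrier G" "C = H #> x" using *(6) by (auto simp: carrier_Mod)
    show ?thesis
      unfolding x(2) normal.transition[OF norm[OF *(2)] norm[OF *(1)] *(3) x(1)]
        normal.transition[OF norm[OF *(4)] norm[OF *(2)] *(5) x(1)]
        normal.transition[OF norm[OF *(4)] norm[OF *(1)] order_trans[OF *(3,5)] x(1)] ..
  qed
  show "pro_space ?X"
  proof (rule pro_space_thinI[OF _ _ _ thin])
    show "obs ?X \<noteq> {}" unfolding p_completion_simps using carrier_in_finite_p_quotients[OF p] by blast
  next
    fix H K assume HK: "H \<in> obs ?X" "K \<in> obs ?X"
    show "\<exists>r\<in>obs ?X. arrs ?X r H \<noteq> {} \<and> arrs ?X r K \<noteq> {}"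
    proof
      show i: "H \<inter> K \<in> obs ?X" using HK finite_p_quotients_Int[OF p] unfolding p_completion_simps by blast
      have "(H \<inter> K, H) \<in> arrs ?X (H \<inter> K) H" "(H \<inter> K, K) \<in> arrs ?X (H \<inter> K) K"
        using HK i unfolding arrs_p_completion p_completion_simps by blast+
      then show "arrs ?X (H \<inter> K) H \<noteq> {} \<and> arrs ?X (H \<inter> K) K \<noteq> {}" by blast
    qed
  next
    fix H assume H: "H \<in> obs ?X"
    then have H': "H \<in> ?fam" unfolding p_completion_simps .
    show "tr ?X (ident (idx ?X) H) = sid (sp ?X H)"
      unfolding p_completion_simps
    proof (rule smaps_eqI[OF sm[OF H' H' order_refl] smaps_sid[OF simplicial_set_nerve]])
      fix n x assume x: "x \<in> simp (nerve (G Mod H)) n"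
      have "trans_map G H H n x = x"
      proof (rule nerve_eqI[OF nerve_map_ext[OF x] nerve_simpD(2)[OF x]])
        fix i j assume ij: "i \<le> j" "j \<le> n"
        obtain g where g: "g \<in> carrier G" "x (i, j) = H #> g" using nerve_simpD(1)[OF x ij] by (auto simp: carrier_Mod)
        show "trans_map G H H n x (i, j) = x (i, j)"
          unfolding nerve_map_apply[OF x ij] g(2) by (rule normal.transition[OF norm[OF H'] norm[OF H'] order_refl g(1)])
      qed
      then show "trans_map G H H n x = sid (nerve (G Mod H)) n x" using x by (simp add: sid_def)
    qed
  next
    fix H K L e e' assume "e \<in> arrs ?X H K" "e' \<in> arrs ?X K L"
    then have e: "e = (H, K)" "e' = (K, L)" and *: "H \<in> ?fam" "K \<in> ?fam" "H \<subseteq> K"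
      "L \<in> ?fam" "K \<subseteq> L" unfolding arrs_p_completion by auto
    note HL = order_trans[OF *(3,5)]
    show "tr ?X (cmp (idx ?X) e' e) = scomp (sp ?X H) (tr ?X e') (tr ?X e)"
      unfolding e p_completion_simps fst_conv snd_conv
    proof (rule smaps_eqI[OF sm[OF *(1,4) HL] smaps_scomp[OF sm[OF *(1-3)] sm[OF *(2,4,5)] simplicial_set_nerve]])
      fix n x assume x: "x \<in> simp (nerve (G Mod H)) n"
      note y = nerve_map_in[OF grp[OF *(1)] grp[OF *(2)] hom[OF *(1-3)] x]
      show "trans_map G H L n x = scomp (nerve (G Mod H)) (trans_map G K L) (trans_map G H K) n x"
        unfolding scomp_apply[OF x]
      proof (rule nerve_eqI[OF nerve_map_ext[OF x] nerve_map_ext[OF y]])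
        fix i j assume ij: "i \<le> j" "j \<le> n"
        show "trans_map G H L n x (i, j) = trans_map G K L n (trans_map G H K n x) (i, j)"
          unfolding nerve_map_apply[OF x ij] nerve_map_apply[OF y ij] tr[OF * nerve_simpD(1)[OF x ij]] ..
      qed
    qed
  next
    fix H K e assume "e \<in> arrs ?X H K"
    then have "e = (H, K)" "H \<in> ?fam" "K \<in> ?fam" "H \<subseteq> K"
      unfolding arrs_p_completion by auto
    then show "tr ?X e \<in> smaps (sp ?X H) (sp ?X K)" using sm by (simp add: p_completion_simps)
  qed (auto simp: p_completion_simps arrs_p_completion simplicial_set_nerve)
qed

lemma (in group) p_completion_cone:
  assumes "H \<in> finite_p_quotients p G"
  shows "quot_map G H \<in> smaps (nerve G) (sp (p_completion p G) H)"
    "e \<in> arrs (p_completion p G) H K \<Longrightarrow>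
      scomp (nerve G) (tr (p_completion p G) e) (quot_map G H) = quot_map G K"
proof -
  have norm: "H \<lhd> G" if "H \<in> finite_p_quotients p G" for H using that by (simp add: finite_p_quotients_def)
  have sm: "quot_map G H \<in> smaps (nerve G) (nerve (G Mod H))" if "H \<in> finite_p_quotients p G" for H
    by (rule nerve_map_smaps[OF is_group normal.factorgroup_is_group normal.Mod_hom]) (rule norm[OF that])+
  show "quot_map G H \<in> smaps (nerve G) (sp (p_completion p G) H)"
    unfolding p_completion_simps by (rule sm[OF assms])
  assume "e \<in> arrs (p_completion p G) H K"
  then have e: "e = (H, K)" "K \<in> finite_p_quotients p G" "H \<subseteq> K" unfolding arrs_p_completion by auto
  show "scomp (nerve G) (tr (p_completion p G) e) (quot_map G H) = quot_map G K"
    unfolding e p_completion_simps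
  proof
    fix n
    show "scomp (nerve G) (trans_map G H K) (quot_map G H) n = quot_map G K n"
    proof (rule extensionalityI)
      fix x assume x: "x \<in> simp (nerve G) n"
      show "scomp (nerve G) (trans_map G H K) (quot_map G H) n x = quot_map G K n x"
        unfolding scomp_apply[OF x] by (rule normal.transition_nerve[OF norm[OF e(2)] norm[OF assms] e(3) x])
    qed (simp_all add: scomp_def nerve_map_def compose_def)
  qed
qed

lemma (in group) p_completion_map_pro_hom:
  assumes p: "prime p"
  shows "p_completion_map p G \<in> pro_hom (const_pro (nerve G)) (p_completion p G)"
  unfolding pro_hom_def
proof (intro CollectI conjI allI ballI)
  let ?X = "p_completion p G" and ?C = "const_pro (nerve G)"
  have g: "germ ?C (nerve (G Mod H)) `` {((), quot_map G H)} = {((), quot_map G H)}"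
    if "H \<in> finite_p_quotients p G" for H
    by (rule germ_const[OF simplicial_set_nerve p_completion_cone(1)[OF that, unfolded p_completion_simps]])
  show "p_completion_map p G \<in> (\<Pi>\<^sub>E H\<in>obs ?X. colim_hom ?C (sp ?X H))"
  proof (rule PiE_I)
    fix H assume "H \<in> obs ?X"
    then have H: "H \<in> finite_p_quotients p G" unfolding p_completion_simps .
    show "p_completion_map p G H \<in> colim_hom ?C (sp ?X H)"
      unfolding p_completion_map_def restrict_apply'[OF H] colim_hom_def p_completion_simps
      by (rule quotientI) (use p_completion_cone(1)[OF H] in \<open>simp add: const_pro_simps p_completion_simps\<close>)
  qed (simp add: p_completion_map_def p_completion_simps)
  fix H K e z assume e: "e \<in> arrs ?X H K" and z: "z \<in> p_completion_map p G H"
  then have HK: "H \<in> finite_p_quotients p G" "K \<in> finite_p_quotients p G" unfolding arrs_p_completion by auto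
  have z: "z = ((), quot_map G H)" using z g[OF HK(1)] HK(1) by (simp add: p_completion_map_def)
  show "case z of (t, f) \<Rightarrow> (t, scomp (sp ?C t) (tr ?X e) f) \<in> p_completion_map p G K"
    unfolding z prod.case const_pro_simps p_completion_cone(2)[OF HK(1) e] p_completion_map_def
      restrict_apply'[OF HK(2)] g[OF HK(2)] by simp
qed

lemma cohom_iso_p_completion:
  assumes p: "prime p" and M: "abelian_group M" and tors: "\<And>x. x \<in> carrier M \<Longrightarrow> [p] \<cdot>\<^bsub>M\<^esub> x = \<zero>\<^bsub>M\<^esub>"
  shows "cohom_iso M (const_pro (nerve (free_group n))) (p_completion p (free_group n)) (p_completion_map p (free_group n))"
  unfolding cohom_iso_def
proof
  fix m
  let ?F = "free_group n" let ?X = "p_completion p ?F"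
  interpret F: group ?F by (rule group_free_group)
  interpret C: comparison M p n by (intro comparison.intro comparison_axioms.intro M p tors)
  have "const_comparison M ?X m (nerve ?F) (\<lambda>H. quot_map ?F H)"
  proof (intro const_comparison.intro const_comparison_axioms.intro thin_pro_cohom.intro M F.thin_p_completion[OF p] simplicial_set_nerve)
    fix H assume "H \<in> obs ?X"
    then have H: "H \<in> finite_p_quotients p ?F" unfolding p_completion_simps .
    show "quot_map ?F H \<in> smaps (nerve ?F) (sp ?X H)"
      by (rule F.p_completion_cone(1)[OF H])
    fix c assume c: "c \<in> cocycles M (sp ?X H) m"
      "compose (simp (nerve ?F) m) c (quot_map ?F H m) \<in> coboundaries M (nerve ?F) m"
    obtain K where K: "K \<in> finite_p_quotients p ?F" "K \<subseteq> H"
      "compose (simp (nerve (?F Mod K)) m) c (trans_map ?F K H m) \<in> coboundaries M (nerve (?F Mod K)) m"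
      using C.pull_coboundary[OF H c(1)[unfolded p_completion_simps] c(2)] by blast
    have "(K, H) \<in> arrs ?X K H" unfolding arrs_p_completion using H K by blast
    then show "\<exists>r. \<exists>e\<in>arrs ?X r H.
        compose (simp (sp ?X r) m) c (tr ?X e m) \<in> coboundaries M (sp ?X r) m"
      using K(3) by (intro exI[of _ K] bexI[of _ "(K, H)"]) (simp_all add: p_completion_simps)
  next
    fix H K e assume e: "e \<in> arrs ?X H K"
    then have H: "H \<in> finite_p_quotients p ?F" unfolding arrs_p_completion by blast
    show "scomp (nerve ?F) (tr ?X e) (quot_map ?F H) = quot_map ?F K"
      by (rule F.p_completion_cone(2)[OF H e])
  next
    fix c assume "c \<in> cocycles M (nerve ?F) m"
    then show "\<exists>s\<in>obs ?X. \<exists>c'\<in>cocycles M (sp ?X s) m. \<exists>b\<in>coboundaries M (nerve ?F) m.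
      c = b \<otimes>\<^bsub>cochains M (nerve ?F) m\<^esub> compose (simp (nerve ?F) m) c' (quot_map ?F s m)"
      unfolding p_completion_simps by (rule C.cocycle_from_quotient)
  qed
  then interpret D: const_comparison M ?X m "nerve ?F" "\<lambda>H. quot_map ?F H" .
  have "D.F = p_completion_map p ?F"
    unfolding D.F_def p_completion_map_def p_completion_simps ..
  then show "pro_cohom_map M (const_pro (nerve ?F)) m (p_completion_map p ?F) \<in>
      iso (pro_cohom M ?X m) (pro_cohom M (const_pro (nerve ?F)) m)"
    using D.pro_cohom_iso by simp
qed

lemma countable_embedding:
  assumes "infinite (UNIV :: 'u set)" "countable A"
  obtains f :: "'a \<Rightarrow> 'u" where "inj_on f A"
proof -
  obtain g :: "nat \<Rightarrow> 'u" where g: "inj g" using infinite_countable_subset[OF assms(1)] by blast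
  obtain f :: "'a \<Rightarrow> nat" where "inj_on f A" using assms(2) unfolding countable_def by blast
  then have "inj_on (g \<circ> f) A" by (rule comp_inj_on) (rule inj_on_subset[OF g subset_UNIV])
  then show thesis by (rule that)
qed

text \<open>The index category is countable and each nerve is levelwise finite, so the whole diagram
  has an isomorphic copy in any infinite universe; there each space is nilpotent by
  \<open>copies_nilpotent_Mod\<close>.\<close>

lemma ess_levelwise_nilpotent_p_completion:
  fixes M :: "('m, 'x) ring_scheme"
  assumes inf: "infinite (UNIV :: 'u set)" and p: "prime p" and M: "abelian_group M"
    and j: "bij_betw j {0..<int p} (carrier M)"
    and j_add: "\<And>a b. a \<in> {0..<int p} \<Longrightarrow> b \<in> {0..<int p} \<Longrightarrow> j ((a + b) mod int p) = j a \<oplus>\<^bsub>M\<^esub> j b"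
    and K: "EM M 2 \<in> K"
  shows "ess_levelwise_nilpotent TYPE('u) K (p_completion p (free_group n))"
proof -
  let ?F = "free_group n" let ?X = "p_completion p ?F"
  interpret F: group ?F by (rule group_free_group)
  interpret X: thin_pro_space ?X by (rule F.thin_p_completion[OF p])
  have co: "countable (finite_p_quotients p ?F)" by (rule countable_finite_p_quotients[OF p])
  have ca: "countable (Ar (idx ?X))"
    by (rule countable_subset[of _ "finite_p_quotients p ?F \<times> finite_p_quotients p ?F"]) (auto simp: p_completion_simps co)
  obtain \<alpha> :: "(bool \<times> nat) list set \<Rightarrow> 'u" where \<alpha>: "inj_on \<alpha> (obs ?X)"
    using countable_embedding[OF inf co] unfolding p_completion_simps by blast
  obtain \<beta> :: "(bool \<times> nat) list set \<times> (bool \<times> nat) list set \<Rightarrow> 'u" where \<beta>: "inj_on \<beta> (Ar (idx ?X))"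
    using countable_embedding[OF inf ca] by blast
  have "\<exists>Y :: 'u sset. simplicial_set Y \<and> siso Y (sp ?X H)" if H: "H \<in> obs ?X" for H
  proof -
    have "finite (carrier (?F Mod H))" using H finite_p_quotients_iff[OF p, of H ?F] unfolding p_completion_simps by blast
    then obtain Y :: "'u sset" where "simplicial_set Y" "siso Y (nerve (?F Mod H))"
      using ex_copy[OF inf simplicial_set_nerve finite_nerve] by metis
    then show ?thesis unfolding p_completion_simps by blast
  qed
  then obtain C :: "(bool \<times> nat) list set \<Rightarrow> 'u sset" where C: "\<And>H. H \<in> obs ?X \<Longrightarrow> simplicial_set (C H)"
    "\<And>H. H \<in> obs ?X \<Longrightarrow> siso (C H) (sp ?X H)" by metis
  obtain Y :: "('u, 'u, 'u) diagram" where Y: "pro_space Y" "pro_isomorphic ?X Y" "\<forall>i\<in>obs Y. \<exists>s\<in>obs ?X. sp Y i = C s"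
    using X.ex_copy[OF \<alpha> \<beta> C] by blast
  have "nilpotent K (C H)" if H: "H \<in> obs ?X" for H
  proof -
    have "copies_nilpotent TYPE('u) K (nerve (?F Mod H))"
      by (rule F.copies_nilpotent_Mod[OF inf p M j j_add K]) (use H in \<open>simp_all add: p_completion_simps\<close>)
    then show ?thesis using C[OF H] unfolding copies_nilpotent_def p_completion_simps by blast
  qed
  then have "\<forall>i\<in>obs Y. nilpotent K (sp Y i)" using Y(3) by metis
  then show ?thesis unfolding ess_levelwise_nilpotent_def using Y(1,2) by blast
qed

theorem theorem9p1:
  fixes p n :: nat
  assumes "prime p"
    and "infinite (UNIV :: 'u set)"
  shows "cohomological_fibrant_replacement TYPE('u) p
           (const_pro (nerve (free_group n)))
           (p_completion p (free_group n))
           (p_completion_map p (free_group n))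
       \<and> homological_fibrant_replacement TYPE('u) p
           (const_pro (nerve (free_group n)))
           (p_completion p (free_group n))
           (p_completion_map p (free_group n))"
proof -
  let ?F = "free_group n" and ?R = "residue_ring (int p)"
  interpret F: group ?F by (rule group_free_group)
  have ps: "pro_space (const_pro (nerve ?F))" "pro_space (p_completion p ?F)"
    using pro_space_const[OF simplicial_set_nerve] thin_pro_space.pro[OF F.thin_p_completion[OF assms(1)]] by blast+
  have hom: "p_completion_map p ?F \<in> pro_hom (const_pro (nerve ?F)) (p_completion p ?F)"
    by (rule F.p_completion_map_pro_hom[OF assms(1)])
  have R: "abelian_group ?R" using cring_residue_ring[OF assms(1)] by (simp add: cring_def ring_def)
  have 1: "cohom_iso ?R (const_pro (nerve ?F)) (p_completion p ?F) (p_completion_map p ?F)"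
    by (rule cohom_iso_p_completion[OF assms(1) R residue_ring_torsion[OF assms(1)]])
  have 2: "cohom_iso M (const_pro (nerve ?F)) (p_completion p ?F) (p_completion_map p ?F)"
    if M: "module ?R M" for M :: "(int, 'u) module"
    by (rule cohom_iso_p_completion[OF assms(1) module.axioms(2)[OF M] module_torsion[OF assms(1) M]])
  \<comment> \<open>The coefficients are the residue ring itself, with the identity as bijection
    onto the residues.\<close>
  have 3: "ess_levelwise_nilpotent TYPE('u) (K_cohomological p) (p_completion p ?F)"
    by (rule ess_levelwise_nilpotent_p_completion[OF assms(2,1) R, where j = "\<lambda>x. x"])
      (auto simp: residue_ring_simps K_cohomological_def bij_betw_def)
  obtain M :: "(int, 'u) module" and j where M: "module ?R M" "bij_betw j {0..<int p} (carrier M)"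
    "\<And>a b. a \<in> {0..<int p} \<Longrightarrow> b \<in> {0..<int p} \<Longrightarrow> j ((a + b) mod int p) = j a \<oplus>\<^bsub>M\<^esub> j b"
    by (rule ex_module_copy[OF assms(1,2)]) (rule that)
  \<comment> \<open>The cardinal of the universe bounds every subset of it, so the whole carrier of
    \<open>M\<close> may serve as generating set; it is infinite by assumption.\<close>
  let ?l = "|UNIV :: 'u set|"
  have "generated_by_at_most p M ?l"
    unfolding generated_by_at_most_def by (rule exI[of _ "carrier M"]) (auto simp: submodule_def subgroup_def intro: card_of_mono1)
  then have EM: "EM M 2 \<in> K_homological p ?l" unfolding K_homological_def using M(1) by blast
  have 4: "ess_levelwise_nilpotent TYPE('u) (K_homological p ?l) (p_completion p ?F)"
    by (rule ess_levelwise_nilpotent_p_completion[OF assms(2,1) module.axioms(2)[OF M(1)] M(2) _ EM]) (rule M(3))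
  have 5: "Cinfinite ?l"
  proof
    show "cinfinite ?l" unfolding cinfinite_def Field_card_of by (rule assms(2))
  qed (rule card_of_Card_order)
  show ?thesis
    unfolding cohomological_fibrant_replacement_def homological_fibrant_replacement_def
      cohomological_weq_def homological_weq_def
    by (intro conjI allI impI exI[of _ ?l] ps hom 1 2 3 4 5)
qed

end
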